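(* Let $1 \le b \le B$ and let $\ell \ge 1$, and assume the internal memory size satisfies $M \ge \ell b$. There is an external-memory data structure that maintains a set of $\ell$ catenable priority queues with attrition (I/O-CPQAs) and supports each of the operations $\textsc{FindMin}$, $\textsc{DeleteMin}$, $\textsc{CatenateAndAttrite}$ and $\textsc{InsertAndAttrite}$ in $\mathcal{O}(1/b)$ amortized I/Os and $\mathcal{O}(1)$ worst case I/Os per operation. Its space usage is $\mathcal{O}(\frac{n-m}{b})$ disk blocks after $n$ calls in total to $\textsc{CatenateAndAttrite}$ and $\textsc{InsertAndAttrite}$ and $m$ calls to $\textsc{DeleteMin}$.
   Context: The computational model is the I/O model: data resides on a disk divided into blocks of $B$ consecutive words, computation takes place for free in an internal memory of $M$ words, and an I/O reads one block from disk into memory or writes one block to disk; time is measured as the number of I/Os and space as the number of disk blocks used. An I/O-CPQA stores a sequence of elements from a totally ordered set and supports: $\textsc{FindMin}(Q)$ returns the minimum element of $Q$; $\textsc{DeleteMin}(Q)$ removes the minimum element $e$ of $Q$ and returns $e$ and $Q\setminus\{e\}$; $\textsc{CatenateAndAttrite}(Q_1,Q_2)$ concatenates $Q_2$ to the end of $Q_1$ and removes ("attrites") every element of $Q_1$ larger than $\min(Q_2)$, returning $\{e \in Q_1 : e < \min(Q_2)\} \cup Q_2$; $\textsc{InsertAndAttrite}(Q,e)$ inserts $e$ at the end of $Q$ and removes all elements of $Q$ larger than $e$.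
   Formalization: The formal theorem additionally assumes M ≥ 2B, the customary assumption of the I/O model; with only M ≥ ℓb the claim fails, e.g. for B = M = b = ℓ = 1, where two elements can never be in memory together to be compared. *)

theory Defs
  imports Complex_Main
begin

text \<open>
  The I/O model. Elements of the ordered set are indivisible: a program can only move them between
  memory cells and compare them, which is why \<open>prog\<close> does not mention the element type. A program
  is a well-founded tree, so it always terminates; infinite branching on the number stored in a cell
  expresses that internal computation is free. Nothing but memory and disk survives from
  one operation to the next.
\<close>

datatype 'a word = Elem 'a | Num nat

datatype prog =
    Halt
  | Copy nat nat prog            \<comment> \<open>source cell, target cell\<close>
  | SetNum nat nat prog          \<comment> \<open>target cell, number\<close>
  | CaseNum nat "nat \<Rightarrow> prog"    \<comment> \<open>branch on the number in a cell\<close>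
  | IfLess nat nat prog prog     \<comment> \<open>compare the elements in two cells\<close>
  | GetArg nat prog              \<comment> \<open>copy the element passed to the operation into a cell\<close>
  | Output nat prog              \<comment> \<open>return the element in a cell\<close>
  | ReadBlock nat nat prog       \<comment> \<open>block address, first target cell\<close>
  | WriteBlock nat nat prog      \<comment> \<open>block address, first source cell\<close>
  | FreeBlock nat prog           \<comment> \<open>the block is no longer in use\<close>

record machine =
  mem_size :: nat
  block_size :: nat
  word_max :: nat   \<comment> \<open>largest number, and largest block address, that fits into a word\<close>

record 'a config =
  mem :: "nat \<Rightarrow> 'a word"
  disk :: "nat \<Rightarrow> 'a word list option"   \<comment> \<open>\<open>None\<close>: block not in use\<close>
  result :: "'a option"
  ios :: nat

text \<open>
  Execution yields \<open>None\<close> on a fault: a cell outside the memory, a number or address that does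
  not fit into a word, a word of the wrong kind, or reading a block that is not in use.
\<close>

primrec exec :: "machine \<Rightarrow> 'a::linorder option \<Rightarrow> prog \<Rightarrow> 'a config \<Rightarrow> 'a config option" where
  "exec mc arg Halt s = Some s"
| "exec mc arg (Copy i j p) s =
    (if i < mem_size mc \<and> j < mem_size mc
     then exec mc arg p (s\<lparr>mem := (mem s)(j := mem s i)\<rparr>) else None)"
| "exec mc arg (SetNum j k p) s =
    (if j < mem_size mc \<and> k \<le> word_max mc
     then exec mc arg p (s\<lparr>mem := (mem s)(j := Num k)\<rparr>) else None)"
| "exec mc arg (CaseNum i f) s =
    (if i < mem_size mc
     then (case mem s i of Num k \<Rightarrow> exec mc arg (f k) s | Elem _ \<Rightarrow> None) else None)"
| "exec mc arg (IfLess i j p q) s =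
    (if i < mem_size mc \<and> j < mem_size mc
     then (case (mem s i, mem s j) of
             (Elem x, Elem y) \<Rightarrow> if x < y then exec mc arg p s else exec mc arg q s
           | _ \<Rightarrow> None)
     else None)"
| "exec mc arg (GetArg j p) s =
    (if j < mem_size mc
     then (case arg of Some e \<Rightarrow> exec mc arg p (s\<lparr>mem := (mem s)(j := Elem e)\<rparr>) | None \<Rightarrow> None)
     else None)"
| "exec mc arg (Output i p) s =
    (if i < mem_size mc
     then (case mem s i of Elem e \<Rightarrow> exec mc arg p (s\<lparr>result := Some e\<rparr>) | Num _ \<Rightarrow> None)
     else None)"
| "exec mc arg (ReadBlock a j p) s =
    (if a \<le> word_max mc \<and> j + block_size mc \<le> mem_size mc
     then (case disk s a of
             Some blk \<Rightarrow> exec mc arg p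
               (s\<lparr>mem := (\<lambda>k. if j \<le> k \<and> k < j + block_size mc then blk ! (k - j) else mem s k),
                  ios := Suc (ios s)\<rparr>)
           | None \<Rightarrow> None)
     else None)"
| "exec mc arg (WriteBlock a i p) s =
    (if a \<le> word_max mc \<and> i + block_size mc \<le> mem_size mc
     then exec mc arg p
       (s\<lparr>disk := (disk s)(a := Some (map (mem s) [i..<i + block_size mc])),
          ios := Suc (ios s)\<rparr>)
     else None)"
| "exec mc arg (FreeBlock a p) s = exec mc arg p (s\<lparr>disk := (disk s)(a := None)\<rparr>)"

definition blank_config :: "'a config" where
  "blank_config = \<lparr>mem = (\<lambda>_. Num 0), disk = (\<lambda>_. None), result = None, ios = 0\<rparr>"

definition blocks_used :: "'a config \<Rightarrow> nat" where
  "blocks_used s = card {a. disk s a \<noteq> None}"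


text \<open>
  Catenable priority queues with attrition. Attrition keeps the stored sequence strictly increasing,
  so that it is determined by the set of its elements. A family of queues is indexed by
  \<open>{..<l}\<close>; the result of catenating queues \<open>i\<close> and \<open>j\<close> becomes queue \<open>i\<close>, and queue \<open>j\<close> is
  left empty. The minimum of an empty queue counts as infinite when catenating.
\<close>

datatype 'a cpqa_op =
    FindMin nat
  | DeleteMin nat
  | CatenateAndAttrite nat nat
  | InsertAndAttrite nat 'a

definition catenate_attrite :: "'a::linorder set \<Rightarrow> 'a set \<Rightarrow> 'a set" where
  "catenate_attrite Q1 Q2 = (if Q2 = {} then Q1 else {e \<in> Q1. e < Min Q2} \<union> Q2)"

definition insert_attrite :: "'a::linorder set \<Rightarrow> 'a \<Rightarrow> 'a set" where
  "insert_attrite Q e = {x \<in> Q. \<not> x > e} \<union> {e}"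

fun cpqa_step :: "'a::linorder cpqa_op \<Rightarrow> (nat \<Rightarrow> 'a set) \<Rightarrow> (nat \<Rightarrow> 'a set)" where
  "cpqa_step (FindMin i) Q = Q"
| "cpqa_step (DeleteMin i) Q = Q(i := Q i - {Min (Q i)})"
| "cpqa_step (CatenateAndAttrite i j) Q = Q(i := catenate_attrite (Q i) (Q j), j := {})"
| "cpqa_step (InsertAndAttrite i e) Q = Q(i := insert_attrite (Q i) e)"

fun cpqa_answer :: "'a::linorder cpqa_op \<Rightarrow> (nat \<Rightarrow> 'a set) \<Rightarrow> 'a option" where
  "cpqa_answer (FindMin i) Q = Some (Min (Q i))"
| "cpqa_answer (DeleteMin i) Q = Some (Min (Q i))"
| "cpqa_answer (CatenateAndAttrite i j) Q = None"
| "cpqa_answer (InsertAndAttrite i e) Q = None"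

fun cpqa_legal :: "nat \<Rightarrow> 'a::linorder cpqa_op \<Rightarrow> (nat \<Rightarrow> 'a set) \<Rightarrow> bool" where
  "cpqa_legal l (FindMin i) Q \<longleftrightarrow> i < l \<and> Q i \<noteq> {}"
| "cpqa_legal l (DeleteMin i) Q \<longleftrightarrow> i < l \<and> Q i \<noteq> {}"
| "cpqa_legal l (CatenateAndAttrite i j) Q \<longleftrightarrow> i < l \<and> j < l \<and> i \<noteq> j"
| "cpqa_legal l (InsertAndAttrite i e) Q \<longleftrightarrow> i < l"

fun all_legal :: "nat \<Rightarrow> 'a::linorder cpqa_op list \<Rightarrow> (nat \<Rightarrow> 'a set) \<Rightarrow> bool" where
  "all_legal l [] Q \<longleftrightarrow> True"
| "all_legal l (x # xs) Q \<longleftrightarrow> cpqa_legal l x Q \<and> all_legal l xs (cpqa_step x Q)"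

fun all_answers :: "'a::linorder cpqa_op list \<Rightarrow> (nat \<Rightarrow> 'a set) \<Rightarrow> 'a option list" where
  "all_answers [] Q = []"
| "all_answers (x # xs) Q = cpqa_answer x Q # all_answers xs (cpqa_step x Q)"

fun is_delete :: "'a cpqa_op \<Rightarrow> bool" where
  "is_delete (DeleteMin i) = True"
| "is_delete _ = False"

fun is_catenate_or_insert :: "'a cpqa_op \<Rightarrow> bool" where
  "is_catenate_or_insert (CatenateAndAttrite i j) = True"
| "is_catenate_or_insert (InsertAndAttrite i e) = True"
| "is_catenate_or_insert _ = False"



record cpqa_impl =
  find_min_prog :: "nat \<Rightarrow> prog"
  delete_min_prog :: "nat \<Rightarrow> prog"
  catenate_prog :: "nat \<Rightarrow> nat \<Rightarrow> prog"
  insert_prog :: "nat \<Rightarrow> prog"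

fun exec_op :: "machine \<Rightarrow> cpqa_impl \<Rightarrow> 'a::linorder cpqa_op \<Rightarrow> 'a config \<Rightarrow> 'a config option" where
  "exec_op mc D (FindMin i) s = exec mc None (find_min_prog D i) s"
| "exec_op mc D (DeleteMin i) s = exec mc None (delete_min_prog D i) s"
| "exec_op mc D (CatenateAndAttrite i j) s = exec mc None (catenate_prog D i j) s"
| "exec_op mc D (InsertAndAttrite i e) s = exec mc (Some e) (insert_prog D i) s"

text \<open>
  Runs a sequence of operations; besides the final configuration, returns for each operation its
  answer and the number of I/Os it performed.
\<close>

fun run_ops :: "machine \<Rightarrow> cpqa_impl \<Rightarrow> 'a::linorder cpqa_op list \<Rightarrow> 'a config
    \<Rightarrow> ('a config \<times> ('a option \<times> nat) list) option" where
  "run_ops mc D [] s = Some (s, [])"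
| "run_ops mc D (x # xs) s =
    (case exec_op mc D x (s\<lparr>result := None, ios := 0\<rparr>) of
       None \<Rightarrow> None
     | Some s' \<Rightarrow>
         (case run_ops mc D xs s' of
            None \<Rightarrow> None
          | Some (s'', tr) \<Rightarrow> Some (s'', (result s', ios s') # tr)))"

end

theory Submission
  imports Defs "HOL-Library.Nat_Bijection"
begin

text \<open>
  Attrition is lazy: a queue is represented by a sequence of elements whose strict suffix minima are
  the elements of the queue, so catenation only has to append sequences. The sequence is cut into
  records of \<open>\<Theta>(b)\<close> elements, and the records form a tree: the root comes first, and it carries a list
  \<open>C\<close> of records that are known to survive, a buffer \<open>B\<close>, and a stack \<open>D\<close> of segments of trees
  whose attrition has been postponed. The invariant that \<open>C\<close> is at least as long as the work
  \<open>D\<close> still requires is restored after every catenation and every removal of the root by a constant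
  number of steps, each of which extends \<open>C\<close>, or drops attrited records, or merges two segments.
  Hence these operations cost \<open>O(1)\<close> I/Os in the worst case.

  If \<open>b\<close> is bounded, this suffices. Otherwise each queue keeps its first and its last \<open>O(b)\<close> elements
  in memory, such that a record is created or consumed only once per \<open>\<Omega>(b)\<close> operations. The
  potential charges each buffered element \<open>O(1)\<close> and each record \<open>O(b)\<close>; the buffers pay for
  new records, and the records for their removal. Blocks of attrited records may stay allocated, but
  the elements stored are never more than the insertions minus the deletions.
\<close>

section \<open>Strict suffix minima\<close>

text \<open>The obstacle is that one insertion may attrite arbitrarily many records while only
  \<open>O(1)\<close> of them may be touched. A key bounds its whole tree from below, so one
  comparison discards a tree unvisited. The danger is then that a root is removed and its successor
  is unknown; the balance \<open>cost D \<le> length C\<close> excludes this, because it makes an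
  empty \<open>C\<close> imply that nothing is left. Attaching a tree leaves a deficit of at most 2,
  removing a root one of at most 1, and a step repays 1: hence two steps after a catenation and one
  after a removal. An operation that creates records lowers the buffer potential, weighted by 900,
  by at least \<open>bt\<close>: \<open>600 * bt\<close> endow up to two records with
  \<open>300 * bt\<close> each, and \<open>300 * bt\<close> pay for up to 300 I/Os. A refill of the
  head buffer is paid by the \<open>300 * bt\<close> of the record consumed, or by the potential
  released when the tail attrites the whole tree. For \<open>b < 128\<close> the unit would be 0,
  which is why bounded \<open>b\<close> is treated apart.\<close>

fun sm :: "'a::linorder list \<Rightarrow> 'a set" where
  "sm [] = {}"
| "sm (x # xs) = (if \<forall>y\<in>set xs. x < y then insert x (sm xs) else sm xs)"

lemma sm_subset: "sm xs \<subseteq> set xs"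
  by (induction xs) auto

lemma finite_sm [simp]: "finite (sm xs)"
  by (rule finite_subset[OF sm_subset]) simp

text \<open>If the first element does not survive, a later \<open>y\<close> lies at or below it, and
  the induction hypothesis for \<open>y\<close> supplies the survivor.\<close>

lemma ex_sm_le: "x \<in> set xs \<Longrightarrow> \<exists>y\<in>sm xs. y \<le> x"
proof (induction xs arbitrary: x)
  case (Cons z xs)
  show ?case
  proof (cases "\<forall>y\<in>set xs. z < y")
    case True
    then show ?thesis using Cons.prems Cons.IH by (cases "x = z") auto
  next
    case False
    then obtain y where "y \<in> set xs" "y \<le> z" by (auto simp: not_less)
    moreover have "sm (z # xs) = sm xs" using False by auto
    ultimately show ?thesis using Cons.prems Cons.IH[of x] Cons.IH[of y] by (auto intro: order_trans)
  qed
qed simp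

lemma sm_eq_empty_iff [simp]: "sm xs = {} \<longleftrightarrow> xs = []"
proof
  assume "sm xs = {}"
  then show "xs = []" using ex_sm_le[of "hd xs" xs] by (cases xs) auto
qed simp

lemma less_sm_iff: "(\<forall>y\<in>sm xs. x < y) \<longleftrightarrow> (\<forall>y\<in>set xs. x < y)"
  using ex_sm_le[of _ xs] sm_subset[of xs] by (meson in_mono less_le_trans)

text \<open>An element of \<open>xs\<close> survives in front of \<open>ys\<close> iff it lies below
  all of \<open>ys\<close>; by \<open>less_sm_iff\<close> this is the comparison with
  \<open>Min (sm ys)\<close> made by \<open>catenate_attrite\<close>.\<close>

lemma sm_append: "sm (xs @ ys) = catenate_attrite (sm xs) (sm ys)"
proof (cases "ys = []")
  case False
  then have "sm (xs @ ys) = {e \<in> sm xs. \<forall>x\<in>set ys. e < x} \<union> sm ys"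
    by (induction xs) auto
  then show ?thesis using False less_sm_iff[of ys] by (auto simp: catenate_attrite_def)
qed (simp add: catenate_attrite_def)

text \<open>A part of a sequence may be simplified without looking at the rest; every local step
  relies on this.\<close>

lemma sm_append_cong: "sm xs = sm xs' \<Longrightarrow> sm ys = sm ys' \<Longrightarrow> sm (xs @ ys) = sm (xs' @ ys')"
  by (simp add: sm_append)

lemma sm_drop:
  assumes "z \<in> set zs" "\<And>y. y \<in> set ys \<Longrightarrow> z \<le> y"
  shows "sm (ys @ zs) = sm zs"
  using assms(2)
proof (induction ys)
  case (Cons y ys)
  then have "z \<le> y" by simp
  then have "\<not> (\<forall>x\<in>set (ys @ zs). y < x)" using assms(1) by (auto simp: not_less)
  then have "sm ((y # ys) @ zs) = sm (ys @ zs)" by auto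
  then show ?case using Cons by simp
qed simp

lemma sm_drop_middle:
  assumes "z \<in> set zs" "\<And>y. y \<in> set ys \<Longrightarrow> z \<le> y"
  shows "sm (xs @ ys @ zs) = sm (xs @ zs)"
  by (rule sm_append_cong[OF refl]) (rule sm_drop[OF assms])

text \<open>The two attrition rules disagree only on an old copy of \<open>e\<close>, which the
  union with \<open>{e}\<close> restores.\<close>

lemma insert_attrite_eq: "insert_attrite Q e = catenate_attrite Q (sm [e])"
  by (auto simp: insert_attrite_def catenate_attrite_def)

lemma Min_sm_Cons: "\<forall>y\<in>set xs. x < y \<Longrightarrow> Min (sm (x # xs)) = x"
  using sm_subset[of xs] by (intro Min_eqI) (auto intro: less_imp_le)

lemma sm_Cons_minus_Min: "\<forall>y\<in>set xs. x < y \<Longrightarrow> sm (x # xs) - {Min (sm (x # xs))} = sm xs"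
  using sm_subset[of xs] by (subst Min_sm_Cons) auto


section \<open>Records on disk\<close>

text \<open>
  Record \<open>a\<close> occupies the blocks \<open>16 a, \<dots>, 16 a + 11\<close>: its elements, and eleven blocks holding one
  number each. Fields 1 to 4 link the record into a list (successor, predecessor, last record of the
  segment, first record of the next lower segment; the latter two are meaningful for the first record
  of a segment only), fields 5 to 10 describe the lists below the record, and field 11 is the
  number of its elements.

  The cells \<open>0, \<dots>, B\<close> are scratch space: the numbers an operation works with are kept in the control
  state of the program.
\<close>

definition getF :: "nat \<Rightarrow> nat \<Rightarrow> (nat \<Rightarrow> prog) \<Rightarrow> prog" where
  "getF a j k = ReadBlock (16 * a + j) 0 (CaseNum 0 k)"

definition setF :: "nat \<Rightarrow> nat \<Rightarrow> nat \<Rightarrow> prog \<Rightarrow> prog" where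
  "setF a j v p = SetNum 0 v (WriteBlock (16 * a + j) 0 p)"

text \<open>The second read overwrites the cells below \<open>B\<close>, so the first key waits in
  cell \<open>B\<close>. This is the reason for one scratch cell beyond a block.\<close>

definition cmpK :: "nat \<Rightarrow> nat \<Rightarrow> nat \<Rightarrow> prog \<Rightarrow> prog \<Rightarrow> prog" where
  "cmpK B a a' p q = ReadBlock (16 * a) 0 (Copy 0 B (ReadBlock (16 * a') 0 (IfLess B 0 p q)))"

primrec freeBlocks :: "nat \<Rightarrow> nat \<Rightarrow> prog \<Rightarrow> prog" where
  "freeBlocks a 0 p = FreeBlock (16 * a) p"
| "freeBlocks a (Suc n) p = FreeBlock (16 * a + Suc n) (freeBlocks a n p)"

text \<open>Only the outermost call writes \<open>v\<close>. With 11 fields this stores the length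
  in field 11 and zeros elsewhere, and zeros in fields 5 to 10 are the header of a record with
  nothing below it.\<close>

primrec writeFields :: "nat \<Rightarrow> nat \<Rightarrow> nat \<Rightarrow> prog \<Rightarrow> prog" where
  "writeFields a v 0 p = p"
| "writeFields a v (Suc n) p = setF a (Suc n) v (writeFields a 0 n p)"

definition newRec :: "nat \<Rightarrow> nat \<Rightarrow> prog \<Rightarrow> prog" where
  "newRec a n p = WriteBlock (16 * a) 0 (writeFields a n 11 p)"

text \<open>The abstract state in which programs are verified: instead of disk blocks it knows the
  live records \<open>vL\<close>, their elements and their fields. Its memory is meaningful above
  cell \<open>B\<close> only.\<close>

record 'a vst =
  vm :: "nat \<Rightarrow> 'a word"
  vres :: "'a option"
  vL :: "nat set"
  vel :: "nat \<Rightarrow> 'a list"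
  vfd :: "nat \<Rightarrow> nat \<Rightarrow> nat"

locale mach =
  fixes B M W :: nat and arg :: "'a::linorder option"
  assumes B1: "1 \<le> B" and BM: "2 * B \<le> M" and W1: "1 \<le> W"
begin

abbreviation mc :: machine where "mc \<equiv> \<lparr>mem_size = M, block_size = B, word_max = W\<rparr>"

text \<open>The bound \<open>f j \<le> W\<close> lets a program store again any number that it has
  read from a record.\<close>

definition Rec :: "(nat \<Rightarrow> 'a word list option) \<Rightarrow> nat \<Rightarrow> 'a list \<Rightarrow> (nat \<Rightarrow> nat) \<Rightarrow> bool" where
  "Rec d a xs f \<longleftrightarrow> xs \<noteq> [] \<and> length xs \<le> B \<and> 16 * a + 15 \<le> W \<and> f 11 = length xs
     \<and> (\<exists>blk. d (16 * a) = Some blk \<and> (\<forall>i<length xs. blk ! i = Elem (xs ! i)))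
     \<and> (\<forall>j\<in>{1..11}. f j \<le> W \<and> (\<exists>blk. d (16 * a + j) = Some blk \<and> blk ! 0 = Num (f j)))"

text \<open>The last conjunct confines the used blocks to the twelve of each live record, which
  turns a bound on \<open>card (vL st)\<close> into a bound on space.\<close>

definition R :: "'a config \<Rightarrow> 'a vst \<Rightarrow> bool" where
  "R s st \<longleftrightarrow> (\<forall>c>B. mem s c = vm st c) \<and> result s = vres st \<and> finite (vL st)
     \<and> (\<forall>a\<in>vL st. Rec (disk s) a (vel st a) (vfd st a))
     \<and> (\<forall>x. disk s x \<noteq> None \<longrightarrow> x div 16 \<in> vL st \<and> x mod 16 \<le> 11)"

text \<open>A weakest precondition with an I/O budget \<open>n\<close>. Programs carry their
  continuations, so each rule below reduces a program to its continuation in an updated abstract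
  state, with what is left of the budget.\<close>

definition safe :: "prog \<Rightarrow> 'a vst \<Rightarrow> nat \<Rightarrow> ('a config \<Rightarrow> bool) \<Rightarrow> bool" where
  "safe p st n Q \<longleftrightarrow> (\<forall>s. R s st \<longrightarrow>
     (\<exists>s'. exec mc arg p s = Some s' \<and> ios s' \<le> ios s + n \<and> Q s'))"

lemma safe_mono: "safe p st n Q \<Longrightarrow> n \<le> m \<Longrightarrow> safe p st m Q"
  unfolding safe_def by (meson add_left_mono order_trans)

lemma safe_step:
  assumes "safe p st' n' Q"
    and "\<And>s. R s st \<Longrightarrow> \<exists>s'. exec mc arg q s = exec mc arg p s' \<and> R s' st' \<and> ios s' + n' \<le> ios s + n"
  shows "safe q st n Q"
  unfolding safe_def
proof (intro allI impI)
  fix s assume "R s st"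
  from assms(2)[OF this] obtain s' where s': "exec mc arg q s = exec mc arg p s'" "R s' st'"
    "ios s' + n' \<le> ios s + n" by blast
  from assms(1) s'(2) obtain s'' where "exec mc arg p s' = Some s''" "ios s'' \<le> ios s' + n'" "Q s''"
    unfolding safe_def by blast
  with s' show "\<exists>s'. exec mc arg q s = Some s' \<and> ios s' \<le> ios s + n \<and> Q s'" by auto
qed

lemma R_Rec: "R s st \<Longrightarrow> a \<in> vL st \<Longrightarrow> Rec (disk s) a (vel st a) (vfd st a)"
  by (simp add: R_def)

lemma Rec_field:
  "Rec d a xs f \<Longrightarrow> 1 \<le> j \<Longrightarrow> j \<le> 11 \<Longrightarrow>
    \<exists>blk. d (16 * a + j) = Some blk \<and> blk ! 0 = Num (f j) \<and> f j \<le> W \<and> 16 * a + j \<le> W"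
  unfolding Rec_def by fastforce

lemma Rec_els:
  "Rec d a xs f \<Longrightarrow> \<exists>blk. d (16 * a) = Some blk \<and> blk ! 0 = Elem (hd xs) \<and>
     (\<forall>i<length xs. blk ! i = Elem (xs ! i)) \<and> 16 * a \<le> W"
  unfolding Rec_def by (fastforce simp: hd_conv_nth)

lemma R_mem: "R s st \<Longrightarrow> (\<And>c. c > B \<Longrightarrow> m c = mem s c) \<Longrightarrow> R (s\<lparr>mem := m, ios := n\<rparr>) st"
  by (simp add: R_def)

text \<open>The bound on the value read is a fact about concrete configurations. The continuation
  may assume it, so the proof first fixes a configuration instead of going through
  \<open>safe_step\<close>.\<close>

lemma safe_getF:
  assumes "a \<in> vL st" "1 \<le> j" "j \<le> 11" "1 \<le> n"
    and "vfd st a j \<le> W \<Longrightarrow> safe (k (vfd st a j)) st (n - 1) Q"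
  shows "safe (getF a j k) st n Q"
  unfolding safe_def
proof (intro allI impI)
  fix s assume s: "R s st"
  obtain blk where blk: "disk s (16 * a + j) = Some blk" "blk ! 0 = Num (vfd st a j)"
      "vfd st a j \<le> W" "16 * a + j \<le> W"
    using Rec_field[OF R_Rec[OF s assms(1)] assms(2,3)] by blast
  let ?s = "s\<lparr>mem := (\<lambda>c. if 0 \<le> c \<and> c < 0 + B then blk ! (c - 0) else mem s c), ios := Suc (ios s)\<rparr>"
  have e: "exec mc arg (getF a j k) s = exec mc arg (k (vfd st a j)) ?s"
    using blk B1 BM by (simp add: getF_def)
  have "R ?s st" by (rule R_mem[OF s]) simp
  from assms(5)[OF blk(3), unfolded safe_def, rule_format, OF this] assms(4)
  show "\<exists>s'. exec mc arg (getF a j k) s = Some s' \<and> ios s' \<le> ios s + n \<and> Q s'"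
    unfolding e by auto
qed

lemma block_addr_inj: "j < 16 \<Longrightarrow> j' < 16 \<Longrightarrow> 16 * a + j = 16 * a' + j' \<longleftrightarrow> a = a' \<and> j = (j'::nat)"
proof -
  assume j: "j < 16" "j' < 16"
  have "(16 * a + j) div 16 = a" "(16 * a' + j') div 16 = a'" using j by simp_all
  then show ?thesis by fastforce
qed

lemma Rec_frame: "Rec d a xs f \<Longrightarrow> (\<And>j. j < 16 \<Longrightarrow> d' (16 * a + j) = d (16 * a + j)) \<Longrightarrow> Rec d' a xs f"
proof -
  assume r: "Rec d a xs f" and eq: "\<And>j. j < 16 \<Longrightarrow> d' (16 * a + j) = d (16 * a + j)"
  have "d' (16 * a) = d (16 * a)" using eq[of 0] by simp
  moreover have "j \<in> {1..11} \<Longrightarrow> d' (16 * a + j) = d (16 * a + j)" for j by (rule eq) simp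
  ultimately show ?thesis using r unfolding Rec_def by simp
qed

text \<open>Field 11 is excluded because \<open>Rec\<close> ties it to the number of
  elements.\<close>

lemma safe_setF:
  assumes "a \<in> vL st" "1 \<le> j" "j \<le> 10" "v \<le> W" "1 \<le> n"
    and "safe p (st\<lparr>vfd := (vfd st)(a := (vfd st a)(j := v))\<rparr>) (n - 1) Q"
  shows "safe (setF a j v p) st n Q"
proof (rule safe_step[OF assms(6)])
  fix s assume s: "R s st"
  note r = R_Rec[OF s assms(1)]
  have le: "16 * a + j \<le> W" using r assms(3) by (auto simp: Rec_def)
  let ?m = "(mem s)(0 := Num v)"
  let ?d = "(disk s)(16 * a + j \<mapsto> map ?m [0..<0 + B])"
  let ?s = "s\<lparr>mem := ?m, disk := ?d, ios := Suc (ios s)\<rparr>"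
  have e: "exec mc arg (setF a j v p) s = exec mc arg p ?s"
    using le assms(4) B1 BM by (simp add: setF_def)
  have rec: "Rec ?d a' (vel st a') (((vfd st)(a := (vfd st a)(j := v))) a')" if "a' \<in> vL st" for a'
  proof (cases "a' = a")
    case True
    have "16 * a + j \<noteq> 16 * a" using assms(2) by simp
    then show ?thesis using r assms(2-4) B1 True
      unfolding Rec_def by (auto simp: nth_append)
  next
    case False
    have "Rec ?d a' (vel st a') (vfd st a')"
      by (rule Rec_frame[OF R_Rec[OF s that]]) (use False assms(3) in \<open>auto simp: block_addr_inj\<close>)
    then show ?thesis using False by simp
  qed
  have "(16 * a + j) div 16 = a" "(16 * a + j) mod 16 = j" using assms(3) by auto
  then have "R ?s (st\<lparr>vfd := (vfd st)(a := (vfd st a)(j := v))\<rparr>)"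
    using s rec assms(1,3) B1 unfolding R_def by auto
  then show "\<exists>s'. exec mc arg (setF a j v p) s = exec mc arg p s' \<and>
      R s' (st\<lparr>vfd := (vfd st)(a := (vfd st a)(j := v))\<rparr>) \<and> ios s' + (n - 1) \<le> ios s + n"
    using e assms(5) by (intro exI[of _ ?s]) auto
qed

lemma safe_cmpK:
  assumes "a \<in> vL st" "a' \<in> vL st" "2 \<le> n"
    and "hd (vel st a) < hd (vel st a') \<Longrightarrow> safe p st (n - 2) Q"
    and "\<not> hd (vel st a) < hd (vel st a') \<Longrightarrow> safe q st (n - 2) Q"
  shows "safe (cmpK B a a' p q) st n Q"
proof -
  let ?b = "hd (vel st a) < hd (vel st a')"
  have "safe (if ?b then p else q) st (n - 2) Q" using assms(4,5) by auto
  then show ?thesis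
  proof (rule safe_step)
    fix s assume s: "R s st"
    obtain blk where blk: "disk s (16 * a) = Some blk" "blk ! 0 = Elem (hd (vel st a))" "16 * a \<le> W"
      using Rec_els[OF R_Rec[OF s assms(1)]] by blast
    obtain blk' where blk': "disk s (16 * a') = Some blk'" "blk' ! 0 = Elem (hd (vel st a'))" "16 * a' \<le> W"
      using Rec_els[OF R_Rec[OF s assms(2)]] by blast
    let ?s = "s\<lparr>mem := (\<lambda>c. if c < B then blk' ! c else if c = B then blk ! 0 else mem s c), ios := Suc (Suc (ios s))\<rparr>"
    have "exec mc arg (cmpK B a a' p q) s = exec mc arg (if ?b then p else q) ?s"
      using blk blk' B1 BM
      by (simp add: cmpK_def) (auto intro!: arg_cong[of _ _ "exec mc arg _"] simp: fun_eq_iff)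
    moreover have "R ?s st" by (rule R_mem[OF s]) simp
    ultimately show "\<exists>s'. exec mc arg (cmpK B a a' p q) s = exec mc arg (if ?b then p else q) s' \<and> R s' st \<and> ios s' + (n - 2) \<le> ios s + n"
      using assms(3) by (intro exI[of _ ?s]) auto
  qed
qed

lemma exec_freeBlocks:
  "exec mc arg (freeBlocks a n p) s =
    exec mc arg p (s\<lparr>disk := (\<lambda>x. if 16 * a \<le> x \<and> x \<le> 16 * a + n then None else disk s x)\<rparr>)"
proof (induction n arbitrary: s)
  case 0
  have "(disk s)(16 * a := None) = (\<lambda>x. if 16 * a \<le> x \<and> x \<le> 16 * a + 0 then None else disk s x)"
    by auto
  then show ?case by simp
next
  case (Suc n)
  have "(\<lambda>x. if 16 * a \<le> x \<and> x \<le> 16 * a + n then None else ((disk s)(16 * a + Suc n := None)) x)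
      = (\<lambda>x. if 16 * a \<le> x \<and> x \<le> 16 * a + Suc n then None else disk s x)"
    by (rule ext) auto
  then show ?case by (simp add: Suc.IH cong: if_cong)
qed

lemma safe_free:
  assumes "safe p (st\<lparr>vL := vL st - {a}\<rparr>) n Q"
  shows "safe (freeBlocks a 15 p) st n Q"
proof (rule safe_step[OF assms])
  fix s assume s: "R s st"
  let ?d = "\<lambda>x. if 16 * a \<le> x \<and> x \<le> 16 * a + 15 then None else disk s x"
  let ?s = "s\<lparr>disk := ?d\<rparr>"
  have "Rec ?d a' (vel st a') (vfd st a')" if "a' \<in> vL st - {a}" for a'
  proof (rule Rec_frame[OF R_Rec[OF s]])
    fix j :: nat assume "j < 16"
    moreover have "a' \<noteq> a" using that by simp
    ultimately have "\<not> (16 * a \<le> 16 * a' + j \<and> 16 * a' + j \<le> 16 * a + 15)" by auto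
    then show "?d (16 * a' + j) = disk s (16 * a' + j)" by (simp only: if_False)
  qed (use that in simp)
  moreover have "x div 16 \<in> vL st - {a} \<and> x mod 16 \<le> 11" if "?d x \<noteq> None" for x
  proof -
    have "disk s x \<noteq> None" "\<not> (16 * a \<le> x \<and> x \<le> 16 * a + 15)" using that by (auto split: if_splits)
    then show ?thesis using s by (auto simp: R_def) 
  qed
  ultimately have "R ?s (st\<lparr>vL := vL st - {a}\<rparr>)" using s by (simp add: R_def)
  then show "\<exists>s'. exec mc arg (freeBlocks a 15 p) s = exec mc arg p s' \<and> R s' (st\<lparr>vL := vL st - {a}\<rparr>) \<and> ios s' + n \<le> ios s + n"
    by (intro exI[of _ ?s]) (simp add: exec_freeBlocks)
qed

lemma exec_writeFields:
  assumes "16 * a + n \<le> W" "v \<le> W"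
  shows "\<exists>s'. exec mc arg (writeFields a v n p) s = exec mc arg p s' \<and>
     (\<forall>c>0. mem s' c = mem s c) \<and> result s' = result s \<and> ios s' = ios s + n \<and>
     (\<forall>j\<in>{1..n}. \<exists>blk. disk s' (16 * a + j) = Some blk \<and> blk ! 0 = Num (if j = n then v else 0)) \<and>
     (\<forall>x. x \<notin> {16 * a + 1..16 * a + n} \<longrightarrow> disk s' x = disk s x)"
  using assms
proof (induction n arbitrary: v s)
  case (Suc n)
  let ?m = "(mem s)(0 := Num v)"
  let ?s = "s\<lparr>mem := ?m, disk := (disk s)(16 * a + Suc n \<mapsto> map ?m [0..<0 + B]), ios := Suc (ios s)\<rparr>"
  have e: "exec mc arg (writeFields a v (Suc n) p) s = exec mc arg (writeFields a 0 n p) ?s"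
    using Suc.prems B1 BM by (simp add: setF_def)
  obtain s' where s': "exec mc arg (writeFields a 0 n p) ?s = exec mc arg p s'"
     "\<forall>c>0. mem s' c = mem ?s c" "result s' = result ?s" "ios s' = ios ?s + n"
     "\<forall>j\<in>{1..n}. \<exists>blk. disk s' (16 * a + j) = Some blk \<and> blk ! 0 = Num (if j = n then 0 else 0)"
     "\<forall>x. x \<notin> {16 * a + 1..16 * a + n} \<longrightarrow> disk s' x = disk ?s x"
    using Suc.IH[of 0 ?s] Suc.prems(1) by auto
  have "disk s' (16 * a + Suc n) = Some (map ?m [0..<0 + B])" using s'(6) by simp
  then have "\<exists>blk. disk s' (16 * a + j) = Some blk \<and> blk ! 0 = Num (if j = Suc n then v else 0)"
    if "j \<in> {1..Suc n}" for j
    using s'(5) that B1 by (cases "j = Suc n") (auto simp: le_Suc_eq)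
  then show ?case
    unfolding e s'(1) using s'(2-4,6) by (intro exI[of _ s']) auto
qed auto

text \<open>Stated for \<open>exec\<close>, since the elements to be written sit in scratch cells,
  which the abstract state does not describe. \<open>safe_insert1\<close> and
  \<open>safe_recFrom\<close> hide these cells again.\<close>

lemma exec_newRec:
  assumes s: "R s st" and "a \<notin> vL st" "16 * a + 15 \<le> W" "xs \<noteq> []" "length xs \<le> B" "length xs \<le> W"
    and m: "\<And>i. i < length xs \<Longrightarrow> mem s i = Elem (xs ! i)"
  shows "\<exists>s'. exec mc arg (newRec a (length xs) p) s = exec mc arg p s' \<and>
     R s' (st\<lparr>vL := insert a (vL st), vel := (vel st)(a := xs),
        vfd := (vfd st)(a := (\<lambda>j. if j = 11 then length xs else 0))\<rparr>) \<and> ios s' = ios s + 12"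
proof -
  let ?blk = "map (mem s) [0..<0 + B]"
  let ?s = "s\<lparr>disk := (disk s)(16 * a \<mapsto> ?blk), ios := Suc (ios s)\<rparr>"
  have e: "exec mc arg (newRec a (length xs) p) s = exec mc arg (writeFields a (length xs) 11 p) ?s"
    using assms(3) BM by (simp add: newRec_def del: writeFields.simps)
  obtain s' where s': "exec mc arg (writeFields a (length xs) 11 p) ?s = exec mc arg p s'"
     "\<forall>c>0. mem s' c = mem ?s c" "result s' = result ?s" "ios s' = ios ?s + 11"
     "\<forall>j\<in>{1..11}. \<exists>blk. disk s' (16 * a + j) = Some blk \<and> blk ! 0 = Num (if j = 11 then length xs else 0)"
     "\<forall>x. x \<notin> {16 * a + 1..16 * a + 11} \<longrightarrow> disk s' x = disk ?s x"
    using exec_writeFields[of a 11 "length xs" p ?s] assms(3,6) by auto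
  let ?f = "\<lambda>j::nat. if j = 11 then length xs else 0"
  have "disk s' (16 * a) = Some ?blk" using s'(6) by simp
  then have ra: "Rec (disk s') a xs ?f"
    using s'(5) assms(3-6) m W1 unfolding Rec_def by auto
  have rb: "Rec (disk s') a' (vel st a') (vfd st a')" if "a' \<in> vL st" for a'
  proof (rule Rec_frame[OF R_Rec[OF s that]])
    fix j :: nat assume j: "j < 16"
    have "a' \<noteq> a" using that assms(2) by auto
    then have "16 * a' + j \<notin> {16 * a..16 * a + 11}" using j by auto
    then have "16 * a' + j \<notin> {16 * a + 1..16 * a + 11}" "16 * a' + j \<noteq> 16 * a" by auto
    then show "disk s' (16 * a' + j) = disk s (16 * a' + j)" using s'(6) by simp
  qed
  have "x div 16 \<in> insert a (vL st) \<and> x mod 16 \<le> 11" if "disk s' x \<noteq> None" for x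
  proof (cases "x \<in> {16 * a..16 * a + 11}")
    case True
    then obtain i where "x = 16 * a + i" "i \<le> 11" by (metis add_le_cancel_left atLeastAtMost_iff le_iff_add)
    then show ?thesis by simp
  next
    case False
    then have "x \<notin> {16 * a + 1..16 * a + 11}" "x \<noteq> 16 * a" by auto
    then have "disk s x \<noteq> None" using s'(6) that by simp
    then show ?thesis using s by (simp add: R_def)
  qed
  then have "R s' (st\<lparr>vL := insert a (vL st), vel := (vel st)(a := xs), vfd := (vfd st)(a := ?f)\<rparr>)"
    using s ra rb s'(2,3) assms(2) unfolding R_def by auto
  then show ?thesis unfolding e s'(1) using s'(4) by (intro exI[of _ s']) auto
qed

lemma R_blocks_used: "R s st \<Longrightarrow> blocks_used s \<le> 12 * card (vL st)"
proof -
  assume s: "R s st"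
  have "{a. disk s a \<noteq> None} \<subseteq> (\<lambda>(a, j). 16 * a + j) ` (vL st \<times> {..11})"
  proof
    fix x assume "x \<in> {a. disk s a \<noteq> None}"
    then have "x div 16 \<in> vL st" "x mod 16 \<le> 11" using s by (auto simp: R_def)
    moreover have "x = 16 * (x div 16) + x mod 16" by simp
    ultimately show "x \<in> (\<lambda>(a, j). 16 * a + j) ` (vL st \<times> {..11})" by (intro image_eqI[of _ _ "(x div 16, x mod 16)"]) auto
  qed
  moreover have f: "finite (vL st \<times> {..11::nat})" using s by (simp add: R_def)
  ultimately have "blocks_used s \<le> card (vL st \<times> {..11::nat})"
    unfolding blocks_used_def by (meson card_image_le card_mono finite_imageI le_trans)
  then show ?thesis by (simp add: card_cartesian_product)
qed

end

section \<open>The queue of records\<close>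

text \<open>
  A record carries a sorted list of elements and three lists of records that follow it: the clean list
  \<open>C\<close>, whose keys are known to survive, the buffer \<open>B\<close>, a sorted list that may still be attrited by \<open>D\<close>,
  and the stack \<open>D\<close> of sorted segments (uppermost, that is last, segment first). The records of \<open>C\<close>
  and \<open>B\<close> have no lists below them, hence they are mere pairs of an address and a list of elements.
\<close>

datatype 'a rc = Rc (ad: nat) (els: "'a list") (kC: "(nat \<times> 'a list) list")
  (kB: "(nat \<times> 'a list) list") (kD: "'a rc list list")

abbreviation key :: "'a rc \<Rightarrow> 'a" where "key r \<equiv> hd (els r)"
abbreviation bkey :: "nat \<times> 'a list \<Rightarrow> 'a" where "bkey c \<equiv> hd (snd c)"

text \<open>The maps over \<open>D\<close> come from primitive recursion through nested lists;
  \<open>prs_eq\<close> gives the readable form. \<open>D\<close> is reversed because its uppermost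
  segment is the last one in the sequence.\<close>

primrec prs :: "'a rc \<Rightarrow> (nat \<times> 'a list) list" where
  "prs (Rc a e C B D) = (a, e) # C @ B @ concat (map concat (rev (map (map prs) D)))"

definition prsD :: "'a rc list list \<Rightarrow> (nat \<times> 'a list) list" where
  "prsD D = concat (map prs (concat (rev D)))"

lemma prs_eq: "prs r = (ad r, els r) # kC r @ kB r @ prsD (kD r)"
proof -
  have "concat (map concat (rev (map (map prs) D))) = prsD D" for D :: "'a rc list list"
    by (induction D) (auto simp: prsD_def)
  then show ?thesis by (cases r) simp
qed

lemmas prs_simps [simp del] = prs.simps

lemma prsD_simps [simp]:
  "prsD [] = []" "prsD (g # D) = prsD D @ concat (map prs g)"
  by (simp_all add: prsD_def)

definition flt :: "(nat \<times> 'a list) list \<Rightarrow> 'a list" where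
  "flt P = concat (map snd P)"

lemma flt_simps [simp]: "flt [] = []" "flt (p # P) = snd p @ flt P" "flt (P @ P') = flt P @ flt P'"
  by (simp_all add: flt_def)

text \<open>The work that \<open>D\<close> may still require: one step for each record, which is
  moved or dropped, and one merge for each segment but the last.\<close>

definition cost :: "'a rc list list \<Rightarrow> nat" where
  "cost D = (if D = [] then 0 else length (concat D) + length D - 1)"

definition bok :: "nat \<times> 'a::linorder list \<Rightarrow> bool" where
  "bok c \<longleftrightarrow> snd c \<noteq> [] \<and> (\<forall>x\<in>set (snd c). bkey c \<le> x)"

text \<open>Only keys are ordered; the other elements of a record may already be attrited by the
  next record. The last conjunct makes \<open>hd (last D)\<close> the least record of the stack, so
  a single comparison can tell whether all of \<open>D\<close> is attrited. A buffer is only allowed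
  in front of a nonempty stack, as otherwise nothing would threaten it.\<close>

definition ok0 :: "(nat \<times> 'a::linorder list) list \<Rightarrow> (nat \<times> 'a list) list \<Rightarrow> 'a rc list list \<Rightarrow> bool" where
  "ok0 C B D \<longleftrightarrow> (\<forall>c\<in>set C \<union> set B. bok c)
     \<and> sorted_wrt (\<lambda>c d. bkey c < bkey d) (C @ B)
     \<and> (\<forall>c\<in>set C. \<forall>r\<in>set (concat D). bkey c < key r)
     \<and> (B \<noteq> [] \<longrightarrow> D \<noteq> [])
     \<and> (\<forall>g\<in>set D. g \<noteq> [] \<and> sorted_wrt (\<lambda>r r'. key r < key r') g)
     \<and> (\<forall>r\<in>set (concat (butlast D)). key (hd (last D)) < key r)"

text \<open>The balance \<open>cost D \<le> length C\<close> is demanded of every record of the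
  tree, not only of the root: when the lists below a record are unfolded into the level above, its
  clean records cover the work that its own stack brings along.\<close>

primrec okr :: "'a::linorder rc \<Rightarrow> bool" where
  "okr (Rc a e C B D) \<longleftrightarrow> bok (a, e) \<and> ok0 C B D \<and> cost D \<le> length C
     \<and> (\<forall>c\<in>set C \<union> set B. hd e < bkey c) \<and> (\<forall>r\<in>set (concat D). hd e < key r)
     \<and> (\<forall>bs\<in>set (map (map okr) D). \<forall>b\<in>set bs. b)"

lemma okr_eq: "okr r \<longleftrightarrow> bok (ad r, els r) \<and> ok0 (kC r) (kB r) (kD r) \<and> cost (kD r) \<le> length (kC r)
     \<and> (\<forall>c\<in>set (kC r) \<union> set (kB r). key r < bkey c) \<and> (\<forall>r'\<in>set (concat (kD r)). key r < key r')
     \<and> (\<forall>r'\<in>set (concat (kD r)). okr r')"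
  by (cases r) auto

lemmas okr_simps [simp del] = okr.simps

text \<open>The balance is left out because it fails temporarily, between the change of a level and
  the steps that restore it.\<close>

definition kids_ok :: "(nat \<times> 'a::linorder list) list \<Rightarrow> (nat \<times> 'a list) list \<Rightarrow> 'a rc list list \<Rightarrow> bool" where
  "kids_ok C B D \<longleftrightarrow> ok0 C B D \<and> (\<forall>r\<in>set (concat D). okr r)"

lemma okr_iff: "okr r \<longleftrightarrow> bok (ad r, els r) \<and> kids_ok (kC r) (kB r) (kD r) \<and> cost (kD r) \<le> length (kC r)
     \<and> (\<forall>c\<in>set (kC r) \<union> set (kB r). key r < bkey c) \<and> (\<forall>r'\<in>set (concat (kD r)). key r < key r')"
  unfolding kids_ok_def by (subst okr_eq) auto

section \<open>Keys as lower bounds of whole trees\<close>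

lemma sorted_wrt_le_last:
  fixes f :: "'b \<Rightarrow> 'a::linorder"
  shows "sorted_wrt (\<lambda>x y. f x < f y) xs \<Longrightarrow> x \<in> set xs \<Longrightarrow> f x \<le> f (last xs)"
  by (induction xs) (auto intro: less_imp_le)

lemma flt_bok: "x \<in> set (flt P) \<Longrightarrow> \<forall>c\<in>set P. bok c \<Longrightarrow> \<exists>c\<in>set P. bkey c \<le> x"
  by (induction P) (auto simp: bok_def)

text \<open>Structural induction: the key is least among the elements of its record and lies below
  the keys of all records underneath, each of which bounds its own tree. A tree can therefore be
  discarded after comparing its key only.\<close>

lemma okr_le: "okr r \<Longrightarrow> x \<in> set (flt (prs r)) \<Longrightarrow> key r \<le> x"
proof (induction r arbitrary: x)
  case (Rc a e C B D)
  let ?r = "Rc a e C B D"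
  have ok: "okr ?r" by fact
  note okr_eq[THEN iffD1, OF ok]
  then have 1: "bok (a, e)" "\<forall>c\<in>set (C @ B). bok c" "\<forall>c\<in>set (C @ B). hd e < bkey c"
    "\<forall>r\<in>set (concat D). hd e < key r" "\<forall>r\<in>set (concat D). okr r"
    by (auto simp: ok0_def)
  from Rc.prems(2) consider "x \<in> set e" | "x \<in> set (flt (C @ B))" | "x \<in> set (flt (prsD D))"
    by (auto simp: prs_eq[of ?r])
  then show ?case
  proof cases
    case 1
    then show ?thesis using \<open>bok (a, e)\<close> by (auto simp: bok_def)
  next
    case 2
    from flt_bok[OF this 1(2)] 1(3) show ?thesis by (auto intro: order_trans less_imp_le)
  next
    case 3
    then obtain g r where r: "g \<in> set D" "r \<in> set g" "x \<in> set (flt (prs r))"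
      by (auto simp: prsD_def flt_def)
    then have "key r \<le> x" using Rc.IH 1(5) by auto
    moreover have "hd e < key r" using 1(4) r by auto
    ultimately show ?thesis by auto
  qed
qed

lemma flt_prsD_le:
  "x \<in> set (flt (prsD D)) \<Longrightarrow> \<forall>r\<in>set (concat D). okr r \<Longrightarrow> \<exists>r\<in>set (concat D). key r \<le> x"
proof -
  assume x: "x \<in> set (flt (prsD D))" and ok: "\<forall>r\<in>set (concat D). okr r"
  from x obtain r where "r \<in> set (concat D)" "x \<in> set (flt (prs r))"
    by (auto simp: prsD_def flt_def)
  then show ?thesis using ok okr_le by blast
qed

lemma key_in_flt: "bok c \<Longrightarrow> c \<in> set P \<Longrightarrow> bkey c \<in> set (flt P)"
  by (auto simp: flt_def bok_def intro!: bexI[of _ c])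

lemma key_in_flt_prsD: "r \<in> set (concat D) \<Longrightarrow> okr r \<Longrightarrow> key r \<in> set (flt (prsD D))"
proof -
  assume r: "r \<in> set (concat D)" "okr r"
  then have "(ad r, els r) \<in> set (prsD D)" "bok (ad r, els r)"
    by (auto simp: prsD_def okr_eq[of r] prs_eq[of r] intro!: bexI[of _ r])
  from key_in_flt[OF this(2,1)] show ?thesis by simp
qed

lemma okr_less: "okr r \<Longrightarrow> x \<in> set (flt (kC r @ kB r @ prsD (kD r))) \<Longrightarrow> key r < x"
proof -
  assume ok: "okr r" and x: "x \<in> set (flt (kC r @ kB r @ prsD (kD r)))"
  note 1 = okr_eq[THEN iffD1, OF ok]
  from x have "x \<in> set (flt (kC r @ kB r)) \<or> x \<in> set (flt (prsD (kD r)))" by auto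
  then show ?thesis
  proof
    assume "x \<in> set (flt (kC r @ kB r))"
    from flt_bok[OF this] 1 show ?thesis by (auto simp: ok0_def intro: less_le_trans)
  next
    assume "x \<in> set (flt (prsD (kD r)))"
    from flt_prsD_le[OF this] 1 show ?thesis by (auto intro: less_le_trans)
  qed
qed

text \<open>\<open>red P P'\<close>: the records \<open>P'\<close> remain of \<open>P\<close> after dropping records that are certainly attrited.\<close>

definition red :: "(nat \<times> 'a::linorder list) list \<Rightarrow> (nat \<times> 'a list) list \<Rightarrow> bool" where
  "red P P' \<longleftrightarrow> set P' \<subseteq> set P \<and> (distinct (map fst P) \<longrightarrow> distinct (map fst P')) \<and> sm (flt P') = sm (flt P)"

lemma red_refl [simp]: "red P P"
  by (simp add: red_def)

lemma red_trans: "red P P' \<Longrightarrow> red P' P'' \<Longrightarrow> red P P''"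
  by (auto simp: red_def)

lemma red_drop:
  assumes "z \<in> set (flt Z)" "\<And>y. y \<in> set (flt Y) \<Longrightarrow> z \<le> y"
  shows "red (X @ Y @ Z) (X @ Z)"
  using sm_drop_middle[OF assms] by (auto simp: red_def)

lemma red_context: "red P P' \<Longrightarrow> red (X @ P) (X @ P')"
  by (auto simp: red_def sm_append)

text \<open>\<open>r\<close> has just joined \<open>C\<close>, and its own lists stand in front of
  \<open>g\<close>, the rest of its segment, which may attrite them. By the balance,
  \<open>kC r = []\<close> means that nothing is below \<open>r\<close>. If the last key of
  \<open>kC r\<close> is not below \<open>key (hd g)\<close>, then \<open>kB r\<close> and
  \<open>kD r\<close>, whose keys are larger still, are gone, and \<open>kC r\<close> may be cut
  anywhere, so it becomes the buffer. Otherwise \<open>kC r\<close> is clean, and the least key of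
  \<open>kD r\<close> decides whether \<open>kD r\<close> is gone or receives \<open>g\<close> on
  top.\<close>

fun unfoldG :: "(nat \<times> 'a::linorder list) list \<Rightarrow> 'a rc \<Rightarrow> 'a rc list \<Rightarrow>
    (nat \<times> 'a list) list \<times> (nat \<times> 'a list) list \<times> 'a rc list list" where
  "unfoldG C r g =
    (if kC r = [] then (C, [], if g = [] then [] else [g])
     else if g = [] then (C @ kC r, kB r, kD r)
     else if \<not> bkey (last (kC r)) < key (hd g) then (C, kC r, [g])
     else if kD r = [] \<or> \<not> key (hd (last (kD r))) < key (hd g) then (C @ kC r, kB r, [g])
     else (C @ kC r, kB r, g # kD r))"

text \<open>The first record of the only segment is known to survive. With two segments, the last
  record of the lower one is compared with the first of the upper one: either the concatenation is
  sorted, or the record compared is attrited together with its tree.\<close>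

fun stepG where
  "stepG C [] = (C, [], [])"
| "stepG C [g] = unfoldG (C @ [(ad (hd g), els (hd g))]) (hd g) (tl g)"
| "stepG C (t # u # D) =
    (if key (last u) < key (hd t) then (C, [], (u @ t) # D)
     else (C, [], t # (if butlast u = [] then D else butlast u # D)))"

text \<open>As the buffer is sorted, a head that is not below the least key of \<open>D\<close>
  means that the entire buffer is attrited; \<open>stepG\<close> then continues without it.\<close>

definition biasG where
  "biasG C B D =
    (if D = [] then (C, B, D)
     else if B \<noteq> [] \<and> bkey (hd B) < key (hd (last D)) then (C @ [hd B], tl B, D)
     else stepG C D)"

text \<open>The records above the lowest segment are covered by the last conjunct of
  \<open>ok0\<close>, those of the lowest segment by its order.\<close>

lemma ok0_hd_last_le:
  assumes "ok0 C B D" "r \<in> set (concat D)"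
  shows "key (hd (last D)) \<le> key r"
proof -
  have "D \<noteq> []" using assms(2) by auto
  then have D: "D = butlast D @ [last D]" by simp
  then have "set (concat D) = set (concat (butlast D)) \<union> set (last D)"
    by (metis concat_append concat.simps append_Nil2 set_append)
  with assms(2) consider "r \<in> set (concat (butlast D))" | "r \<in> set (last D)" by auto
  then show ?thesis
  proof cases
    case 1
    then show ?thesis using assms(1) by (auto simp: ok0_def intro: less_imp_le)
  next
    case 2
    have "sorted_wrt (\<lambda>r r'. key r < key r') (last D)" using assms(1) \<open>D \<noteq> []\<close> by (auto simp: ok0_def)
    then show ?thesis using 2 by (cases "last D") (auto intro: less_imp_le)
  qed
qed

lemma ok0_CD: "ok0 C B D \<Longrightarrow> c \<in> set C \<Longrightarrow> r \<in> set (concat D) \<Longrightarrow> bkey c < key r"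
  unfolding ok0_def by blast

lemma hd_last_in: "ok0 C B D \<Longrightarrow> D \<noteq> [] \<Longrightarrow> hd (last D) \<in> set (concat D)"
  by (auto simp: ok0_def intro!: bexI[of _ "last D"])

lemma red_drop_buffer:
  assumes "kids_ok C B D" "D \<noteq> []" "B = [] \<or> \<not> bkey (hd B) < key (hd (last D))"
  shows "kids_ok C [] D" "red (C @ B @ prsD D) (C @ prsD D)"
proof -
  have ok: "ok0 C B D" using assms by (simp add: kids_ok_def)
  then show "kids_ok C [] D" using assms by (auto simp: kids_ok_def ok0_def sorted_wrt_append)
  let ?r = "hd (last D)"
  have r: "?r \<in> set (concat D)" by (rule hd_last_in[OF ok assms(2)])
  have okr: "okr ?r" using assms(1) r unfolding kids_ok_def by blast
  show "red (C @ B @ prsD D) (C @ prsD D)"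
  proof (rule red_drop[OF key_in_flt_prsD[OF r okr]])
    fix y assume y: "y \<in> set (flt B)"
    then have B: "B \<noteq> []" by auto
    then have "key ?r \<le> bkey (hd B)" using assms(3) by auto
    moreover obtain c where c: "c \<in> set B" "bkey c \<le> y" using flt_bok[OF y] ok by (auto simp: ok0_def)
    moreover have "bkey (hd B) \<le> bkey c"
      using ok c(1) B by (cases B) (auto simp: ok0_def sorted_wrt_append intro: less_imp_le)
    ultimately show "key ?r \<le> y" by auto
  qed
qed

text \<open>\<open>P\<close> is the sequence before the step and \<open>n\<close> the deficit
  allowed afterwards.\<close>

definition post :: "(nat \<times> 'a::linorder list) list \<Rightarrow> nat \<Rightarrow>
    (nat \<times> 'a list) list \<times> (nat \<times> 'a list) list \<times> 'a rc list list \<Rightarrow> bool" where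
  "post P n = (\<lambda>(C, B, D). kids_ok C B D \<and> red P (C @ B @ prsD D) \<and> cost D \<le> length C + n)"

lemma cost_pos: "\<forall>g\<in>set D. g \<noteq> [] \<Longrightarrow> D \<noteq> [] \<Longrightarrow> 1 \<le> cost D"
  by (cases D) (auto simp: cost_def neq_Nil_conv)

text \<open>The purpose of the balance: a nonempty stack costs at least 1, so without clean records
  there is no stack, and without a stack no buffer. Hence the successor of a root is always the
  first record of \<open>C\<close>.\<close>

lemma kids_ok_empty: "kids_ok C B D \<Longrightarrow> cost D \<le> length C \<Longrightarrow> C = [] \<Longrightarrow> B = [] \<and> D = []"
  using cost_pos[of D] by (auto simp: kids_ok_def ok0_def)

text \<open>The record added to \<open>C\<close> repays one unit. The work brought by
  \<open>kD r\<close> is matched by \<open>kC r\<close>, which enters \<open>C\<close> whenever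
  \<open>kD r\<close> is retained.\<close>

lemma unfoldG_post:
  assumes "kids_ok C [] [r # g]" "cost [r # g] \<le> length C + n"
  shows "post (C @ prsD [r # g]) (n - 1) (unfoldG (C @ [(ad r, els r)]) r g)"
proof -
  have ok: "ok0 C [] [r # g]" and r: "okr r" and g: "\<forall>r\<in>set g. okr r"
    using assms(1) by (auto simp: kids_ok_def)
  note r' = okr_iff[THEN iffD1, OF r]
  have k: "kids_ok (kC r) (kB r) (kD r)" "cost (kD r) \<le> length (kC r)" using r' by auto
  then have ok': "ok0 (kC r) (kB r) (kD r)" by (simp add: kids_ok_def)
  let ?C = "C @ [(ad r, els r)]"
  have c: "length g + 1 \<le> length C + n" using assms(2) by (simp add: cost_def)
  have rg: "\<forall>r'\<in>set g. key r < key r'" using ok by (auto simp: ok0_def)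
  have P: "C @ prsD [r # g] = ?C @ kC r @ kB r @ prsD (kD r) @ prsD [g]"
    by (simp add: prs_eq[of r])
  have g0: "kids_ok ?C [] [g]" if "g \<noteq> []"
    using ok r' g that by (auto simp: kids_ok_def ok0_def sorted_wrt_append)
  have p1: "bkey c < key r" if "c \<in> set C" for c using ok that by (auto simp: ok0_def)
  have p2: "bkey c < bkey d" if "c \<in> set C" "d \<in> set (kC r) \<union> set (kB r)" for c d
    using p1[OF that(1)] r' that(2) by (meson less_trans)
  have p3: "bkey c < key d" if "c \<in> set C" "d \<in> set (concat (kD r))" for c d
    using p1[OF that(1)] r' that(2) by (meson less_trans)
  have p4: "\<forall>c\<in>set (?C @ kC r). \<forall>d\<in>set (concat (kD r)). bkey c < key d"
    using p3 r' ok0_CD[OF ok'] by (simp add: ball_Un del: set_concat)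
  have p5: "\<forall>c\<in>set (?C @ kC r) \<union> set (kB r). bok c" using ok ok' r' by (auto simp: ok0_def)
  have p6: "sorted_wrt (\<lambda>c d. bkey c < bkey d) ((?C @ kC r) @ kB r)"
  proof -
    have "\<forall>c\<in>set C. bkey c < key r" "\<forall>c\<in>set C. \<forall>d\<in>set (kC r). bkey c < bkey d"
      "\<forall>c\<in>set C. \<forall>d\<in>set (kB r). bkey c < bkey d" using p1 p2 by blast+
    then show ?thesis using ok ok' r' unfolding ok0_def sorted_wrt_append by (simp add: ball_Un)
  qed
  note CD = p4 and srtCB = p5 p6
  have srtC: "\<forall>c\<in>set ?C \<union> set (kC r). bok c" "sorted_wrt (\<lambda>c d. bkey c < bkey d) (?C @ kC r)"
    using p5 p6 by (simp_all add: sorted_wrt_append)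
  consider (1) "kC r = []" | (2) "kC r \<noteq> []" "g = []"
    | (3) "kC r \<noteq> []" "g \<noteq> []" "\<not> bkey (last (kC r)) < key (hd g)"
    | (4) "kC r \<noteq> []" "g \<noteq> []" "bkey (last (kC r)) < key (hd g)"
    by blast
  then show ?thesis
  proof cases
    case 1
    then have e: "kB r = []" "kD r = []" using kids_ok_empty[OF k] by auto
    show ?thesis
    proof (cases "g = []")
      case True
      have "kids_ok ?C [] []" using ok r' by (auto simp: kids_ok_def ok0_def sorted_wrt_append)
      then show ?thesis using 1 e True P by (simp add: post_def cost_def)
    next
      case False
      then show ?thesis using 1 e P g0 c by (simp add: post_def cost_def)
    qed
  next
    case 2
    have "ok0 (?C @ kC r) (kB r) (kD r)"
      using ok' p4 p5 p6 unfolding ok0_def by blast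
    then have "kids_ok (?C @ kC r) (kB r) (kD r)" using k by (simp add: kids_ok_def)
    then show ?thesis using 2 k P by (simp add: post_def)
  next
    case 3
    have h: "hd g \<in> set (concat [g])" "okr (hd g)" using 3 g by auto
    have "bok (last (kC r))" using ok' 3 by (auto simp: ok0_def)
    have srt: "bkey (last (kC r)) \<le> bkey c" if "c \<in> set (kB r)" for c
      using ok' that 3 unfolding ok0_def sorted_wrt_append by (auto intro: less_imp_le)
    \<comment> \<open>All keys in \<open>kB r\<close> and \<open>kD r\<close> exceed the last key of
      \<open>kC r\<close>, which is at least the key of \<open>hd g\<close>, and \<open>hd g\<close>
      comes later.\<close>
    have red: "red ((?C @ kC r) @ (kB r @ prsD (kD r)) @ prsD [g]) ((?C @ kC r) @ prsD [g])"
    proof (rule red_drop[OF key_in_flt_prsD[OF h]])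
      fix y assume "y \<in> set (flt (kB r @ prsD (kD r)))"
      then have "y \<in> set (flt (kB r)) \<or> y \<in> set (flt (prsD (kD r)))" by auto
      then have "bkey (last (kC r)) \<le> y"
      proof
        assume "y \<in> set (flt (kB r))"
        from flt_bok[OF this] ok' srt show ?thesis by (fastforce simp: ok0_def)
      next
        assume "y \<in> set (flt (prsD (kD r)))"
        from flt_prsD_le[OF this] k obtain d where d: "d \<in> set (concat (kD r))" "key d \<le> y"
          by (auto simp: kids_ok_def)
        then show ?thesis using ok0_CD[OF ok' last_in_set[OF 3(1)] d(1)] by auto
      qed
      then show "key (hd g) \<le> y" using 3 by auto
    qed
    have "kids_ok ?C (kC r) [g]"
      using g0[OF 3(2)] srtC ok' unfolding kids_ok_def ok0_def by auto
    then show ?thesis using 3 P c red by (simp add: post_def cost_def)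
  next
    case 4
    have Cg: "bkey c < key r'" if "c \<in> set (kC r)" "r' \<in> set g" for c r'
    proof -
      have "bkey c \<le> bkey (last (kC r))"
        using ok' that(1) by (intro sorted_wrt_le_last[of bkey]) (auto simp: ok0_def sorted_wrt_append)
      also have "\<dots> < key (hd g)" using 4 by simp
      also have "key (hd g) \<le> key r'" using ok that(2) 4 by (cases g) (auto simp: ok0_def intro: less_imp_le)
      finally show ?thesis .
    qed
    show ?thesis
    proof (cases "kD r = [] \<or> \<not> key (hd (last (kD r))) < key (hd g)")
      case True
      have h: "hd g \<in> set (concat [g])" "okr (hd g)" using 4 g by auto
      have red: "red ((?C @ kC r @ kB r) @ prsD (kD r) @ prsD [g]) ((?C @ kC r @ kB r) @ prsD [g])"
      proof (rule red_drop[OF key_in_flt_prsD[OF h]])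
        fix y assume y: "y \<in> set (flt (prsD (kD r)))"
        from flt_prsD_le[OF this] k obtain r' where r'': "r' \<in> set (concat (kD r))" "key r' \<le> y"
          by (auto simp: kids_ok_def)
        from ok0_hd_last_le[OF ok' r''(1)] r'' True show "key (hd g) \<le> y" by auto
      qed
      have "\<forall>c\<in>set (?C @ kC r). \<forall>d\<in>set (concat [g]). bkey c < key d"
        using Cg g0[OF 4(2)] unfolding kids_ok_def ok0_def by (simp add: ball_Un)
      then have "kids_ok (?C @ kC r) (kB r) [g]"
        using g0[OF 4(2)] srtCB ok' unfolding kids_ok_def ok0_def by auto
      then show ?thesis using 4 True P c red by (simp add: post_def cost_def)
    next
      case False
      have gD: "\<forall>r'\<in>set g. key (hd (last (kD r))) < key r'"
        using False ok by (cases g) (auto simp: ok0_def intro: less_trans)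
      have "\<forall>c\<in>set (?C @ kC r). \<forall>d\<in>set (concat (g # kD r)). bkey c < key d"
        using Cg g0[OF 4(2)] CD unfolding kids_ok_def ok0_def by (simp add: ball_Un del: set_concat)
      moreover have "\<forall>d\<in>set (concat (butlast (g # kD r))). key (hd (last (g # kD r))) < key d"
        using gD ok' False by (simp add: ok0_def ball_Un)
      ultimately have "kids_ok (?C @ kC r) (kB r) (g # kD r)"
        using g0[OF 4(2)] srtCB k False unfolding kids_ok_def ok0_def by auto
      \<comment> \<open>Pushing \<open>g\<close> adds \<open>length g + 1\<close>, which the
        hypothesis bounds by \<open>length C + n\<close>; \<open>r\<close> itself contributes the
        unit that is gained.\<close>
      moreover have "cost (g # kD r) \<le> length (?C @ kC r) + (n - 1)"
        using k(2) c False by (simp add: cost_def)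
      ultimately show ?thesis using 4 False P by (simp add: post_def)
    qed
  qed
qed

text \<open>With at least two segments \<open>C\<close> is unchanged and the cost falls: by a
  segment after a merge, by a record, possibly with its segment, after a removal.\<close>

lemma stepG_post:
  assumes "kids_ok C [] D" "D \<noteq> []" "cost D \<le> length C + n"
  shows "post (C @ prsD D) (n - 1) (stepG C D)"
proof (cases "(C, D)" rule: stepG.cases)
  case (2 C' g)
  then have g: "D = [g]" "C' = C" by auto
  then obtain r g' where "g = r # g'" using assms(1) by (cases g) (auto simp: kids_ok_def ok0_def)
  then show ?thesis using unfoldG_post[of C r g' n] assms g by (simp del: unfoldG.simps)
next
  case (3 C' t u D')
  then have D: "D = t # u # D'" by simp
  have ok: "ok0 C [] D" and okr: "\<forall>r\<in>set (concat D). okr r" using assms(1) by (auto simp: kids_ok_def)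
  have tu: "t \<noteq> []" "u \<noteq> []" "sorted_wrt (\<lambda>r r'. key r < key r') t" "sorted_wrt (\<lambda>r r'. key r < key r') u"
    using ok D by (auto simp: ok0_def)
  then have u: "u = butlast u @ [last u]" by simp
  have c: "length (concat D') + length u + length t + length D' + 1 \<le> length C + n"
    using assms(3) D by (simp add: cost_def)
  have ub: "bkey c < key r" if "c \<in> set C" "r \<in> set (butlast u)" for c r
    using ok D that in_set_butlastD[of r u] by (auto simp: ok0_def)
  show ?thesis
  proof (cases "key (last u) < key (hd t)")
    case True
    have ut: "key r < key r'" if "r \<in> set u" "r' \<in> set t" for r r'
    proof -
      have "key r \<le> key (last u)" using sorted_wrt_le_last[OF tu(4) that(1)] .
      also note True
      also have "key (hd t) \<le> key r'" using tu(3) that(2) by (cases t) (auto intro: less_imp_le)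
      finally show ?thesis .
    qed
    have "set (concat ((u @ t) # D')) = set (concat D)" using D by auto
    moreover have "\<forall>r\<in>set (concat (butlast ((u @ t) # D'))). key (hd (last ((u @ t) # D'))) < key r"
      using ok D tu by (cases "D' = []") (auto simp: ok0_def)
    ultimately have "kids_ok C [] ((u @ t) # D')"
      using ok okr D ut tu unfolding kids_ok_def ok0_def by (simp add: sorted_wrt_append)
    then show ?thesis using D True c by (simp add: post_def cost_def)
  next
    case False
    let ?D = "if butlast u = [] then D' else butlast u # D'"
    \<comment> \<open>If \<open>u\<close> were the lowest segment, its only record would be the
      least of the stack and hence lie below \<open>hd t\<close>, contrary to the case at hand. Thus
      the lowest segment never vanishes.\<close>
    have nl: "D' \<noteq> []" if "butlast u = []"
    proof
      assume "D' = []"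
      moreover have "hd u = last u" using that u by (metis append_Nil list.sel(1) last.simps)
      ultimately show False using ok D False tu by (auto simp: ok0_def)
    qed
    have h: "hd t \<in> set (concat [t])" "okr (hd t)" using tu okr D by auto
    have Du: "prsD (t # u # D') = (prsD D' @ concat (map prs (butlast u))) @ prs (last u) @ prsD [t]"
      by (subst u) (simp del: append_butlast_last_id)
    have red: "red (C @ prsD D) (C @ prsD (t # ?D))"
    proof -
      have "red (C @ (prsD D' @ concat (map prs (butlast u))) @ prs (last u) @ prsD [t])
         (C @ (prsD D' @ concat (map prs (butlast u))) @ prsD [t])"
      proof (rule red_context, rule red_drop[OF key_in_flt_prsD[OF h]])
        fix y assume "y \<in> set (flt (prs (last u)))"
        moreover have "okr (last u)" using okr D tu by auto
        ultimately have "key (last u) \<le> y" using okr_le by blast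
        then show "key (hd t) \<le> y" using False by auto
      qed
      then show ?thesis unfolding D Du by (auto split: if_splits)
    qed
    have "sorted_wrt (\<lambda>r r'. key r < key r') (butlast u)" using tu(4) u by (metis sorted_wrt_append)
    moreover have "hd (butlast u) = hd u" if "butlast u \<noteq> []" using that u by (metis hd_append2)
    moreover have "set (concat (t # ?D)) \<subseteq> set (concat D)" using D in_set_butlastD[of _ u] by auto
    moreover have "\<forall>r\<in>set (concat (butlast (t # ?D))). key (hd (last (t # ?D))) < key r"
      using ok D tu nl in_set_butlastD[of _ u] \<open>butlast u \<noteq> [] \<Longrightarrow> hd (butlast u) = hd u\<close>
      by (cases "D' = []") (auto simp: ok0_def)
    moreover define D2 where "D2 = t # ?D"
    ultimately have 1: "set (concat D2) \<subseteq> set (concat D)"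
      "\<forall>r\<in>set (concat (butlast D2)). key (hd (last D2)) < key r" by simp_all
    have "\<forall>g\<in>set D2. g \<noteq> [] \<and> sorted_wrt (\<lambda>r r'. key r < key r') g"
      using ok D \<open>sorted_wrt _ (butlast u)\<close> by (auto simp: D2_def ok0_def)
    moreover have "\<forall>c\<in>set C. \<forall>r\<in>set (concat D2). bkey c < key r" using ok0_CD[OF ok] 1(1) by blast
    moreover have "\<forall>r\<in>set (concat D2). okr r" using okr 1(1) by blast
    moreover have "(\<forall>c\<in>set C \<union> set []. bok c) \<and> sorted_wrt (\<lambda>c d. bkey c < bkey d) (C @ [])"
      using ok by (simp add: ok0_def)
    ultimately have "kids_ok C [] D2" using 1(2) unfolding kids_ok_def ok0_def by blast
    then have "kids_ok C [] (t # ?D)" by (simp add: D2_def)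
    moreover have "length u = Suc (length (butlast u))" using tu by (simp add: Suc_leI)
    ultimately show ?thesis using D False red c by (auto simp: post_def cost_def)
  qed
qed (use assms in auto)

text \<open>A step repays one unit of deficit, by a longer \<open>C\<close> or a cheaper
  \<open>D\<close>, unless \<open>D\<close> is empty and there is no deficit.\<close>

lemma biasG_post:
  assumes "kids_ok C B D" "cost D \<le> length C + n"
  shows "post (C @ B @ prsD D) (n - 1) (biasG C B D)"
proof -
  consider "D = []" | "D \<noteq> []" "B \<noteq> []" "bkey (hd B) < key (hd (last D))"
    | "D \<noteq> []" "B = [] \<or> \<not> bkey (hd B) < key (hd (last D))" by blast
  then show ?thesis
  proof cases
    case 1
    then show ?thesis using assms by (auto simp: biasG_def post_def cost_def)
  next
    case 2
    then obtain c B' where B: "B = c # B'" by (cases B) auto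
    have ok: "ok0 C B D" using assms by (simp add: kids_ok_def)
    have "bkey c < key r" if "r \<in> set (concat D)" for r
      using ok0_hd_last_le[OF ok that] 2 B by auto
    then have "kids_ok (C @ [c]) B' D" using assms B ok by (auto simp: kids_ok_def ok0_def)
    then show ?thesis using 2 B assms(2) by (simp add: biasG_def post_def)
  next
    case 3
    note d = red_drop_buffer[OF assms(1) 3]
    have "post (C @ prsD D) (n - 1) (stepG C D)" using stepG_post[OF d(1) 3(1) assms(2)] .
    then have "post (C @ B @ prsD D) (n - 1) (stepG C D)"
      using d(2) by (auto simp: post_def intro: red_trans)
    then show ?thesis using 3 by (auto simp: biasG_def)
  qed
qed

text \<open>The level after appending the tree \<open>r\<close>. If \<open>r\<close> cuts into
  \<open>C\<close>, everything behind \<open>C\<close> is attrited and \<open>C\<close> is demoted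
  to a buffer. Otherwise \<open>C\<close> is untouched, and the least key of \<open>D\<close> tells
  whether \<open>r\<close> replaces the stack or becomes a new segment on top.\<close>

definition attG where
  "attG C B D r =
    (if C \<noteq> [] \<and> \<not> bkey (last C) < key r then ([], C, [[r]])
     else if D = [] \<or> \<not> key (hd (last D)) < key r then (C, B, [[r]])
     else (C, B, [r] # D))"

text \<open>A new segment of one record raises the cost by at most 2. If \<open>C\<close> is demoted
  or \<open>D\<close> is replaced, the new cost is just 1.\<close>

lemma attG_post:
  assumes "kids_ok C B D" "cost D \<le> length C" "okr r"
  shows "post (C @ B @ prsD D @ prs r) 2 (attG C B D r)"
proof -
  have ok: "ok0 C B D" using assms by (simp add: kids_ok_def)
  have h: "r \<in> set (concat [[r]])" by simp
  consider (1) "C \<noteq> []" "\<not> bkey (last C) < key r"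
    | (2) "C = [] \<or> bkey (last C) < key r" "D = [] \<or> \<not> key (hd (last D)) < key r"
    | (3) "C = [] \<or> bkey (last C) < key r" "D \<noteq> []" "key (hd (last D)) < key r" by blast
  then show ?thesis
  proof cases
    case 1
    have srt: "bkey (last C) \<le> bkey c" if "c \<in> set B" for c
      using ok that 1 unfolding ok0_def sorted_wrt_append by (auto intro: less_imp_le)
    have "red (C @ (B @ prsD D) @ prsD [[r]]) (C @ prsD [[r]])"
    proof (rule red_drop[OF key_in_flt_prsD[OF h assms(3)]])
      fix y assume "y \<in> set (flt (B @ prsD D))"
      then have "y \<in> set (flt B) \<or> y \<in> set (flt (prsD D))" by auto
      then have "bkey (last C) \<le> y"
      proof
        assume "y \<in> set (flt B)"
        from flt_bok[OF this] ok srt show ?thesis by (fastforce simp: ok0_def)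
      next
        assume "y \<in> set (flt (prsD D))"
        from flt_prsD_le[OF this] assms(1) obtain r' where r': "r' \<in> set (concat D)" "key r' \<le> y"
          by (auto simp: kids_ok_def)
        have "bkey (last C) < key r'" using ok0_CD[OF ok last_in_set[OF 1(1)] r'(1)] .
        then show ?thesis using r'(2) by auto
      qed
      then show "key r \<le> y" using 1 by auto
    qed
    moreover have "kids_ok [] C [[r]]" using ok assms(3) by (auto simp: kids_ok_def ok0_def sorted_wrt_append)
    ultimately show ?thesis using 1 by (simp add: post_def attG_def cost_def)
  next
    case 2
    have Cr: "bkey c < key r" if "c \<in> set C" for c
    proof -
      have "C \<noteq> []" using that by auto
      then have "bkey c \<le> bkey (last C)" using ok that
        by (intro sorted_wrt_le_last[of bkey]) (auto simp: ok0_def sorted_wrt_append)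
      then show ?thesis using 2 \<open>C \<noteq> []\<close> by auto
    qed
    have "red ((C @ B) @ prsD D @ prsD [[r]]) ((C @ B) @ prsD [[r]])"
    proof (rule red_drop[OF key_in_flt_prsD[OF h assms(3)]])
      fix y assume "y \<in> set (flt (prsD D))"
      from flt_prsD_le[OF this] assms(1) obtain r' where r': "r' \<in> set (concat D)" "key r' \<le> y"
        by (auto simp: kids_ok_def)
      from ok0_hd_last_le[OF ok r'(1)] r' 2 show "key r \<le> y" by auto
    qed
    moreover have "kids_ok C B [[r]]" using ok assms(3) Cr by (auto simp: kids_ok_def ok0_def)
    ultimately show ?thesis using 2 by (auto simp: post_def attG_def cost_def)
  next
    case 3
    have Cr: "bkey c < key r" if "c \<in> set C" for c
    proof -
      have "bkey c < key (hd (last D))" using ok that hd_last_in[OF ok 3(2)] by (auto simp: ok0_def)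
      then show ?thesis using 3 by auto
    qed
    have "kids_ok C B ([r] # D)" using ok assms(1,3) Cr 3 by (auto simp: kids_ok_def ok0_def)
    then show ?thesis using 3 assms(2) by (auto simp: post_def attG_def cost_def)
  qed
qed

section \<open>Linked lists of records\<close>

type_synonym hdr = "nat \<times> nat \<times> nat \<times> nat \<times> nat \<times> nat"

definition readH :: "nat \<Rightarrow> (hdr \<Rightarrow> prog) \<Rightarrow> prog" where
  "readH a k = getF a 5 (\<lambda>cf. getF a 6 (\<lambda>cl. getF a 7 (\<lambda>bf. getF a 8 (\<lambda>bl. getF a 9 (\<lambda>df.
     getF a 10 (\<lambda>dt. k (cf, cl, bf, bl, df, dt)))))))"

fun writeH :: "nat \<Rightarrow> hdr \<Rightarrow> prog \<Rightarrow> prog" where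
  "writeH a (cf, cl, bf, bl, df, dt) p = setF a 5 cf (setF a 6 cl (setF a 7 bf (setF a 8 bl
     (setF a 9 df (setF a 10 dt p)))))"

definition appP :: "nat \<Rightarrow> nat \<Rightarrow> nat \<Rightarrow> prog \<Rightarrow> prog" where
  "appP cf cl x p = (if cf = 0 then p else setF cl 1 x p)"

text \<open>\<open>df\<close> and \<open>dt\<close> are the first records of the lowest and of the
  uppermost segment, so they differ iff there are several segments. In that branch \<open>u\<close>
  and \<open>ul\<close> are the ends of the second segment. In the other one \<open>e\<close> is the
  last record of the segment, \<open>n\<close> the second, and \<open>c\<close> to \<open>d'\<close>
  is the header of the record that is unfolded.\<close>

definition stepP :: "nat \<Rightarrow> nat \<Rightarrow> nat \<Rightarrow> nat \<Rightarrow> nat \<Rightarrow> (hdr \<Rightarrow> prog) \<Rightarrow> prog" where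
  "stepP B cf cl df dt k =
   (if df \<noteq> dt then
      getF dt 4 (\<lambda>u. getF u 3 (\<lambda>ul. cmpK B ul dt
        (getF dt 3 (\<lambda>e. setF ul 1 dt (setF dt 2 ul (setF u 3 e (k (cf, cl, 0, 0, df, u))))))
        (if ul = u then getF u 4 (\<lambda>v. setF dt 4 v (k (cf, cl, 0, 0, df, dt)))
         else getF ul 2 (\<lambda>w. setF u 3 w (k (cf, cl, 0, 0, df, dt))))))
    else
      getF df 3 (\<lambda>e. readH df (\<lambda>(c, c', b, b', d, d'). appP cf cl df
        (if e = df then
           (if c = 0 then k (if cf = 0 then df else cf, df, 0, 0, 0, 0)
            else setF df 1 c (k (if cf = 0 then df else cf, c', b, b', d, d')))
         else
           getF df 1 (\<lambda>n. setF n 3 e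
             (if c = 0 then k (if cf = 0 then df else cf, df, 0, 0, n, n)
              else cmpK B c' n
                (setF df 1 c
                  (if d = 0 then k (if cf = 0 then df else cf, c', b, b', n, n)
                   else cmpK B d n (setF n 4 d' (k (if cf = 0 then df else cf, c', b, b', d, n)))
                     (k (if cf = 0 then df else cf, c', b, b', n, n))))
                (k (if cf = 0 then df else cf, df, c, c', n, n))))))))"

fun biasP :: "nat \<Rightarrow> hdr \<Rightarrow> (hdr \<Rightarrow> prog) \<Rightarrow> prog" where
  "biasP B (cf, cl, bf, bl, df, dt) k =
   (if df = 0 then k (cf, cl, bf, bl, df, dt)
    else if bf = 0 then stepP B cf cl df dt k
    else cmpK B bf df
      (appP cf cl bf
        (if bf = bl then k (if cf = 0 then bf else cf, bf, 0, bl, df, dt)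
         else getF bf 1 (\<lambda>n. k (if cf = 0 then bf else cf, bf, n, bl, df, dt))))
      (stepP B cf cl df dt k))"

text \<open>Performs \<open>attG\<close>, then the two steps that its deficit of 2 calls for.
  \<open>a'\<close> first becomes a segment of its own, which is the purpose of writing field 3. The
  header of \<open>a\<close> stays in the control state until all is done.\<close>

definition linkP :: "nat \<Rightarrow> nat \<Rightarrow> nat \<Rightarrow> prog \<Rightarrow> prog" where
  "linkP B a a' p = readH a (\<lambda>(cf, cl, bf, bl, df, dt). setF a' 3 a'
     (let fin = (\<lambda>h. biasP B h (\<lambda>h. biasP B h (\<lambda>h. writeH a h p)));
          rest = (if df = 0 then fin (cf, cl, bf, bl, a', a')
            else cmpK B df a' (setF a' 4 dt (fin (cf, cl, bf, bl, df, a'))) (fin (cf, cl, bf, bl, a', a')))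
      in if cf = 0 then rest else cmpK B cl a' rest (fin (0, 0, cf, cl, a', a'))))"

text \<open>If the second key is not larger, the whole first tree is attrited; its blocks are not
  freed, as that would require visiting them.\<close>

definition catP :: "nat \<Rightarrow> nat \<Rightarrow> nat \<Rightarrow> (nat \<Rightarrow> prog) \<Rightarrow> prog" where
  "catP B a a' k = cmpK B a a' (linkP B a a' (k a)) (k a')"

text \<open>The continuation of \<open>popP\<close> receives \<open>0\<close> if no record is left.\<close>

definition popP :: "nat \<Rightarrow> nat \<Rightarrow> (nat \<Rightarrow> prog) \<Rightarrow> prog" where
  "popP B a k = readH a (\<lambda>(cf, cl, bf, bl, df, dt). freeBlocks a 15
     (let fin = (\<lambda>h. biasP B h (\<lambda>h. writeH cf h (k cf)))
      in if cf = 0 then k 0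
         else if cf = cl then fin (0, 0, bf, bl, df, dt)
         else getF cf 1 (\<lambda>n. fin (n, cl, bf, bl, df, dt))))"

section \<open>Representation of levels by linked records\<close>

definition lends :: "nat list \<Rightarrow> nat \<Rightarrow> nat \<Rightarrow> bool" where
  "lends xs f l \<longleftrightarrow> (if xs = [] then f = 0 else f = hd xs \<and> l = last xs)"

text \<open>The successor of the last record is left open: the end of a list is known from its
  header, so cutting a list needs no write to its new last record.\<close>

definition slist :: "(nat \<Rightarrow> nat \<Rightarrow> nat) \<Rightarrow> nat list \<Rightarrow> bool" where
  "slist fd xs \<longleftrightarrow> successively (\<lambda>x y. fd x 1 = y) xs"

text \<open>Segments need predecessors, because attrition removes their records from the
  end.\<close>

definition dlist :: "(nat \<Rightarrow> nat \<Rightarrow> nat) \<Rightarrow> nat list \<Rightarrow> bool" where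
  "dlist fd xs \<longleftrightarrow> successively (\<lambda>x y. fd x 1 = y \<and> fd y 2 = x) xs"

fun dstk :: "(nat \<Rightarrow> nat \<Rightarrow> nat) \<Rightarrow> nat list list \<Rightarrow> bool" where
  "dstk fd [] \<longleftrightarrow> True"
| "dstk fd (g # ds) \<longleftrightarrow> g \<noteq> [] \<and> dlist fd g \<and> fd (hd g) 3 = last g \<and>
     (ds \<noteq> [] \<longrightarrow> fd (hd g) 4 = hd (hd ds)) \<and> dstk fd ds"

fun repA :: "(nat \<Rightarrow> nat \<Rightarrow> nat) \<Rightarrow> hdr \<Rightarrow> nat list \<Rightarrow> nat list \<Rightarrow> nat list list \<Rightarrow> bool" where
  "repA fd (cf, cl, bf, bl, df, dt) cs bs ds \<longleftrightarrow>
     lends cs cf cl \<and> lends bs bf bl \<and> slist fd cs \<and> slist fd bs \<and> dstk fd ds \<and>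
     (if ds = [] then df = 0 else df = hd (last ds) \<and> dt = hd (hd ds))"

definition repG where
  "repG fd h = (\<lambda>(C, B, D). repA fd h (map fst C) (map fst B) (map (map ad) D))"

definition hdr_of :: "(nat \<Rightarrow> nat) \<Rightarrow> hdr" where
  "hdr_of f = (f 5, f 6, f 7, f 8, f 9, f 10)"

primrec rep :: "(nat \<Rightarrow> nat \<Rightarrow> nat) \<Rightarrow> 'a rc \<Rightarrow> bool" where
  "rep fd (Rc a e C B D) \<longleftrightarrow> repA fd (hdr_of (fd a)) (map fst C) (map fst B) (map (map ad) D)
     \<and> (\<forall>bs\<in>set (map (map (rep fd)) D). \<forall>b\<in>set bs. b)"

lemma rep_eq: "rep fd r \<longleftrightarrow> repG fd (hdr_of (fd (ad r))) (kC r, kB r, kD r) \<and> (\<forall>r'\<in>set (concat (kD r)). rep fd r')"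
  by (cases r) (auto simp: repG_def)

lemmas rep_simps [simp del] = rep.simps

lemma successively_cong':
  assumes "\<And>i. Suc i < length xs \<Longrightarrow> P (xs ! i) (xs ! Suc i) = P' (xs ! i) (xs ! Suc i)"
  shows "successively P xs = successively P' xs"
  using assms by (auto simp: successively_conv_nth)

lemma slist_cong:
  assumes "\<forall>x\<in>set (butlast xs). fd' x 1 = fd x 1"
  shows "slist fd' xs = slist fd xs"
  unfolding slist_def
proof (rule successively_cong')
  fix i assume "Suc i < length xs"
  then have "xs ! i \<in> set (butlast xs)" by (metis Suc_lessE diff_Suc_1 length_butlast less_Suc_eq nth_butlast nth_mem)
  then show "(fd' (xs ! i) 1 = xs ! Suc i) = (fd (xs ! i) 1 = xs ! Suc i)" using assms by auto
qed

lemma dlist_cong: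
  assumes "\<forall>x\<in>set (butlast xs). fd' x 1 = fd x 1" "\<forall>x\<in>set (tl xs). fd' x 2 = fd x 2"
  shows "dlist fd' xs = dlist fd xs"
  unfolding dlist_def
proof (rule successively_cong')
  fix i assume i: "Suc i < length xs"
  then have "xs ! i \<in> set (butlast xs)" by (metis Suc_lessE diff_Suc_1 length_butlast less_Suc_eq nth_butlast nth_mem)
  moreover have "xs ! Suc i \<in> set (tl xs)" using i by (cases xs) auto
  ultimately show "(fd' (xs ! i) 1 = xs ! Suc i \<and> fd' (xs ! Suc i) 2 = xs ! i) =
    (fd (xs ! i) 1 = xs ! Suc i \<and> fd (xs ! Suc i) 2 = xs ! i)" using assms by auto
qed

lemma in_set_tlD: "x \<in> set (tl xs) \<Longrightarrow> x \<in> set xs"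
  by (cases xs) auto

lemma hd_notin_tl: "distinct xs \<Longrightarrow> xs \<noteq> [] \<Longrightarrow> hd xs \<notin> set (tl xs)"
  by (cases xs) auto

lemma last_notin_butlast: "distinct xs \<Longrightarrow> xs \<noteq> [] \<Longrightarrow> last xs \<notin> set (butlast xs)"
  by (cases xs rule: rev_cases) auto

lemma ad_in_prs: "r \<in> set g \<Longrightarrow> ad r \<in> fst ` set (concat (map prs g))"
  by (force simp: prs_eq[of r])

lemma distinct_ad: "distinct (map fst (concat (map prs g))) \<Longrightarrow> distinct (map ad g)"
proof (induction g)
  case (Cons r g)
  have "ad r \<in> fst ` set (prs r)" by (simp add: prs_eq[of r])
  then have "ad r \<notin> fst ` set (concat (map prs g))" using Cons.prems by auto
  then have "ad r \<notin> ad ` set g" using ad_in_prs by (metis imageE)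
  then show ?case using Cons by auto
qed simp

lemma ad_prsD: "r \<in> set (concat D) \<Longrightarrow> (ad r, els r) \<in> set (prsD D)"
  by (auto simp: prsD_def prs_eq[of r] intro!: bexI[of _ r])

lemma ad_subset_prsD: "set (concat (map (map ad) D)) \<subseteq> set (map fst (prsD D))"
  using ad_prsD by force

lemma dstk_cong:
  assumes "\<forall>x\<in>set (concat ds). \<forall>j<5. fd' x j = fd x j"
  shows "dstk fd' ds = dstk fd ds"
  using assms
proof (induction ds)
  case (Cons g ds)
  have "dlist fd' g = dlist fd g"
    by (rule dlist_cong) (use Cons.prems in \<open>auto dest: in_set_butlastD in_set_tlD\<close>)
  moreover have "hd g \<in> set (concat (g # ds))" if "g \<noteq> []" using that by simp
  ultimately show ?case using Cons by auto
qed simp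

lemma dstk_nonempty: "dstk fd ds \<Longrightarrow> g \<in> set ds \<Longrightarrow> g \<noteq> []"
  by (induction ds) auto

lemma repA_cong:
  assumes "\<forall>x\<in>set cs \<union> set bs \<union> set (concat ds). \<forall>j<5. fd' x j = fd x j"
  shows "repA fd' h cs bs ds = repA fd h cs bs ds"
proof -
  have "slist fd' cs = slist fd cs" "slist fd' bs = slist fd bs"
    by (rule slist_cong; use assms in \<open>auto dest!: in_set_butlastD\<close>)+
  moreover have "dstk fd' ds = dstk fd ds" by (rule dstk_cong) (use assms in auto)
  ultimately show ?thesis by (cases h) simp
qed

lemma slist_append:
  "slist fd (xs @ ys) \<longleftrightarrow> slist fd xs \<and> slist fd ys \<and> (xs \<noteq> [] \<longrightarrow> ys \<noteq> [] \<longrightarrow> fd (last xs) 1 = hd ys)"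
  unfolding slist_def by (auto simp: successively_append_iff)

lemma dlist_append:
  "dlist fd (xs @ ys) \<longleftrightarrow> dlist fd xs \<and> dlist fd ys \<and>
    (xs \<noteq> [] \<longrightarrow> ys \<noteq> [] \<longrightarrow> fd (last xs) 1 = hd ys \<and> fd (hd ys) 2 = last xs)"
  unfolding dlist_def by (auto simp: successively_append_iff)

lemma slist_simps [simp]: "slist fd []" "slist fd [x]"
  by (simp_all add: slist_def)

lemma dlist_simps [simp]: "dlist fd []" "dlist fd [x]"
  by (simp_all add: dlist_def)

text \<open>Steps change links, that is fields below 5, and only of the records of one level.
  Headers stay, so the trees below these records are unaffected.\<close>

definition upd :: "nat set \<Rightarrow> (nat \<Rightarrow> nat \<Rightarrow> nat) \<Rightarrow> (nat \<Rightarrow> nat \<Rightarrow> nat) \<Rightarrow> bool" where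
  "upd X fd fd' \<longleftrightarrow> (\<forall>x. x \<notin> X \<longrightarrow> fd' x = fd x) \<and> (\<forall>x j. 5 \<le> j \<longrightarrow> fd' x j = fd x j)"

lemma upd_refl [simp]: "upd X fd fd"
  by (simp add: upd_def)

lemma upd_step: "upd X fd fd' \<Longrightarrow> x \<in> X \<Longrightarrow> j < 5 \<Longrightarrow> upd X fd (fd'(x := (fd' x)(j := v)))"
  by (auto simp: upd_def)

definition app_fd :: "(nat \<Rightarrow> nat \<Rightarrow> nat) \<Rightarrow> nat list \<Rightarrow> nat \<Rightarrow> nat \<Rightarrow> nat \<Rightarrow> nat" where
  "app_fd fd cs x = (if cs = [] then fd else fd(last cs := (fd (last cs))(1 := x)))"

lemma app_fd_other: "x \<notin> set cs \<Longrightarrow> app_fd fd cs y x = fd x"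
  by (auto simp: app_fd_def)

lemma slist_app_fd: "slist fd cs \<Longrightarrow> distinct cs \<Longrightarrow> slist (app_fd fd cs x) (cs @ [x])"
proof (cases "cs = []")
  case False
  assume a: "slist fd cs" "distinct cs"
  have "last cs \<notin> set (butlast cs)" using a(2) False by (rule last_notin_butlast)
  then have "slist (app_fd fd cs x) cs = slist fd cs"
    by (intro slist_cong) (auto simp: app_fd_def)
  then show ?thesis using a False by (simp add: slist_append app_fd_def)
qed simp

lemma upd_app_fd: "set cs \<subseteq> X \<Longrightarrow> upd X fd (app_fd fd cs x)"
proof -
  assume "set cs \<subseteq> X"
  then have "cs \<noteq> [] \<Longrightarrow> last cs \<in> X" using last_in_set[of cs] by blast
  then show ?thesis by (auto simp: app_fd_def upd_def)
qed

section \<open>One step on the linked representation\<close>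

context mach
begin

text \<open>Connects the tree with the disk: its records are live, stored with their elements, at
  pairwise distinct addresses, none of which is 0, the null pointer.\<close>

definition good :: "'a vst \<Rightarrow> (nat \<times> 'a list) list \<Rightarrow> bool" where
  "good st P \<longleftrightarrow> distinct (map fst P) \<and>
     (\<forall>p\<in>set P. fst p \<in> vL st \<and> 0 < fst p \<and> fst p \<le> W \<and> vel st (fst p) = snd p)"

lemma good_red: "good st P \<Longrightarrow> red P P' \<Longrightarrow> good st P'"
  by (auto simp: good_def red_def)

lemma good_fd [simp]: "good (st\<lparr>vfd := fd\<rparr>) P = good st P"
  by (simp add: good_def)

fun hle :: "hdr \<Rightarrow> bool" where
  "hle (cf, cl, bf, bl, df, dt) \<longleftrightarrow> cf \<le> W \<and> cl \<le> W \<and> bf \<le> W \<and> bl \<le> W \<and> df \<le> W \<and> dt \<le> W"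

lemma safe_readH:
  assumes "a \<in> vL st" "6 \<le> n" "hle (hdr_of (vfd st a)) \<Longrightarrow> safe (k (hdr_of (vfd st a))) st (n - 6) Q"
  shows "safe (readH a k) st n Q"
  unfolding readH_def using assms
  by (intro safe_getF) (auto simp: hdr_of_def numeral_eq_Suc)

lemma safe_writeH:
  assumes "a \<in> vL st" "6 \<le> n" "hle h"
    "\<And>fd'. hdr_of (fd' a) = h \<Longrightarrow> (\<forall>x. x \<noteq> a \<longrightarrow> fd' x = vfd st x) \<Longrightarrow> (\<forall>j<5. fd' a j = vfd st a j) \<Longrightarrow>
        safe p (st\<lparr>vfd := fd'\<rparr>) (n - 6) Q"
  shows "safe (writeH a h p) st n Q"
proof (cases h)
  case (fields cf cl bf bl df dt)
  let ?fd = "(vfd st)(a := (vfd st a)(5 := cf, 6 := cl, 7 := bf, 8 := bl, 9 := df, 10 := dt))"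
  have "safe p (st\<lparr>vfd := ?fd\<rparr>) (n - 6) Q"
    by (rule assms(4)) (auto simp: hdr_of_def fields)
  then show ?thesis using assms(1-3)
    unfolding fields writeH.simps by (intro safe_setF) (auto simp: numeral_eq_Suc)
qed

lemma safe_appP:
  assumes "lends cs cf cl" "0 \<notin> set cs" "set cs \<subseteq> vL st" "x \<le> W" "1 \<le> n"
    "safe p (st\<lparr>vfd := app_fd (vfd st) cs x\<rparr>) (n - 1) Q"
  shows "safe (appP cf cl x p) st n Q"
proof (cases "cs = []")
  case True
  then have "safe p st (n - 1) Q" using assms(6) by (simp add: app_fd_def)
  then show ?thesis using True assms(1) by (auto simp: appP_def lends_def intro: safe_mono)
next
  case False
  then have "cl = last cs" "cf \<noteq> 0" "last cs \<in> set cs" using assms(1,2) by (cases cs; auto simp: lends_def)+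
  then show ?thesis using assms False unfolding appP_def app_fd_def
    by (auto intro!: safe_setF)
qed

lemma lends_app: "0 \<notin> set cs \<Longrightarrow> lends cs cf cl \<Longrightarrow> lends (cs @ [x]) (if cf = 0 then x else cf) x"
  by (cases cs) (auto simp: lends_def)

lemma lends_app2: "0 \<notin> set cs \<Longrightarrow> lends cs cf cl \<Longrightarrow> lends ds c c' \<Longrightarrow> ds \<noteq> [] \<Longrightarrow>
    lends (cs @ x # ds) (if cf = 0 then x else cf) c'"
  by (cases cs) (auto simp: lends_def)

text \<open>The continuation only learns that the new header represents \<open>stepG C D\<close>;
  order and balance are then supplied by \<open>stepG_post\<close>.\<close>

lemma safe_stepP_deep:
  assumes D: "D = t # u # D'" and ok: "ok0 C [] D"
    and rep: "repG (vfd st) (cf, cl, bf, bl, df, dt) (C, B', D)"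
    and good: "good st (C @ prsD D)" and hle: "hle (cf, cl, bf, bl, df, dt)"
    and K: "\<And>fd' h. upd (ad ` set (concat D)) (vfd st) fd' \<Longrightarrow> hle h \<Longrightarrow>
        repG fd' h (stepG C D) \<Longrightarrow> safe (k h) (st\<lparr>vfd := fd'\<rparr>) n Q"
  shows "safe (stepP B cf cl df dt k) st (n + 18) Q"
proof -
  let ?fd = "vfd st"
  define T where "T = map ad t"
  define U where "U = map ad u"
  define DD where "DD = map (map ad) D'"
  have ne: "t \<noteq> []" "u \<noteq> []" "T \<noteq> []" "U \<noteq> []" using ok D by (auto simp: ok0_def T_def U_def)
  have r: "lends (map fst C) cf cl" "slist ?fd (map fst C)" "dstk ?fd (T # U # DD)"
    "df = hd (last (U # DD))" "dt = hd T"
    using rep D by (auto simp: repG_def T_def U_def DD_def)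
  have sub: "(ad r, els r) \<in> set (C @ prsD D)" if "r \<in> set (concat D)" for r
    using that by (auto simp: prsD_def prs_eq[of r] intro!: bexI[of _ r])
  have adr: "ad r \<in> vL st \<and> 0 < ad r \<and> ad r \<le> W \<and> vel st (ad r) = els r" if "r \<in> set (concat D)" for r
    using good sub[OF that] unfolding good_def by fastforce
  have "distinct (map fst (prsD D))" using good by (simp add: good_def)
  then have "distinct (map ad (concat (rev D)))" unfolding prsD_def by (rule distinct_ad)
  then have "distinct (concat (map (map ad) (rev D)))" by (simp add: map_concat)
  then have dist: "distinct (U @ T)" "set (concat DD) \<inter> set (U @ T) = {}"
    by (auto simp: D T_def U_def DD_def)
  have disjC: "set (map fst C) \<inter> set (concat (T # U # DD)) = {}"
  proof -
    have "set (map fst C) \<inter> set (map fst (prsD D)) = {}" using good by (simp add: good_def)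
    moreover have "set (concat (T # U # DD)) \<subseteq> set (map fst (prsD D))"
    proof
      fix x assume "x \<in> set (concat (T # U # DD))"
      then obtain r where "r \<in> set (concat (rev D))" "x = ad r" by (auto simp: T_def U_def DD_def D)
      then show "x \<in> set (map fst (prsD D))" using ad_in_prs[of r "concat (rev D)"] by (simp add: prsD_def del: set_concat)
    qed
    ultimately show ?thesis by blast
  qed
  have aT: "x \<in> vL st" "0 < x" "x \<le> W" "x \<in> ad ` set (concat D)" if "x \<in> set (concat (T # U # DD))" for x
  proof -
    from that obtain r where "r \<in> set (concat D)" "x = ad r" by (auto simp: T_def U_def DD_def D)
    then show "x \<in> vL st" "0 < x" "x \<le> W" "x \<in> ad ` set (concat D)" using adr by auto
  qed
  have hT: "hd T \<in> set (concat (T # U # DD))" "last T \<in> set (concat (T # U # DD))" 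
    "hd U \<in> set (concat (T # U # DD))" "last U \<in> set (concat (T # U # DD))" 
    using ne by auto
  have ds: "hd T \<notin> set U" "hd T \<notin> set (concat DD)" "last U \<notin> set T" "last U \<notin> set (concat DD)"
    "hd U \<notin> set T" "hd U \<notin> set (concat DD)" "hd T \<in> set T" "hd U \<in> set U" "last U \<in> set U"
    using dist ne hd_in_set[OF ne(3)] hd_in_set[OF ne(4)] last_in_set[OF ne(4)]
    by (auto simp del: hd_in_set last_in_set set_concat)
  have "df \<in> set (concat (U # DD))"
  proof -
    have "last (U # DD) \<in> set (U # DD)" by simp
    moreover have "last (U # DD) \<noteq> []" using dstk_nonempty[OF r(3)] by (metis calculation list.set_intros(2))
    ultimately show ?thesis unfolding r(4) by (metis UN_iff hd_in_set set_concat)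
  qed
  then have dfdt: "df \<noteq> dt" using ds(1,2) r(5) by auto
  have vel: "hd (vel st (last U)) = key (last u)" "hd (vel st (hd T)) = key (hd t)"
    using adr[of "last u"] adr[of "hd t"] ne by (auto simp: D U_def T_def last_map hd_map)
  have f: "?fd dt 4 = hd U" "?fd (hd U) 3 = last U" "?fd dt 3 = last T" using r by auto
  have fr: "slist fd' (map fst C)" if "upd (ad ` set (concat D)) ?fd fd'" for fd'
  proof -
    have "set (map fst C) \<inter> ad ` set (concat D) = {}"
      using disjC by (auto simp: T_def U_def DD_def D)
    then have "slist fd' (map fst C) = slist ?fd (map fst C)"
      using that by (intro slist_cong ballI) (drule in_set_butlastD, unfold upd_def, metis disjoint_iff)
    then show ?thesis using r by simp
  qed
  have mT: "hd T \<in> vL st" "last U \<in> vL st" "hd U \<in> vL st" "hd T \<le> W" "last U \<le> W" "last T \<le> W" "hd U \<le> W"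
    using aT hT by blast+
  have tlT: "hd T \<notin> set (tl T)" "last U \<notin> set (butlast U)" "hd U \<notin> set (tl U)"
    using dist(1) ne by (simp_all add: hd_notin_tl last_notin_butlast)
  show ?thesis
  proof (cases "key (last u) < key (hd t)")
    case True
    let ?f1 = "?fd(last U := (?fd (last U))(1 := hd T))"
    let ?f2 = "?f1(hd T := (?f1 (hd T))(2 := last U))"
    let ?f3 = "?f2(hd U := (?f2 (hd U))(3 := last T))"
    have u3: "upd (ad ` set (concat D)) ?fd ?f3"
      by (intro upd_step upd_refl) (use aT hT in auto)
    have "dlist ?f3 U = dlist ?fd U" "dlist ?f3 T = dlist ?fd T" 
      by (rule dlist_cong; use ds tlT in \<open>auto dest: in_set_butlastD in_set_tlD\<close>)+
    moreover have "dstk ?f3 DD = dstk ?fd DD" by (rule dstk_cong) (use ds in auto)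
    moreover have "?f3 (hd U) 4 = ?fd (hd U) 4" using ds by auto
    ultimately have "dstk ?f3 ((U @ T) # DD)"
      using r(3) ne ds by (auto simp: dlist_append)
    then have g: "repG ?f3 (cf, cl, 0, 0, df, hd U) (stepG C D)"
      using r fr[OF u3] True ne by (auto simp: D repG_def lends_def T_def U_def DD_def hd_append)
    have "safe (k (cf, cl, 0, 0, df, hd U)) (st\<lparr>vfd := ?f3\<rparr>) n Q"
      by (rule K[OF u3 _ g]) (use hle aT hT in auto)
    \<comment> \<open>Paths through the program use different numbers of I/Os, so the continuation
      is provided for every remaining budget from \<open>n\<close> on.\<close>
    then have 1: "\<forall>m\<ge>n. safe (k (cf, cl, 0, 0, df, hd U)) (st\<lparr>vfd := ?f3\<rparr>) m Q" by (auto intro: safe_mono)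
    show ?thesis unfolding stepP_def using dfdt mT vel True f r(5) 1
      by (auto intro!: safe_getF safe_setF safe_cmpK)
  next
    case False
    show ?thesis
    proof (cases "last U = hd U")
      case True
      then have U: "U = [last U]" using tlT(2,3) ne dist
        by (cases U rule: rev_cases) (auto simp: hd_append split: if_splits)
      then obtain r0 where u: "u = [r0]" by (cases u) (auto simp: U_def)
      \<comment> \<open>As in \<open>stepG_post\<close>, the lowest segment does not vanish; hence
        field 4 of \<open>u\<close> does lead to a segment.\<close>
      have DD: "DD \<noteq> []"
      proof
        assume "DD = []"
        then have "D' = []" by (simp add: DD_def)
        then show False using ok D False u ne by (auto simp: ok0_def)
      qed
      let ?f1 = "?fd(hd T := (?fd (hd T))(4 := ?fd (hd U) 4))"
      have u1: "upd (ad ` set (concat D)) ?fd ?f1" by (intro upd_step upd_refl) (use aT hT in auto)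
      have "dlist ?f1 T = dlist ?fd T" by (rule dlist_cong) auto
      moreover have "dstk ?f1 DD = dstk ?fd DD" by (rule dstk_cong) (use ds in auto)
      ultimately have "dstk ?f1 (T # DD)" using r(3) DD by auto
      then have g: "repG ?f1 (cf, cl, 0, 0, df, dt) (stepG C D)"
        using r fr[OF u1] False DD u by (auto simp: D repG_def lends_def T_def U_def DD_def)
      have "?fd (hd U) 4 \<in> set (concat (T # U # DD))"
        using r(3) DD dstk_nonempty[OF r(3), of "hd DD"] by (auto intro!: bexI[of _ "hd DD"])
      note v = aT(3)[OF this]
      have "safe (k (cf, cl, 0, 0, df, dt)) (st\<lparr>vfd := ?f1\<rparr>) n Q"
        by (rule K[OF u1 _ g]) (use hle in auto)
      then have 1: "\<forall>m\<ge>n. safe (k (cf, cl, 0, 0, df, dt)) (st\<lparr>vfd := ?f1\<rparr>) m Q" by (auto intro: safe_mono)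
      show ?thesis unfolding stepP_def using dfdt mT vel False True f r(5) 1 v
        by (auto intro!: safe_getF safe_setF safe_cmpK)
    next
      case neq: False
      then have bl: "butlast u \<noteq> []" using ne by (cases u rule: rev_cases) (auto simp: U_def)
      then have U: "U = map ad (butlast u) @ [last U]" using ne
        by (simp add: U_def last_map) (metis append_butlast_last_id list.simps(8,9) map_append)
      let ?V = "map ad (butlast u)"
      have V: "?V \<noteq> []" "hd ?V = hd U" using bl U by (auto simp: hd_append) (metis U hd_append2 map_is_Nil_conv)
      have "dlist ?fd U" using r(3) by simp
      then have dV: "dlist ?fd (?V @ [last U])" by (subst (asm) U)
      have f2: "?fd (last U) 2 = last ?V" using dV V by (simp add: dlist_append)
      let ?f1 = "?fd(hd U := (?fd (hd U))(3 := last ?V))"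
      have u1: "upd (ad ` set (concat D)) ?fd ?f1" by (intro upd_step upd_refl) (use aT hT in auto)
      have "dlist ?f1 T = dlist ?fd T" "dlist ?f1 ?V = dlist ?fd ?V" by (rule dlist_cong; auto)+
      moreover have "dlist ?fd ?V" using dV by (simp add: dlist_append)
      moreover have "dstk ?f1 DD = dstk ?fd DD" by (rule dstk_cong) (use ds in auto)
      ultimately have "dstk ?f1 (T # ?V # DD)" using r(3) V ds by auto
      moreover have "df = hd (last (?V # DD))" using r(4) V by auto
      ultimately have g: "repG ?f1 (cf, cl, 0, 0, df, dt) (stepG C D)"
        using r fr[OF u1] False bl V by (auto simp: D repG_def lends_def T_def U_def DD_def)
      have "last ?V \<in> set U" using V(1) by (subst U) (metis Un_iff last_in_set set_append)
      then have "last ?V \<in> set (concat (T # U # DD))" by simp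
      note v = aT(3)[OF this]
      have "safe (k (cf, cl, 0, 0, df, dt)) (st\<lparr>vfd := ?f1\<rparr>) n Q"
        by (rule K[OF u1 _ g]) (use hle in auto)
      then have 1: "\<forall>m\<ge>n. safe (k (cf, cl, 0, 0, df, dt)) (st\<lparr>vfd := ?f1\<rparr>) m Q" by (auto intro: safe_mono)
      show ?thesis unfolding stepP_def using dfdt mT vel False neq f f2 r(5) 1 v
        by (auto intro!: safe_getF safe_setF safe_cmpK)
    qed
  qed
qed

text \<open>The header of \<open>r\<close>, already on disk, becomes most of the new header of the
  level: whole lists change hands by copying a few addresses.\<close>

lemma safe_stepP_single:
  assumes D: "D = [r # g]" and ok: "ok0 C [] D" and rr: "rep (vfd st) r" and okr: "okr r"
    and rep: "repG (vfd st) (cf, cl, bf, bl, df, dt) (C, B', D)"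
    and good: "good st (C @ prsD D)" and hle: "hle (cf, cl, bf, bl, df, dt)"
    and K: "\<And>fd' h. upd (fst ` set C \<union> ad ` set (concat D)) (vfd st) fd' \<Longrightarrow> hle h \<Longrightarrow>
        repG fd' h (stepG C D) \<Longrightarrow> safe (k h) (st\<lparr>vfd := fd'\<rparr>) n Q"
  shows "safe (stepP B cf cl df dt k) st (n + 18) Q"
proof -
  let ?fd = "vfd st"
  let ?X = "fst ` set C \<union> ad ` set (concat D)"
  define cs where "cs = map fst C"
  define G where "G = map ad g"
  define a where "a = ad r"
  define kc where "kc = map fst (kC r)"
  define kb where "kb = map fst (kB r)"
  define kd where "kd = map (map ad) (kD r)"
  obtain c c' b b' d d' where h: "hdr_of (?fd a) = (c, c', b, b', d, d')" by (metis prod_cases6)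
  have r: "lends cs cf cl" "slist ?fd cs" "dlist ?fd (a # G)" "?fd a 3 = last (a # G)" "df = a" "dt = a"
    using rep D by (auto simp: repG_def cs_def G_def a_def)
  have k: "lends kc c c'" "lends kb b b'" "slist ?fd kc" "slist ?fd kb" "dstk ?fd kd"
      "if kd = [] then d = 0 else d = hd (last kd) \<and> d' = hd (hd kd)"
    using rr h by (auto simp: rep_eq[of _ r] repG_def kc_def kb_def kd_def a_def)
  have P: "C @ prsD D = C @ (a, els r) # kC r @ kB r @ prsD (kD r) @ concat (map prs g)"
    by (simp add: D prs_eq[of r] a_def)
  have "distinct (map fst (C @ prsD D))" using good by (simp add: good_def)
  then have dist: "distinct (cs @ a # kc @ kb @ map fst (prsD (kD r)) @ map fst (concat (map prs g)))"
    unfolding P by (simp add: cs_def kc_def kb_def)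
  have Gs: "set G \<subseteq> set (map fst (concat (map prs g)))" using ad_in_prs[of _ g] by (auto simp: G_def)
  have ks: "set (concat kd) \<subseteq> set (map fst (prsD (kD r)))" unfolding kd_def by (rule ad_subset_prsD)
  have dG: "distinct G" unfolding G_def by (rule distinct_ad) (use dist in simp)
  have d1: "a \<notin> set cs" "a \<notin> set kc" "a \<notin> set kb" "a \<notin> set (concat kd)" "a \<notin> set G"
    "set cs \<inter> set kc = {}" "set cs \<inter> set kb = {}" "set cs \<inter> set (concat kd) = {}" "set cs \<inter> set G = {}"
    "set kc \<inter> set G = {}" "set kb \<inter> set G = {}" "set (concat kd) \<inter> set G = {}" "distinct cs" "distinct kc"
    using dist Gs ks by (auto simp del: set_concat)
  have gd: "fst p \<in> vL st \<and> 0 < fst p \<and> fst p \<le> W \<and> vel st (fst p) = snd p"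
    if "p \<in> set (C @ (a, els r) # kC r @ kB r @ prsD (kD r) @ concat (map prs g))" for p
    using good that unfolding P good_def by blast
  have aC: "x \<in> vL st \<and> 0 < x \<and> x \<le> W" if "x \<in> set (cs @ a # kc @ kb @ concat kd @ G)" for x
  proof -
    have "x \<in> fst ` set (C @ (a, els r) # kC r @ kB r @ prsD (kD r) @ concat (map prs g))"
      using that Gs ks unfolding cs_def kc_def kb_def by (auto simp del: set_concat)
    then obtain p where "p \<in> set (C @ (a, els r) # kC r @ kB r @ prsD (kD r) @ concat (map prs g))" "x = fst p"
      by blast
    then show ?thesis using gd by blast
  qed
  have z: "0 \<notin> set cs" "0 \<notin> set kc" "0 \<notin> set kb" "0 \<notin> set (concat kd)" "0 < a" "set cs \<subseteq> vL st" "a \<in> vL st" "a \<le> W"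
    using aC by (auto simp del: set_concat)
  have aX: "a \<in> ?X" "set G \<subseteq> ?X" "set cs \<subseteq> ?X" by (auto simp: D a_def G_def cs_def)
  define f where "f = (if cf = 0 then a else cf)"
  let ?f0 = "app_fd ?fd cs a"
  have u0: "upd ?X ?fd ?f0" using aX by (intro upd_app_fd) simp
  have s0: "slist ?f0 (cs @ [a])" using r d1 by (intro slist_app_fd)
  have o: "?f0 x = ?fd x" if "x \<notin> set cs" for x using that by (rule app_fd_other)
  have l0: "lends (cs @ [a]) (f) a" using lends_app[OF z(1) r(1)] by (simp add: f_def)
  have l1: "kc \<noteq> [] \<Longrightarrow> lends (cs @ a # kc) (f) c'"
    using lends_app2[OF z(1) r(1) k(1)] by (simp add: f_def)
  have c0: "c = 0 \<longleftrightarrow> kc = []" using k(1) z(2) by (cases kc) (auto simp: lends_def)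
  have d0: "d = 0 \<longleftrightarrow> kd = []"
  proof (cases "kd = []")
    case False
    then have "last kd \<noteq> []" using dstk_nonempty[OF k(5)] by simp
    then have "hd (last kd) \<in> set (concat kd)" using False by (auto intro!: bexI[of _ "last kd"])
    then show ?thesis using k(6) False z(4) by (metis (full_types))
  qed (use k in simp)
  have ddF: "d \<noteq> 0 \<and> d = ad (hd (last (kD r))) \<and> hd (last (kD r)) \<in> set (concat (kD r))" if "kd \<noteq> []"
  proof -
    have ok': "ok0 (kC r) (kB r) (kD r)" using okr_eq[THEN iffD1, OF okr] by blast
    have ne: "kD r \<noteq> []" using that by (simp add: kd_def)
    then have "last (kD r) \<noteq> []" using ok' by (simp add: ok0_def)
    then have "hd (last kd) = ad (hd (last (kD r)))" using ne by (simp add: kd_def last_map hd_map)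
    then show ?thesis using hd_last_in[OF ok' ne] k(6) d0 that by simp
  qed
  have lf: "f \<le> W" using z hle by (auto simp: f_def)
  \<comment> \<open>Only links of \<open>C\<close> and of the segment are written, and their
    addresses are disjoint from the lists below \<open>r\<close>; so these lists are still linked
    when they move up a level.\<close>
  have kidcong: "slist fd' kc = slist ?fd kc" "slist fd' kb = slist ?fd kb" "dstk fd' kd = dstk ?fd kd"
    if "upd ?X ?fd fd'" for fd'
  proof -
    have X: "?X = set cs \<union> insert a (set G)" by (auto simp: D a_def G_def cs_def)
    have e: "fd' x = ?fd x" if "x \<in> set kc \<union> set kb \<union> set (concat kd)" for x
      using that \<open>upd ?X ?fd fd'\<close> d1 unfolding X upd_def by (auto simp del: set_concat)
    show "slist fd' kc = slist ?fd kc" "slist fd' kb = slist ?fd kb"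
      by (rule slist_cong; use e in \<open>auto dest!: in_set_butlastD\<close>)+
    show "dstk fd' kd = dstk ?fd kd" by (rule dstk_cong) (use e in auto)
  qed
  show ?thesis
  proof (cases "g = []")
    case g: True
    show ?thesis
    proof (cases "kc = []")
      case True
      have g0: "repG ?f0 (f, a, 0, 0, 0, 0) (stepG C D)"
        using g True s0 l0 by (simp add: D repG_def kc_def lends_def cs_def a_def)
      have "safe (k (f, a, 0, 0, 0, 0)) (st\<lparr>vfd := ?f0\<rparr>) n Q"
        by (rule K[OF u0 _ g0]) (use lf z in simp)
      then have 1: "\<forall>m\<ge>n. safe (k (f, a, 0, 0, 0, 0)) (st\<lparr>vfd := ?f0\<rparr>) m Q" by (auto intro: safe_mono)
      show ?thesis unfolding stepP_def r(5,6) f_def[symmetric]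
        using 1 z r g True c0 h by (auto simp: G_def intro!: safe_getF safe_readH safe_appP[OF r(1)])
    next
      case False
      let ?f1 = "?f0(a := (?f0 a)(1 := c))"
      have u1: "upd ?X ?fd ?f1" by (intro upd_step u0) (use aX in auto)
      have "slist ?f1 cs = slist ?f0 cs" by (rule slist_cong) (use d1 in \<open>auto dest!: in_set_butlastD\<close>)
      then have "slist ?f1 ((cs @ [a]) @ kc)"
        using s0 kidcong[OF u1] k False d1
        by (simp only: slist_append) (auto simp: lends_def app_fd_other app_fd_def)
      then have g0: "repG ?f1 (f, c', b, b', d, d') (stepG C D)"
        using g False l1 k kidcong[OF u1]
        by (simp add: D repG_def kc_def kb_def kd_def cs_def a_def del: fun_upd_apply)
      have "c' \<in> set kc" "c \<in> set kc" using False k(1) by (auto simp: lends_def)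
      then have cc: "c \<le> W" "c' \<le> W" using aC by auto
      have 1: "\<forall>m\<ge>n. hle (c, c', b, b', d, d') \<longrightarrow> safe (k (f, c', b, b', d, d')) (st\<lparr>vfd := ?f1\<rparr>) m Q"
        by (intro allI impI, rule safe_mono[OF K[OF u1 _ g0]]) (use lf in simp_all)
      show ?thesis unfolding stepP_def r(5,6) f_def[symmetric]
        using 1 z r g False c0 h cc d1(1) by (auto simp: G_def o intro!: safe_getF safe_setF safe_readH safe_appP[OF r(1)])
    qed
  next
    case g: False
    then have G: "G \<noteq> []" by (simp add: G_def)
    let ?n = "hd G"
    have n: "?n \<in> set G" "?n \<in> vL st" "?n \<le> W" "?n \<in> ?X" "?n \<noteq> a" "?n \<notin> set cs" "last G \<in> set G" "last G \<le> W" "last G \<noteq> a"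
    proof -
      show 1: "?n \<in> set G" "last G \<in> set G" using G by simp_all
      then show "?n \<in> vL st" "?n \<le> W" "last G \<le> W" using aC by auto
      show "?n \<in> ?X" using 1 aX by auto
      show "?n \<noteq> a" "?n \<notin> set cs" "last G \<noteq> a" using 1 d1(5,9) by auto
    qed
    have fa: "?fd a 1 = ?n" "?fd a 3 = last G" "?f0 a 1 = ?n" "a \<noteq> ?n"
      using r(3,4) G n(5) d1(1) by (cases G; auto simp: dlist_def o)+
    let ?f1 = "?f0(?n := (?f0 ?n)(3 := last G))"
    have u1: "upd ?X ?fd ?f1" by (intro upd_step u0) (use n in auto)
    have s1: "slist fd' (cs @ [a])" if "\<And>x. x \<in> set cs \<Longrightarrow> fd' x = ?f1 x" for fd'
    proof -
      have "slist fd' (cs @ [a]) = slist ?f0 (cs @ [a])"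
        by (rule slist_cong) (use that n(6) in auto)
      then show ?thesis using s0 by simp
    qed
    have t1: "dstk fd' [G]" if "\<And>x j. x \<in> set G \<Longrightarrow> j < 4 \<Longrightarrow> fd' x j = ?f1 x j" for fd'
    proof -
      have e: "?f1 x j = ?fd x j" if "x \<in> set G" "j \<noteq> 3" for x j
      proof -
        have "x \<notin> set cs" using that(1) d1(9) by auto
        then show ?thesis using that(2) n(6) by (auto simp: o)
      qed
      have "dlist fd' G = dlist ?fd G"
        by (rule dlist_cong; use that e in \<open>auto dest!: in_set_butlastD in_set_tlD simp del: fun_upd_apply\<close>)
      moreover have "dlist ?fd G" using r(3) dlist_append[of ?fd "[a]" G] by simp
      ultimately show ?thesis using that[of ?n 3] n G by simp
    qed
    have velk: "hd (vel st ?n) = key (hd g)"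
    proof -
      have "(ad (hd g), els (hd g)) \<in> set (concat (map prs g))"
        using g by (auto simp: prs_eq[of "hd g"] intro!: bexI[of _ "hd g"])
      then show ?thesis using gd[of "(ad (hd g), els (hd g))"] g by (simp add: G_def hd_map)
    qed
    show ?thesis
    proof (cases "kc = []")
      case True
      have g0: "repG ?f1 (f, a, 0, 0, ?n, ?n) (stepG C D)"
        using g True s1[of ?f1] t1[of ?f1] l0
        by (simp add: D repG_def kc_def lends_def cs_def a_def G_def del: fun_upd_apply)
      have "safe (k (f, a, 0, 0, ?n, ?n)) (st\<lparr>vfd := ?f1\<rparr>) n Q"
        by (rule K[OF u1 _ g0]) (use lf z n in simp)
      then have 1: "\<forall>m\<ge>n. safe (k (f, a, 0, 0, ?n, ?n)) (st\<lparr>vfd := ?f1\<rparr>) m Q" by (auto intro: safe_mono)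
      show ?thesis unfolding stepP_def r(5,6) f_def[symmetric]
        using 1 z r(1) fa n G True c0 h by (auto intro!: safe_getF safe_setF safe_readH safe_appP[OF r(1)])
    next
      case False
      have cc': "c' \<in> set kc" "c \<in> set kc" "c = hd kc" "c' = last kc" using False k(1) by (auto simp: lends_def)
      then have cc: "c \<le> W" "c' \<le> W" "c \<noteq> 0" "c' \<in> vL st" using aC z(2) by auto
      have velc: "hd (vel st c') = bkey (last (kC r))"
      proof -
        have "kC r \<noteq> []" using False by (simp add: kc_def)
        then show ?thesis using gd[of "last (kC r)"] cc'(4) by (simp add: kc_def last_map)
      qed
      let ?p = "cmpK B c' ?n (setF a 1 c (if d = 0 then k (f, c', b, b', ?n, ?n)
        else cmpK B d ?n (setF ?n 4 d' (k (f, c', b, b', d, ?n))) (k (f, c', b, b', ?n, ?n))))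
        (k (f, a, c, c', ?n, ?n))"
      \<comment> \<open>All remaining branches share a prefix of ten I/Os: field 3 and the header of
        \<open>r\<close>, the link from \<open>C\<close>, the link to \<open>n\<close> and the new
        end of the segment. Eight are left.\<close>
      have pre: "safe (stepP B cf cl df dt k) st (n + 18) Q"
        if p: "hle (c, c', b, b', d, d') \<Longrightarrow> safe ?p (st\<lparr>vfd := ?f1\<rparr>) (8 + n) Q"
      proof -
        define p where "p = ?p"
        have p: "hle (c, c', b, b', d, d') \<Longrightarrow> safe p (st\<lparr>vfd := ?f1\<rparr>) (8 + n) Q"
          using p by (simp only: p_def)
        show ?thesis unfolding stepP_def r(5,6) f_def[symmetric]
          using p z(1,6-8) fa n(2,3,8,9) cc(3) h p_def[symmetric]
          by (auto intro!: safe_getF safe_setF safe_readH safe_appP[OF r(1)])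
      qed
      show ?thesis
      proof (cases "bkey (last (kC r)) < key (hd g)")
        case nc: False
        have g0: "repG ?f1 (f, a, c, c', ?n, ?n) (stepG C D)"
          using g nc False s1[of ?f1] t1[of ?f1] l0 k kidcong[OF u1]
          by (simp add: D repG_def kc_def cs_def a_def G_def del: fun_upd_apply)
        have "safe (k (f, a, c, c', ?n, ?n)) (st\<lparr>vfd := ?f1\<rparr>) n Q"
          by (rule K[OF u1 _ g0]) (use lf z n cc in simp)
        then have 1: "\<forall>m\<ge>n. safe (k (f, a, c, c', ?n, ?n)) (st\<lparr>vfd := ?f1\<rparr>) m Q" by (auto intro: safe_mono)
        show ?thesis
          by (rule pre) (use 1 z(7,8) n(2,3) cc velc velk nc in \<open>auto intro!: safe_setF safe_cmpK\<close>)
      next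
        case nc: True
        let ?f2 = "?f1(a := (?f1 a)(1 := c))"
        have u2: "upd ?X ?fd ?f2" by (intro upd_step u1) (use aX in auto)
        have sl: "slist fd' (cs @ a # kc)"
          if "upd ?X ?fd fd'" "\<And>x. x \<in> set cs \<Longrightarrow> fd' x = ?f1 x" "fd' a 1 = c" for fd'
        proof -
          have "slist fd' ((cs @ [a]) @ kc)"
            using s1[of fd', OF that(2)] kidcong(1)[OF that(1)] k(3) that(3) cc'
            by (simp only: slist_append) simp
          then show ?thesis by simp
        qed
        show ?thesis
        proof (cases "kd = [] \<or> \<not> key (hd (last (kD r))) < key (hd g)")
          case kd: True
          have "slist ?f2 (cs @ a # kc)" by (rule sl[OF u2]) (use d1(1) in auto)
          moreover have "dstk ?f2 [G]" by (rule t1) (use d1(5) in auto)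
          ultimately have g0: "repG ?f2 (f, c', b, b', ?n, ?n) (stepG C D)"
            using g nc kd False l1[OF False] k kidcong[OF u2]
            by (simp add: D repG_def kc_def kb_def cs_def a_def G_def kd_def del: fun_upd_apply dstk.simps)
          have 1: "\<forall>m\<ge>n. hle (c, c', b, b', d, d') \<longrightarrow> safe (k (f, c', b, b', ?n, ?n)) (st\<lparr>vfd := ?f2\<rparr>) m Q"
            by (intro allI impI, rule safe_mono[OF K[OF u2 _ g0]]) (use lf n in simp_all)
          show ?thesis
          proof (cases "kd = []")
            case True
            then have "d = 0" using d0 by simp
            show ?thesis
              by (rule pre) (use 1 z(7,8) n(2,3) cc velc velk nc \<open>d = 0\<close> in \<open>auto intro!: safe_setF safe_cmpK\<close>)
          next
            case kne: False
            have dd: "d \<noteq> 0" "d = ad (hd (last (kD r)))" "hd (last (kD r)) \<in> set (concat (kD r))"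
            proof -
              show "d \<noteq> 0" "d = ad (hd (last (kD r)))" "hd (last (kD r)) \<in> set (concat (kD r))"
                using ddF[OF kne] by blast+
            qed
            then have dv: "d \<in> vL st" "hd (vel st d) = key (hd (last (kD r)))"
              using gd[of "(d, els (hd (last (kD r))))"] ad_prsD[OF dd(3)] by auto
            show ?thesis
              by (rule pre) (use 1 z(7,8) n(2,3) cc velc velk nc dd(1) kd kne dv in \<open>auto intro!: safe_setF safe_cmpK\<close>)
          qed
        next
          case kd: False
          let ?f3 = "?f2(?n := (?f2 ?n)(4 := d'))"
          have u3: "upd ?X ?fd ?f3" by (intro upd_step u2) (use n in auto)
          have dd: "d \<noteq> 0" "d = ad (hd (last (kD r)))" "hd (last (kD r)) \<in> set (concat (kD r))"
          proof -
            show "d \<noteq> 0" "d = ad (hd (last (kD r)))" "hd (last (kD r)) \<in> set (concat (kD r))"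
              using ddF kd by blast+
          qed
          have "d \<in> vL st" "hd (vel st d) = key (hd (last (kD r)))"
            using gd[of "(d, els (hd (last (kD r))))"] ad_prsD[OF dd(3)] dd(2) by auto
          note dv = this
          have "slist ?f3 (cs @ a # kc)" by (rule sl[OF u3]) (use n d1 in auto)
          moreover have "dstk ?f3 [G]" by (rule t1) (use n d1(5) in auto)
          then have "dstk ?f3 (G # kd)" using kidcong[OF u3] k(5,6) kd by simp
          ultimately have g0: "repG ?f3 (f, c', b, b', d, ?n) (stepG C D)"
            using g nc kd False l1[OF False] k kidcong[OF u3]
            by (simp add: D repG_def kc_def kb_def cs_def a_def G_def kd_def del: fun_upd_apply dstk.simps)
          have 1: "\<forall>m\<ge>n. hle (c, c', b, b', d, d') \<longrightarrow> safe (k (f, c', b, b', d, ?n)) (st\<lparr>vfd := ?f3\<rparr>) m Q"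
            by (intro allI impI, rule safe_mono[OF K[OF u3 _ g0]]) (use lf n in simp_all)
          show ?thesis
            by (rule pre) (use 1 z(7,8) n(2,3) cc velc velk nc dd(1) kd dv in \<open>auto intro!: safe_setF safe_cmpK\<close>)
        qed
      qed
    qed
  qed
qed

end

section \<open>Catenation and removal of the first record\<close>

text \<open>The links of the root belong to the level above it and may change; its header and
  everything below it must not.\<close>

lemma rep_frame:
  assumes "rep fd r" "\<forall>x\<in>fst ` set (kC r @ kB r @ prsD (kD r)). fd' x = fd x" "\<forall>j\<ge>5. fd' (ad r) j = fd (ad r) j"
  shows "rep fd' r"
  using assms
proof (induction r)
  case (Rc a e C B D)
  let ?r = "Rc a e C B D"
  note 1 = rep_eq[THEN iffD1, OF Rc.prems(1)]
  have fr: "fd' x = fd x" if "x \<in> fst ` set (C @ B @ prsD D)" for x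
    using Rc.prems(2) that unfolding rc.sel by blast
  have "repA fd' (hdr_of (fd' a)) (map fst C) (map fst B) (map (map ad) D) =
      repA fd (hdr_of (fd' a)) (map fst C) (map fst B) (map (map ad) D)"
    by (rule repA_cong) (use fr ad_subset_prsD[of D] in \<open>force simp del: set_concat\<close>)
  moreover have "hdr_of (fd' a) = hdr_of (fd a)" using Rc.prems(3) by (simp add: hdr_of_def)
  moreover have "rep fd' r" if r: "r \<in> set (concat D)" for r
  proof -
    have sub: "set (prs r) \<subseteq> set (prsD D)" using r by (auto simp: prsD_def)
    from r obtain g where g: "g \<in> set D" "r \<in> set g" by auto
    have "fd' (ad r) = fd (ad r)" using fr ad_prsD[OF r] by force
    moreover have "fd' x = fd x" if "x \<in> fst ` set (kC r @ kB r @ prsD (kD r))" for x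
    proof -
      have "x \<in> fst ` set (prs r)" using that by (auto simp: prs_eq[of r])
      then have "x \<in> fst ` set (C @ B @ prsD D)" using sub by auto
      then show ?thesis by (rule fr)
    qed
    moreover have "rep fd r" using 1 r by auto
    ultimately show ?thesis using Rc.IH[OF g] by auto
  qed
  ultimately show ?case using 1 by (subst rep_eq) (auto simp: repG_def)
qed

lemma rep_frame':
  "rep fd r \<Longrightarrow> (\<And>x. x \<in> fst ` set (prs r) \<Longrightarrow> fd' x = fd x) \<Longrightarrow> rep fd' r"
  by (rule rep_frame[of fd]) (auto simp: prs_eq[of r])

text \<open>New records enter the stack only by unfolding, hence from directly below an old record.
  This identifies the trees whose representation must be carried over a step.\<close>

lemma biasG_sub:
  assumes "biasG C B D = (C', B', D')" "r' \<in> set (concat D')" "\<forall>g\<in>set D. g \<noteq> []"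
  shows "r' \<in> set (concat D) \<or> (\<exists>r\<in>set (concat D). r' \<in> set (concat (kD r)))"
proof (cases "D = [] \<or> (B \<noteq> [] \<and> bkey (hd B) < key (hd (last D)))")
  case True
  then show ?thesis using assms by (auto simp: biasG_def split: if_splits)
next
  case False
  then have e: "stepG C D = (C', B', D')" using assms(1) by (auto simp: biasG_def)
  show ?thesis
  proof (cases "(C, D)" rule: stepG.cases)
    case (2 C0 g)
    then have D: "D = [g]" by simp
    then obtain r g' where "g = r # g'" using assms(3) by (cases g) auto
    then show ?thesis using e assms(2) D by (auto split: if_splits)
  next
    case (3 C0 t u D0)
    then show ?thesis using e assms(2) by (auto split: if_splits dest: in_set_butlastD)
  qed (use e assms False in auto)
qed

text \<open>Addresses in the flattened sequence are distinct, so what lies below a stack record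
  avoids all records whose links a step may write.\<close>

lemma desc_disjoint:
  assumes "distinct (map fst (C @ B @ prsD D))" "r \<in> set (concat D)"
  shows "fst ` set (kC r @ kB r @ prsD (kD r)) \<inter> (fst ` set C \<union> fst ` set B \<union> ad ` set (concat D)) = {}"
proof -
  have "r \<in> set (concat (rev D))" using assms(2) by auto
  then obtain xs ys where xy: "concat (rev D) = xs @ r # ys" by (metis split_list)
  then have P: "prsD D = concat (map prs xs) @ (ad r, els r) # (kC r @ kB r @ prsD (kD r)) @ concat (map prs ys)"
    by (simp add: prsD_def prs_eq[of r])
  have "set (concat D) = set (concat (rev D))" by simp
  then have s: "set (concat D) = set xs \<union> {r} \<union> set ys" unfolding xy by auto
  have "ad ` set xs \<subseteq> fst ` set (concat (map prs xs))" "ad ` set ys \<subseteq> fst ` set (concat (map prs ys))"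
    using ad_in_prs by blast+
  moreover have dj: "fst ` set (kC r @ kB r @ prsD (kD r)) \<inter> (fst ` set C \<union> fst ` set B \<union>
      (fst ` set (concat (map prs xs)) \<union> {ad r} \<union> fst ` set (concat (map prs ys)))) = {}"
  proof -
    have dl: "distinct (c @ b @ x @ a # e @ y) \<Longrightarrow> set e \<inter> (set c \<union> set b \<union> (set x \<union> {a} \<union> set y)) = {}"
      for c b x e y :: "nat list" and a by auto
    show ?thesis
      using dl[of "map fst C" "map fst B" "map fst (concat (map prs xs))" "ad r"
          "map fst (kC r @ kB r @ prsD (kD r))" "map fst (concat (map prs ys))"] assms(1)
      unfolding P by (simp only: map_append list.map fst_conv set_map set_append append_assoc append_Cons image_Un)
  qed
  ultimately have "ad ` set (concat D) \<subseteq> fst ` set (concat (map prs xs)) \<union> {ad r} \<union> fst ` set (concat (map prs ys))"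
    unfolding s image_Un by blast
  then show ?thesis using dj by blast
qed

lemma red_flt: "red P P' \<Longrightarrow> set (flt P') \<subseteq> set (flt P)"
  unfolding red_def flt_def by (metis UN_mono list.set_map set_concat subset_image_iff image_mono Union_mono)

context mach
begin

text \<open>A level whose header \<open>h\<close> is held in the control state while the header on
  disk may be outdated.\<close>

definition lev :: "'a vst \<Rightarrow> hdr \<Rightarrow> (nat \<times> 'a list) list \<Rightarrow> (nat \<times> 'a list) list \<Rightarrow> 'a rc list list \<Rightarrow> bool" where
  "lev st h C B' D \<longleftrightarrow> kids_ok C B' D \<and> repG (vfd st) h (C, B', D) \<and> (\<forall>r\<in>set (concat D). rep (vfd st) r)
     \<and> good st (C @ B' @ prsD D) \<and> hle h"

lemma good_Cons: "good st ((a, e) # P) \<longleftrightarrow> a \<notin> fst ` set P \<and> a \<in> vL st \<and> 0 < a \<and> a \<le> W \<and> vel st a = e \<and> good st P"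
  by (auto simp: good_def simp del: split_paired_All)

lemma good_append: "good st (P @ P') \<longleftrightarrow> good st P \<and> good st P' \<and> fst ` set P \<inter> fst ` set P' = {}"
  by (auto simp: good_def simp del: split_paired_All)

lemma good_free:
  assumes "good st P" "a \<notin> fst ` set P"
  shows "good (st\<lparr>vL := vL st - {a}\<rparr>) P"
proof -
  have "fst p \<noteq> a" if "p \<in> set P" for p using assms(2) that by blast
  then show ?thesis using assms(1) by (simp add: good_def)
qed

text \<open>The pointer half of the correctness of \<open>biasP\<close>: only links of this level
  change, and the outcome represents \<open>biasG\<close>. \<open>safe_biasP\<close> joins it with
  \<open>biasG_post\<close>.\<close>

lemma biasP_fields:
  assumes lev: "lev st h C B0 D"
    and K: "\<And>fd' h'. upd (fst ` set C \<union> fst ` set B0 \<union> ad ` set (concat D)) (vfd st) fd' \<Longrightarrow> hle h' \<Longrightarrow>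
        repG fd' h' (biasG C B0 D) \<Longrightarrow> safe (k h') (st\<lparr>vfd := fd'\<rparr>) n Q"
  shows "safe (biasP B h k) st (n + 20) Q"
proof -
  obtain cf cl bf bl df dt where h: "h = (cf, cl, bf, bl, df, dt)" by (metis prod_cases6)
  have l: "kids_ok C B0 D" "repG (vfd st) h (C, B0, D)" "\<forall>r\<in>set (concat D). rep (vfd st) r"
    "good st (C @ B0 @ prsD D)" "hle h" using lev by (auto simp: lev_def)
  have ok: "ok0 C B0 D" using l by (simp add: kids_ok_def)
  let ?X = "fst ` set C \<union> fst ` set B0 \<union> ad ` set (concat D)"
  have mem: "fst p \<in> vL st \<and> 0 < fst p \<and> fst p \<le> W \<and> vel st (fst p) = snd p" if "p \<in> set (C @ B0 @ prsD D)" for p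
    using l(4) that unfolding good_def by blast
  show ?thesis
  proof (cases "D = []")
    case True
    have "repG (vfd st) h (biasG C B0 D)" using l(2) True by (simp add: biasG_def)
    from K[OF _ l(5) this] have "safe (k h) st n Q" by simp
    then have "safe (k h) st (n + 20) Q" by (rule safe_mono) simp
    moreover have "df = 0" using l(2) True h by (simp add: repG_def)
    ultimately show ?thesis by (simp add: h)
  next
    case False
    have r0: "hd (last D) \<in> set (concat D)" using hd_last_in[OF ok False] .
    have ne: "last D \<noteq> []" using ok False by (simp add: ok0_def)
    have df: "df = ad (hd (last D))" using l(2) False ne h by (simp add: repG_def last_map hd_map)
    have dfm: "df \<in> vL st" "0 < df" "vel st df = els (hd (last D))"
      using mem[of "(ad (hd (last D)), els (hd (last D)))"] ad_prsD[OF r0] df by auto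
    have step: "safe (stepP B cf cl df dt k) st (n + 18) Q"
      if b: "B0 = [] \<or> \<not> bkey (hd B0) < key (hd (last D))"
    proof -
      have d: "kids_ok C [] D" "red (C @ B0 @ prsD D) (C @ prsD D)" using red_drop_buffer[OF l(1) False b] .
      have ok': "ok0 C [] D" using d by (simp add: kids_ok_def)
      have good: "good st (C @ prsD D)" using good_red[OF l(4) d(2)] .
      have e: "biasG C B0 D = stepG C D" using b False by (auto simp: biasG_def)
      have X: "upd ?X (vfd st) fd'" if "upd Y (vfd st) fd'" "Y \<subseteq> ?X" for fd' Y
        using that unfolding upd_def by blast
      show ?thesis
      proof (cases "(C, D)" rule: stepG.cases)
        case (2 C' g)
        then have D: "D = [g]" by simp
        then obtain r g' where g: "g = r # g'" using ok' by (cases g) (auto simp: ok0_def)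
        then have D: "D = [r # g']" using D by simp
        have r: "rep (vfd st) r" "okr r" using l(1,3) D by (auto simp: kids_ok_def)
        show ?thesis
          by (rule safe_stepP_single[OF D ok' r l(2)[unfolded h] good l(5)[unfolded h]])
            (rule K[OF X], auto simp: e)
      next
        case (3 C' t u D')
        then have D: "D = t # u # D'" by simp
        show ?thesis
          by (rule safe_stepP_deep[OF D ok' l(2)[unfolded h] good l(5)[unfolded h]])
            (rule K[OF X], auto simp: e)
      qed (use False in auto)
    qed
    show ?thesis
    proof (cases "B0 = []")
      case True
      then have "bf = 0" using l(2) h by (simp add: repG_def lends_def)
      then show ?thesis using step[OF disjI1[OF True]] dfm by (auto simp: h intro: safe_mono)
    next
      case B0: False
      then obtain c B' where B': "B0 = c # B'" by (cases B0) auto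
      have bf: "bf = fst c" "bl = last (map fst B0)" using l(2) h B' by (auto simp: repG_def lends_def)
      have bfm: "bf \<in> vL st" "0 < bf" "bf \<le> W" "vel st bf = snd c" using mem[of c] B' bf by auto
      have e: "biasP B h k = cmpK B bf df
        (appP cf cl bf
          (if bf = bl then k (if cf = 0 then bf else cf, bf, 0, bl, df, dt)
           else getF bf 1 (\<lambda>n. k (if cf = 0 then bf else cf, bf, n, bl, df, dt))))
        (stepP B cf cl df dt k)"
        using dfm bfm by (simp add: h)
      show ?thesis
      proof (cases "bkey c < key (hd (last D))")
        case nb: False
        have "safe (stepP B cf cl df dt k) st (n + 18) Q" by (rule step) (use nb B' in simp)
        then show ?thesis unfolding e using nb dfm bfm by (intro safe_cmpK) (auto intro: safe_mono)
      next
        case True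
        let ?cs = "map fst C"
        have r: "lends ?cs cf cl" "slist (vfd st) ?cs" "slist (vfd st) (map fst B0)" "dstk (vfd st) (map (map ad) D)"
          "dt = hd (hd (map (map ad) D))"
          using l(2) h False by (auto simp: repG_def)
        have cs: "0 \<notin> set ?cs" "set ?cs \<subseteq> vL st" using mem by force+
        have dist: "distinct (map fst (C @ B0 @ prsD D))" using l(4) by (simp add: good_def)
        let ?f = "app_fd (vfd st) ?cs bf"
        have u: "upd ?X (vfd st) ?f" by (rule upd_app_fd) auto
        have s1: "slist ?f (?cs @ [bf])" using r(2) dist by (intro slist_app_fd) auto
        have fr: "?f x = vfd st x" if "x \<notin> set ?cs" for x using that by (rule app_fd_other)
        have "slist ?f (map fst B0) = slist (vfd st) (map fst B0)"
        proof (rule slist_cong, rule ballI)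
          fix x assume "x \<in> set (butlast (map fst B0))"
          then have "x \<in> set (map fst B0)" by (rule in_set_butlastD)
          then have "x \<notin> set ?cs" using dist by auto
          then show "?f x 1 = vfd st x 1" using fr by simp
        qed
        then have s2: "slist ?f (map fst B')" using r(3) B' slist_append[of ?f "[fst c]" "map fst B'"] by simp
        have "dstk ?f (map (map ad) D) = dstk (vfd st) (map (map ad) D)"
        proof (rule dstk_cong, intro ballI allI impI)
          fix x j assume "x \<in> set (concat (map (map ad) D))"
          then have "x \<notin> set ?cs" using ad_subset_prsD[of D] dist by (auto simp del: set_concat)
          then show "?f x j = vfd st x j" using fr by simp
        qed
        then have s3: "dstk ?f (map (map ad) D)" using r by simp
        have f1: "vfd st bf 1 = hd (map fst B')" if "B' \<noteq> []"
          using r(3) B' that bf slist_append[of "vfd st" "[fst c]" "map fst B'"] by simp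
        have bfc: "bf \<notin> set ?cs" using dist B' bf by auto
        have bb: "bf = bl \<longleftrightarrow> B' = []"
        proof
          assume "bf = bl"
          then show "B' = []" using bf B' dist last_in_set[of "map fst B'"] by (cases "B' = []") auto
        qed (use bf B' in auto)
        let ?f' = "if cf = 0 then bf else cf"
        have lf: "?f' \<le> W" using bfm l(5) h by auto
        let ?n = "if B' = [] then 0 else hd (map fst B')"
        have nW: "?n \<le> W" using mem[of "hd B'"] B' by (auto simp: hd_map)
        have g: "repG ?f (?f', bf, ?n, bl, df, dt) (biasG C B0 D)"
          using True B' False s1 s2 s3 bf lends_app[OF cs(1) r(1), of bf] df r(5) ne
          by (auto simp: biasG_def repG_def lends_def last_map hd_map)
        have 1: "safe (k (?f', bf, ?n, bl, df, dt)) (st\<lparr>vfd := ?f\<rparr>) n Q"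
          by (rule K[OF u _ g]) (use lf nW l(5) h bfm in auto)
        define f' where "f' = ?f'"
        have 2: "safe (appP cf cl bf
           (if bf = bl then k (f', bf, 0, bl, df, dt) else getF bf 1 (\<lambda>n. k (f', bf, n, bl, df, dt)))) st (n + 18) Q"
        proof (rule safe_appP[OF r(1) cs bfm(3)])
          show "safe (if bf = bl then k (f', bf, 0, bl, df, dt) else getF bf 1 (\<lambda>n. k (f', bf, n, bl, df, dt)))
             (st\<lparr>vfd := ?f\<rparr>) (n + 18 - 1) Q"
          proof (cases "B' = []")
            case True
            then show ?thesis using 1 bb by (auto simp: f'_def intro: safe_mono)
          next
            case ne: False
            have "safe (getF bf 1 (\<lambda>n. k (f', bf, n, bl, df, dt))) (st\<lparr>vfd := ?f\<rparr>) (n + 18 - 1) Q"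
              by (rule safe_getF) (use bfm fr[OF bfc] f1 ne 1 in \<open>auto simp: f'_def intro: safe_mono\<close>)
            then show ?thesis using ne bb by simp
          qed
        qed simp
        then show ?thesis unfolding e f'_def[symmetric] using True dfm bfm
          by (intro safe_cmpK) (auto intro: safe_mono)
      qed
    qed
  qed
qed

lemma safe_biasP:
  assumes lev: "lev st h C B0 D" and c: "cost D \<le> length C + m"
    and K: "\<And>fd' h' C' B' D'. (\<forall>x. x \<notin> fst ` set (C @ B0 @ prsD D) \<longrightarrow> fd' x = vfd st x) \<Longrightarrow>
        lev (st\<lparr>vfd := fd'\<rparr>) h' C' B' D' \<Longrightarrow> red (C @ B0 @ prsD D) (C' @ B' @ prsD D') \<Longrightarrow>
        cost D' \<le> length C' + (m - 1) \<Longrightarrow> safe (k h') (st\<lparr>vfd := fd'\<rparr>) n Q"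
  shows "safe (biasP B h k) st (n + 20) Q"
proof (rule biasP_fields[OF lev])
  fix fd' h'
  let ?X = "fst ` set C \<union> fst ` set B0 \<union> ad ` set (concat D)"
  assume u: "upd ?X (vfd st) fd'" and h': "hle h'" and r: "repG fd' h' (biasG C B0 D)"
  obtain C' B' D' where b: "biasG C B0 D = (C', B', D')" by (metis prod_cases3)
  have l: "kids_ok C B0 D" "\<forall>r\<in>set (concat D). rep (vfd st) r" "good st (C @ B0 @ prsD D)"
    using lev by (auto simp: lev_def)
  have dist: "distinct (map fst (C @ B0 @ prsD D))" using l(3) by (simp add: good_def)
  have p: "kids_ok C' B' D'" "red (C @ B0 @ prsD D) (C' @ B' @ prsD D')" "cost D' \<le> length C' + (m - 1)"
    using biasG_post[OF l(1) c] b by (auto simp: post_def)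
  have ne: "\<forall>g\<in>set D. g \<noteq> []" using l(1) by (simp add: kids_ok_def ok0_def)
  \<comment> \<open>A record that was in the stack keeps its header and what is below it. One
    brought up by unfolding lies, with its whole tree, outside the written addresses.\<close>
  have "rep fd' r'" if "r' \<in> set (concat D')" for r'
    using biasG_sub[OF b that ne]
  proof
    assume r': "r' \<in> set (concat D)"
    show ?thesis
      by (rule rep_frame[of "vfd st"]) (use l(2) r' desc_disjoint[OF dist r'] u in \<open>auto simp: upd_def disjoint_iff simp del: set_concat\<close>)
  next
    assume "\<exists>r\<in>set (concat D). r' \<in> set (concat (kD r))"
    then obtain r where r: "r \<in> set (concat D)" "r' \<in> set (concat (kD r))" by blast
    have "set (prs r') \<subseteq> set (prsD (kD r))" using r(2) by (auto simp: prsD_def)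
    then have e: "fd' x = vfd st x" if "x \<in> fst ` set (prs r')" for x
    proof -
      have "x \<in> fst ` set (kC r @ kB r @ prsD (kD r))"
        using that \<open>set (prs r') \<subseteq> _\<close> unfolding set_append image_Un by blast
      then have "x \<notin> ?X" using desc_disjoint[OF dist r(1)] by blast
      then show ?thesis using u by (simp add: upd_def)
    qed
    have "rep (vfd st) r'" using l(2) r rep_eq[of "vfd st" r] by blast
    then show ?thesis by (rule rep_frame') (rule e)
  qed
  then have "lev (st\<lparr>vfd := fd'\<rparr>) h' C' B' D'"
    using p h' r b good_red[OF l(3) p(2)] by (simp add: lev_def)
  moreover have "\<forall>x. x \<notin> fst ` set (C @ B0 @ prsD D) \<longrightarrow> fd' x = vfd st x"
  proof (intro allI impI)
    fix x assume "x \<notin> fst ` set (C @ B0 @ prsD D)"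
    moreover have "ad ` set (concat D) \<subseteq> fst ` set (prsD D)" using ad_prsD by force
    ultimately have "x \<notin> ?X" unfolding set_append image_Un by blast
    then show "fd' x = vfd st x" using u by (simp add: upd_def)
  qed
  ultimately show "safe (k h') (st\<lparr>vfd := fd'\<rparr>) n Q" using K p by blast
qed

definition tree :: "'a vst \<Rightarrow> 'a rc \<Rightarrow> bool" where
  "tree st r \<longleftrightarrow> okr r \<and> rep (vfd st) r \<and> good st (prs r)"

text \<open>Closes a level: writing its header into the record \<open>a\<close>, whose key lies
  below all its elements, yields a tree. The header belongs to no list, so the lists stay
  linked.\<close>

lemma lev_tree:
  assumes "lev st h C B' D" "cost D \<le> length C" "bok (a, e)" "good st ((a, e) # C @ B' @ prsD D)"
    "\<forall>x\<in>set (flt (C @ B' @ prsD D)). hd e < x"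
    "hdr_of (fd' a) = h" "\<forall>x. x \<noteq> a \<longrightarrow> fd' x = vfd st x"
  shows "tree (st\<lparr>vfd := fd'\<rparr>) (Rc a e C B' D)"
proof -
  have l: "kids_ok C B' D" "repG (vfd st) h (C, B', D)" "\<forall>r\<in>set (concat D). rep (vfd st) r"
    using assms(1) by (auto simp: lev_def)
  have na: "a \<notin> fst ` set (C @ B' @ prsD D)" using assms(4) by (auto simp: good_def)
  have bok: "\<forall>c\<in>set C \<union> set B'. bok c" using l(1) by (auto simp: kids_ok_def ok0_def)
  have "hd e < bkey c" if "c \<in> set C \<union> set B'" for c
    using assms(5) key_in_flt[of c "C @ B' @ prsD D"] bok that by auto
  moreover have "hd e < key r" if "r \<in> set (concat D)" for r
  proof -
    have "okr r" using l(1) that by (auto simp: kids_ok_def)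
    from key_in_flt_prsD[OF that this] assms(5) show ?thesis by simp
  qed
  ultimately have "okr (Rc a e C B' D)" using l(1) assms(2,3) by (subst okr_iff) auto
  moreover have "rep fd' r" if "r \<in> set (concat D)" for r
  proof (rule rep_frame'[of "vfd st"])
    fix x assume "x \<in> fst ` set (prs r)"
    moreover have "fst ` set (prs r) \<subseteq> fst ` set (C @ B' @ prsD D)" using that by (auto simp: prsD_def)
    ultimately have "x \<noteq> a" using na by blast
    then show "fd' x = vfd st x" using assms(7) by simp
  qed (use l that in blast)
  moreover have "repG fd' h (C, B', D)"
  proof -
    have "repA fd' h (map fst C) (map fst B') (map (map ad) D) = repA (vfd st) h (map fst C) (map fst B') (map (map ad) D)"
      by (rule repA_cong) (use na assms(7) ad_subset_prsD[of D] in \<open>force simp del: set_concat\<close>)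
    then show ?thesis using l(2) by (simp add: repG_def)
  qed
  ultimately show ?thesis using assms(4,6) unfolding tree_def by (subst rep_eq) (auto simp: prs_eq[of "Rc a e C B' D"])
qed

lemma tree_frame:
  assumes "tree st r" "\<And>x. x \<in> fst ` set (prs r) \<Longrightarrow> vfd st' x = vfd st x \<and> vel st' x = vel st x \<and> (x \<in> vL st \<longrightarrow> x \<in> vL st')"
  shows "tree st' r"
proof -
  have "rep (vfd st') r"
    by (rule rep_frame'[of "vfd st"]) (use assms in \<open>auto simp: tree_def\<close>)
  moreover have "good st' (prs r)" using assms by (fastforce simp: tree_def good_def)
  ultimately show ?thesis using assms(1) by (simp add: tree_def)
qed

text \<open>Since \<open>key r < key r'\<close>, the root of the first tree survives and the second
  tree is appended to the level below it. The balance may be violated by 2 in between; both steps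
  run on the header in the control state.\<close>

lemma safe_linkP:
  assumes t: "tree st r" "tree st r'" and dj: "fst ` set (prs r) \<inter> fst ` set (prs r') = {}" and lt: "key r < key r'"
    and K: "\<And>fd' r''. tree (st\<lparr>vfd := fd'\<rparr>) r'' \<Longrightarrow> ad r'' = ad r \<Longrightarrow> red (prs r @ prs r') (prs r'') \<Longrightarrow>
        (\<forall>x. x \<notin> fst ` set (prs r @ prs r') \<longrightarrow> fd' x = vfd st x) \<Longrightarrow> safe p (st\<lparr>vfd := fd'\<rparr>) n Q"
  shows "safe (linkP B (ad r) (ad r') p) st (n + 60) Q"
proof -
  let ?a = "ad r" and ?a' = "ad r'" and ?fd = "vfd st"
  let ?C = "kC r" and ?B = "kB r" and ?D = "kD r"
  have t1: "okr r" "rep ?fd r" "good st (prs r)" "okr r'" "rep ?fd r'" "good st (prs r')"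
    using t by (auto simp: tree_def)
  have mem: "x \<in> vL st \<and> 0 < x \<and> x \<le> W" if "x \<in> fst ` set (prs r) \<union> fst ` set (prs r')" for x
    using t1(3,6) that by (auto simp: good_def)
  have hr: "(?a, els r) \<in> set (prs r)" "(?a', els r') \<in> set (prs r')" by (simp_all add: prs_eq[of r] prs_eq[of r'])
  then have a: "?a \<in> fst ` set (prs r)" "?a' \<in> fst ` set (prs r')" by force+
  have aL: "?a \<in> vL st" "?a' \<in> vL st" "?a' \<le> W" "0 < ?a'" using mem a by auto
  have vela: "vel st ?a' = els r'" using t1(6) hr(2) by (auto simp: good_def)
  let ?P = "?C @ ?B @ prsD ?D @ prs r'"
  have good: "good st ((?a, els r) # ?P)"
  proof -
    have "good st (prs r @ prs r')" using t1(3,6) dj by (simp add: good_append)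
    then show ?thesis by (simp add: prs_eq[of r])
  qed
  then have goodP: "good st ?P" by (simp add: good_def)
  obtain cf cl bf bl df dt where h: "hdr_of (?fd ?a) = (cf, cl, bf, bl, df, dt)" by (metis prod_cases6)
  let ?f1 = "?fd(?a' := (?fd ?a')(3 := ?a'))"
  define fin where "fin = (\<lambda>h. biasP B h (\<lambda>h. biasP B h (\<lambda>h. writeH ?a h p)))"
  have aP: "x \<noteq> ?a" "x \<noteq> ?a'" if "x \<in> fst ` set (?C @ ?B @ prsD ?D)" for x
  proof -
    have "good st ((?C @ ?B @ prsD ?D) @ prs r')" using goodP by simp
    from good_append[THEN iffD1, OF this] that a(2) show "x \<noteq> ?a'" by blast
    show "x \<noteq> ?a" using t1(3) that unfolding prs_eq[of r] good_Cons by blast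
  qed
  have adP: "ad ` set (concat ?D) \<subseteq> fst ` set (prsD ?D)" using ad_prsD by force
  \<comment> \<open>The common end of all branches, once the header represents \<open>attG\<close>:
    two steps of 20 I/Os and 6 I/Os for the header.\<close>
  have fin: "safe (fin h') (st\<lparr>vfd := fd'\<rparr>) (n + 46) Q"
    if u: "upd {?a'} ?fd fd'" and h': "hle h'" and rg: "repG fd' h' (attG ?C ?B ?D r')" for fd' h'
  proof -
    obtain C B' D where att: "attG ?C ?B ?D r' = (C, B', D)" by (metis prod_cases3)
    have po: "kids_ok C B' D" "red ?P (C @ B' @ prsD D)" "cost D \<le> length C + 2"
      using attG_post[of ?C ?B ?D r'] okr_iff[THEN iffD1, OF t1(1)] t1(4) att by (auto simp: post_def)
    have "rep fd' r0" if "r0 \<in> set (concat D)" for r0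
    proof (cases "r0 = r'")
      case True
      have "?a' \<notin> fst ` set (kC r' @ kB r' @ prsD (kD r'))"
        using t1(6) unfolding good_def prs_eq[of r'] by (auto simp del: set_append map_append)
      then have "\<forall>x\<in>fst ` set (kC r' @ kB r' @ prsD (kD r')). fd' x = ?fd x"
        using u unfolding upd_def by (metis singletonD)
      then show ?thesis unfolding True by (rule rep_frame[OF t1(5)]) (use u in \<open>simp add: upd_def\<close>)
    next
      case False
      then have r0: "r0 \<in> set (concat ?D)" using that att by (auto simp: attG_def split: if_splits)
      show ?thesis
      proof (rule rep_frame'[of ?fd])
        show "rep ?fd r0" using r0 rep_eq[of ?fd r] t1(2) by blast
        fix x assume "x \<in> fst ` set (prs r0)"
        moreover have "set (prs r0) \<subseteq> set (prsD ?D)" using r0 by (auto simp: prsD_def)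
        ultimately have "x \<in> fst ` set (?C @ ?B @ prsD ?D)" by auto
        then show "fd' x = ?fd x" using aP u by (simp add: upd_def)
      qed
    qed
    then have l1: "lev (st\<lparr>vfd := fd'\<rparr>) h' C B' D"
      using po h' rg att good_red[OF goodP po(2)] by (simp add: lev_def)
    have sub1: "fst ` set (C @ B' @ prsD D) \<subseteq> fst ` set ?P" using po(2) unfolding red_def by blast
    have "safe (biasP B h' (\<lambda>h. biasP B h (\<lambda>h. writeH ?a h p))) (st\<lparr>vfd := fd'\<rparr>) (n + 26 + 20) Q"
    proof (rule safe_biasP[OF l1 po(3)])
      fix fd2 h2 C2 B2 D2
      assume 2: "\<forall>x. x \<notin> fst ` set (C @ B' @ prsD D) \<longrightarrow> fd2 x = vfd (st\<lparr>vfd := fd'\<rparr>) x"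
        "lev (st\<lparr>vfd := fd', vfd := fd2\<rparr>) h2 C2 B2 D2"
        "red (C @ B' @ prsD D) (C2 @ B2 @ prsD D2)" "cost D2 \<le> length C2 + (2 - 1)"
      have sub2: "fst ` set (C2 @ B2 @ prsD D2) \<subseteq> fst ` set ?P" using 2(3) sub1 unfolding red_def by blast
      have l2: "lev (st\<lparr>vfd := fd2\<rparr>) h2 C2 B2 D2" using 2(2) by simp
      have c2: "cost D2 \<le> length C2 + 1" using 2(4) by simp
      have "safe (biasP B h2 (\<lambda>h. writeH ?a h p)) (st\<lparr>vfd := fd2\<rparr>) (n + 6 + 20) Q"
      proof (rule safe_biasP[OF l2 c2])
        fix fd3 h3 C3 B3 D3
        assume 3: "\<forall>x. x \<notin> fst ` set (C2 @ B2 @ prsD D2) \<longrightarrow> fd3 x = vfd (st\<lparr>vfd := fd2\<rparr>) x"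
          "lev (st\<lparr>vfd := fd2, vfd := fd3\<rparr>) h3 C3 B3 D3"
          "red (C2 @ B2 @ prsD D2) (C3 @ B3 @ prsD D3)" "cost D3 \<le> length C3 + (1 - 1)"
        have l3: "lev (st\<lparr>vfd := fd3\<rparr>) h3 C3 B3 D3" using 3(2) by simp
        have c3: "cost D3 \<le> length C3" using 3(4) by simp
        have red: "red ?P (C3 @ B3 @ prsD D3)" using po(2) 2(3) 3(3) by (blast intro: red_trans)
        let ?r = "Rc ?a (els r) C3 B3 D3"
        have rd: "red (prs r @ prs r') (prs ?r)"
          using red_context[OF red, of "[(?a, els r)]"] by (simp add: prs_eq[of r] prs_eq[of ?r])
        have "safe (writeH ?a h3 p) (st\<lparr>vfd := fd3\<rparr>) (n + 6) Q"
        proof (rule safe_writeH)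
          fix fd4 assume 4: "hdr_of (fd4 ?a) = h3" "\<forall>x. x \<noteq> ?a \<longrightarrow> fd4 x = vfd (st\<lparr>vfd := fd3\<rparr>) x"
          have "tree (st\<lparr>vfd := fd3, vfd := fd4\<rparr>) ?r"
          proof (rule lev_tree[OF l3 c3])
            show "bok (?a, els r)" using okr_iff[THEN iffD1, OF t1(1)] by blast
            show "good (st\<lparr>vfd := fd3\<rparr>) ((?a, els r) # C3 @ B3 @ prsD D3)"
              using good_red[OF good] red_context[OF red, of "[(?a, els r)]"] by simp
            show "\<forall>x\<in>set (flt (C3 @ B3 @ prsD D3)). key r < x"
            proof
              fix x assume "x \<in> set (flt (C3 @ B3 @ prsD D3))"
              then have "x \<in> set (flt ?P)" using red_flt[OF red] by blast
              then have "x \<in> set (flt (?C @ ?B @ prsD ?D)) \<or> x \<in> set (flt (prs r'))" by auto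
              then show "key r < x" using okr_less[OF t1(1)] okr_le[OF t1(4)] lt by (meson less_le_trans)
            qed
          qed (use 4 in auto)
          then have tr: "tree (st\<lparr>vfd := fd4\<rparr>) ?r" by simp
          have fr: "\<forall>x. x \<notin> fst ` set (prs r @ prs r') \<longrightarrow> fd4 x = ?fd x"
          proof (intro allI impI)
            fix x assume x: "x \<notin> fst ` set (prs r @ prs r')"
            have "fst ` set ?P \<subseteq> fst ` set (prs r @ prs r')" by (rule image_mono) (auto simp: prs_eq[of r])
            then have "x \<notin> fst ` set ?P" "x \<noteq> ?a" "x \<noteq> ?a'" using x a unfolding set_append image_Un by blast+
            moreover from this have "x \<notin> fst ` set (C2 @ B2 @ prsD D2)" "x \<notin> fst ` set (C @ B' @ prsD D)"
              using sub1 sub2 by blast+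
            ultimately show "fd4 x = ?fd x" using 4(2) 3(1) 2(1) u by (simp add: upd_def)
          qed
          have "safe p (st\<lparr>vfd := fd4\<rparr>) n Q" using K[OF tr _ rd fr] by simp
          then show "safe p (st\<lparr>vfd := fd3, vfd := fd4\<rparr>) (n + 6 - 6) Q" by simp
        qed (use aL l3 in \<open>auto simp: lev_def\<close>)
        then show "safe (writeH ?a h3 p) (st\<lparr>vfd := fd2, vfd := fd3\<rparr>) (n + 6) Q" by simp
      qed
      then show "safe (biasP B h2 (\<lambda>h. writeH ?a h p)) (st\<lparr>vfd := fd', vfd := fd2\<rparr>) (n + 26) Q"
        by (simp add: add.commute)
    qed
    then show ?thesis by (simp add: fin_def add.commute)
  qed
  have u1: "upd {?a'} ?fd ?f1" by (simp add: upd_def)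
  have rg: "repA ?fd (cf, cl, bf, bl, df, dt) (map fst ?C) (map fst ?B) (map (map ad) ?D)"
    using t1(2) h by (simp add: rep_eq[of _ r] repG_def)
  have rg': "repA fd' (cf, cl, bf, bl, df, dt) (map fst ?C) (map fst ?B) (map (map ad) ?D)"
    if u: "upd {?a'} ?fd fd'" for fd'
  proof -
    have "repA fd' (cf, cl, bf, bl, df, dt) (map fst ?C) (map fst ?B) (map (map ad) ?D) =
        repA ?fd (cf, cl, bf, bl, df, dt) (map fst ?C) (map fst ?B) (map (map ad) ?D)"
    proof (rule repA_cong, intro ballI allI impI)
      fix x j assume "x \<in> set (map fst ?C) \<union> set (map fst ?B) \<union> set (concat (map (map ad) ?D))"
      then have "x \<in> fst ` set (?C @ ?B @ prsD ?D)" using ad_subset_prsD[of ?D] by (auto simp del: set_concat)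
      then show "fd' x j = ?fd x j" using aP u by (simp add: upd_def)
    qed
    then show ?thesis using rg by simp
  qed
  have okD: "ok0 ?C ?B ?D" using okr_eq[THEN iffD1, OF t1(1)] by blast
  have memC: "fst q \<in> vL st \<and> 0 < fst q \<and> fst q \<le> W \<and> vel st (fst q) = snd q" if "q \<in> set ?P" for q
    using goodP that unfolding good_def by blast
  have c0: "cf = 0 \<longleftrightarrow> ?C = []" "?C \<noteq> [] \<Longrightarrow> cl \<in> vL st \<and> vel st cl = snd (last ?C)"
  proof -
    show "cf = 0 \<longleftrightarrow> ?C = []" using rg memC[of "hd ?C"] by (cases ?C) (auto simp: lends_def)
    show "cl \<in> vL st \<and> vel st cl = snd (last ?C)" if "?C \<noteq> []"
      using rg memC[of "last ?C"] that by (auto simp: lends_def last_map)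
  qed
  have d0: "df = 0 \<longleftrightarrow> ?D = []" "?D \<noteq> [] \<Longrightarrow> df \<in> vL st \<and> vel st df = els (hd (last ?D))"
  proof -
    have "df \<in> vL st \<and> vel st df = els (hd (last ?D)) \<and> 0 < df" if "?D \<noteq> []"
    proof -
      have r0: "hd (last ?D) \<in> set (concat ?D)" using hd_last_in[OF okD that] .
      have "last ?D \<noteq> []" using okD that by (simp add: ok0_def)
      then have "df = ad (hd (last ?D))" using rg that by (simp add: last_map hd_map)
      then show ?thesis using memC[of "(ad (hd (last ?D)), els (hd (last ?D)))"] ad_prsD[OF r0] by auto
    qed
    then show "df = 0 \<longleftrightarrow> ?D = []" "?D \<noteq> [] \<Longrightarrow> df \<in> vL st \<and> vel st df = els (hd (last ?D))"
      using rg by (cases "?D = []"; simp)+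
  qed
  have hle0: "hle (cf, cl, bf, bl, df, dt) \<Longrightarrow> safe (setF ?a' 3 ?a'
      (let rest = (if df = 0 then fin (cf, cl, bf, bl, ?a', ?a')
            else cmpK B df ?a' (setF ?a' 4 dt (fin (cf, cl, bf, bl, df, ?a'))) (fin (cf, cl, bf, bl, ?a', ?a')))
      in if cf = 0 then rest else cmpK B cl ?a' rest (fin (0, 0, cf, cl, ?a', ?a')))) st (n + 54) Q"
  proof -
    assume hl: "hle (cf, cl, bf, bl, df, dt)"
    have A: "safe (fin (cf, cl, bf, bl, ?a', ?a')) (st\<lparr>vfd := ?f1\<rparr>) (n + 46) Q"
      if "?C = [] \<or> bkey (last ?C) < key r'" "?D = [] \<or> \<not> key (hd (last ?D)) < key r'"
    proof (rule fin[OF u1])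
      have "attG ?C ?B ?D r' = (?C, ?B, [[r']])" using that by (auto simp: attG_def)
      then show "repG ?f1 (cf, cl, bf, bl, ?a', ?a') (attG ?C ?B ?D r')"
        using rg'[OF u1] by (simp add: repG_def del: fun_upd_apply) simp
    qed (use hl aL in simp)
    have A': "safe (setF ?a' 4 dt (fin (cf, cl, bf, bl, df, ?a'))) (st\<lparr>vfd := ?f1\<rparr>) (n + 47) Q"
      if "?C = [] \<or> bkey (last ?C) < key r'" "?D \<noteq> []" "key (hd (last ?D)) < key r'"
    proof -
      let ?f2 = "?f1(?a' := (?f1 ?a')(4 := dt))"
      have u2: "upd {?a'} ?fd ?f2" by (auto simp: upd_def)
      have att: "attG ?C ?B ?D r' = (?C, ?B, [r'] # ?D)" using that by (auto simp: attG_def)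
      have gen: "repG f2 (cf, cl, bf, bl, df, ?a') (attG ?C ?B ?D r')"
        if "upd {?a'} ?fd f2" "f2 ?a' 3 = ?a'" "f2 ?a' 4 = dt" for f2
        unfolding att using rg'[OF that(1)] that(2,3) \<open>?D \<noteq> []\<close> by (simp add: repG_def)
      have "repG ?f2 (cf, cl, bf, bl, df, ?a') (attG ?C ?B ?D r')" by (rule gen[OF u2]) simp_all
      from fin[OF u2 _ this] have "safe (fin (cf, cl, bf, bl, df, ?a')) (st\<lparr>vfd := ?f2\<rparr>) (n + 46) Q"
        using hl aL by simp
      then show ?thesis using aL hl by (intro safe_setF) (auto simp del: fun_upd_apply simp: add.commute)
    qed
    have A'': "safe (fin (0, 0, cf, cl, ?a', ?a')) (st\<lparr>vfd := ?f1\<rparr>) (n + 46) Q"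
      if "?C \<noteq> []" "\<not> bkey (last ?C) < key r'"
    proof (rule fin[OF u1])
      have "attG ?C ?B ?D r' = ([], ?C, [[r']])" using that by (auto simp: attG_def)
      then show "repG ?f1 (0, 0, cf, cl, ?a', ?a') (attG ?C ?B ?D r')"
        using rg'[OF u1] by (simp add: repG_def lends_def del: fun_upd_apply) simp
    qed (use hl aL in simp)
    let ?rest = "if df = 0 then fin (cf, cl, bf, bl, ?a', ?a')
      else cmpK B df ?a' (setF ?a' 4 dt (fin (cf, cl, bf, bl, df, ?a'))) (fin (cf, cl, bf, bl, ?a', ?a'))"
    have rest: "safe ?rest (st\<lparr>vfd := ?f1\<rparr>) (n + 50) Q" if c: "?C = [] \<or> bkey (last ?C) < key r'"
    proof (cases "?D = []")
      case True
      then have "safe ?rest (st\<lparr>vfd := ?f1\<rparr>) (n + 46) Q" using A[OF c] d0 by simp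
      then show ?thesis by (rule safe_mono) simp
    next
      case False
      have "safe (cmpK B df ?a' (setF ?a' 4 dt (fin (cf, cl, bf, bl, df, ?a'))) (fin (cf, cl, bf, bl, ?a', ?a')))
        (st\<lparr>vfd := ?f1\<rparr>) (n + 50) Q"
      proof (rule safe_cmpK)
        show "safe (setF ?a' 4 dt (fin (cf, cl, bf, bl, df, ?a'))) (st\<lparr>vfd := ?f1\<rparr>) (n + 50 - 2) Q"
          if "hd (vel (st\<lparr>vfd := ?f1\<rparr>) df) < hd (vel (st\<lparr>vfd := ?f1\<rparr>) ?a')"
          by (rule safe_mono[OF A'[OF c False]]) (use that d0(2)[OF False] vela in auto)
        show "safe (fin (cf, cl, bf, bl, ?a', ?a')) (st\<lparr>vfd := ?f1\<rparr>) (n + 50 - 2) Q"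
          if "\<not> hd (vel (st\<lparr>vfd := ?f1\<rparr>) df) < hd (vel (st\<lparr>vfd := ?f1\<rparr>) ?a')"
          by (rule safe_mono[OF A[OF c]]) (use that d0(2)[OF False] vela in auto)
      qed (use d0(2)[OF False] aL in auto)
      then show ?thesis using False d0(1) by simp
    qed
    have "safe (if cf = 0 then ?rest else cmpK B cl ?a' ?rest (fin (0, 0, cf, cl, ?a', ?a'))) (st\<lparr>vfd := ?f1\<rparr>) (n + 53) Q"
    proof (cases "?C = []")
      case True
      then show ?thesis using safe_mono[OF rest[OF disjI1[OF True]]] c0(1) by simp
    next
      case False
      have "safe (cmpK B cl ?a' ?rest (fin (0, 0, cf, cl, ?a', ?a'))) (st\<lparr>vfd := ?f1\<rparr>) (n + 53) Q"
      proof (rule safe_cmpK)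
        show "safe ?rest (st\<lparr>vfd := ?f1\<rparr>) (n + 53 - 2) Q"
          if "hd (vel (st\<lparr>vfd := ?f1\<rparr>) cl) < hd (vel (st\<lparr>vfd := ?f1\<rparr>) ?a')"
          by (rule safe_mono[OF rest]) (use that c0(2)[OF False] vela in auto)
        show "safe (fin (0, 0, cf, cl, ?a', ?a')) (st\<lparr>vfd := ?f1\<rparr>) (n + 53 - 2) Q"
          if "\<not> hd (vel (st\<lparr>vfd := ?f1\<rparr>) cl) < hd (vel (st\<lparr>vfd := ?f1\<rparr>) ?a')"
          by (rule safe_mono[OF A''[OF False]]) (use that c0(2)[OF False] vela in auto)
      qed (use c0(2)[OF False] aL in auto)
      then show ?thesis using False c0(1) by simp
    qed
    then show ?thesis unfolding Let_def using aL by (intro safe_setF) (auto simp: add.commute)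
  qed
  show ?thesis unfolding linkP_def
    by (rule safe_readH) (use aL hle0 in \<open>auto simp: h Let_def fin_def add.commute simp del: biasP.simps\<close>)
qed

text \<open>In the second case \<open>okr_le\<close> shows that all of the first tree is at least
  \<open>key r'\<close>, so dropping it preserves the suffix minima.\<close>

lemma safe_catP:
  assumes t: "tree st r" "tree st r'" and dj: "fst ` set (prs r) \<inter> fst ` set (prs r') = {}"
    and K: "\<And>fd' r''. tree (st\<lparr>vfd := fd'\<rparr>) r'' \<Longrightarrow> red (prs r @ prs r') (prs r'') \<Longrightarrow>
        (\<forall>x. x \<notin> fst ` set (prs r @ prs r') \<longrightarrow> fd' x = vfd st x) \<Longrightarrow> safe (k (ad r'')) (st\<lparr>vfd := fd'\<rparr>) n Q"
  shows "safe (catP B (ad r) (ad r') k) st (n + 62) Q"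
proof -
  have hr: "(ad r, els r) \<in> set (prs r)" "(ad r', els r') \<in> set (prs r')" by (simp_all add: prs_eq[of r] prs_eq[of r'])
  have v: "ad r \<in> vL st" "ad r' \<in> vL st" "vel st (ad r) = els r" "vel st (ad r') = els r'"
    using t hr by (force simp: tree_def good_def)+
  show ?thesis unfolding catP_def
  proof (rule safe_cmpK)
    assume "hd (vel st (ad r)) < hd (vel st (ad r'))"
    then have lt: "key r < key r'" using v by simp
    have "safe (linkP B (ad r) (ad r') (k (ad r))) st (n + 60) Q"
      by (rule safe_linkP[OF t dj lt]) (metis K)
    then show "safe (linkP B (ad r) (ad r') (k (ad r))) st (n + 62 - 2) Q" by (rule safe_mono) simp
  next
    assume "\<not> hd (vel st (ad r)) < hd (vel st (ad r'))"
    then have le: "key r' \<le> key r" using v by simp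
    have ok: "okr r" "okr r'" using t by (auto simp: tree_def)
    have "red ([] @ prs r @ prs r') ([] @ prs r')"
    proof (rule red_drop)
      show "key r' \<in> set (flt (prs r'))"
        using key_in_flt[OF _ hr(2)] okr_iff[THEN iffD1, OF ok(2)] by simp
      show "key r' \<le> y" if "y \<in> set (flt (prs r))" for y using okr_le[OF ok(1) that] le by simp
    qed
    then have "safe (k (ad r')) (st\<lparr>vfd := vfd st\<rparr>) n Q" using K[of "vfd st" r'] t(2) by simp
    then show "safe (k (ad r')) st (n + 62 - 2) Q" by (auto intro: safe_mono)
  qed (use v in auto)
qed

text \<open>Only the root is freed. The first clean record becomes the new root and takes over the
  header, which it can do because clean records have nothing below them.\<close>

lemma safe_popP:
  assumes t: "tree st r"
    and K0: "tl (prs r) = [] \<Longrightarrow> safe (k 0) (st\<lparr>vL := vL st - {ad r}\<rparr>) n Q"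
    and K: "\<And>fd' r''. tree (st\<lparr>vL := vL st - {ad r}, vfd := fd'\<rparr>) r'' \<Longrightarrow> red (tl (prs r)) (prs r'') \<Longrightarrow>
        (\<forall>x. x \<notin> fst ` set (prs r) \<longrightarrow> fd' x = vfd st x) \<Longrightarrow>
        safe (k (ad r'')) (st\<lparr>vL := vL st - {ad r}, vfd := fd'\<rparr>) n Q"
  shows "safe (popP B (ad r) k) st (n + 40) Q"
proof -
  let ?a = "ad r" and ?fd = "vfd st"
  let ?C = "kC r" and ?B = "kB r" and ?D = "kD r"
  let ?st = "st\<lparr>vL := vL st - {?a}\<rparr>"
  have t1: "okr r" "rep ?fd r" "good st (prs r)" using t by (auto simp: tree_def)
  have P: "prs r = (?a, els r) # ?C @ ?B @ prsD ?D" by (rule prs_eq)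
  have aL: "?a \<in> vL st" using t1(3) by (simp add: good_def P)
  have good: "good ?st (?C @ ?B @ prsD ?D)" using t1(3) unfolding P good_Cons by (intro good_free) auto
  obtain cf cl bf bl df dt where h: "hdr_of (?fd ?a) = (cf, cl, bf, bl, df, dt)" by (metis prod_cases6)
  define fin where "fin = (\<lambda>h. biasP B h (\<lambda>h. writeH cf h (k cf)))"
  let ?p = "if cf = 0 then k 0 else if cf = cl then fin (0, 0, bf, bl, df, dt) else getF cf 1 (\<lambda>n. fin (n, cl, bf, bl, df, dt))"
  have ok: "kids_ok ?C ?B ?D" "cost ?D \<le> length ?C" using okr_iff[THEN iffD1, OF t1(1)] by blast+
  have rg: "repA ?fd (cf, cl, bf, bl, df, dt) (map fst ?C) (map fst ?B) (map (map ad) ?D)"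
    and rk: "\<forall>r'\<in>set (concat ?D). rep ?fd r'"
    using rep_eq[THEN iffD1, OF t1(2)] h by (auto simp: repG_def)
  have "safe ?p ?st (n + 30) Q" if hl: "hle (cf, cl, bf, bl, df, dt)"
  proof (cases ?C)
    case Nil
    \<comment> \<open>Here the balance pays off: without a clean record the root was the whole
      tree.\<close>
    then have e: "?B = []" "?D = []" using kids_ok_empty[OF ok] by auto
    have "cf = 0" using rg Nil by (simp add: lends_def)
    then show ?thesis using K0 e Nil P by (auto intro: safe_mono)
  next
    case (Cons c C)
    have c: "fst c \<in> vL ?st" "0 < fst c" "vel ?st (fst c) = snd c" using good Cons by (auto simp: good_def)
    have cf: "cf = fst c" "cl = last (map fst ?C)" using rg Cons by (auto simp: lends_def)
    have dist: "distinct (map fst (?C @ ?B @ prsD ?D))" using good by (simp add: good_def)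
    have okC: "kids_ok C ?B ?D" using ok(1) Cons by (auto simp: kids_ok_def ok0_def)
    have goodC: "good ?st (C @ ?B @ prsD ?D)" using good Cons by (auto simp: good_def)
    have cl: "cf = cl \<longleftrightarrow> C = []"
    proof
      assume "cf = cl"
      then show "C = []" using cf Cons dist last_in_set[of "map fst C"] by (cases "C = []") auto
    qed (use cf Cons in auto)
    have sl: "slist ?fd (fst c # map fst C)" using rg Cons by simp
    then have slC: "slist ?fd (map fst C)" "C \<noteq> [] \<Longrightarrow> ?fd cf 1 = hd (map fst C)"
      using slist_append[of ?fd "[fst c]" "map fst C"] cf by auto
    have lt: "bkey c < x" if "x \<in> set (flt (C @ ?B @ prsD ?D))" for x
    proof -
      have okk: "ok0 (c # C) ?B ?D" using ok(1) Cons by (simp add: kids_ok_def)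
      from that have "x \<in> set (flt (C @ ?B)) \<or> x \<in> set (flt (prsD ?D))" by auto
      then show ?thesis
      proof
        assume x: "x \<in> set (flt (C @ ?B))"
        from flt_bok[OF this] okk obtain d where "d \<in> set (C @ ?B)" "bkey d \<le> x" by (auto simp: ok0_def)
        moreover from this have "bkey c < bkey d" using okk by (auto simp: ok0_def)
        ultimately show ?thesis by simp
      next
        assume x: "x \<in> set (flt (prsD ?D))"
        from flt_prsD_le[OF this] ok(1) obtain d where d: "d \<in> set (concat ?D)" "key d \<le> x" by (auto simp: kids_ok_def)
        moreover from this have "bkey c < key d" using ok0_CD[OF okk _ d(1)] by simp
        ultimately show ?thesis by simp
      qed
    qed
    have fin: "safe (fin h') ?st (n + 26) Q"
      if h': "hle h'" and r': "repG ?fd h' (C, ?B, ?D)" for h'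
    proof -
      have l1: "lev ?st h' C ?B ?D" using okC h' r' rk goodC by (simp add: lev_def)
      \<comment> \<open>Promoting the first clean record to the root leaves a deficit of at most 1,
        hence a single step.\<close>
      have c1: "cost ?D \<le> length C + 1" using ok(2) Cons by simp
      have "safe (biasP B h' (\<lambda>h. writeH cf h (k cf))) ?st (n + 6 + 20) Q"
      proof (rule safe_biasP[OF l1 c1])
        fix fd2 h2 C2 B2 D2
        assume 2: "\<forall>x. x \<notin> fst ` set (C @ ?B @ prsD ?D) \<longrightarrow> fd2 x = vfd ?st x"
          "lev (?st\<lparr>vfd := fd2\<rparr>) h2 C2 B2 D2"
          "red (C @ ?B @ prsD ?D) (C2 @ B2 @ prsD D2)" "cost D2 \<le> length C2 + (1 - 1)"
        have c2: "cost D2 \<le> length C2" using 2(4) by simp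
        let ?r = "Rc (fst c) (snd c) C2 B2 D2"
        have rd: "red (tl (prs r)) (prs ?r)"
          using red_context[OF 2(3), of "[c]"] by (simp add: P prs_eq[of ?r] Cons)
        show "safe (writeH cf h2 (k cf)) (?st\<lparr>vfd := fd2\<rparr>) (n + 6) Q"
        proof (rule safe_writeH)
          fix fd4 assume 4: "hdr_of (fd4 cf) = h2" "\<forall>x. x \<noteq> cf \<longrightarrow> fd4 x = vfd (?st\<lparr>vfd := fd2\<rparr>) x"
          have "tree (?st\<lparr>vfd := fd2, vfd := fd4\<rparr>) ?r"
          proof (rule lev_tree[OF 2(2) c2])
            show "bok (fst c, snd c)" using ok(1) Cons by (simp add: kids_ok_def ok0_def)
            have "good ?st (prs ?r)" using good_red[OF _ rd] good by (simp add: P)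
            then show "good (?st\<lparr>vfd := fd2\<rparr>) ((fst c, snd c) # C2 @ B2 @ prsD D2)" by (simp add: prs_eq[of ?r])
            show "\<forall>x\<in>set (flt (C2 @ B2 @ prsD D2)). bkey c < x"
              using lt red_flt[OF 2(3)] by blast
          qed (use 4 cf in auto)
          then have tr: "tree (?st\<lparr>vfd := fd4\<rparr>) ?r" by simp
          have fr: "\<forall>x. x \<notin> fst ` set (prs r) \<longrightarrow> fd4 x = ?fd x"
          proof (intro allI impI)
            fix x assume x: "x \<notin> fst ` set (prs r)"
            have "set (C @ ?B @ prsD ?D) \<subseteq> set (prs r)" "c \<in> set (prs r)" by (auto simp: P Cons)
            then have "x \<notin> fst ` set (C @ ?B @ prsD ?D)" "x \<noteq> cf" using x cf by blast+
            then show "fd4 x = ?fd x" using 4(2) 2(1) by simp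
          qed
          have "safe (k cf) (?st\<lparr>vfd := fd4\<rparr>) n Q" using K[OF tr rd fr] cf by simp
          then show "safe (k cf) (?st\<lparr>vfd := fd2, vfd := fd4\<rparr>) (n + 6 - 6) Q" by simp
        qed (use c cf 2(2) in \<open>auto simp: lev_def\<close>)
      qed
      then show ?thesis by (simp add: fin_def add.commute)
    qed
    show ?thesis
    proof (cases "C = []")
      case True
      have "safe (fin (0, 0, bf, bl, df, dt)) ?st (n + 26) Q"
        by (rule fin) (use hl rg True in \<open>auto simp: repG_def lends_def\<close>)
      then show ?thesis using True cl cf c by (auto intro: safe_mono)
    next
      case False
      let ?n = "hd (map fst C)"
      have "?n \<le> W" using goodC False by (cases C) (auto simp: good_def)
      then have "safe (fin (?n, cl, bf, bl, df, dt)) ?st (n + 26) Q"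
        by (intro fin) (use hl rg False Cons cf slC in \<open>auto simp: repG_def lends_def\<close>)
      then have 1: "safe (fin (?n, cl, bf, bl, df, dt)) ?st (n + 30 - 1) Q" by (rule safe_mono) simp
      have "safe (getF cf 1 (\<lambda>n. fin (n, cl, bf, bl, df, dt))) ?st (n + 30) Q"
      proof (rule safe_getF)
        show "safe (fin (vfd ?st cf 1, cl, bf, bl, df, dt)) ?st (n + 30 - 1) Q"
          using 1 slC(2)[OF False] by simp
      qed (use c cf in auto)
      then show ?thesis using False cl cf c by simp
    qed
  qed
  then have "safe (freeBlocks ?a 15 ?p) st (n + 30) Q" if "hle (cf, cl, bf, bl, df, dt)"
    using that by (intro safe_free) simp
  then have 1: "safe (freeBlocks ?a 15 ?p) st (n + 40 - 6) Q" if "hle (cf, cl, bf, bl, df, dt)"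
    by (rule safe_mono[OF _]) (use that in simp_all)
  show ?thesis unfolding popP_def
    by (rule safe_readH) (use aL 1 in \<open>auto simp: h fin_def Let_def add.commute simp del: biasP.simps\<close>)
qed

section \<open>Families of address-disjoint trees\<close>

definition world :: "'a vst \<Rightarrow> (nat \<Rightarrow> 'a rc option) \<Rightarrow> bool" where
  "world st tr \<longleftrightarrow> (\<forall>i r. tr i = Some r \<longrightarrow> tree st r) \<and>
     (\<forall>i j r r'. tr i = Some r \<longrightarrow> tr j = Some r' \<longrightarrow> i \<noteq> j \<longrightarrow> fst ` set (prs r) \<inter> fst ` set (prs r') = {})"

end

definition root_addr :: "(nat \<Rightarrow> 'a rc option) \<Rightarrow> nat \<Rightarrow> nat" where
  "root_addr tr i = (case tr i of None \<Rightarrow> 0 | Some r \<Rightarrow> ad r)"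

definition fl :: "(nat \<Rightarrow> 'a rc option) \<Rightarrow> nat \<Rightarrow> 'a list" where
  "fl tr i = (case tr i of None \<Rightarrow> [] | Some r \<Rightarrow> flt (prs r))"

lemma fl_eq_other: "tr' i = tr j \<Longrightarrow> fl tr' i = fl tr j" "tr' i = tr j \<Longrightarrow> root_addr tr' i = root_addr tr j"
  by (simp_all add: fl_def root_addr_def)

context mach
begin

lemma world_cong: "vL st' = vL st \<Longrightarrow> vel st' = vel st \<Longrightarrow> vfd st' = vfd st \<Longrightarrow> world st' tr = world st tr"
  by (simp add: world_def tree_def good_def)

lemma world_vm [simp]: "world (st\<lparr>vm := m\<rparr>) tr = world st tr"
  "world (st\<lparr>vres := x\<rparr>) tr = world st tr"
  by (rule world_cong; simp)+

lemma world_root: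
  assumes "world st tr" "tr i = Some r"
  shows "root_addr tr i = ad r" "ad r \<in> vL st" "0 < ad r" "ad r \<le> W" "vel st (ad r) = els r" "els r \<noteq> []"
    "fl tr i = els r @ flt (tl (prs r))" "\<forall>x\<in>set (flt (tl (prs r))). key r < x" "\<forall>x\<in>set (fl tr i). key r \<le> x"
proof -
  have t: "okr r" "good st (prs r)" using assms by (auto simp: world_def tree_def)
  show "root_addr tr i = ad r" using assms(2) by (simp add: root_addr_def)
  have P: "prs r = (ad r, els r) # kC r @ kB r @ prsD (kD r)" by (rule prs_eq)
  show "ad r \<in> vL st" "0 < ad r" "ad r \<le> W" "vel st (ad r) = els r" using t(2) by (auto simp: P good_def)
  show "els r \<noteq> []" using okr_iff[THEN iffD1, OF t(1)] by (simp add: bok_def)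
  show "fl tr i = els r @ flt (tl (prs r))" using assms(2) by (simp add: fl_def P)
  show "\<forall>x\<in>set (flt (tl (prs r))). key r < x" using okr_less[OF t(1)] unfolding P list.sel by blast
  show "\<forall>x\<in>set (fl tr i). key r \<le> x" using okr_le[OF t(1)] assms(2) by (simp add: fl_def)
qed

lemma root_eq_0: "world st tr \<Longrightarrow> root_addr tr i = 0 \<longleftrightarrow> tr i = None"
  using world_root(3)[of st tr i] by (cases "tr i") (auto simp: root_addr_def)

lemma root_le: "world st tr \<Longrightarrow> root_addr tr i \<le> W"
  using world_root(4)[of st tr i] by (cases "tr i") (auto simp: root_addr_def)

lemma fl_eq_Nil: "world st tr \<Longrightarrow> fl tr i = [] \<longleftrightarrow> tr i = None"
  using world_root(6,7)[of st tr i] by (cases "tr i") (auto simp: fl_def)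

text \<open>An operation on tree \<open>i\<close> preserves the family if its writes avoid the
  addresses of the other trees; these may also be emptied, which is how a catenated tree disappears
  from its slot.\<close>

lemma world_upd:
  assumes w: "world st tr" and others: "\<And>m. m \<noteq> i \<Longrightarrow> tr' m = tr m \<or> tr' m = None"
    and t: "\<And>r. tr' i = Some r \<Longrightarrow> tree st' r"
    and dj: "\<And>r m r'. tr' i = Some r \<Longrightarrow> tr' m = Some r' \<Longrightarrow> m \<noteq> i \<Longrightarrow> fst ` set (prs r) \<inter> fst ` set (prs r') = {}"
    and fr: "\<And>m r x. tr' m = Some r \<Longrightarrow> m \<noteq> i \<Longrightarrow> x \<in> fst ` set (prs r) \<Longrightarrow>
        vfd st' x = vfd st x \<and> vel st' x = vel st x \<and> (x \<in> vL st \<longrightarrow> x \<in> vL st')"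
  shows "world st' tr'"
proof -
  have tr: "tr m = Some r" if "tr' m = Some r" "m \<noteq> i" for m r using others[OF that(2)] that(1) by auto
  have tree: "tree st' r" if "tr' m = Some r" for m r
  proof (cases "m = i")
    case True
    then show ?thesis using t that by simp
  next
    case False
    have "tree st r" using w tr[OF that False] by (auto simp: world_def)
    then show ?thesis by (rule tree_frame) (use fr[OF that False] in blast)
  qed
  have "fst ` set (prs r) \<inter> fst ` set (prs r') = {}" if "tr' m = Some r" "tr' m' = Some r'" "m \<noteq> m'" for m m' r r'
  proof -
    consider "m = i" | "m' = i" | "m \<noteq> i" "m' \<noteq> i" by blast
    then show ?thesis
    proof cases
      case 1
      then show ?thesis using dj that by blast
    next
      case 2
      then show ?thesis using dj[of r' m r] that by blast
    next
      case 3
      then show ?thesis using w tr that unfolding world_def by blast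
    qed
  qed
  then show ?thesis using tree unfolding world_def by blast
qed

lemma safe_wcat:
  assumes w: "world st tr" and ij: "i \<noteq> j" and s: "tr i \<noteq> None" "tr j \<noteq> None"
    and K: "\<And>fd' tr'. world (st\<lparr>vfd := fd'\<rparr>) tr' \<Longrightarrow> (\<forall>m. m \<noteq> i \<longrightarrow> m \<noteq> j \<longrightarrow> tr' m = tr m) \<Longrightarrow>
        tr' j = None \<Longrightarrow> tr' i \<noteq> None \<Longrightarrow> sm (fl tr' i) = sm (fl tr i @ fl tr j) \<Longrightarrow>
        set (fl tr' i) \<subseteq> set (fl tr i) \<union> set (fl tr j) \<Longrightarrow> safe (k (root_addr tr' i)) (st\<lparr>vfd := fd'\<rparr>) n Q"
  shows "safe (catP B (root_addr tr i) (root_addr tr j) k) st (n + 62) Q"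
proof -
  obtain r r' where r: "tr i = Some r" "tr j = Some r'" using s by auto
  have t: "tree st r" "tree st r'" "fst ` set (prs r) \<inter> fst ` set (prs r') = {}"
    using w r ij unfolding world_def by blast+
  have "safe (catP B (ad r) (ad r') k) st (n + 62) Q"
  proof (rule safe_catP[OF t])
    fix fd' r''
    assume 1: "tree (st\<lparr>vfd := fd'\<rparr>) r''" "red (prs r @ prs r') (prs r'')"
      "\<forall>x. x \<notin> fst ` set (prs r @ prs r') \<longrightarrow> fd' x = vfd st x"
    let ?tr = "tr(i := Some r'', j := None)"
    have o: "fst ` set (prs r0) \<inter> fst ` set (prs r @ prs r') = {}" if "tr m = Some r0" "m \<noteq> i" "m \<noteq> j" for m r0
      using w r that unfolding world_def set_append image_Un by blast
    have sub: "fst ` set (prs r'') \<subseteq> fst ` set (prs r @ prs r')" using 1(2) unfolding red_def by blast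
    have "world (st\<lparr>vfd := fd'\<rparr>) ?tr"
    proof (rule world_upd[OF w, of i])
      fix r0 m r1 assume "?tr i = Some r0" "?tr m = Some r1" "m \<noteq> i"
      then have "r0 = r''" "tr m = Some r1" "m \<noteq> j" using ij by (auto split: if_splits)
      then show "fst ` set (prs r0) \<inter> fst ` set (prs r1) = {}" using o[of m r1] sub \<open>m \<noteq> i\<close> by blast
    next
      fix m r0 x assume "?tr m = Some r0" "m \<noteq> i" and x: "x \<in> fst ` set (prs r0)"
      then have "tr m = Some r0" "m \<noteq> i" "m \<noteq> j" by (auto split: if_splits)
      from o[OF this] x have "x \<notin> fst ` set (prs r @ prs r')" by blast
      then show "vfd (st\<lparr>vfd := fd'\<rparr>) x = vfd st x \<and> vel (st\<lparr>vfd := fd'\<rparr>) x = vel st x \<and> (x \<in> vL st \<longrightarrow> x \<in> vL (st\<lparr>vfd := fd'\<rparr>))"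
        using 1(3) by simp
    qed (use 1(1) ij in \<open>auto split: if_splits\<close>)
    moreover have "sm (fl ?tr i) = sm (fl tr i @ fl tr j)" using 1(2) r ij by (simp add: fl_def red_def)
    moreover have "set (fl ?tr i) \<subseteq> set (fl tr i) \<union> set (fl tr j)" using red_flt[OF 1(2)] r ij by (simp add: fl_def)
    ultimately have "safe (k (root_addr ?tr i)) (st\<lparr>vfd := fd'\<rparr>) n Q" using ij by (intro K) auto
    then show "safe (k (ad r'')) (st\<lparr>vfd := fd'\<rparr>) n Q" using ij by (simp add: root_addr_def)
  qed
  then show ?thesis using r by (simp add: root_addr_def)
qed

lemma safe_wpop:
  assumes w: "world st tr" and r: "tr i = Some r"
    and K: "\<And>fd' tr'. world (st\<lparr>vL := vL st - {ad r}, vfd := fd'\<rparr>) tr' \<Longrightarrow> (\<forall>m. m \<noteq> i \<longrightarrow> tr' m = tr m) \<Longrightarrow>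
        sm (fl tr' i) = sm (flt (tl (prs r))) \<Longrightarrow> set (fl tr' i) \<subseteq> set (flt (tl (prs r))) \<Longrightarrow>
        safe (k (root_addr tr' i)) (st\<lparr>vL := vL st - {ad r}, vfd := fd'\<rparr>) n Q"
  shows "safe (popP B (root_addr tr i) k) st (n + 40) Q"
proof -
  have t: "tree st r" using w r unfolding world_def by blast
  have ain: "ad r \<in> fst ` set (prs r)" by (simp add: prs_eq[of r])
  have o: "fst ` set (prs r0) \<inter> fst ` set (prs r) = {}" if "tr m = Some r0" "m \<noteq> i" for m r0
    using w r that unfolding world_def by blast
  have "safe (popP B (ad r) k) st (n + 40) Q"
  proof (rule safe_popP[OF t])
    assume e: "tl (prs r) = []"
    let ?tr = "tr(i := None)"
    have "world (st\<lparr>vL := vL st - {ad r}, vfd := vfd st\<rparr>) ?tr"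
    proof (rule world_upd[OF w, of i])
      fix m r0 x assume "?tr m = Some r0" "m \<noteq> i" and x: "x \<in> fst ` set (prs r0)"
      then have "tr m = Some r0" "m \<noteq> i" by (auto split: if_splits)
      from o[OF this] x ain have "x \<noteq> ad r" by blast
      then show "vfd (st\<lparr>vL := vL st - {ad r}, vfd := vfd st\<rparr>) x = vfd st x \<and>
          vel (st\<lparr>vL := vL st - {ad r}, vfd := vfd st\<rparr>) x = vel st x \<and>
          (x \<in> vL st \<longrightarrow> x \<in> vL (st\<lparr>vL := vL st - {ad r}, vfd := vfd st\<rparr>))" by simp
    qed auto
    then have "safe (k (root_addr ?tr i)) (st\<lparr>vL := vL st - {ad r}, vfd := vfd st\<rparr>) n Q"
      by (rule K) (simp_all add: fl_def e)
    then show "safe (k 0) (st\<lparr>vL := vL st - {ad r}\<rparr>) n Q" by (simp add: root_addr_def)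
  next
    fix fd' r''
    let ?st = "st\<lparr>vL := vL st - {ad r}, vfd := fd'\<rparr>"
    assume 1: "tree ?st r''" "red (tl (prs r)) (prs r'')"
      "\<forall>x. x \<notin> fst ` set (prs r) \<longrightarrow> fd' x = vfd st x"
    let ?tr = "tr(i := Some r'')"
    have "set (tl (prs r)) \<subseteq> set (prs r)" by (auto dest: in_set_tlD)
    then have sub: "fst ` set (prs r'') \<subseteq> fst ` set (prs r)" using 1(2) unfolding red_def by blast
    have "world ?st ?tr"
    proof (rule world_upd[OF w, of i])
      fix r0 m r1 assume "?tr i = Some r0" "?tr m = Some r1" "m \<noteq> i"
      then have "r0 = r''" "tr m = Some r1" by (auto split: if_splits)
      then show "fst ` set (prs r0) \<inter> fst ` set (prs r1) = {}" using o[of m r1] sub \<open>m \<noteq> i\<close> by blast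
    next
      fix m r0 x assume "?tr m = Some r0" "m \<noteq> i" and x: "x \<in> fst ` set (prs r0)"
      then have "tr m = Some r0" "m \<noteq> i" by (auto split: if_splits)
      from o[OF this] x have "x \<notin> fst ` set (prs r)" by blast
      moreover from this have "x \<noteq> ad r" using ain by blast
      ultimately show "vfd ?st x = vfd st x \<and> vel ?st x = vel st x \<and> (x \<in> vL st \<longrightarrow> x \<in> vL ?st)"
        using 1(3) by simp
    qed (use 1(1) in \<open>auto split: if_splits\<close>)
    moreover have "sm (fl ?tr i) = sm (flt (tl (prs r)))" using 1(2) by (simp add: fl_def red_def)
    moreover have "set (fl ?tr i) \<subseteq> set (flt (tl (prs r)))" using red_flt[OF 1(2)] by (simp add: fl_def)
    ultimately have "safe (k (root_addr ?tr i)) ?st n Q" by (intro K) auto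
    then show "safe (k (ad r'')) ?st n Q" by (simp add: root_addr_def)
  qed
  then show ?thesis using r by (simp add: root_addr_def)
qed

definition add_rec :: "'a vst \<Rightarrow> nat \<Rightarrow> 'a list \<Rightarrow> 'a vst" where
  "add_rec st a xs = st\<lparr>vL := insert a (vL st), vel := (vel st)(a := xs),
     vfd := (vfd st)(a := (\<lambda>j. if j = 11 then length xs else 0))\<rparr>"

lemma world_new:
  assumes w: "world st tr" and i: "tr i = None" and a: "a \<notin> vL st" "0 < a" "a \<le> W" and xs: "xs \<noteq> []" "\<forall>x\<in>set xs. hd xs \<le> x"
  shows "world (add_rec st a xs) (tr(i := Some (Rc a xs [] [] [])))" (is "world ?st ?tr")
proof (rule world_upd[OF w, of i])
  let ?r = "Rc a xs [] [] []"
  have P: "prs ?r = [(a, xs)]" by (simp add: prs_eq[of ?r])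
  have "okr ?r" using xs by (subst okr_iff) (simp add: bok_def kids_ok_def ok0_def cost_def)
  moreover have "rep (vfd ?st) ?r" by (subst rep_eq) (simp add: repG_def hdr_of_def lends_def add_rec_def)
  moreover have "good ?st (prs ?r)" using a by (simp add: P good_def add_rec_def)
  ultimately show "tree ?st r" if "?tr i = Some r" for r using that by (simp add: tree_def)
  have o: "a \<notin> fst ` set (prs r')" if "tr m = Some r'" for m r'
  proof -
    have "good st (prs r')" using w that unfolding world_def tree_def by blast
    then show ?thesis using a(1) unfolding good_def by blast
  qed
  show "fst ` set (prs r) \<inter> fst ` set (prs r') = {}" if "?tr i = Some r" "?tr m = Some r'" "m \<noteq> i" for r m r'
    using that o[of m r'] P by auto
  show "vfd ?st x = vfd st x \<and> vel ?st x = vel st x \<and> (x \<in> vL st \<longrightarrow> x \<in> vL ?st)"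
    if "?tr m = Some r" "m \<noteq> i" "x \<in> fst ` set (prs r)" for m r x
    using that o[of m r] by (auto simp: add_rec_def)
qed simp

lemma world_move:
  assumes "world st tr" "i \<noteq> j"
  shows "world st (tr(i := tr j, j := None))"
  unfolding world_def
proof (intro conjI allI impI)
  let ?tr = "tr(i := tr j, j := None)"
  show "tree st r" if "?tr m = Some r" for m r
    using assms that unfolding world_def by (auto split: if_splits)
  fix m m' r r' assume a: "?tr m = Some r" "?tr m' = Some r'" "m \<noteq> m'"
  define f where "f = (\<lambda>m. if m = i then j else m)"
  have "tr (f m) = Some r" "tr (f m') = Some r'" "f m \<noteq> f m'" using a by (auto simp: f_def split: if_splits)
  then show "fst ` set (prs r) \<inter> fst ` set (prs r') = {}" using assms(1) unfolding world_def by blast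
qed

end

section \<open>Sequences of operations\<close>

fun op_arg :: "'a cpqa_op \<Rightarrow> 'a option" where
  "op_arg (InsertAndAttrite i e) = Some e"
| "op_arg _ = None"

fun op_prog :: "cpqa_impl \<Rightarrow> 'a cpqa_op \<Rightarrow> prog" where
  "op_prog D (FindMin i) = find_min_prog D i"
| "op_prog D (DeleteMin i) = delete_min_prog D i"
| "op_prog D (CatenateAndAttrite i j) = catenate_prog D i j"
| "op_prog D (InsertAndAttrite i e) = insert_prog D i"

lemma exec_op_eq: "exec_op mc D x s = exec mc (op_arg x) (op_prog D x) s"
  by (cases x) simp_all

text \<open>
  In the invariant \<open>Inv s Q t e \<phi>\<close>, \<open>t\<close> counts the operations performed, \<open>e\<close> bounds the number of
  elements stored, and \<open>\<phi>\<close> is the potential that pays for future I/Os.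
\<close>

lemma run_ops_inv:
  fixes Inv :: "'a::linorder config \<Rightarrow> (nat \<Rightarrow> 'a set) \<Rightarrow> nat \<Rightarrow> nat \<Rightarrow> nat \<Rightarrow> bool"
  assumes step: "\<And>s Q t e \<phi> x. Inv s Q t e \<phi> \<Longrightarrow> cpqa_legal l x Q \<Longrightarrow> t < N \<Longrightarrow>
     \<exists>s' e' \<phi>'. exec mc (op_arg x) (op_prog D x) (s\<lparr>result := None, ios := 0\<rparr>) = Some s' \<and>
       result s' = cpqa_answer x Q \<and> ios s' \<le> \<kappa> \<and> \<beta> * ios s' + \<phi>' \<le> \<phi> + c \<and>
       e' + (if is_delete x then 1 else 0) \<le> e + (if is_catenate_or_insert x then 1 else 0) \<and>
       Inv s' (cpqa_step x Q) (Suc t) e' \<phi>'"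
  shows "Inv s Q t e \<phi> \<Longrightarrow> all_legal l ops Q \<Longrightarrow> t + length ops \<le> N \<Longrightarrow>
     \<exists>s' tr Q' e' \<phi>'. run_ops mc D ops s = Some (s', tr) \<and> map fst tr = all_answers ops Q \<and>
       (\<forall>k\<in>set (map snd tr). k \<le> \<kappa>) \<and> \<beta> * sum_list (map snd tr) + \<phi>' \<le> \<phi> + c * length ops \<and>
       e' + length (filter is_delete ops) \<le> e + length (filter is_catenate_or_insert ops) \<and>
       Inv s' Q' (t + length ops) e' \<phi>'"
proof (induction ops arbitrary: s Q t e \<phi>)
  case Nil
  then show ?case by auto
next
  case (Cons x ops)
  from Cons.prems obtain s1 e1 \<phi>1 where 1: "exec mc (op_arg x) (op_prog D x) (s\<lparr>result := None, ios := 0\<rparr>) = Some s1"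
      "result s1 = cpqa_answer x Q" "ios s1 \<le> \<kappa>" "\<beta> * ios s1 + \<phi>1 \<le> \<phi> + c"
      "e1 + (if is_delete x then 1 else 0) \<le> e + (if is_catenate_or_insert x then 1 else 0)"
      "Inv s1 (cpqa_step x Q) (Suc t) e1 \<phi>1"
    using step[of s Q t e \<phi> x] by auto
  from Cons.IH[OF 1(6)] Cons.prems obtain s2 tr Q' e2 \<phi>2 where 2:
      "run_ops mc D ops s1 = Some (s2, tr)" "map fst tr = all_answers ops (cpqa_step x Q)"
      "\<forall>k\<in>set (map snd tr). k \<le> \<kappa>" "\<beta> * sum_list (map snd tr) + \<phi>2 \<le> \<phi>1 + c * length ops"
      "e2 + length (filter is_delete ops) \<le> e1 + length (filter is_catenate_or_insert ops)"
      "Inv s2 Q' (Suc t + length ops) e2 \<phi>2"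
    by auto
  have "run_ops mc D (x # ops) s = Some (s2, (result s1, ios s1) # tr)"
    using 1(1) 2(1) by (simp add: exec_op_eq)
  moreover have "\<beta> * sum_list (map snd ((result s1, ios s1) # tr)) + \<phi>2 \<le> \<phi> + c * length (x # ops)"
    using 1(4) 2(4) by (simp add: algebra_simps)
  moreover have "e2 + length (filter is_delete (x # ops)) \<le> e + length (filter is_catenate_or_insert (x # ops))"
    using 1(5) 2(5) by (auto split: if_splits)
  ultimately show ?case using 1(2,3) 2(2,3,6) by (intro exI[of _ s2] exI[of _ "(result s1, ios s1) # tr"] exI) auto
qed


section \<open>Small blocks\<close>

text \<open>
  If \<open>b\<close> is bounded, every operation may perform a constant number of I/Os, and a queue is a tree of
  one-element records. Between two operations cell \<open>i\<close> holds the address of the root of queue \<open>i\<close>,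
  paired with the number of records allocated so far; during an operation the control state keeps
  these numbers, because the memory may have no cells to spare.
\<close>

primrec readNums :: "nat \<Rightarrow> ((nat \<Rightarrow> nat) \<Rightarrow> prog) \<Rightarrow> prog" where
  "readNums 0 k = k (\<lambda>_. 0)"
| "readNums (Suc n) k = CaseNum n (\<lambda>v. readNums n (\<lambda>f. k (f(n := v))))"

primrec writeNums :: "nat \<Rightarrow> (nat \<Rightarrow> nat) \<Rightarrow> prog" where
  "writeNums 0 f = Halt"
| "writeNums (Suc n) f = SetNum n (f n) (writeNums n f)"

definition finS :: "nat \<Rightarrow> (nat \<Rightarrow> nat) \<Rightarrow> nat \<Rightarrow> prog" where
  "finS l g c = writeNums l (\<lambda>i. prod_encode (g i, c))"

definition initS :: "nat \<Rightarrow> ((nat \<Rightarrow> nat) \<Rightarrow> nat \<Rightarrow> prog) \<Rightarrow> prog" where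
  "initS l k = readNums l (\<lambda>f. k (\<lambda>i. fst (prod_decode (f i))) (snd (prod_decode (f 0))))"

definition outP :: "nat \<Rightarrow> prog \<Rightarrow> prog" where
  "outP a p = ReadBlock (16 * a) 0 (Output 0 p)"

definition small_impl :: "nat \<Rightarrow> nat \<Rightarrow> cpqa_impl" where
  "small_impl B l = \<lparr>
     find_min_prog = (\<lambda>i. initS l (\<lambda>g c. outP (g i) (finS l g c))),
     delete_min_prog = (\<lambda>i. initS l (\<lambda>g c. outP (g i) (popP B (g i) (\<lambda>a. finS l (g(i := a)) c)))),
     catenate_prog = (\<lambda>i j. initS l (\<lambda>g c.
       if g j = 0 then finS l g c
       else if g i = 0 then finS l (g(i := g j, j := 0)) c
       else catP B (g i) (g j) (\<lambda>a. finS l (g(i := a, j := 0)) c))),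
     insert_prog = (\<lambda>i. initS l (\<lambda>g c. GetArg 0 (newRec (Suc c) 1
       (if g i = 0 then finS l (g(i := Suc c)) (Suc c)
        else catP B (g i) (Suc c) (\<lambda>a. finS l (g(i := a)) (Suc c))))))\<rparr>"

context mach
begin

lemma exec_readNums:
  assumes "n \<le> M" "\<forall>i<n. mem s i = Num (f i)"
  shows "exec mc arg (readNums n k) s = exec mc arg (k (\<lambda>i. if i < n then f i else 0)) s"
  using assms
proof (induction n arbitrary: k)
  case (Suc n)
  have "(\<lambda>i. if i < n then f i else 0)(n := f n) = (\<lambda>i. if i < Suc n then f i else 0)"
    by (auto simp: fun_eq_iff less_Suc_eq)
  then show ?case using Suc by simp
qed simp

lemma exec_writeNums:
  assumes "n \<le> M" "\<forall>i<n. f i \<le> W"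
  shows "exec mc arg (writeNums n f) s = Some (s\<lparr>mem := (\<lambda>i. if i < n then Num (f i) else mem s i)\<rparr>)"
  using assms
proof (induction n arbitrary: s)
  case (Suc n)
  have "(\<lambda>i. if i < n then Num (f i) else ((mem s)(n := Num (f n))) i) = (\<lambda>i. if i < Suc n then Num (f i) else mem s i)"
    by (auto simp: fun_eq_iff less_Suc_eq)
  then show ?case using Suc by (simp cong: if_cong)
qed simp

lemma safe_outP:
  assumes "a \<in> vL st" "1 \<le> n" "safe p (st\<lparr>vres := Some (hd (vel st a))\<rparr>) (n - 1) Q"
  shows "safe (outP a p) st n Q"
proof (rule safe_step[OF assms(3)])
  fix s assume s: "R s st"
  obtain blk where blk: "disk s (16 * a) = Some blk" "blk ! 0 = Elem (hd (vel st a))" "16 * a \<le> W"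
    using Rec_els[OF R_Rec[OF s assms(1)]] by blast
  let ?s = "s\<lparr>mem := (\<lambda>c. if 0 \<le> c \<and> c < 0 + B then blk ! (c - 0) else mem s c), ios := Suc (ios s), result := Some (hd (vel st a))\<rparr>"
  have "exec mc arg (outP a p) s = exec mc arg p ?s" using blk B1 BM by (simp add: outP_def)
  moreover have "R ?s (st\<lparr>vres := Some (hd (vel st a))\<rparr>)" using s by (simp add: R_def)
  ultimately show "\<exists>s'. exec mc arg (outP a p) s = exec mc arg p s' \<and> R s' (st\<lparr>vres := Some (hd (vel st a))\<rparr>) \<and> ios s' + (n - 1) \<le> ios s + n"
    using assms(2) by (intro exI[of _ ?s]) simp
qed

lemma safe_insert1:
  assumes "arg = Some e" "a \<notin> vL st" "16 * a + 15 \<le> W" "safe p (add_rec st a [e]) n Q"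
  shows "safe (GetArg 0 (newRec a 1 p)) st (n + 12) Q"
proof (rule safe_step[OF assms(4)])
  fix s assume s: "R s st"
  let ?s = "s\<lparr>mem := (mem s)(0 := Elem e)\<rparr>"
  have "R ?s st" using s B1 by (simp add: R_def)
  from exec_newRec[OF this assms(2,3), of "[e]" p] obtain s' where
    "exec mc arg (newRec a 1 p) ?s = exec mc arg p s'" "R s' (add_rec st a [e])" "ios s' = ios ?s + 12"
    using B1 W1 by (auto simp: add_rec_def)
  then show "\<exists>s'. exec mc arg (GetArg 0 (newRec a 1 p)) s = exec mc arg p s' \<and> R s' (add_rec st a [e]) \<and> ios s' + n \<le> ios s + (n + 12)"
    using assms(1) B1 BM by (intro exI[of _ s']) simp
qed

end

locale small = mach +
  fixes l N :: nat
  assumes l: "1 \<le> l" "l \<le> M" and WN: "16 * N + 31 \<le> W"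
    and Wp: "\<And>a c. a \<le> N \<Longrightarrow> c \<le> N \<Longrightarrow> prod_encode (a, c) \<le> W"
begin

text \<open>No address exceeds the counter \<open>c\<close>, so \<open>Suc c\<close> is fresh.
  Addresses are never reused, which keeps allocation trivial and bounds them by the number of
  operations.\<close>

definition invS :: "'a vst \<Rightarrow> (nat \<Rightarrow> 'a rc option) \<Rightarrow> nat \<Rightarrow> (nat \<Rightarrow> 'a set) \<Rightarrow> nat \<Rightarrow> nat \<Rightarrow> bool" where
  "invS st tr c Q t e \<longleftrightarrow> world st tr \<and> (\<forall>i\<ge>l. tr i = None) \<and> (\<forall>i<l. Q i = sm (fl tr i)) \<and>
     (\<forall>a\<in>vL st. a \<le> c \<and> length (vel st a) = 1) \<and> finite (vL st) \<and> c \<le> t \<and> card (vL st) \<le> e"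

definition InvS :: "'a config \<Rightarrow> (nat \<Rightarrow> 'a set) \<Rightarrow> nat \<Rightarrow> nat \<Rightarrow> nat \<Rightarrow> bool" where
  "InvS s Q t e \<phi> \<longleftrightarrow> \<phi> = 0 \<and> (\<exists>st tr c. R s st \<and> invS st tr c Q t e \<and> (\<forall>i<l. mem s i = Num (prod_encode (root_addr tr i, c))))"

lemma root_le_c: "invS st tr c Q t e \<Longrightarrow> root_addr tr i \<le> c"
proof (cases "tr i")
  case (Some r)
  assume i: "invS st tr c Q t e"
  then have "world st tr" by (simp add: invS_def)
  from world_root(1,2)[OF this Some] i show ?thesis by (simp add: invS_def)
qed (simp add: root_addr_def)

lemma safe_finS:
  assumes "invS st tr c Q t e" "t \<le> N" "\<forall>i<l. g i = root_addr tr i" "vres st = r"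
  shows "safe (finS l g c) st n (\<lambda>s'. result s' = r \<and> InvS s' Q t e 0)"
  unfolding safe_def
proof (intro allI impI)
  fix s assume s: "R s st"
  have c: "c \<le> N" using assms(1,2) by (simp add: invS_def)
  have g: "prod_encode (g i, c) \<le> W" if "i < l" for i
    using root_le_c[OF assms(1), of i] c that assms(3) by (intro Wp) auto
  let ?s = "s\<lparr>mem := (\<lambda>i. if i < l then Num (prod_encode (g i, c)) else mem s i)\<rparr>"
  have e: "exec mc arg (finS l g c) s = Some ?s"
    unfolding finS_def using exec_writeNums[of l "\<lambda>i. prod_encode (g i, c)" s] g l by simp
  have "R ?s (st\<lparr>vm := mem ?s\<rparr>)" using s by (simp add: R_def)
  moreover have "invS (st\<lparr>vm := mem ?s\<rparr>) tr c Q t e" using assms(1) by (simp add: invS_def)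
  moreover have "\<forall>i<l. mem ?s i = Num (prod_encode (root_addr tr i, c))" using assms(3) by simp
  ultimately have "InvS ?s Q t e 0" unfolding InvS_def by blast
  moreover have "result ?s = r" using s assms(4) by (simp add: R_def)
  ultimately show "\<exists>s'. exec mc arg (finS l g c) s = Some s' \<and> ios s' \<le> ios s + n \<and> result s' = r \<and> InvS s' Q t e 0"
    unfolding e by simp
qed

text \<open>The cells holding the roots may be scratch cells, about which \<open>R\<close> says
  nothing; hence they are read at the level of \<open>exec\<close> before the abstract reasoning
  starts. The counter is the same in all cells, and \<open>1 \<le> l\<close> makes cell 0 one of
  them.\<close>

lemma exec_initS:
  assumes s: "R s st" and c: "\<forall>i<l. mem s i = Num (prod_encode (root_addr tr i, c))"
    and k: "\<And>g. \<forall>i<l. g i = root_addr tr i \<Longrightarrow> safe (k g c) (st\<lparr>vres := None\<rparr>) n Q"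
  shows "\<exists>s'. exec mc arg (initS l k) (s\<lparr>result := None, ios := 0\<rparr>) = Some s' \<and> ios s' \<le> n \<and> Q s'"
proof -
  let ?s = "s\<lparr>result := None, ios := 0\<rparr>"
  let ?f = "\<lambda>i. if i < l then prod_encode (root_addr tr i, c) else 0"
  let ?g = "\<lambda>i. fst (prod_decode (?f i))"
  have e: "exec mc arg (initS l k) ?s = exec mc arg (k ?g (snd (prod_decode (?f 0)))) ?s"
    unfolding initS_def using exec_readNums[of l ?s "\<lambda>i. prod_encode (root_addr tr i, c)"] c l by simp
  have "snd (prod_decode (?f 0)) = c" using l by simp
  moreover have "safe (k ?g c) (st\<lparr>vres := None\<rparr>) n Q" by (rule k) simp
  moreover have "R ?s (st\<lparr>vres := None\<rparr>)" using s by (simp add: R_def)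
  ultimately show ?thesis unfolding e safe_def by fastforce
qed

lemma InvS_find:
  assumes "InvS s Q t e \<phi>" "cpqa_legal l (FindMin i) Q" "t < N"
  shows "\<exists>s'. exec mc arg (find_min_prog (small_impl B l) i) (s\<lparr>result := None, ios := 0\<rparr>) = Some s' \<and> ios s' \<le> 80 \<and>
    result s' = Some (Min (Q i)) \<and> InvS s' Q (Suc t) e 0"
proof -
  from assms(1) obtain st tr c where 1: "R s st" "invS st tr c Q t e" "\<forall>i<l. mem s i = Num (prod_encode (root_addr tr i, c))"
    by (auto simp: InvS_def)
  have i: "i < l" "Q i \<noteq> {}" using assms(2) by auto
  have w: "world st tr" using 1(2) by (simp add: invS_def)
  have Q: "Q i = sm (fl tr i)" using 1(2) i by (simp add: invS_def)
  then obtain r where r: "tr i = Some r" using i fl_eq_Nil[OF w] by auto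
  note wr = world_root[OF w r]
  have "length (els r) = 1" using 1(2) wr(2,5) by (auto simp: invS_def)
  then have els: "els r = [key r]" by (cases "els r") auto
  have m: "Min (Q i) = key r" unfolding Q wr(7) by (subst els) (use Min_sm_Cons[OF wr(8)] in simp)
  show ?thesis unfolding small_impl_def cpqa_impl.simps
  proof (rule exec_initS[OF 1(1,3)])
    fix g assume g: "\<forall>i<l. g i = root_addr tr i"
    have "invS (st\<lparr>vres := None, vres := Some (key r)\<rparr>) tr c Q (Suc t) e" using 1(2) by (simp add: invS_def)
    from safe_finS[OF this _ g] have "safe (finS l g c) (st\<lparr>vres := None, vres := Some (key r)\<rparr>) 79
       (\<lambda>s'. result s' = Some (Min (Q i)) \<and> InvS s' Q (Suc t) e 0)" using assms(3) m by simp
    then show "safe (outP (g i) (finS l g c)) (st\<lparr>vres := None\<rparr>) 80 (\<lambda>s'. result s' = Some (Min (Q i)) \<and> InvS s' Q (Suc t) e 0)"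
      using wr g i by (intro safe_outP) auto
  qed
qed

lemma InvS_delete:
  assumes "InvS s Q t e \<phi>" "cpqa_legal l (DeleteMin i) Q" "t < N"
  shows "\<exists>s'. exec mc arg (delete_min_prog (small_impl B l) i) (s\<lparr>result := None, ios := 0\<rparr>) = Some s' \<and> ios s' \<le> 80 \<and>
    result s' = Some (Min (Q i)) \<and> InvS s' (cpqa_step (DeleteMin i) Q) (Suc t) (e - 1) 0 \<and> 1 \<le> e"
proof -
  from assms(1) obtain st tr c where 1: "R s st" "invS st tr c Q t e" "\<forall>i<l. mem s i = Num (prod_encode (root_addr tr i, c))"
    by (auto simp: InvS_def)
  have i: "i < l" "Q i \<noteq> {}" using assms(2) by auto
  have w: "world st tr" using 1(2) by (simp add: invS_def)
  have Q: "Q i = sm (fl tr i)" using 1(2) i by (simp add: invS_def)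
  then obtain r where r: "tr i = Some r" using i fl_eq_Nil[OF w] by auto
  note wr = world_root[OF w r]
  have "length (els r) = 1" using 1(2) wr(2,5) by (auto simp: invS_def)
  then have els: "els r = [key r]" by (cases "els r") auto
  have m: "Min (Q i) = key r" unfolding Q wr(7) by (subst els) (use Min_sm_Cons[OF wr(8)] in simp)
  have m2: "Q i - {Min (Q i)} = sm (flt (tl (prs r)))"
    unfolding Q wr(7) by (subst els, subst els) (use sm_Cons_minus_Min[OF wr(8)] in simp)
  let ?st = "st\<lparr>vres := None, vres := Some (key r)\<rparr>"
  have e1: "1 \<le> e"
  proof -
    have "finite (vL st)" "card (vL st) \<le> e" using 1(2) by (auto simp: invS_def)
    then show ?thesis using wr(2) card_gt_0_iff[of "vL st"] by fastforce
  qed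
  let ?Q = "cpqa_step (DeleteMin i) Q"
  let ?post = "\<lambda>s'. result s' = Some (Min (Q i)) \<and> InvS s' ?Q (Suc t) (e - 1) 0"
  have "\<exists>s'. exec mc arg (delete_min_prog (small_impl B l) i) (s\<lparr>result := None, ios := 0\<rparr>) = Some s' \<and> ios s' \<le> 80 \<and> ?post s'"
    unfolding small_impl_def cpqa_impl.simps
  proof (rule exec_initS[OF 1(1,3)])
    fix g assume g: "\<forall>i<l. g i = root_addr tr i"
    have w': "world ?st tr" using w by simp
    have "safe (popP B (root_addr tr i) (\<lambda>a. finS l (g(i := a)) c)) ?st (39 + 40) ?post"
    proof (rule safe_wpop[OF w' r])
      fix fd' tr' assume 2: "world (?st\<lparr>vL := vL ?st - {ad r}, vfd := fd'\<rparr>) tr'" "\<forall>m. m \<noteq> i \<longrightarrow> tr' m = tr m"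
        "sm (fl tr' i) = sm (flt (tl (prs r)))"
      have "sm (fl tr' k) = ?Q k" if "k < l" for k
        using 2(2,3) m2 1(2) that fl_eq_other(1)[of tr' k tr k] by (cases "k = i") (auto simp: invS_def)
      moreover have "card (vL st - {ad r}) \<le> e - 1"
        using 1(2) wr(2) by (auto simp: invS_def)
      ultimately have inv: "invS (?st\<lparr>vL := vL ?st - {ad r}, vfd := fd'\<rparr>) tr' c ?Q (Suc t) (e - 1)"
        using 2 1(2) i by (auto simp: invS_def)
      show "safe (finS l (g(i := root_addr tr' i)) c) (?st\<lparr>vL := vL ?st - {ad r}, vfd := fd'\<rparr>) 39 ?post"
      proof (rule safe_finS[OF inv])
        show "\<forall>k<l. (g(i := root_addr tr' i)) k = root_addr tr' k" using g 2(2) fl_eq_other(2)[of tr' _ tr] by auto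
      qed (use assms(3) m in auto)
    qed
    then show "safe (outP (g i) (popP B (g i) (\<lambda>a. finS l (g(i := a)) c))) (st\<lparr>vres := None\<rparr>) 80 ?post"
      using wr g i by (intro safe_outP) auto
  qed
  then show ?thesis using e1 by blast
qed

lemma InvS_cat:
  assumes "InvS s Q t e \<phi>" "cpqa_legal l (CatenateAndAttrite i j) Q" "t < N"
  shows "\<exists>s'. exec mc arg (catenate_prog (small_impl B l) i j) (s\<lparr>result := None, ios := 0\<rparr>) = Some s' \<and> ios s' \<le> 80 \<and>
    result s' = None \<and> InvS s' (cpqa_step (CatenateAndAttrite i j) Q) (Suc t) e 0"
proof -
  from assms(1) obtain st tr c where 1: "R s st" "invS st tr c Q t e" "\<forall>i<l. mem s i = Num (prod_encode (root_addr tr i, c))"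
    by (auto simp: InvS_def)
  have i: "i < l" "j < l" "i \<noteq> j" using assms(2) by auto
  have w: "world st tr" using 1(2) by (simp add: invS_def)
  have Q: "Q k = sm (fl tr k)" if "k < l" for k using 1(2) that by (simp add: invS_def)
  let ?Q = "cpqa_step (CatenateAndAttrite i j) Q"
  let ?post = "\<lambda>s'. result s' = None \<and> InvS s' ?Q (Suc t) e 0"
  let ?st = "st\<lparr>vres := None\<rparr>"
  have Qi: "?Q i = sm (fl tr i @ fl tr j)" using i Q by (simp add: sm_append)
  show ?thesis unfolding small_impl_def cpqa_impl.simps
  proof (rule exec_initS[OF 1(1,3)])
    fix g assume g: "\<forall>i<l. g i = root_addr tr i"
    have *: "safe (finS l g' c) (?st\<lparr>vfd := fd'\<rparr>) 18 ?post"
      if "world (?st\<lparr>vfd := fd'\<rparr>) tr'" "\<forall>m. m \<noteq> i \<longrightarrow> m \<noteq> j \<longrightarrow> tr' m = tr m" "tr' j = None"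
        "sm (fl tr' i) = sm (fl tr i @ fl tr j)" "\<forall>k<l. g' k = root_addr tr' k" for fd' tr' g'
    proof -
      have "sm (fl tr' k) = ?Q k" if "k < l" for k
      proof -
        consider "k = i" | "k = j" | "k \<noteq> i" "k \<noteq> j" by blast
        then show ?thesis
        proof cases
          case 2
          then show ?thesis using \<open>tr' j = None\<close> by (simp add: fl_def)
        next
          case 3
          then have "fl tr' k = fl tr k" using \<open>\<forall>m. m \<noteq> i \<longrightarrow> m \<noteq> j \<longrightarrow> tr' m = tr m\<close> by (intro fl_eq_other) simp
          then show ?thesis using Q that 3 by simp
        qed (use Qi \<open>sm (fl tr' i) = _\<close> in simp)
      qed
      then have inv: "invS (?st\<lparr>vfd := fd'\<rparr>) tr' c ?Q (Suc t) e"
        using that 1(2) i by (auto simp: invS_def)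
      show ?thesis by (rule safe_finS[OF inv]) (use assms(3) that in auto)
    qed
    show "safe (if g j = 0 then finS l g c else if g i = 0 then finS l (g(i := g j, j := 0)) c
       else catP B (g i) (g j) (\<lambda>a. finS l (g(i := a, j := 0)) c)) ?st 80 ?post"
    proof (cases "tr j = None")
      case True
      then have "safe (finS l g c) (?st\<lparr>vfd := vfd ?st\<rparr>) 18 ?post"
        using w g by (intro *[of _ tr]) (auto simp: fl_def)
      moreover have "g j = 0" using True g i by (simp add: root_addr_def)
      ultimately show ?thesis by (auto intro: safe_mono)
    next
      case j: False
      then have gj: "g j \<noteq> 0" using root_eq_0[OF w] g i by simp
      show ?thesis
      proof (cases "tr i = None")
        case True
        let ?tr = "tr(i := tr j, j := None)"
        have "safe (finS l (g(i := g j, j := 0)) c) (?st\<lparr>vfd := vfd ?st\<rparr>) 18 ?post"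
          using world_move[OF w i(3)] g i True by (intro *[of _ ?tr]) (auto simp: fl_def root_addr_def)
        moreover have "g i = 0" using True g i by (simp add: root_addr_def)
        ultimately show ?thesis using gj by (auto intro: safe_mono)
      next
        case False
        then have gi: "g i \<noteq> 0" using root_eq_0[OF w] g i by simp
        have w': "world ?st tr" using w by simp
        have "safe (catP B (root_addr tr i) (root_addr tr j) (\<lambda>a. finS l (g(i := a, j := 0)) c)) ?st (18 + 62) ?post"
        proof (rule safe_wcat[OF w' i(3) False j])
          fix fd' tr'
          assume 2: "world (?st\<lparr>vfd := fd'\<rparr>) tr'" "\<forall>m. m \<noteq> i \<longrightarrow> m \<noteq> j \<longrightarrow> tr' m = tr m" "tr' j = None"
            "sm (fl tr' i) = sm (fl tr i @ fl tr j)"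
          show "safe (finS l (g(i := root_addr tr' i, j := 0)) c) (?st\<lparr>vfd := fd'\<rparr>) 18 ?post"
          proof (rule *[OF 2])
            show "\<forall>k<l. (g(i := root_addr tr' i, j := 0)) k = root_addr tr' k"
              using g i 2(2,3) fl_eq_other(2)[of tr' _ tr] by (auto simp: root_addr_def[of tr' j])
          qed
        qed
        then show ?thesis using gi gj g i by simp
      qed
    qed
  qed
qed

lemma InvS_insert:
  assumes "InvS s Q t e \<phi>" "cpqa_legal l (InsertAndAttrite i x) Q" "t < N" and arg: "arg = Some x"
  shows "\<exists>s'. exec mc arg (insert_prog (small_impl B l) i) (s\<lparr>result := None, ios := 0\<rparr>) = Some s' \<and> ios s' \<le> 80 \<and>
    result s' = None \<and> InvS s' (cpqa_step (InsertAndAttrite i x) Q) (Suc t) (Suc e) 0"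
proof -
  from assms(1) obtain st tr c where 1: "R s st" "invS st tr c Q t e" "\<forall>i<l. mem s i = Num (prod_encode (root_addr tr i, c))"
    by (auto simp: InvS_def)
  have i: "i < l" "i \<noteq> l" using assms(2) by auto
  have w: "world st tr" using 1(2) by (simp add: invS_def)
  have Q: "Q k = sm (fl tr k)" if "k < l" for k using 1(2) that by (simp add: invS_def)
  let ?Q = "cpqa_step (InsertAndAttrite i x) Q"
  let ?post = "\<lambda>s'. result s' = None \<and> InvS s' ?Q (Suc t) (Suc e) 0"
  let ?a = "Suc c"
  let ?st = "add_rec (st\<lparr>vres := None\<rparr>) ?a [x]"
  have c: "c < N" "?a \<notin> vL st" using 1(2) assms(3) by (auto simp: invS_def)
  \<comment> \<open>Slot \<open>l\<close> belongs to no queue; the new element lives there as a tree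
    until it is catenated to queue \<open>i\<close>.\<close>
  let ?tr = "tr(l := Some (Rc ?a [x] [] [] []))"
  have tl: "tr l = None" using 1(2) by (simp add: invS_def)
  have w1: "world ?st ?tr"
    by (rule world_new) (use w tl c WN in auto)
  have fll: "fl ?tr l = [x]" "root_addr ?tr l = ?a" by (simp_all add: fl_def root_addr_def prs_eq)
  have Qi: "?Q i = sm (fl tr i @ [x])" using i Q by (simp add: sm_append insert_attrite_eq)
  show ?thesis unfolding small_impl_def cpqa_impl.simps
  proof (rule exec_initS[OF 1(1,3)])
    fix g assume g: "\<forall>i<l. g i = root_addr tr i"
    have *: "safe (finS l g' ?a) (?st\<lparr>vfd := fd'\<rparr>) 6 ?post"
      if "world (?st\<lparr>vfd := fd'\<rparr>) tr'" "\<forall>m. m \<noteq> i \<longrightarrow> m \<noteq> l \<longrightarrow> tr' m = tr m" "tr' l = None"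
        "sm (fl tr' i) = sm (fl tr i @ [x])" "\<forall>k<l. g' k = root_addr tr' k" for fd' tr' g'
    proof -
      have "sm (fl tr' k) = ?Q k" if "k < l" for k
      proof (cases "k = i")
        case False
        then have "fl tr' k = fl tr k" using \<open>\<forall>m. m \<noteq> i \<longrightarrow> m \<noteq> l \<longrightarrow> tr' m = tr m\<close> that by (intro fl_eq_other) simp
        then show ?thesis using Q that False by simp
      qed (use Qi \<open>sm (fl tr' i) = _\<close> in simp)
      moreover have "tr' k = None" if "k \<ge> l" for k
        using that i 1(2) \<open>tr' l = None\<close> \<open>\<forall>m. m \<noteq> i \<longrightarrow> m \<noteq> l \<longrightarrow> tr' m = tr m\<close> by (cases "k = l") (auto simp: invS_def)
      ultimately have inv: "invS (?st\<lparr>vfd := fd'\<rparr>) tr' ?a ?Q (Suc t) (Suc e)"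
        using that(1) 1(2) c(2) by (auto simp: invS_def add_rec_def intro: le_SucI)
      show ?thesis by (rule safe_finS[OF inv]) (use assms(3) that in \<open>auto simp: add_rec_def\<close>)
    qed
    have "safe (if g i = 0 then finS l (g(i := ?a)) ?a else catP B (g i) ?a (\<lambda>a. finS l (g(i := a)) ?a)) ?st 68 ?post"
    proof (cases "tr i = None")
      case True
      let ?tr' = "?tr(i := ?tr l, l := None)"
      have "safe (finS l (g(i := ?a)) ?a) (?st\<lparr>vfd := vfd ?st\<rparr>) 6 ?post"
      proof (rule *[of _ ?tr'])
        show "world (?st\<lparr>vfd := vfd ?st\<rparr>) ?tr'" using world_move[OF w1 i(2)] by simp
      qed (use g i True fll in \<open>auto simp: fl_def root_addr_def\<close>)
      moreover have "g i = 0" using True g i by (simp add: root_addr_def)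
      ultimately show ?thesis by (auto intro: safe_mono)
    next
      case False
      then have gi: "g i \<noteq> 0" using root_eq_0[OF w] g i by simp
      have ri: "root_addr ?tr i = g i" "fl ?tr i = fl tr i" using g i by (auto simp: root_addr_def fl_def)
      have "safe (catP B (root_addr ?tr i) (root_addr ?tr l) (\<lambda>a. finS l (g(i := a)) ?a)) ?st (6 + 62) ?post"
      proof (rule safe_wcat[OF w1 i(2)])
        fix fd' tr'
        assume 2: "world (?st\<lparr>vfd := fd'\<rparr>) tr'" "\<forall>m. m \<noteq> i \<longrightarrow> m \<noteq> l \<longrightarrow> tr' m = ?tr m" "tr' l = None"
          "sm (fl tr' i) = sm (fl ?tr i @ fl ?tr l)"
        have 3: "\<forall>m. m \<noteq> i \<longrightarrow> m \<noteq> l \<longrightarrow> tr' m = tr m" using 2(2) by simp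
        show "safe (finS l (g(i := root_addr tr' i)) ?a) (?st\<lparr>vfd := fd'\<rparr>) 6 ?post"
        proof (rule *[OF 2(1) 3 2(3)])
          show "\<forall>k<l. (g(i := root_addr tr' i)) k = root_addr tr' k"
            using g i 3 fl_eq_other(2)[of tr' _ tr] by auto
          show "sm (fl tr' i) = sm (fl tr i @ [x])" using 2(4) ri fll by simp
        qed
      qed (use False i in auto)
      then show ?thesis using gi ri fll by simp
    qed
    then have "safe (GetArg 0 (newRec ?a 1 (if g i = 0 then finS l (g(i := ?a)) ?a
        else catP B (g i) ?a (\<lambda>a. finS l (g(i := a)) ?a)))) (st\<lparr>vres := None\<rparr>) (68 + 12) ?post"
      by (intro safe_insert1[OF arg]) (use c WN in auto)
    then show "safe (GetArg 0 (newRec ?a 1 (if g i = 0 then finS l (g(i := ?a)) ?a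
        else catP B (g i) ?a (\<lambda>a. finS l (g(i := a)) ?a)))) (st\<lparr>vres := None\<rparr>) 80 ?post" by simp
  qed
qed

lemma InvS_step:
  assumes "InvS s Q t e \<phi>" "cpqa_legal l x Q" "t < N" "op_arg x = arg"
  shows "\<exists>s' e' \<phi>'. exec mc arg (op_prog (small_impl B l) x) (s\<lparr>result := None, ios := 0\<rparr>) = Some s' \<and>
       result s' = cpqa_answer x Q \<and> ios s' \<le> 80 \<and> 1 * ios s' + \<phi>' \<le> \<phi> + 80 \<and>
       e' + (if is_delete x then 1 else 0) \<le> e + (if is_catenate_or_insert x then 1 else 0) \<and>
       InvS s' (cpqa_step x Q) (Suc t) e' \<phi>'"
proof (cases x)
  case (FindMin i)
  from InvS_find[OF assms(1) _ assms(3), of i] assms(2,4) FindMin obtain s' where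
    "exec mc arg (op_prog (small_impl B l) x) (s\<lparr>result := None, ios := 0\<rparr>) = Some s'"
    "result s' = cpqa_answer x Q" "ios s' \<le> 80" "InvS s' (cpqa_step x Q) (Suc t) (e) 0"
    by auto
  then show ?thesis using FindMin by (intro exI[of _ s'] exI[of _ "e"] exI[of _ 0]) simp
next
  case (DeleteMin i)
  from InvS_delete[OF assms(1) _ assms(3), of i] assms(2,4) DeleteMin obtain s' where
    "exec mc arg (op_prog (small_impl B l) x) (s\<lparr>result := None, ios := 0\<rparr>) = Some s'"
    "result s' = cpqa_answer x Q" "ios s' \<le> 80" "InvS s' (cpqa_step x Q) (Suc t) (e - 1) 0" "1 \<le> e"
    by auto
  then show ?thesis using DeleteMin by (intro exI[of _ s'] exI[of _ "e - 1"] exI[of _ 0]) simp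
next
  case (CatenateAndAttrite i j)
  from InvS_cat[OF assms(1) _ assms(3), of i j] assms(2,4) CatenateAndAttrite obtain s' where
    "exec mc arg (op_prog (small_impl B l) x) (s\<lparr>result := None, ios := 0\<rparr>) = Some s'"
    "result s' = cpqa_answer x Q" "ios s' \<le> 80" "InvS s' (cpqa_step x Q) (Suc t) (e) 0"
    by auto
  then show ?thesis using CatenateAndAttrite by (intro exI[of _ s'] exI[of _ "e"] exI[of _ 0]) simp
next
  case (InsertAndAttrite i y)
  from InvS_insert[OF assms(1) _ assms(3), of i y] assms(2,4) InsertAndAttrite obtain s' where
    "exec mc arg (op_prog (small_impl B l) x) (s\<lparr>result := None, ios := 0\<rparr>) = Some s'"
    "result s' = cpqa_answer x Q" "ios s' \<le> 80" "InvS s' (cpqa_step x Q) (Suc t) (Suc e) 0"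
    by auto
  then show ?thesis using InsertAndAttrite by (intro exI[of _ s'] exI[of _ "Suc e"] exI[of _ 0]) simp
qed

lemma InvS_blank: "InvS blank_config (\<lambda>_. {}) 0 0 0"
proof -
  let ?st = "\<lparr>vm = (\<lambda>_. Num 0), vres = None, vL = {}, vel = (\<lambda>_. []), vfd = (\<lambda>_ _. 0)\<rparr> :: 'a vst"
  let ?tr = "\<lambda>_. None :: 'a rc option"
  have "R blank_config ?st" by (simp add: R_def blank_config_def)
  moreover have "invS ?st ?tr 0 (\<lambda>_. {}) 0 0" by (simp add: invS_def world_def fl_def)
  \<comment> \<open>The blank memory needs no initialization, because the pair \<open>(0, 0)\<close>
    is encoded as 0.\<close>
  moreover have "\<forall>i<l. mem blank_config i = Num (prod_encode (root_addr ?tr i, 0))"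
    by (simp add: blank_config_def root_addr_def prod_encode_def)
  ultimately show ?thesis unfolding InvS_def by blast
qed

lemma InvS_blocks: "InvS s Q t e \<phi> \<Longrightarrow> blocks_used s \<le> 12 * e"
  using R_blocks_used by (fastforce simp: InvS_def invS_def)

end

section \<open>Large blocks\<close>

primrec copyN :: "nat \<Rightarrow> nat \<Rightarrow> nat \<Rightarrow> prog \<Rightarrow> prog" where
  "copyN c d 0 p = p"
| "copyN c d (Suc n) p = Copy c d (copyN (Suc c) (Suc d) n p)"

primrec countL :: "nat \<Rightarrow> nat \<Rightarrow> nat \<Rightarrow> nat \<Rightarrow> (nat \<Rightarrow> prog) \<Rightarrow> prog" where
  "countL c d 0 i k = k i"
| "countL c d (Suc n) i k = IfLess (c + i) d (countL c d n (Suc i) k) (k i)"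

definition recFrom :: "nat \<Rightarrow> nat \<Rightarrow> nat \<Rightarrow> prog \<Rightarrow> prog" where
  "recFrom c n a p = copyN c 0 n (newRec a n p)"

definition loadRec :: "nat \<Rightarrow> nat \<Rightarrow> nat \<Rightarrow> prog \<Rightarrow> prog" where
  "loadRec a c n p = ReadBlock (16 * a) 0 (copyN 0 c n p)"

text \<open>For \<open>bt \<le> n \<le> 4 * bt\<close>, splitting an input of more than
  \<open>2 * bt\<close> elements in halves gives two records with between \<open>bt\<close> and
  \<open>2 * bt\<close> elements.\<close>

definition emit :: "nat \<Rightarrow> nat \<Rightarrow> nat \<Rightarrow> nat \<Rightarrow> nat \<Rightarrow> (nat \<Rightarrow> nat \<Rightarrow> prog) \<Rightarrow> prog" where
  "emit B bt c n a k =
    (if n \<le> 2 * bt then recFrom c n (Suc a) (k (Suc a) (Suc a))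
     else recFrom c (n div 2) (Suc a) (recFrom (c + n div 2) (n - n div 2) (Suc (Suc a))
       (catP B (Suc a) (Suc (Suc a)) (\<lambda>r. k r (Suc (Suc a))))))"

text \<open>
  Cell \<open>B + 1\<close> counts the records allocated so far, and queue \<open>i\<close> owns \<open>16 bt\<close> cells: its first elements
  are kept from \<open>hz B bt i\<close> on, its last ones from \<open>tz B bt i\<close> on, and the three cells from
  \<open>nz B bt i\<close> on hold the root of the tree of the remaining elements (\<open>0\<close> if there are none) and the
  lengths of the two buffers. Queue \<open>l\<close> is scratch space that turns an insertion into a catenation.
\<close>

definition hz :: "nat \<Rightarrow> nat \<Rightarrow> nat \<Rightarrow> nat" where "hz B bt i = B + 2 + 16 * bt * i"
definition tz :: "nat \<Rightarrow> nat \<Rightarrow> nat \<Rightarrow> nat" where "tz B bt i = hz B bt i + 6 * bt"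
definition nz :: "nat \<Rightarrow> nat \<Rightarrow> nat \<Rightarrow> nat" where "nz B bt i = hz B bt i + 10 * bt"

definition setQ :: "nat \<Rightarrow> nat \<Rightarrow> nat \<Rightarrow> nat \<Rightarrow> nat \<Rightarrow> nat \<Rightarrow> prog \<Rightarrow> prog" where
  "setQ B bt i g h t p = SetNum (nz B bt i) g (SetNum (nz B bt i + 1) h (SetNum (nz B bt i + 2) t p))"

definition getQ :: "nat \<Rightarrow> nat \<Rightarrow> nat \<Rightarrow> (nat \<Rightarrow> nat \<Rightarrow> nat \<Rightarrow> prog) \<Rightarrow> prog" where
  "getQ B bt i k = CaseNum (nz B bt i) (\<lambda>g. CaseNum (nz B bt i + 1) (\<lambda>h. CaseNum (nz B bt i + 2) (\<lambda>t. k g h t)))"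

definition finQ :: "nat \<Rightarrow> nat \<Rightarrow> nat \<Rightarrow> nat \<Rightarrow> nat \<Rightarrow> nat \<Rightarrow> nat \<Rightarrow> prog" where
  "finQ B bt i g h t c = setQ B bt i g h t (SetNum (B + 1) c Halt)"

definition catMove :: "nat \<Rightarrow> nat \<Rightarrow> nat \<Rightarrow> nat \<Rightarrow> nat \<Rightarrow> nat \<Rightarrow> nat \<Rightarrow> nat \<Rightarrow> prog" where
  "catMove B bt i j g2 h2 t2 c =
    copyN (hz B bt j) (hz B bt i) h2 (copyN (tz B bt j) (tz B bt i) t2 (finQ B bt i g2 h2 t2 c))"

text \<open>The first queue has no tree, hence no tail, and its head buffer is extended by that of
  the second. Beyond \<open>3 * bt\<close> elements, \<open>2 * bt\<close> are kept; the rest has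
  more than \<open>bt\<close> and at most \<open>4 * bt\<close>, as \<open>emit\<close>
  requires.\<close>

definition catSmall :: "nat \<Rightarrow> nat \<Rightarrow> nat \<Rightarrow> nat \<Rightarrow> nat \<Rightarrow> nat \<Rightarrow> nat \<Rightarrow> nat \<Rightarrow> nat \<Rightarrow> prog" where
  "catSmall B bt i j h g2 h2 t2 c =
    copyN (hz B bt j) (hz B bt i + h) h2 (copyN (tz B bt j) (tz B bt i) t2
      (if h + h2 \<le> 3 * bt then finQ B bt i g2 (h + h2) t2 c
       else emit B bt (hz B bt i + 2 * bt) (h + h2 - 2 * bt) c (\<lambda>a c.
         if g2 = 0 then finQ B bt i a (2 * bt) t2 c
         else catP B a g2 (\<lambda>g. finQ B bt i g (2 * bt) t2 c))))"

text \<open>The head buffer of the second queue has been appended to the tail of the first. Without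
  a second tree a short tail can stay in memory. In front of a second tree it has to become a
  record; if it is too short, the first record of that tree is borrowed, which gives at least
  \<open>bt\<close> and fewer than \<open>3 * bt\<close> elements.\<close>

definition catBig :: "nat \<Rightarrow> nat \<Rightarrow> nat \<Rightarrow> nat \<Rightarrow> nat \<Rightarrow> nat \<Rightarrow> nat \<Rightarrow> nat \<Rightarrow> nat \<Rightarrow> nat \<Rightarrow> nat \<Rightarrow> prog" where
  "catBig B bt i j g1 h t g2 h2 t2 c =
    (if g2 = 0 then
       if t + h2 < bt then finQ B bt i g1 h (t + h2) c
       else emit B bt (tz B bt i) (t + h2) c (\<lambda>a c. catP B g1 a (\<lambda>g. finQ B bt i g h 0 c))
     else if bt \<le> t + h2 then
       emit B bt (tz B bt i) (t + h2) c (\<lambda>a c. catP B g1 a (\<lambda>g. catP B g g2 (\<lambda>g.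
         copyN (tz B bt j) (tz B bt i) t2 (finQ B bt i g h t2 c))))
     else
       getF g2 11 (\<lambda>n. loadRec g2 (tz B bt i + (t + h2)) n (popP B g2 (\<lambda>g2.
         emit B bt (tz B bt i) (t + h2 + n) c (\<lambda>a c. catP B g1 a (\<lambda>g.
           if g2 = 0 then copyN (tz B bt j) (tz B bt i) t2 (finQ B bt i g h t2 c)
           else catP B g g2 (\<lambda>g. copyN (tz B bt j) (tz B bt i) t2 (finQ B bt i g h t2 c))))))))"

text \<open>The first element of the second queue trims the sorted head and tail of the first in
  memory; the tree between them is attrited lazily by \<open>catP\<close>. If nothing of the head
  remains, the whole first queue is attrited, because its head lies below the rest.\<close>

definition catBody :: "nat \<Rightarrow> nat \<Rightarrow> nat \<Rightarrow> nat \<Rightarrow> nat \<Rightarrow> nat \<Rightarrow> nat \<Rightarrow> nat \<Rightarrow> nat \<Rightarrow> nat \<Rightarrow> nat \<Rightarrow> prog" where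
  "catBody B bt i j g1 h1 t1 g2 h2 t2 c =
    countL (hz B bt i) (hz B bt j) h1 0 (\<lambda>h.
      if h = 0 then catMove B bt i j g2 h2 t2 c
      else if g1 = 0 then catSmall B bt i j h g2 h2 t2 c
      else countL (tz B bt i) (hz B bt j) t1 0 (\<lambda>t. copyN (hz B bt j) (tz B bt i + t) h2
        (catBig B bt i j g1 h t g2 h2 t2 c)))"

definition trimP :: "nat \<Rightarrow> nat \<Rightarrow> nat \<Rightarrow> nat \<Rightarrow> (nat \<Rightarrow> prog) \<Rightarrow> prog" where
  "trimP b c d n k = (if b = 0 then k n else countL c d n 0 k)"

text \<open>An exhausted head buffer is refilled from the first record of the tree, trimmed by the
  tail and by the key of the next record, which is fetched into a spare cell of the tail area. If
  the tail leaves nothing of the record, it attrites the whole tree; the tree is abandoned and the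
  tail becomes the head.\<close>

definition delBody :: "nat \<Rightarrow> nat \<Rightarrow> nat \<Rightarrow> nat \<Rightarrow> nat \<Rightarrow> nat \<Rightarrow> nat \<Rightarrow> prog" where
  "delBody B bt i g h t c =
    (if 2 \<le> h then copyN (hz B bt i + 1) (hz B bt i) (h - 1) (finQ B bt i g (h - 1) t c)
     else if g = 0 then finQ B bt i 0 0 0 c
     else getF g 11 (\<lambda>n. loadRec g (hz B bt i) n (trimP t (hz B bt i) (tz B bt i) n (\<lambda>m.
       if m = 0 then copyN (tz B bt i) (hz B bt i) t (finQ B bt i 0 t 0 c)
       else popP B g (\<lambda>g.
         if g = 0 then copyN (tz B bt i) (hz B bt i + m) t (finQ B bt i 0 (m + t) 0 c)
         else loadRec g (tz B bt i + 2 * bt) 1 (countL (hz B bt i) (tz B bt i + 2 * bt) m 0 (\<lambda>m.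
           finQ B bt i g m t c)))))))"

definition large_impl :: "nat \<Rightarrow> nat \<Rightarrow> nat \<Rightarrow> cpqa_impl" where
  "large_impl B bt l = \<lparr>
     find_min_prog = (\<lambda>i. Output (hz B bt i) Halt),
     delete_min_prog = (\<lambda>i. Output (hz B bt i) (getQ B bt i (\<lambda>g h t. CaseNum (B + 1) (\<lambda>c. delBody B bt i g h t c)))),
     catenate_prog = (\<lambda>i j. getQ B bt i (\<lambda>g1 h1 t1. getQ B bt j (\<lambda>g2 h2 t2. CaseNum (B + 1) (\<lambda>c.
       if h2 = 0 then Halt else setQ B bt j 0 0 0 (catBody B bt i j g1 h1 t1 g2 h2 t2 c))))),
     insert_prog = (\<lambda>i. GetArg (hz B bt l) (getQ B bt i (\<lambda>g h t. CaseNum (B + 1) (\<lambda>c.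
       catBody B bt i l g h t 0 1 0 c))))\<rparr>"

definition seg :: "(nat \<Rightarrow> 'a word) \<Rightarrow> nat \<Rightarrow> 'a list \<Rightarrow> bool" where
  "seg m c xs \<longleftrightarrow> (\<forall>k<length xs. m (c + k) = Elem (xs ! k))"

definition put :: "(nat \<Rightarrow> 'a word) \<Rightarrow> nat \<Rightarrow> 'a list \<Rightarrow> nat \<Rightarrow> 'a word" where
  "put m c xs = (\<lambda>x. if c \<le> x \<and> x < c + length xs then Elem (xs ! (x - c)) else m x)"

lemma seg_Nil [simp]: "seg m c []"
  by (simp add: seg_def)

lemma put_Nil [simp]: "put m c [] = m"
  by (auto simp: put_def fun_eq_iff)

lemma seg_Cons: "seg m c (x # xs) \<longleftrightarrow> m c = Elem x \<and> seg m (Suc c) xs"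
  by (simp add: seg_def All_less_Suc2)

lemma seg_append: "seg m c (xs @ ys) \<longleftrightarrow> seg m c xs \<and> seg m (c + length xs) ys"
  by (induction xs arbitrary: c) (auto simp: seg_Cons)

lemma seg_take: "seg m c xs \<Longrightarrow> seg m c (take n xs)"
  using seg_append[of m c "take n xs" "drop n xs"] by simp

lemma seg_drop: "seg m c xs \<Longrightarrow> n \<le> length xs \<Longrightarrow> seg m (c + n) (drop n xs)"
  using seg_append[of m c "take n xs" "drop n xs"] by (simp add: min_absorb2)

lemma seg_put [simp]: "seg (put m c xs) c xs"
  by (simp add: seg_def put_def)

lemma seg_cong: "(\<And>x. c \<le> x \<Longrightarrow> x < c + length xs \<Longrightarrow> m' x = m x) \<Longrightarrow> seg m' c xs = seg m c xs"
  by (auto simp: seg_def)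

lemma seg_put_other: "d + length ys \<le> c \<or> c + length xs \<le> d \<Longrightarrow> seg (put m c xs) d ys = seg m d ys"
  by (rule seg_cong) (auto simp: put_def)

section \<open>Moving elements within memory\<close>

context mach
begin

lemma R_vm: "R s st \<Longrightarrow> (\<forall>c>B. m c = m' c) \<Longrightarrow> R (s\<lparr>mem := m\<rparr>) (st\<lparr>vm := m'\<rparr>)"
  by (simp add: R_def)

lemma safe_SetNum:
  assumes "B < j" "j < M" "v \<le> W" "safe p (st\<lparr>vm := (vm st)(j := Num v)\<rparr>) n Q"
  shows "safe (SetNum j v p) st n Q"
proof (rule safe_step[OF assms(4)])
  fix s assume s: "R s st"
  have "R (s\<lparr>mem := (mem s)(j := Num v)\<rparr>) (st\<lparr>vm := (vm st)(j := Num v)\<rparr>)"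
    by (rule R_vm[OF s]) (use s in \<open>simp add: R_def\<close>)
  then show "\<exists>s'. exec mc arg (SetNum j v p) s = exec mc arg p s' \<and> R s' (st\<lparr>vm := (vm st)(j := Num v)\<rparr>) \<and> ios s' + n \<le> ios s + n"
    using assms(2,3) by (intro exI[of _ "s\<lparr>mem := (mem s)(j := Num v)\<rparr>"]) simp
qed

lemma safe_CaseNum:
  assumes "B < i" "i < M" "vm st i = Num v" "safe (f v) st n Q"
  shows "safe (CaseNum i f) st n Q"
proof (rule safe_step[OF assms(4)])
  fix s assume s: "R s st"
  then have "mem s i = Num v" using assms(1,3) by (simp add: R_def)
  then show "\<exists>s'. exec mc arg (CaseNum i f) s = exec mc arg (f v) s' \<and> R s' st \<and> ios s' + n \<le> ios s + n"
    using s assms(2) by (intro exI[of _ s]) simp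
qed

lemma safe_Output:
  assumes "B < i" "i < M" "vm st i = Elem x" "safe p (st\<lparr>vres := Some x\<rparr>) n Q"
  shows "safe (Output i p) st n Q"
proof (rule safe_step[OF assms(4)])
  fix s assume s: "R s st"
  then have "mem s i = Elem x" using assms(1,3) by (simp add: R_def)
  then show "\<exists>s'. exec mc arg (Output i p) s = exec mc arg p s' \<and> R s' (st\<lparr>vres := Some x\<rparr>) \<and> ios s' + n \<le> ios s + n"
    using s assms(2) by (intro exI[of _ "s\<lparr>result := Some x\<rparr>"]) (simp add: R_def)
qed

lemma safe_GetArg:
  assumes "B < j" "j < M" "arg = Some e" "safe p (st\<lparr>vm := put (vm st) j [e]\<rparr>) n Q"
  shows "safe (GetArg j p) st n Q"
proof (rule safe_step[OF assms(4)])
  fix s assume s: "R s st"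
  have "R (s\<lparr>mem := (mem s)(j := Elem e)\<rparr>) (st\<lparr>vm := put (vm st) j [e]\<rparr>)"
    by (rule R_vm[OF s]) (use s in \<open>auto simp: R_def put_def\<close>)
  then show "\<exists>s'. exec mc arg (GetArg j p) s = exec mc arg p s' \<and> R s' (st\<lparr>vm := put (vm st) j [e]\<rparr>) \<and> ios s' + n \<le> ios s + n"
    using assms(2,3) by (intro exI[of _ "s\<lparr>mem := (mem s)(j := Elem e)\<rparr>"]) simp
qed

text \<open>Copying upwards from the first cell tolerates overlap if the target lies below the
  source; deletion shifts the head buffer by one cell in this way.\<close>

lemma exec_copyN:
  assumes "seg (mem s) c xs" "d \<le> c \<or> c + length xs \<le> d" "c + length xs \<le> M" "d + length xs \<le> M"
  shows "exec mc arg (copyN c d (length xs) p) s = exec mc arg p (s\<lparr>mem := put (mem s) d xs\<rparr>)"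
  using assms
proof (induction xs arbitrary: c d s)
  case (Cons x xs)
  let ?s = "s\<lparr>mem := (mem s)(d := mem s c)\<rparr>"
  have x: "mem s c = Elem x" "seg (mem s) (Suc c) xs" using Cons.prems(1) by (auto simp: seg_Cons)
  have "seg (mem ?s) (Suc c) xs = seg (mem s) (Suc c) xs"
    by (rule seg_cong) (use Cons.prems(2) in auto)
  then have "seg (mem ?s) (Suc c) xs" using x by blast
  moreover have "Suc d \<le> Suc c \<or> Suc c + length xs \<le> Suc d" "Suc c + length xs \<le> M" "Suc d + length xs \<le> M"
    using Cons.prems by auto
  ultimately have IH: "exec mc arg (copyN (Suc c) (Suc d) (length xs) p) ?s = exec mc arg p (?s\<lparr>mem := put (mem ?s) (Suc d) xs\<rparr>)"
    by (rule Cons.IH)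
  have "put ((mem s)(d := Elem x)) (Suc d) xs = put (mem s) d (x # xs)"
    by (auto simp: put_def fun_eq_iff nth_Cons' Suc_diff_Suc)
  then have e: "?s\<lparr>mem := put (mem ?s) (Suc d) xs\<rparr> = s\<lparr>mem := put (mem s) d (x # xs)\<rparr>" using x by simp
  have "exec mc arg (copyN c d (length (x # xs)) p) s = exec mc arg (copyN (Suc c) (Suc d) (length xs) p) ?s"
    using Cons.prems by simp
  then show ?case unfolding IH e .
qed simp

lemma put_above: "B < d \<Longrightarrow> \<forall>c>B. m c = m' c \<Longrightarrow> \<forall>c>B. put m d xs c = put m' d xs c"
  by (simp add: put_def)

lemma safe_copyN:
  assumes "seg (vm st) c xs" "length xs = k" "d \<le> c \<or> c + k \<le> d" "c + k \<le> M" "d + k \<le> M" "B < c" "B < d"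
    "safe p (st\<lparr>vm := put (vm st) d xs\<rparr>) n Q"
  shows "safe (copyN c d k p) st n Q"
proof (rule safe_step[OF assms(8)])
  fix s assume s: "R s st"
  then have m: "\<forall>c>B. mem s c = vm st c" by (simp add: R_def)
  have "seg (mem s) c xs = seg (vm st) c xs" by (rule seg_cong) (use m assms(6) in auto)
  then have "exec mc arg (copyN c d k p) s = exec mc arg p (s\<lparr>mem := put (mem s) d xs\<rparr>)"
    using assms exec_copyN[of s c xs d p] by simp
  moreover have "R (s\<lparr>mem := put (mem s) d xs\<rparr>) (st\<lparr>vm := put (vm st) d xs\<rparr>)"
    by (rule R_vm[OF s put_above[OF assms(7) m]])
  ultimately show "\<exists>s'. exec mc arg (copyN c d k p) s = exec mc arg p s' \<and> R s' (st\<lparr>vm := put (vm st) d xs\<rparr>) \<and> ios s' + n \<le> ios s + n"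
    by auto
qed

lemma exec_countL:
  assumes "seg (mem s) (c + i) xs" "mem s d = Elem y" "c + i + length xs \<le> M" "d < M"
  shows "exec mc arg (countL c d (length xs) i k) s = exec mc arg (k (i + length (takeWhile (\<lambda>x. x < y) xs))) s"
  using assms
proof (induction xs arbitrary: i)
  case (Cons x xs)
  have "mem s (c + i) = Elem x" "seg (mem s) (c + Suc i) xs" using Cons.prems(1) by (auto simp: seg_Cons)
  then show ?case using Cons by simp
qed simp

lemma safe_countL:
  assumes "seg (vm st) c xs" "length xs = m" "vm st d = Elem y" "c + m \<le> M" "d < M" "B < c" "B < d"
    "safe (k (length (takeWhile (\<lambda>x. x < y) xs))) st n Q"
  shows "safe (countL c d m 0 k) st n Q"
proof (rule safe_step[OF assms(8)])
  fix s assume s: "R s st"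
  then have m: "\<forall>c>B. mem s c = vm st c" by (simp add: R_def)
  have "seg (mem s) c xs = seg (vm st) c xs" by (rule seg_cong) (use m assms(6) in auto)
  then have "exec mc arg (countL c d m 0 k) s = exec mc arg (k (length (takeWhile (\<lambda>x. x < y) xs))) s"
    using assms m exec_countL[of s c 0 xs d y k] by simp
  then show "\<exists>s'. exec mc arg (countL c d m 0 k) s = exec mc arg (k (length (takeWhile (\<lambda>x. x < y) xs))) s' \<and> R s' st \<and> ios s' + n \<le> ios s + n"
    using s by auto
qed

text \<open>Elements pass through the scratch cells, from which \<open>newRec\<close> writes a whole
  block; what follows them in the block is junk that \<open>Rec\<close> ignores.\<close>

lemma safe_recFrom:
  assumes "seg (vm st) c xs" "length xs = k" "xs \<noteq> []" "k \<le> B" "c + k \<le> M" "B < c"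
    "a \<notin> vL st" "16 * a + 15 \<le> W" "k \<le> W" "safe p (add_rec st a xs) n Q"
  shows "safe (recFrom c k a p) st (n + 12) Q"
proof (rule safe_step[OF assms(10)])
  fix s assume s: "R s st"
  then have m: "\<forall>c>B. mem s c = vm st c" by (simp add: R_def)
  have "seg (mem s) c xs = seg (vm st) c xs" by (rule seg_cong) (use m assms(6) in auto)
  then have e: "exec mc arg (recFrom c k a p) s = exec mc arg (newRec a k p) (s\<lparr>mem := put (mem s) 0 xs\<rparr>)"
    unfolding recFrom_def using assms exec_copyN[of s c xs 0 "newRec a k p"] by simp
  let ?s = "s\<lparr>mem := put (mem s) 0 xs\<rparr>"
  have "R ?s st" using s assms(2,4) by (simp add: R_def put_def)
  from exec_newRec[OF this assms(7,8,3), of p] obtain s' where "exec mc arg (newRec a k p) ?s = exec mc arg p s'"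
    "R s' (add_rec st a xs)" "ios s' = ios ?s + 12"
    using assms(2,4,9) by (auto simp: add_rec_def put_def)
  then show "\<exists>s'. exec mc arg (recFrom c k a p) s = exec mc arg p s' \<and> R s' (add_rec st a xs) \<and> ios s' + n \<le> ios s + (n + 12)"
    unfolding e by (intro exI[of _ s']) simp
qed

lemma safe_loadRec:
  assumes "a \<in> vL st" "k \<le> length (vel st a)" "c + k \<le> M" "B < c" "1 \<le> n"
    "safe p (st\<lparr>vm := put (vm st) c (take k (vel st a))\<rparr>) (n - 1) Q"
  shows "safe (loadRec a c k p) st n Q"
proof (rule safe_step[OF assms(6)])
  fix s assume s: "R s st"
  have rec: "Rec (disk s) a (vel st a) (vfd st a)" by (rule R_Rec[OF s assms(1)])
  obtain blk where blk: "disk s (16 * a) = Some blk" "\<forall>i<length (vel st a). blk ! i = Elem (vel st a ! i)" "16 * a \<le> W"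
    using Rec_els[OF rec] by blast
  have kB: "k \<le> B" using rec assms(2) by (simp add: Rec_def)
  let ?m = "\<lambda>x. if 0 \<le> x \<and> x < 0 + B then blk ! (x - 0) else mem s x"
  let ?s = "s\<lparr>mem := ?m, ios := Suc (ios s)\<rparr>"
  let ?xs = "take k (vel st a)"
  have l: "length ?xs = k" using assms(2) by simp
  have "exec mc arg (loadRec a c k p) s = exec mc arg (copyN 0 c k p) ?s"
    unfolding loadRec_def using blk BM by simp
  also have "\<dots> = exec mc arg p (?s\<lparr>mem := put (mem ?s) c ?xs\<rparr>)"
  proof -
    have "seg (mem ?s) 0 ?xs" using blk(2) assms(2) kB by (simp add: seg_def)
    then show ?thesis using exec_copyN[of ?s 0 ?xs c p] assms kB l BM by simp
  qed
  finally have e: "exec mc arg (loadRec a c k p) s = exec mc arg p (?s\<lparr>mem := put (mem ?s) c ?xs\<rparr>)" .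
  have "R ?s st" by (rule R_mem[OF s]) simp
  then have "R (?s\<lparr>mem := put (mem ?s) c ?xs\<rparr>) (st\<lparr>vm := put (vm st) c ?xs\<rparr>)"
    by (rule R_vm) (rule put_above[OF assms(4)], use s in \<open>simp add: R_def\<close>)
  then show "\<exists>s'. exec mc arg (loadRec a c k p) s = exec mc arg p s' \<and> R s' (st\<lparr>vm := put (vm st) c ?xs\<rparr>) \<and> ios s' + (n - 1) \<le> ios s + n"
    using e assms(5) by (intro exI[of _ "?s\<lparr>mem := put (mem ?s) c ?xs\<rparr>"]) simp
qed

end

lemma takeWhile_less_sorted:
  fixes xs :: "'a::linorder list"
  assumes "sorted_wrt (<) xs" "y \<in> set (dropWhile (\<lambda>x. x < e) xs)"
  shows "e \<le> y"
  using assms by (induction xs) (auto split: if_splits intro: less_imp_le order_trans)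

lemma takeWhile_less: "x \<in> set (takeWhile (\<lambda>x. x < e) xs) \<Longrightarrow> x < e"
  by (induction xs) (auto split: if_splits)

text \<open>In a sorted list the elements that are not below \<open>e\<close> form a suffix, so
  \<open>countL\<close> can find the cut by comparing from the left.\<close>

lemma sm_trim:
  assumes "sorted_wrt (<) xs" "e \<in> set zs"
  shows "sm (takeWhile (\<lambda>x. x < e) xs @ zs) = sm (xs @ zs)"
proof -
  have "sm (takeWhile (\<lambda>x. x < e) xs @ dropWhile (\<lambda>x. x < e) xs @ zs) = sm (takeWhile (\<lambda>x. x < e) xs @ zs)"
    by (rule sm_drop_middle[OF assms(2)]) (rule takeWhile_less_sorted[OF assms(1)])
  then show ?thesis by (metis append_assoc takeWhile_dropWhile_id)
qed

lemma sorted_takeWhile: "sorted_wrt P xs \<Longrightarrow> sorted_wrt P (takeWhile p xs)"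
  by (metis sorted_wrt_append takeWhile_dropWhile_id)

text \<open>Memory consists of scratch cells, the counter and \<open>l + 1\<close> zones, one of
  them for insertions. An operation creates at most two records, hence the factor 2 in
  \<open>WN\<close>; \<open>M \<le> W\<close> allows storing the lengths of records and
  buffers.\<close>

locale large = mach +
  fixes bt l N :: nat
  assumes bt: "1 \<le> bt" "2 * bt \<le> B" and lM: "B + 2 + 16 * bt * (l + 1) \<le> M" and MW: "M \<le> W"
    and WN: "16 * (2 * N + 2) + 15 \<le> W"
begin

abbreviation "hh \<equiv> hz B bt"
abbreviation "tt \<equiv> tz B bt"
abbreviation "nn \<equiv> nz B bt"

definition inz :: "nat \<Rightarrow> nat \<Rightarrow> bool" where
  "inz i x \<longleftrightarrow> hh i \<le> x \<and> x < hh i + 16 * bt"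

text \<open>During a catenation the head area holds two heads of at most \<open>3 * bt\<close>
  elements, hence the offset 6. The tail area holds fewer than \<open>bt\<close> elements followed
  by such a head, or fewer than \<open>bt\<close> followed by a record of at most
  \<open>2 * bt\<close>, hence 4 more.\<close>

lemma zone_eqs: "tt i = hh i + 6 * bt" "nn i = hh i + 10 * bt"
  by (simp_all add: tz_def nz_def)

lemma zone_B: "B + 1 < hh i" "\<not> inz i (B + 1)"
  by (simp_all add: hz_def inz_def)

lemma zone_M: "i \<le> l \<Longrightarrow> hh i + 16 * bt \<le> M"
proof -
  assume "i \<le> l"
  then have "16 * bt * (i + 1) \<le> 16 * bt * (l + 1)" by (intro mult_le_mono2) simp
  moreover have "16 * bt * (i + 1) = 16 * bt * i + 16 * bt" by simp
  ultimately show ?thesis using lM unfolding hz_def by linarith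
qed

lemma zone_disj: "i \<noteq> k \<Longrightarrow> inz i x \<Longrightarrow> \<not> inz k x"
proof -
  have *: "hh i + 16 * bt \<le> hh k" if "i < k" for i k
  proof -
    have "16 * bt * (i + 1) \<le> 16 * bt * k" using that by (intro mult_le_mono2) simp
    moreover have "16 * bt * (i + 1) = 16 * bt * i + 16 * bt" by simp
    ultimately show ?thesis unfolding hz_def by linarith
  qed
  assume "i \<noteq> k" "inz i x"
  then show ?thesis using *[of i k] *[of k i] by (cases "i < k") (auto simp: inz_def)
qed

text \<open>The lower bound on the size of records gives the space bound, the upper one makes a
  record fit into a block, and order permits trimming. The bound on addresses makes
  \<open>Suc a\<close> fresh.\<close>

definition hinv :: "'a vst \<Rightarrow> nat \<Rightarrow> bool" where
  "hinv st a \<longleftrightarrow> finite (vL st) \<and> (\<forall>x\<in>vL st. x \<le> a \<and> bt \<le> length (vel st x) \<and> length (vel st x) \<le> 2 * bt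
     \<and> sorted_wrt (<) (vel st x))"

definition esum :: "'a vst \<Rightarrow> nat" where
  "esum st = (\<Sum>x\<in>vL st. length (vel st x))"

text \<open>The head lies below everything else, so the minimum is always in memory. Tree and tail
  are not compared: the tail may attrite the tree, which is settled when records are loaded. A queue
  without a tree is kept in the head buffer alone.\<close>

definition qok :: "'a list \<Rightarrow> 'a list \<Rightarrow> 'a list \<Rightarrow> bool" where
  "qok H T f \<longleftrightarrow> sorted_wrt (<) H \<and> sorted_wrt (<) T \<and> (\<forall>x\<in>set H. \<forall>y\<in>set f \<union> set T. x < y) \<and>
     length H \<le> 3 * bt \<and> length T < bt \<and> (f = [] \<longrightarrow> T = []) \<and> (H = [] \<longrightarrow> f = [])"

text \<open>In front of a tree the head counts as if it had at least \<open>2 * bt\<close> elements.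
  Refilling it from a record therefore raises nothing, and joining two queues that both have trees
  releases one such share.\<close>

definition qpot :: "'a list \<Rightarrow> 'a list \<Rightarrow> 'a list \<Rightarrow> nat" where
  "qpot f H T = (if f = [] then length H else 2 * bt + length T + (length H - 2 * bt))"

definition qmem :: "(nat \<Rightarrow> 'a word) \<Rightarrow> nat \<Rightarrow> 'a list \<Rightarrow> 'a list \<Rightarrow> nat \<Rightarrow> bool" where
  "qmem m i H T g \<longleftrightarrow> seg m (hh i) H \<and> seg m (tt i) T \<and> m (nn i) = Num g \<and>
     m (nn i + 1) = Num (length H) \<and> m (nn i + 2) = Num (length T)"

definition invL :: "'a vst \<Rightarrow> (nat \<Rightarrow> 'a rc option) \<Rightarrow> nat \<Rightarrow> (nat \<Rightarrow> 'a list) \<Rightarrow> (nat \<Rightarrow> 'a list) \<Rightarrow> bool" where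
  "invL st tr a Hs Ts \<longleftrightarrow> world st tr \<and> (\<forall>k\<ge>l. tr k = None) \<and> hinv st a \<and> vm st (B + 1) = Num a \<and>
     (\<forall>k\<le>l. qmem (vm st) k (Hs k) (Ts k) (root_addr tr k) \<and> qok (Hs k) (Ts k) (fl tr k))"

text \<open>
  \<open>Done\<close> describes the final configuration of an operation that changes only queue \<open>i\<close>: \<open>C\<close> is the
  resulting content of the queue, \<open>E\<close> and \<open>P\<close> bound the contributions of the disk and of queue \<open>i\<close>
  to the number of stored elements and to the potential.
\<close>

definition Done :: "nat \<Rightarrow> (nat \<Rightarrow> 'a list) \<Rightarrow> (nat \<Rightarrow> 'a list) \<Rightarrow> (nat \<Rightarrow> 'a list) \<Rightarrow> 'a set \<Rightarrow> nat \<Rightarrow> nat \<Rightarrow> nat \<Rightarrow>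
    'a option \<Rightarrow> 'a config \<Rightarrow> bool" where
  "Done i Hs Ts F C E P A r s \<longleftrightarrow> (\<exists>st tr a H T. R s st \<and> invL st tr a (Hs(i := H)) (Ts(i := T)) \<and>
     (\<forall>k\<le>l. k \<noteq> i \<longrightarrow> fl tr k = F k) \<and> sm (H @ fl tr i @ T) = C \<and> esum st + length H + length T \<le> E \<and>
     300 * bt * card (vL st) + 900 * qpot (fl tr i) H T \<le> P \<and> a \<le> A \<and> result s = r)"

lemma qmem_frame: "(\<And>x. inz i x \<Longrightarrow> m' x = m x) \<Longrightarrow> length H \<le> 6 * bt \<Longrightarrow> length T \<le> 4 * bt \<Longrightarrow> qmem m i H T g \<Longrightarrow> qmem m' i H T g"
proof -
  assume m: "\<And>x. inz i x \<Longrightarrow> m' x = m x" and l: "length H \<le> 6 * bt" "length T \<le> 4 * bt" and q: "qmem m i H T g"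
  have "seg m' (hh i) H = seg m (hh i) H" "seg m' (tt i) T = seg m (tt i) T"
    by (rule seg_cong, rule m, use l in \<open>simp add: inz_def zone_eqs\<close>)+
  moreover have "inz i (nn i)" "inz i (nn i + 1)" "inz i (nn i + 2)" using bt by (simp_all add: inz_def zone_eqs)
  ultimately show ?thesis using q m unfolding qmem_def by simp
qed

lemma qok_len: "qok H T f \<Longrightarrow> length H \<le> 6 * bt \<and> length T \<le> 4 * bt"
  by (simp add: qok_def)

lemma safe_Halt: "(\<And>s. R s st \<Longrightarrow> Q s) \<Longrightarrow> safe Halt st n Q"
  by (simp add: safe_def)

lemma safe_setQ:
  assumes "i \<le> l" "g \<le> W" "h \<le> W" "t \<le> W"
    "safe p (st\<lparr>vm := (vm st)(nn i := Num g, nn i + 1 := Num h, nn i + 2 := Num t)\<rparr>) n Q"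
  shows "safe (setQ B bt i g h t p) st n Q"
  unfolding setQ_def using assms zone_M[OF assms(1)] zone_B[of i] bt
  by (intro safe_SetNum) (simp_all add: zone_eqs)

lemma safe_getQ:
  assumes "i \<le> l" "qmem (vm st) i H T g" "safe (k g (length H) (length T)) st n Q"
  shows "safe (getQ B bt i k) st n Q"
  unfolding getQ_def using assms zone_M[OF assms(1)] zone_B[of i] bt
  by (intro safe_CaseNum) (auto simp: zone_eqs qmem_def)

lemma safe_finQ:
  assumes w: "world st tr" and none: "\<forall>k\<ge>l. tr k = None" and i: "i < l"
    and oth: "\<And>k. k \<le> l \<Longrightarrow> k \<noteq> i \<Longrightarrow> qmem (vm st) k (Hs k) (Ts k) (root_addr tr k) \<and> qok (Hs k) (Ts k) (fl tr k)"
    and s: "seg (vm st) (hh i) H" "seg (vm st) (tt i) T" and q: "qok H T (fl tr i)" and h: "hinv st a" "a \<le> W"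
    and F: "\<And>k. k \<le> l \<Longrightarrow> k \<noteq> i \<Longrightarrow> fl tr k = F k" and C: "sm (H @ fl tr i @ T) = C"
    and E: "esum st + length H + length T \<le> E" and P: "300 * bt * card (vL st) + 900 * qpot (fl tr i) H T \<le> P"
    and A: "a \<le> A" and r: "vres st = r"
  shows "safe (finQ B bt i (root_addr tr i) (length H) (length T) a) st n (Done i Hs Ts F C E P A r)"
proof -
  let ?m = "(vm st)(nn i := Num (root_addr tr i), nn i + 1 := Num (length H), nn i + 2 := Num (length T), B + 1 := Num a)"
  let ?st = "st\<lparr>vm := ?m\<rparr>"
  have ql: "length H \<le> 3 * bt" "length T < bt" using q by (auto simp: qok_def)
  have nzi: "inz i (nn i)" "inz i (nn i + 1)" "inz i (nn i + 2)" using bt by (simp_all add: inz_def zone_eqs)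
  have qi: "qmem ?m i H T (root_addr tr i)"
  proof -
    have "seg ?m (hh i) H = seg (vm st) (hh i) H" "seg ?m (tt i) T = seg (vm st) (tt i) T"
      by (rule seg_cong, use ql zone_B[of i] in \<open>simp add: zone_eqs\<close>)+
    moreover have "B + 1 < nn i" using zone_B[of i] by (simp add: zone_eqs)
    ultimately show ?thesis using s by (simp add: qmem_def)
  qed
  have qk: "qmem ?m k (Hs k) (Ts k) (root_addr tr k)" if k: "k \<le> l" "k \<noteq> i" for k
  proof (rule qmem_frame[of _ _ "vm st"])
    fix x assume x: "inz k x"
    then have "\<not> inz i x" using zone_disj[of k i x] k by simp
    then have "x \<noteq> nn i" "x \<noteq> nn i + 1" "x \<noteq> nn i + 2" using nzi by auto
    moreover have "x \<noteq> B + 1" using x zone_B(2)[of k] by auto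
    ultimately show "?m x = vm st x" by simp
  qed (use oth[OF k] qok_len in auto)
  have inv: "invL ?st tr a (Hs(i := H)) (Ts(i := T))"
    unfolding invL_def
  proof (intro conjI allI impI)
    show "world ?st tr" using w by simp
    show "hinv ?st a" using h by (simp add: hinv_def)
    fix k assume k: "k \<le> l"
    show "qmem (vm ?st) k ((Hs(i := H)) k) ((Ts(i := T)) k) (root_addr tr k)"
      using qi qk[OF k] by (cases "k = i") simp_all
    show "qok ((Hs(i := H)) k) ((Ts(i := T)) k) (fl tr k)" using q oth[OF k] by (cases "k = i") simp_all
  qed (use none in auto)
  have "Done i Hs Ts F C E P A r s'" if "R s' ?st" for s'
    unfolding Done_def
  proof (intro exI conjI)
    show "R s' ?st" by fact
    show "invL ?st tr a (Hs(i := H)) (Ts(i := T))" by fact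
    show "result s' = r" using that r by (simp add: R_def)
  qed (use F C E P A in \<open>auto simp: esum_def\<close>)
  then have "safe Halt ?st n (Done i Hs Ts F C E P A r)" by (rule safe_Halt)
  then show ?thesis unfolding finQ_def
    using i h(2) root_le[OF w, of i] ql zone_M[of i] zone_B[of i] MW bt BM B1
    by (intro safe_setQ safe_SetNum) (simp_all add: zone_eqs)
qed

lemma hinv_add:
  assumes "hinv st a" "bt \<le> length xs" "length xs \<le> 2 * bt" "sorted_wrt (<) xs"
  shows "Suc a \<notin> vL st" "hinv (add_rec st (Suc a) xs) (Suc a)" "esum (add_rec st (Suc a) xs) = esum st + length xs"
    "card (vL (add_rec st (Suc a) xs)) = Suc (card (vL st))"
proof -
  show n: "Suc a \<notin> vL st" using assms(1) by (auto simp: hinv_def)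
  show "hinv (add_rec st (Suc a) xs) (Suc a)" using assms by (auto simp: hinv_def add_rec_def)
  have "(\<Sum>x\<in>vL st. length (((vel st)(Suc a := xs)) x)) = (\<Sum>x\<in>vL st. length (vel st x))"
    by (rule sum.cong) (use n in auto)
  then show "esum (add_rec st (Suc a) xs) = esum st + length xs"
    using assms(1) n by (simp add: esum_def add_rec_def hinv_def)
  show "card (vL (add_rec st (Suc a) xs)) = Suc (card (vL st))" using assms(1) n by (simp add: add_rec_def hinv_def)
qed

lemma hinv_fd [simp]: "hinv (st\<lparr>vfd := fd\<rparr>) a = hinv st a" "esum (st\<lparr>vfd := fd\<rparr>) = esum st"
  "hinv (st\<lparr>vm := m\<rparr>) a = hinv st a" "esum (st\<lparr>vm := m\<rparr>) = esum st"
  "hinv (st\<lparr>vres := x\<rparr>) a = hinv st a" "esum (st\<lparr>vres := x\<rparr>) = esum st"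
  by (simp_all add: hinv_def esum_def)

lemma hinv_free:
  assumes "hinv st a" "x \<in> vL st"
  shows "hinv (st\<lparr>vL := vL st - {x}, vfd := fd\<rparr>) a" "esum (st\<lparr>vL := vL st - {x}, vfd := fd\<rparr>) + length (vel st x) = esum st"
    "card (vL st) = Suc (card (vL st - {x}))"
proof -
  have f: "finite (vL st)" using assms(1) by (simp add: hinv_def)
  show "hinv (st\<lparr>vL := vL st - {x}, vfd := fd\<rparr>) a" using assms(1) by (simp add: hinv_def)
  show "esum (st\<lparr>vL := vL st - {x}, vfd := fd\<rparr>) + length (vel st x) = esum st"
    using sum.remove[OF f assms(2), of "\<lambda>x. length (vel st x)"] by (simp add: esum_def)
  show "card (vL st) = Suc (card (vL st - {x}))" using f assms(2) by (rule card.remove)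
qed

definition emitted :: "'a vst \<Rightarrow> (nat \<Rightarrow> 'a rc option) \<Rightarrow> 'a vst \<Rightarrow> (nat \<Rightarrow> 'a rc option) \<Rightarrow> 'a list \<Rightarrow> nat \<Rightarrow> nat \<Rightarrow> bool" where
  "emitted st tr st' tr' xs a a' \<longleftrightarrow> world st' tr' \<and> (\<forall>m. m \<noteq> l + 2 \<longrightarrow> tr' m = tr m) \<and> tr' (l + 2) \<noteq> None \<and>
     sm (fl tr' (l + 2)) = sm xs \<and> set (fl tr' (l + 2)) \<subseteq> set xs \<and> vm st' = vm st \<and> vres st' = vres st \<and>
     hinv st' a' \<and> a' \<le> a + 2 \<and> esum st' = esum st + length xs \<and> card (vL st') \<le> card (vL st) + 2"

lemma sorted_hd_le: "sorted_wrt (<) (xs::'a list) \<Longrightarrow> \<forall>x\<in>set xs. hd xs \<le> x"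
  by (cases xs) (auto intro: less_imp_le)

text \<open>The new records are built as trees in the slots \<open>l + 2\<close> and
  \<open>l + 3\<close>, which belong to no queue; the result remains in slot
  \<open>l + 2\<close>.\<close>

lemma safe_emit:
  assumes w: "world st tr" and none: "tr (l + 2) = None" "tr (l + 3) = None" and s: "seg (vm st) c xs"
    and srt: "sorted_wrt (<) xs" and len: "length xs = n" "bt \<le> n" "n \<le> 4 * bt" and c: "B < c" "c + n \<le> M"
    and h: "hinv st a" and aW: "16 * (a + 2) + 15 \<le> W"
    and K: "\<And>st' tr' a'. emitted st tr st' tr' xs a a' \<Longrightarrow> safe (k (root_addr tr' (l + 2)) a') st' m Q"
  shows "safe (emit B bt c n a k) st (m + 90) Q"
proof (cases "n \<le> 2 * bt")
  case True
  have ne: "xs \<noteq> []" using len bt by auto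
  note ha = hinv_add[OF h, of xs, unfolded len(1), OF len(2) True srt]
  let ?st = "add_rec st (Suc a) xs"
  let ?r = "Rc (Suc a) xs [] [] []"
  let ?tr = "tr(l + 2 := Some ?r)"
  have "world ?st ?tr" by (rule world_new[OF w none(1)]) (use ha ne aW sorted_hd_le[OF srt] in auto)
  moreover have "fl ?tr (l + 2) = xs" by (simp add: fl_def prs_eq[of ?r])
  ultimately have "emitted st tr ?st ?tr xs a (Suc a)"
    using ha len(1) by (simp add: emitted_def) (simp add: add_rec_def)
  from K[OF this] have "safe (k (Suc a) (Suc a)) ?st m Q" by (simp add: root_addr_def)
  then have "safe (recFrom c n (Suc a) (k (Suc a) (Suc a))) st (m + 12) Q"
    by (intro safe_recFrom[OF s len(1) ne]) (use True bt c ha aW MW in auto)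
  then have "safe (recFrom c n (Suc a) (k (Suc a) (Suc a))) st (m + 90) Q" by (rule safe_mono) simp
  then show ?thesis using True by (simp add: emit_def)
next
  case False
  let ?n = "n div 2"
  let ?xs = "take ?n xs" and ?ys = "drop ?n xs"
  have l1: "length ?xs = ?n" "length ?ys = n - ?n" using len(1) by auto
  \<comment> \<open>From \<open>2 * bt < n \<le> 4 * bt\<close>; rounding in \<open>n div 2\<close>
    does no harm at either end.\<close>
  have b1: "bt \<le> ?n" "?n \<le> 2 * bt" "bt \<le> n - ?n" "n - ?n \<le> 2 * bt" using False len(3) by auto
  have "0 < length ?xs" "0 < length ?ys" using l1 b1 bt by linarith+
  then have ne: "?xs \<noteq> []" "?ys \<noteq> []" by (simp_all only: length_greater_0_conv not_False_eq_True)
  have srt': "sorted_wrt (<) ?xs" "sorted_wrt (<) ?ys" "\<forall>x\<in>set ?xs. \<forall>y\<in>set ?ys. x < y"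
    using srt sorted_wrt_append[of "(<)" ?xs ?ys] by simp_all
  let ?st1 = "add_rec st (Suc a) ?xs"
  let ?st2 = "add_rec ?st1 (Suc (Suc a)) ?ys"
  note h1 = hinv_add[OF h, of ?xs, unfolded l1, OF b1(1,2) srt'(1)]
  note h2 = hinv_add[OF h1(2), of ?ys, unfolded l1, OF b1(3,4) srt'(2)]
  let ?r1 = "Rc (Suc a) ?xs [] [] []" and ?r2 = "Rc (Suc (Suc a)) ?ys [] [] []"
  let ?tr1 = "tr(l + 2 := Some ?r1)"
  let ?tr2 = "?tr1(l + 3 := Some ?r2)"
  have w1: "world ?st1 ?tr1" by (rule world_new[OF w none(1)]) (use h1 ne aW sorted_hd_le[OF srt'(1)] in auto)
  have w2: "world ?st2 ?tr2" by (rule world_new[OF w1]) (use h2 ne aW sorted_hd_le[OF srt'(2)] none in auto)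
  have f2: "fl ?tr2 (l + 2) = ?xs" "fl ?tr2 (l + 3) = ?ys" "root_addr ?tr2 (l + 2) = Suc a" "root_addr ?tr2 (l + 3) = Suc (Suc a)"
    by (simp_all add: fl_def prs_eq[of ?r1] prs_eq[of ?r2] root_addr_def)
  have "safe (catP B (root_addr ?tr2 (l + 2)) (root_addr ?tr2 (l + 3)) (\<lambda>r. k r (Suc (Suc a)))) ?st2 (m + 62) Q"
  proof (rule safe_wcat[OF w2])
    fix fd' tr'
    assume 3: "world (?st2\<lparr>vfd := fd'\<rparr>) tr'" "\<forall>m. m \<noteq> l + 2 \<longrightarrow> m \<noteq> l + 3 \<longrightarrow> tr' m = ?tr2 m"
      "tr' (l + 3) = None" "tr' (l + 2) \<noteq> None" "sm (fl tr' (l + 2)) = sm (fl ?tr2 (l + 2) @ fl ?tr2 (l + 3))"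
      "set (fl tr' (l + 2)) \<subseteq> set (fl ?tr2 (l + 2)) \<union> set (fl ?tr2 (l + 3))"
    have "tr' m = tr m" if "m \<noteq> l + 2" for m using 3(2,3) that none(2) by (cases "m = l + 3") auto
    moreover have "sm (fl tr' (l + 2)) = sm xs" using 3(5) unfolding f2 by simp
    moreover have "set (fl tr' (l + 2)) \<subseteq> set xs" using 3(6) unfolding f2 by (metis append_take_drop_id set_append)
    moreover have "vm ?st2 = vm st" "vres ?st2 = vres st" by (simp_all add: add_rec_def)
    moreover have "esum ?st2 = esum st + length xs" using h1(3) h2(3) len(1) l1 by simp
    moreover have "card (vL ?st2) \<le> card (vL st) + 2" using h1(4) h2(4) by simp
    ultimately have "emitted st tr (?st2\<lparr>vfd := fd'\<rparr>) tr' xs a (Suc (Suc a))"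
      using 3(1,4) h2(2) by (simp add: emitted_def)
    then show "safe (k (root_addr tr' (l + 2)) (Suc (Suc a))) (?st2\<lparr>vfd := fd'\<rparr>) m Q" by (rule K)
  qed auto
  then have "safe (catP B (Suc a) (Suc (Suc a)) (\<lambda>r. k r (Suc (Suc a)))) ?st2 (m + 62) Q" unfolding f2 .
  moreover have sy: "seg (vm ?st1) (c + ?n) ?ys" using seg_drop[OF s, of ?n] len(1) by (simp add: add_rec_def)
  moreover have nn: "?n \<le> n" by simp
  have nums: "n - ?n \<le> B" "c + ?n + (n - ?n) \<le> M" "B < c + ?n" "16 * Suc (Suc a) + 15 \<le> W" "n - ?n \<le> W"
    "?n \<le> B" "c + ?n \<le> M" "16 * Suc a + 15 \<le> W" "?n \<le> W"
    subgoal using b1 bt by linarith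
    subgoal using c nn by linarith
    subgoal using c by linarith
    subgoal using aW by simp
    subgoal using b1 bt MW BM by linarith
    subgoal using b1 bt by linarith
    subgoal using c nn by linarith
    subgoal using aW by simp
    subgoal using b1 bt MW BM by linarith
    done
  ultimately have "safe (recFrom (c + ?n) (n - ?n) (Suc (Suc a)) (catP B (Suc a) (Suc (Suc a)) (\<lambda>r. k r (Suc (Suc a))))) ?st1 (m + 62 + 12) Q"
    by (intro safe_recFrom[OF sy l1(2) ne(2) nums(1-3) h2(1) nums(4,5)])
  then have "safe (recFrom c ?n (Suc a) (recFrom (c + ?n) (n - ?n) (Suc (Suc a)) (catP B (Suc a) (Suc (Suc a)) (\<lambda>r. k r (Suc (Suc a)))))) st (m + 62 + 12 + 12) Q"
    by (intro safe_recFrom[OF seg_take[OF s] l1(1) ne(1) nums(6,7) c(1) h1(1) nums(8,9)])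
  from safe_mono[OF this, of "m + 90"] show ?thesis unfolding emit_def using False by simp
qed

end

context large
begin

lemma put_inz: "hh i \<le> c \<Longrightarrow> c + length xs \<le> hh i + 16 * bt \<Longrightarrow> \<not> inz i x \<Longrightarrow> put m c xs x = m x"
  by (auto simp: put_def inz_def)

text \<open>The common end of all operations on queue \<open>i\<close>: a memory changed only inside
  zone \<open>i\<close> leaves the other queues as they were.\<close>

lemma queue_leaf:
  assumes i: "i < l"
    and oth: "\<And>k. k \<le> l \<Longrightarrow> k \<noteq> i \<Longrightarrow> qmem (vm st) k (Hs k) (Ts k) (root_addr tr k) \<and> qok (Hs k) (Ts k) (fl tr k)"
    and A: "A \<le> W"
    and 1: "world st' tr'" "\<forall>m\<le>l. m \<noteq> i \<longrightarrow> tr' m = tr m" "\<forall>k\<ge>l. tr' k = None"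
    "\<forall>x. \<not> inz i x \<longrightarrow> vm st' x = vm st x" "seg (vm st') (hh i) H" "seg (vm st') (tt i) T"
    "qok H T (fl tr' i)" "sm (H @ fl tr' i @ T) = C" "vres st' = vres st" "hinv st' a'" "a' \<le> A"
    "esum st' + length H + length T \<le> E" "300 * bt * card (vL st') + 900 * qpot (fl tr' i) H T \<le> P"
    "length H = hn" "length T = tn" "g = root_addr tr' i"
  shows "safe (finQ B bt i g hn tn a') st' n (Done i Hs Ts (fl tr) C E P A (vres st))"
proof -
  have fr: "fl tr' k = fl tr k" "root_addr tr' k = root_addr tr k" if "k \<le> l" "k \<noteq> i" for k
    using 1(2) that by (auto intro!: fl_eq_other)
  have "safe (finQ B bt i (root_addr tr' i) (length H) (length T) a') st' n (Done i Hs Ts (fl tr) C E P A (vres st))"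
  proof (rule safe_finQ[OF 1(1,3) i _ 1(5,6,7,10) _ _ 1(8,12,13,11,9)])
    fix k assume k: "k \<le> l" "k \<noteq> i"
    have "qmem (vm st') k (Hs k) (Ts k) (root_addr tr k)"
    proof (rule qmem_frame[of _ _ "vm st"])
      fix x assume "inz k x"
      then show "vm st' x = vm st x" using 1(4) zone_disj[of k i x] k by auto
    qed (use oth[OF k] qok_len in auto)
    then show "qmem (vm st') k (Hs k) (Ts k) (root_addr tr' k) \<and> qok (Hs k) (Ts k) (fl tr' k)"
      using oth[OF k] fr[OF k] by simp
    show "fl tr' k = fl tr k" using fr[OF k] by simp
  next
    show "a' \<le> W" using 1(11) A by simp
  qed
  then show ?thesis using 1(14-16) by simp
qed

text \<open>That field 11 is the length follows from any configuration related to \<open>st\<close>;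
  if there is none, \<open>safe\<close> holds vacuously.\<close>

lemma safe_getSize:
  assumes "x \<in> vL st" "1 \<le> n" "safe (k (length (vel st x))) st (n - 1) Q"
  shows "safe (getF x 11 k) st n Q"
proof (cases "\<exists>s. R s st")
  case True
  then obtain s where "R s st" by blast
  from R_Rec[OF this assms(1)] have "vfd st x 11 = length (vel st x)" by (simp add: Rec_def)
  then show ?thesis using assms by (intro safe_getF) auto
next
  case False
  then show ?thesis by (simp add: safe_def)
qed

section \<open>Catenation of two buffered queues, the second tree parked in slot
  \<open>l + 1\<close>\<close>

context
  fixes i j :: nat and st :: "'a vst" and tr :: "nat \<Rightarrow> 'a rc option" and Hs Ts :: "nat \<Rightarrow> 'a list"
    and H1 T1 H2 T2 :: "'a list" and a :: nat
  assumes i: "i < l" and j: "j \<le> l" and ij: "i \<noteq> j"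
    and w: "world st tr" and none: "\<forall>k\<ge>l. k \<noteq> l + 1 \<longrightarrow> tr k = None"
    and oth: "\<And>k. k \<le> l \<Longrightarrow> k \<noteq> i \<Longrightarrow> qmem (vm st) k (Hs k) (Ts k) (root_addr tr k) \<and> qok (Hs k) (Ts k) (fl tr k)"
    and q1: "seg (vm st) (hh i) H1" "seg (vm st) (tt i) T1" "qok H1 T1 (fl tr i)"
    and q2: "seg (vm st) (hh j) H2" "seg (vm st) (tt j) T2" "qok H2 T2 (fl tr (l + 1))" "H2 \<noteq> []"
    and h: "hinv st a" and aW: "16 * (a + 2) + 15 \<le> W"
begin

abbreviation (input) "f1 \<equiv> fl tr i"
abbreviation (input) "f2 \<equiv> fl tr (l + 1)"
abbreviation (input) "e0 \<equiv> hd H2"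
abbreviation (input) "H1' \<equiv> takeWhile (\<lambda>x. x < e0) H1"
abbreviation (input) "T1' \<equiv> takeWhile (\<lambda>x. x < e0) T1"
abbreviation (input) "CC \<equiv> sm (H1 @ f1 @ T1 @ H2 @ f2 @ T2)"
abbreviation (input) "EE \<equiv> esum st + length H1 + length T1 + length H2 + length T2"
abbreviation (input) "PP \<equiv> 300 * bt * card (vL st) + 900 * (qpot f1 H1 T1 + qpot f2 H2 T2)"
abbreviation (input) "goal P \<equiv> Done i Hs Ts (fl tr) CC EE P (a + 2) (vres st)"

lemma aW': "a + 2 \<le> W" using aW by simp

lemmas cat_leaf = queue_leaf[OF i oth aW']

lemma e0_in: "e0 \<in> set H2" using q2(4) by simp

lemma H2_ge: "y \<in> set H2 \<Longrightarrow> e0 \<le> y"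
  using q2(3) sorted_hd_le by (auto simp: qok_def)

lemma e0_less: "y \<in> set f2 \<union> set T2 \<Longrightarrow> e0 < y"
  using q2(3) e0_in by (auto simp: qok_def)

lemma trim_less: "x \<in> set H1' \<union> set T1' \<Longrightarrow> y \<in> set H2 \<union> set f2 \<union> set T2 \<Longrightarrow> x < y"
proof -
  assume x: "x \<in> set H1' \<union> set T1'" and y: "y \<in> set H2 \<union> set f2 \<union> set T2"
  have "x < e0" using x takeWhile_less[of x e0 H1] takeWhile_less[of x e0 T1] by auto
  moreover have "e0 \<le> y" using y H2_ge e0_less by (auto intro: less_imp_le)
  ultimately show ?thesis by simp
qed

lemma srt: "sorted_wrt (<) H1" "sorted_wrt (<) T1" "sorted_wrt (<) H2" "sorted_wrt (<) T2"
  "sorted_wrt (<) H1'" "sorted_wrt (<) T1'"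
  using q1(3) q2(3) sorted_takeWhile by (auto simp: qok_def)

lemma H1_less: "x \<in> set H1' \<Longrightarrow> y \<in> set f1 \<union> set T1' \<union> set H2 \<union> set f2 \<union> set T2 \<Longrightarrow> x < y"
proof -
  assume x: "x \<in> set H1'" and y: "y \<in> set f1 \<union> set T1' \<union> set H2 \<union> set f2 \<union> set T2"
  show "x < y"
  proof (cases "y \<in> set f1 \<union> set T1'")
    case True
    then have "y \<in> set f1 \<union> set T1" by (auto dest: set_takeWhileD)
    moreover have "x \<in> set H1" using x by (auto dest: set_takeWhileD)
    ultimately show ?thesis using q1(3) by (auto simp: qok_def)
  next
    case False
    then show ?thesis using y x trim_less by blast
  qed
qed

lemma CC_trim: "CC = sm (H1' @ f1 @ T1' @ H2 @ f2 @ T2)"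
proof -
  have "sm (T1' @ H2 @ f2 @ T2) = sm (T1 @ H2 @ f2 @ T2)" by (rule sm_trim[OF srt(2)]) (use e0_in in simp)
  then have "sm (f1 @ T1' @ H2 @ f2 @ T2) = sm (f1 @ T1 @ H2 @ f2 @ T2)" by (rule sm_append_cong[OF refl])
  then have "sm (H1' @ f1 @ T1' @ H2 @ f2 @ T2) = sm (H1' @ f1 @ T1 @ H2 @ f2 @ T2)" by (rule sm_append_cong[OF refl])
  moreover have "sm (H1' @ f1 @ T1 @ H2 @ f2 @ T2) = CC" by (rule sm_trim[OF srt(1)]) (use e0_in in simp)
  ultimately show ?thesis by simp
qed

text \<open>An empty trimmed head means that the least element of the first queue is at least
  \<open>e0\<close>, unless that queue is empty.\<close>

lemma CC_move: "H1' = [] \<Longrightarrow> CC = sm (H2 @ f2 @ T2)"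
proof -
  assume e: "H1' = []"
  have "e0 \<le> y" if "y \<in> set (H1 @ f1 @ T1)" for y
  proof (cases H1)
    case Nil
    then have "f1 = []" "T1 = []" using q1(3) by (auto simp: qok_def)
    then show ?thesis using that Nil by simp
  next
    case (Cons z zs)
    then have z: "e0 \<le> z" using e by (auto split: if_splits)
    have "z \<le> y" using that q1(3) Cons by (auto simp: qok_def intro: less_imp_le)
    then show ?thesis using z by simp
  qed
  then have "sm ((H1 @ f1 @ T1) @ H2 @ f2 @ T2) = sm (H2 @ f2 @ T2)"
    by (intro sm_drop[of e0]) (use e0_in in auto)
  then show ?thesis by simp
qed

lemma lens: "length H1' \<le> length H1" "length T1' \<le> length T1" "length H1 \<le> 3 * bt" "length H2 \<le> 3 * bt"
  "length T1 < bt" "length T2 < bt"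
  using q1(3) q2(3) by (auto simp: qok_def length_takeWhile_le)

lemma zones: "B < hh i" "B < hh j" "hh i + 16 * bt \<le> M" "hh j + 16 * bt \<le> M"
  "hh i + 16 * bt \<le> hh j \<or> hh j + 16 * bt \<le> hh i"
proof -
  show "B < hh i" "B < hh j" using zone_B[of i] zone_B[of j] by auto
  show "hh i + 16 * bt \<le> M" "hh j + 16 * bt \<le> M" using zone_M[of i] zone_M[of j] i j by auto
  show "hh i + 16 * bt \<le> hh j \<or> hh j + 16 * bt \<le> hh i"
  proof (rule ccontr)
    assume "\<not> ?thesis"
    then have "inz i (max (hh i) (hh j))" "inz j (max (hh i) (hh j))" by (auto simp: inz_def)
    then show False using zone_disj[OF ij] by blast
  qed
qed

lemma cat_move:
  assumes e: "H1' = []"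
  shows "safe (catMove B bt i j (root_addr tr (l + 1)) (length H2) (length T2) a) st n (goal PP)"
proof -
  let ?m1 = "put (vm st) (hh i) H2"
  let ?m2 = "put ?m1 (tt i) T2"
  let ?tr = "tr(i := tr (l + 1), l + 1 := None)"
  have s1: "seg ?m1 (tt j) T2" using q2(2) zones lens by (subst seg_put_other) (auto simp: zone_eqs)
  have s2: "seg ?m2 (hh i) H2" using lens by (subst seg_put_other) (auto simp: zone_eqs)
  have "?m2 x = ?m1 x" "?m1 x = vm st x" if "\<not> inz i x" for x
    by (rule put_inz[OF _ _ that]; use lens in \<open>simp add: zone_eqs\<close>)+
  then have out: "?m2 x = vm st x" if "\<not> inz i x" for x using that by simp
  have f: "fl ?tr i = f2" "root_addr ?tr i = root_addr tr (l + 1)" using i by (auto intro!: fl_eq_other)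
  have "safe (finQ B bt i (root_addr tr (l + 1)) (length H2) (length T2) a) (st\<lparr>vm := ?m2\<rparr>) n (goal PP)"
  proof (rule cat_leaf[where tr' = ?tr and H = H2 and T = T2])
    show "world (st\<lparr>vm := ?m2\<rparr>) ?tr" using world_move[OF w, of i "l + 1"] i by simp
    show "sm (H2 @ fl ?tr i @ T2) = CC" using CC_move[OF e] f by simp
    show "qok H2 T2 (fl ?tr i)" using q2(3) f by simp
  qed (use i none out s2 h f in \<open>auto simp: algebra_simps\<close>)
  then have "safe (copyN (tt j) (tt i) (length T2) (finQ B bt i (root_addr tr (l + 1)) (length H2) (length T2) a)) (st\<lparr>vm := ?m1\<rparr>) n (goal PP)"
    by (intro safe_copyN) (use s1 zones lens in \<open>auto simp: zone_eqs\<close>)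
  then show ?thesis unfolding catMove_def
    by (intro safe_copyN[OF q2(1)]) (use zones lens in \<open>auto simp: zone_eqs\<close>)
qed

text \<open>A drop of \<open>bt\<close> in the buffer potential releases \<open>900 * bt\<close>:
  \<open>600 * bt\<close> endow up to two new records, \<open>300 * bt\<close> remain for the
  I/Os.\<close>

lemma cost_bound:
  assumes "c \<le> card (vL st) + 2" "q + bt \<le> qpot f1 H1 T1 + qpot f2 H2 T2"
  shows "300 * bt * c + 900 * q \<le> PP - 300 * bt" "300 * bt \<le> PP"
proof -
  have "300 * bt * c \<le> 300 * bt * (card (vL st) + 2)" using assms(1) by (rule mult_le_mono2)
  also have "\<dots> = 300 * bt * card (vL st) + 600 * bt" by (simp add: algebra_simps)
  finally have 1: "300 * bt * c \<le> 300 * bt * card (vL st) + 600 * bt" .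
  have 2: "900 * q + 900 * bt \<le> 900 * (qpot f1 H1 T1 + qpot f2 H2 T2)"
    using mult_le_mono2[OF assms(2), of 900] by (simp only: distrib_left)
  show "300 * bt * c + 900 * q \<le> PP - 300 * bt" "300 * bt \<le> PP" using 1 2 by linarith+
qed

text \<open>\<open>n\<close> is 0 if everything fits into the head buffer, and 300 if records are
  created; only the latter has to be paid for.\<close>

lemma cat_small:
  assumes e: "H1' \<noteq> []" and g1: "tr i = None"
  shows "\<exists>n\<le>300. n * bt \<le> PP \<and>
    safe (catSmall B bt i j (length H1') (root_addr tr (l + 1)) (length H2) (length T2) a) st n (goal (PP - n * bt))"
proof -
  define xs where "xs = H1' @ H2"
  let ?h = "length H1'"
  have lx: "length xs = ?h + length H2" by (simp add: xs_def)
  have xne: "xs \<noteq> []" using q2(4) by (simp add: xs_def)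
  let ?m1 = "put (vm st) (hh i + ?h) H2"
  let ?m2 = "put ?m1 (tt i) T2"
  have f1: "f1 = []" using g1 by (simp add: fl_def)
  then have T1: "T1 = []" using q1(3) by (simp add: qok_def)
  have len: "length xs \<le> 6 * bt" using lens lx by simp
  have s1: "seg ?m1 (tt j) T2" using q2(2) zones lens by (subst seg_put_other) (auto simp: zone_eqs)
  have "seg (vm st) (hh i) H1'" using seg_append[of "vm st" "hh i" H1' "dropWhile (\<lambda>x. x < e0) H1"] q1(1) by simp
  then have "seg ?m1 (hh i) xs" unfolding xs_def seg_append by (subst seg_put_other) auto
  then have s2: "seg ?m2 (hh i) xs" using len by (subst seg_put_other) (auto simp: zone_eqs)
  have "?m2 x = ?m1 x" "?m1 x = vm st x" if "\<not> inz i x" for x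
    by (rule put_inz[OF _ _ that]; use lens in \<open>simp add: zone_eqs\<close>)+
  then have out: "\<forall>x. \<not> inz i x \<longrightarrow> ?m2 x = vm st x" by simp
  have CC': "CC = sm (xs @ f2 @ T2)" using CC_trim f1 T1 by (simp add: xs_def)
  have srtx: "sorted_wrt (<) xs" using srt(3,5) trim_less unfolding xs_def sorted_wrt_append by blast
  have xl: "\<forall>x\<in>set xs. \<forall>y\<in>set f2 \<union> set T2. x < y" using trim_less q2(3) unfolding xs_def qok_def set_append by blast
  let ?st = "st\<lparr>vm := ?m2\<rparr>"
  let ?p = "if ?h + length H2 \<le> 3 * bt then finQ B bt i (root_addr tr (l + 1)) (?h + length H2) (length T2) a
       else emit B bt (hh i + 2 * bt) (?h + length H2 - 2 * bt) a (\<lambda>a c.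
         if root_addr tr (l + 1) = 0 then finQ B bt i a (2 * bt) (length T2) c
         else catP B a (root_addr tr (l + 1)) (\<lambda>g. finQ B bt i g (2 * bt) (length T2) c))"
  have pre: "safe (catSmall B bt i j (length H1') (root_addr tr (l + 1)) (length H2) (length T2) a) st n (goal P)"
    if "safe ?p ?st n (goal P)" for n P
  proof -
    have "safe (copyN (tt j) (tt i) (length T2) ?p) (st\<lparr>vm := ?m1\<rparr>) n (goal P)"
      by (rule safe_copyN[where xs = T2]) (use s1 zones lens that in \<open>auto simp: zone_eqs\<close>)
    then show ?thesis unfolding catSmall_def
      by (intro safe_copyN[OF q2(1)]) (use zones lens in \<open>auto simp: zone_eqs\<close>)
  qed
  have l1: "l + 1 \<noteq> l + 2" "i \<noteq> l + 1" "i \<noteq> l + 2" using i by auto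
  show ?thesis
  proof (cases "?h + length H2 \<le> 3 * bt")
    case True
    let ?tr = "tr(i := tr (l + 1), l + 1 := None)"
    have f: "fl ?tr i = f2" "root_addr ?tr i = root_addr tr (l + 1)" using i by (auto intro!: fl_eq_other)
    have "safe (finQ B bt i (root_addr tr (l + 1)) (?h + length H2) (length T2) a) ?st 0 (goal PP)"
    proof (rule cat_leaf[where tr' = ?tr and H = xs and T = T2])
      show "world ?st ?tr" using world_move[OF w, of i "l + 1"] i by simp
      show "sm (xs @ fl ?tr i @ T2) = CC" using CC' f by simp
      show "qok xs T2 (fl ?tr i)" using q2(3,4) f srtx xl True lx xne by (simp add: qok_def)
      have "qpot f2 xs T2 \<le> qpot f1 H1 T1 + qpot f2 H2 T2" using lens(1) f1 lx by (auto simp: qpot_def)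
      then show "300 * bt * card (vL ?st) + 900 * qpot (fl ?tr i) xs T2 \<le> PP" using f by simp
    qed (use i none out s2 h f lens lx in auto)
    then have "safe ?p ?st 0 (goal PP)" using True by simp
    from pre[OF this] show ?thesis by (intro exI[of _ 0]) simp
  next
    case False
    have "length (take (2 * bt) xs) = 2 * bt" using False lx by simp
    then obtain H ys where hy: "H @ ys = xs" and lH0: "length H = 2 * bt"
      using append_take_drop_id[of "2 * bt" xs] by blast
    have lH: "length H = 2 * bt" "length ys = ?h + length H2 - 2 * bt"
      using lH0 lx length_append[of H ys, unfolded hy] by simp_all
    have so: "sorted_wrt (<) H" "sorted_wrt (<) ys" "\<forall>x\<in>set H. \<forall>y\<in>set ys. x < y"
      using srtx unfolding hy[symmetric] sorted_wrt_append by simp_all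
    have sH: "seg ?m2 (hh i) H" and sy: "seg (vm ?st) (hh i + 2 * bt) ys"
      using s2 unfolding hy[symmetric] seg_append lH(1) by simp_all
    have sT: "seg ?m2 (tt i) T2" by simp
    have cH: "H \<noteq> []" using lH bt by auto
    have subH: "set H \<subseteq> set xs" unfolding hy[symmetric] by simp
    have subY: "set ys \<subseteq> set xs" unfolding hy[symmetric] by simp
    \<comment> \<open>Together the heads have more than \<open>3 * bt\<close> elements, of which the
      new head keeps \<open>2 * bt\<close>.\<close>
    have qp: "2 * bt + length T2 + bt \<le> qpot f1 H1 T1 + qpot f2 H2 T2"
    proof (cases "f2 = []")
      case True
      then have "T2 = []" using q2(3) by (simp add: qok_def)
      then show ?thesis using True f1 False lens(1) by (simp add: qpot_def)
    next
      case fne: False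
      then show ?thesis using f1 False lens(1) by (simp add: qpot_def)
    qed
    have "safe (emit B bt (hh i + 2 * bt) (?h + length H2 - 2 * bt) a (\<lambda>a c.
         if root_addr tr (l + 1) = 0 then finQ B bt i a (2 * bt) (length T2) c
         else catP B a (root_addr tr (l + 1)) (\<lambda>g. finQ B bt i g (2 * bt) (length T2) c))) ?st (62 + 90) (goal (PP - 300 * bt))"
    proof (rule safe_emit)
      fix st' tr' a' assume em: "emitted ?st tr st' tr' ys a a'"
      have w': "world st' tr'" and o': "\<forall>m. m \<noteq> l + 2 \<longrightarrow> tr' m = tr m" and n': "tr' (l + 2) \<noteq> None"
        and sm': "sm (fl tr' (l + 2)) = sm ys" "set (fl tr' (l + 2)) \<subseteq> set ys"
        and v': "vm st' = ?m2" "vres st' = vres st" "hinv st' a'" "a' \<le> a + 2" "esum st' = esum st + length ys"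
        "card (vL st') \<le> card (vL st) + 2" using em by (auto simp: emitted_def)
      have EEb: "esum st' + length H + length T2 \<le> EE" using v'(5) lH lens False by simp
      have leaf: "safe (finQ B bt i (root_addr tr'' (l + 2)) (2 * bt) (length T2) a') (st'\<lparr>vfd := fd'\<rparr>) m (goal (PP - 300 * bt))"
        if w2: "world (st'\<lparr>vfd := fd'\<rparr>) tr''" and o2: "\<forall>m. m \<noteq> l + 1 \<longrightarrow> m \<noteq> l + 2 \<longrightarrow> tr'' m = tr m"
          and n2: "tr'' (l + 1) = None" "tr'' (l + 2) \<noteq> None" and sm2: "sm (fl tr'' (l + 2)) = sm (ys @ f2)"
          and sub2: "set (fl tr'' (l + 2)) \<subseteq> set ys \<union> set f2" for tr'' fd' m
      proof -
        let ?tr = "tr''(i := tr'' (l + 2), l + 2 := None)"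
        have f: "fl ?tr i = fl tr'' (l + 2)" "root_addr ?tr i = root_addr tr'' (l + 2)" using i by (auto intro!: fl_eq_other)
        have fne: "fl tr'' (l + 2) \<noteq> []" using fl_eq_Nil[OF w2] n2 by simp
        show ?thesis
        proof (rule cat_leaf[where tr' = ?tr and H = H and T = T2])
          show "world (st'\<lparr>vfd := fd'\<rparr>) ?tr" using world_move[OF w2, of i "l + 2"] i by simp
          have "sm (H @ fl tr'' (l + 2) @ T2) = sm (H @ (ys @ f2) @ T2)"
            by (rule sm_append_cong[OF refl], rule sm_append_cong[OF sm2 refl])
          also have "\<dots> = CC" unfolding CC' by (metis append_assoc hy)
          finally show "sm (H @ fl ?tr i @ T2) = CC" using f by simp
          have "\<forall>x\<in>set H. \<forall>y\<in>set (fl tr'' (l + 2)) \<union> set T2. x < y"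
            using so(3) sub2 subH xl by blast
          then show "qok H T2 (fl ?tr i)" using f so(1) lH cH fne q2(3) by (simp add: qok_def)
          have "qpot (fl tr'' (l + 2)) H T2 = 2 * bt + length T2" using fne lH by (simp add: qpot_def)
          then show "300 * bt * card (vL (st'\<lparr>vfd := fd'\<rparr>)) + 900 * qpot (fl ?tr i) H T2 \<le> PP - 300 * bt"
            using cost_bound(1)[OF v'(6), of "2 * bt + length T2"] qp f by simp
          show "\<forall>k\<ge>l. ?tr k = None"
          proof (intro allI impI)
            fix k assume "l \<le> k"
            then show "?tr k = None" using none o2 n2(1) i by (cases "k = l + 1"; cases "k = l + 2") auto
          qed
          show "\<forall>m\<le>l. m \<noteq> i \<longrightarrow> ?tr m = tr m" using o2 by auto
        qed (use v' out sH sT lH f EEb in auto)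
      qed
      show "safe (if root_addr tr (l + 1) = 0 then finQ B bt i (root_addr tr' (l + 2)) (2 * bt) (length T2) a'
         else catP B (root_addr tr' (l + 2)) (root_addr tr (l + 1)) (\<lambda>g. finQ B bt i g (2 * bt) (length T2) a')) st' 62 (goal (PP - 300 * bt))"
      proof (cases "tr (l + 1) = None")
        case True
        then have "f2 = []" by (simp add: fl_def)
        then have "safe (finQ B bt i (root_addr tr' (l + 2)) (2 * bt) (length T2) a') (st'\<lparr>vfd := vfd st'\<rparr>) 62 (goal (PP - 300 * bt))"
          by (intro leaf) (use w' o' n' sm' True in auto)
        then show ?thesis using True by (simp add: root_addr_def)
      next
        case ne: False
        have r1: "root_addr tr' (l + 1) = root_addr tr (l + 1)" "fl tr' (l + 1) = f2" using o' by (auto intro!: fl_eq_other)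
        have "safe (catP B (root_addr tr' (l + 2)) (root_addr tr' (l + 1)) (\<lambda>g. finQ B bt i g (2 * bt) (length T2) a')) st' (0 + 62) (goal (PP - 300 * bt))"
        proof (rule safe_wcat[OF w'])
          fix fd' tr''
          assume 3: "world (st'\<lparr>vfd := fd'\<rparr>) tr''" "\<forall>m. m \<noteq> l + 2 \<longrightarrow> m \<noteq> l + 1 \<longrightarrow> tr'' m = tr' m"
            "tr'' (l + 1) = None" "tr'' (l + 2) \<noteq> None" "sm (fl tr'' (l + 2)) = sm (fl tr' (l + 2) @ fl tr' (l + 1))"
            "set (fl tr'' (l + 2)) \<subseteq> set (fl tr' (l + 2)) \<union> set (fl tr' (l + 1))"
          show "safe (finQ B bt i (root_addr tr'' (l + 2)) (2 * bt) (length T2) a') (st'\<lparr>vfd := fd'\<rparr>) 0 (goal (PP - 300 * bt))"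
          proof (rule leaf[OF 3(1)])
            show "sm (fl tr'' (l + 2)) = sm (ys @ f2)" unfolding 3(5) r1 by (rule sm_append_cong[OF sm'(1) refl])
            show "set (fl tr'' (l + 2)) \<subseteq> set ys \<union> set f2" using 3(6) sm'(2) r1 by auto
          qed (use 3 o' in auto)
        qed (use n' ne o' in auto)
        moreover have "root_addr tr (l + 1) \<noteq> 0" using ne root_eq_0[OF w] by simp
        ultimately show ?thesis using r1 by simp
      qed
    qed (use w none sy so lH zones lens False h aW i in \<open>auto simp: zone_eqs\<close>)
    then have "safe ?p ?st 152 (goal (PP - 300 * bt))" using False by simp
    from safe_mono[OF pre[OF this], of 300] show ?thesis
      using cost_bound(2)[OF le_add1 qp] by (intro exI[of _ 300]) simp
  qed
qed

text \<open>Every branch except the one that just extends the tail creates records. Without a second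
  tree the payment comes from the \<open>bt\<close> or more buffered elements turned into records,
  otherwise from the potential share that the second queue had for its head.\<close>

lemma cat_big:
  assumes e: "H1' \<noteq> []" and g1: "tr i \<noteq> None"
  shows "\<exists>n\<le>300. n * bt \<le> PP \<and>
    safe (catBig B bt i j (root_addr tr i) (length H1') (length T1') (root_addr tr (l + 1)) (length H2) (length T2) a)
      (st\<lparr>vm := put (vm st) (tt i + length T1') H2\<rparr>) n (goal (PP - n * bt))"
proof -
  define xs where "xs = T1' @ H2"
  define h' where "h' = length H1'"
  let ?t = "length T1'"
  let ?m1 = "put (vm st) (tt i + ?t) H2"
  let ?st1 = "st\<lparr>vm := ?m1\<rparr>"
  let ?g2 = "root_addr tr (l + 1)"
  have lx: "?t + length H2 = length xs" by (simp add: xs_def)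
  have lxs: "length xs \<le> length T1 + length H2" "length xs < 4 * bt" using lens by (auto simp: xs_def)
  have hl: "h' \<le> length H1" using lens(1) by (simp add: h'_def)
  have f1: "f1 \<noteq> []" using g1 fl_eq_Nil[OF w] by simp
  have out1: "?m1 x = vm st x" if "\<not> inz i x" for x
    by (rule put_inz[OF _ _ that]; use lens in \<open>simp add: zone_eqs\<close>)
  have "seg (vm st) (hh i) H1'" using seg_append[of "vm st" "hh i" H1' "dropWhile (\<lambda>x. x < e0) H1"] q1(1) by simp
  then have sH: "seg ?m1 (hh i) H1'" using lens by (subst seg_put_other) (auto simp: zone_eqs)
  have "seg (vm st) (tt i) T1'" using seg_append[of "vm st" "tt i" T1' "dropWhile (\<lambda>x. x < e0) T1"] q1(2) by simp
  then have sx: "seg ?m1 (tt i) xs" unfolding xs_def seg_append by (subst seg_put_other) auto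
  have sTj: "seg ?m1 (tt j) T2" using q2(2) zones lens by (subst seg_put_other) (auto simp: zone_eqs)
  have srtx: "sorted_wrt (<) xs" using srt(3,6) trim_less unfolding xs_def sorted_wrt_append by blast
  have CC': "CC = sm (H1' @ f1 @ xs @ f2 @ T2)" using CC_trim by (simp add: xs_def)
  have xf: "\<forall>x\<in>set xs. \<forall>y\<in>set f2. x < y" using trim_less q2(3) unfolding xs_def qok_def set_append by blast
  have Hl: "\<forall>x\<in>set H1'. \<forall>y\<in>set f1 \<union> set xs \<union> set f2 \<union> set T2. x < y" using H1_less unfolding xs_def set_append by blast
  have w1: "world ?st1 tr" using w by simp
  have h1: "hinv ?st1 a" using h by simp
  have ne: "i \<noteq> l + 1" "i \<noteq> l + 2" using i by auto
  have qp1: "qpot f1 H1 T1 = 2 * bt + length T1 + (length H1 - 2 * bt)" using f1 by (simp add: qpot_def)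
  have fin: "safe (finQ B bt i (root_addr tr'' i) h' tn a') st'' m (goal (PP - 300 * bt))"
    if c: "world st'' tr''" "\<forall>m\<le>l. m \<noteq> i \<longrightarrow> tr'' m = tr m" "\<forall>k\<ge>l. tr'' k = None"
      "\<forall>x. \<not> inz i x \<longrightarrow> vm st'' x = vm st x" "seg (vm st'') (hh i) H1'" "seg (vm st'') (tt i) T" "tr'' i \<noteq> None"
      "sm (fl tr'' i @ T) = sm (f1 @ xs @ f2 @ T2)" "set (fl tr'' i) \<subseteq> set f1 \<union> set xs \<union> set f2" "T = T2 \<or> T = []"
      "vres st'' = vres st" "hinv st'' a'" "a' \<le> a + 2" "esum st'' \<le> esum st + length xs" "card (vL st'') \<le> card (vL st) + 2"
      "length xs + length T \<le> length T1 + length H2 + length T2"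
      "2 * bt + length T + (h' - 2 * bt) + bt \<le> qpot f1 H1 T1 + qpot f2 H2 T2" "length T = tn"
    for st'' tr'' T tn a' m
  proof (rule cat_leaf[where tr' = tr'' and H = H1' and T = T])
    have fne: "fl tr'' i \<noteq> []" using fl_eq_Nil[OF c(1)] c(7) by simp
    have sub: "set T \<subseteq> set T2" "length T < bt" "sorted_wrt (<) T" using c(10) lens bt srt(4) by auto
    have "\<forall>x\<in>set H1'. \<forall>y\<in>set (fl tr'' i) \<union> set T. x < y" using Hl c(9) sub(1) by blast
    then show "qok H1' T (fl tr'' i)" using e fne sub srt(5) lens by (simp add: qok_def)
    show "sm (H1' @ fl tr'' i @ T) = CC" unfolding CC' by (rule sm_append_cong[OF refl c(8)])
    show "esum st'' + length H1' + length T \<le> EE" using c(14,16) hl by (simp add: h'_def)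
    have "qpot (fl tr'' i) H1' T = 2 * bt + length T + (h' - 2 * bt)" using fne by (simp add: qpot_def h'_def)
    then show "300 * bt * card (vL st'') + 900 * qpot (fl tr'' i) H1' T \<le> PP - 300 * bt"
      using cost_bound(1)[OF c(15,17)] by simp
  qed (use c h'_def in auto)
  have E: "16 * (a + 2) + 15 \<le> W" by (rule aW)
  have nn: "tr (l + 2) = None" "tr (l + 3) = None" using none by auto
  show ?thesis
  proof (cases "tr (l + 1) = None")
    case True
    then have f2: "f2 = []" and g2: "?g2 = 0" by (simp_all add: fl_def root_addr_def)
    then have T2: "T2 = []" using q2(3) by (simp add: qok_def)
    have none': "\<forall>k\<ge>l. tr k = None" using none True by auto
    have qp2: "qpot f2 H2 T2 = length H2" using f2 by (simp add: qpot_def)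
    show ?thesis
    proof (cases "length xs < bt")
      case small: True
      have "safe (finQ B bt i (root_addr tr i) (length H1') (length xs) a) ?st1 0 (goal PP)"
      proof (rule cat_leaf[where tr' = tr and H = H1' and T = xs])
        show "qok H1' xs f1" using Hl srt(5) srtx lens e f1 small by (auto simp: qok_def)
        show "sm (H1' @ f1 @ xs) = CC" using CC' f2 T2 by simp
        have "qpot f1 H1' xs \<le> qpot f1 H1 T1 + qpot f2 H2 T2"
          unfolding qp1 qp2 using f1 hl lxs by (simp add: qpot_def h'_def)
        then show "300 * bt * card (vL ?st1) + 900 * qpot f1 H1' xs \<le> PP" by simp
        show "esum ?st1 + length H1' + length xs \<le> EE" using lxs hl by (simp add: h'_def)
      qed (use w1 none' out1 sH sx h1 in auto)
      then have "safe (catBig B bt i j (root_addr tr i) (length H1') ?t ?g2 (length H2) (length T2) a) ?st1 0 (goal PP)"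
        unfolding catBig_def lx using g2 small by simp
      then show ?thesis by (intro exI[of _ 0]) simp
    next
      case big: False
      have qp: "2 * bt + 0 + (h' - 2 * bt) + bt \<le> qpot f1 H1 T1 + qpot f2 H2 T2"
        unfolding qp1 qp2 using hl lxs big by simp
      have "safe (emit B bt (tt i) (length xs) a (\<lambda>a c. catP B (root_addr tr i) a (\<lambda>g. finQ B bt i g h' 0 c))) ?st1 (62 + 90) (goal (PP - 300 * bt))"
      proof (rule safe_emit[OF w1 nn])
        fix st' tr' a' assume em: "emitted ?st1 tr st' tr' xs a a'"
        have w': "world st' tr'" and o': "\<forall>m. m \<noteq> l + 2 \<longrightarrow> tr' m = tr m" and n': "tr' (l + 2) \<noteq> None"
          and sm': "sm (fl tr' (l + 2)) = sm xs" "set (fl tr' (l + 2)) \<subseteq> set xs"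
          and v': "vm st' = ?m1" "vres st' = vres st" "hinv st' a'" "a' \<le> a + 2" "esum st' = esum st + length xs"
          "card (vL st') \<le> card (vL st) + 2" using em by (auto simp: emitted_def)
        have r1: "root_addr tr' i = root_addr tr i" "fl tr' i = f1" using o' ne by (auto intro!: fl_eq_other)
        have "safe (catP B (root_addr tr' i) (root_addr tr' (l + 2)) (\<lambda>g. finQ B bt i g h' 0 a')) st' (0 + 62) (goal (PP - 300 * bt))"
        proof (rule safe_wcat[OF w'])
          fix fd' tr''
          assume 3: "world (st'\<lparr>vfd := fd'\<rparr>) tr''" "\<forall>m. m \<noteq> i \<longrightarrow> m \<noteq> l + 2 \<longrightarrow> tr'' m = tr' m"
            "tr'' (l + 2) = None" "tr'' i \<noteq> None" "sm (fl tr'' i) = sm (fl tr' i @ fl tr' (l + 2))"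
            "set (fl tr'' i) \<subseteq> set (fl tr' i) \<union> set (fl tr' (l + 2))"
          show "safe (finQ B bt i (root_addr tr'' i) h' 0 a') (st'\<lparr>vfd := fd'\<rparr>) 0 (goal (PP - 300 * bt))"
          proof (rule fin[where T = "[]"])
            show "sm (fl tr'' i @ []) = sm (f1 @ xs @ f2 @ T2)"
              unfolding append_Nil2 3(5) r1 f2 T2 by (rule sm_append_cong[OF refl sm'(1)])
            show "set (fl tr'' i) \<subseteq> set f1 \<union> set xs \<union> set f2" using 3(6) sm'(2) unfolding r1 by blast
            show "\<forall>k\<ge>l. tr'' k = None"
            proof (intro allI impI)
              fix k assume "l \<le> k"
              then show "tr'' k = None" using 3(2,3) o' none' i by (cases "k = l + 1"; cases "k = l + 2") auto
            qed
            show "\<forall>m\<le>l. m \<noteq> i \<longrightarrow> tr'' m = tr m" using 3(2) o' by auto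
          qed (use 3(1,4) v' out1 sH lxs qp in auto)
        qed (use ne n' o' g1 in auto)
        then show "safe (catP B (root_addr tr i) (root_addr tr' (l + 2)) (\<lambda>g. finQ B bt i g h' 0 a')) st' 62 (goal (PP - 300 * bt))"
          unfolding r1 by simp
      qed (use sx srtx big lxs zones h1 aW in \<open>auto simp: zone_eqs\<close>)
      then have "safe (catBig B bt i j (root_addr tr i) (length H1') ?t ?g2 (length H2) (length T2) a) ?st1 152 (goal (PP - 300 * bt))"
        unfolding catBig_def lx h'_def using g2 big by simp
      from safe_mono[OF this, of 300] show ?thesis using cost_bound(2)[OF le_add1 qp] by (intro exI[of _ 300]) simp
    qed
  next
    case False
    then obtain r2 where r2: "tr (l + 1) = Some r2" by auto
    note wr = world_root[OF w r2]
    have g2: "?g2 \<noteq> 0" using False root_eq_0[OF w] by simp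
    have f2ne: "f2 \<noteq> []" using False fl_eq_Nil[OF w] by simp
    \<comment> \<open>The second queue contributed at least \<open>2 * bt + length T2\<close>; only
      \<open>length T2\<close> survives of this.\<close>
    have qp: "2 * bt + length T2 + (h' - 2 * bt) + bt \<le> qpot f1 H1 T1 + qpot f2 H2 T2"
      unfolding qp1 using hl f2ne by (simp add: qpot_def)
    let ?fin = "\<lambda>g c. copyN (tt j) (tt i) (length T2) (finQ B bt i g h' (length T2) c)"
    have fin2: "safe (?fin (root_addr tr'' i) a') st'' m (goal (PP - 300 * bt))"
      if c: "world st'' tr''" "\<forall>m\<le>l. m \<noteq> i \<longrightarrow> tr'' m = tr m" "\<forall>k\<ge>l. tr'' k = None"
        "\<forall>x. \<not> inz i x \<longrightarrow> vm st'' x = vm st x" "seg (vm st'') (hh i) H1'" "tr'' i \<noteq> None"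
        "sm (fl tr'' i) = sm (f1 @ xs @ f2)" "set (fl tr'' i) \<subseteq> set f1 \<union> set xs \<union> set f2"
        "vres st'' = vres st" "hinv st'' a'" "a' \<le> a + 2" "esum st'' \<le> esum st + length xs" "card (vL st'') \<le> card (vL st) + 2"
      for st'' tr'' a' m
    proof -
      let ?st = "st''\<lparr>vm := put (vm st'') (tt i) T2\<rparr>"
      have "safe (finQ B bt i (root_addr tr'' i) h' (length T2) a') ?st m (goal (PP - 300 * bt))"
      proof (rule fin[where T = T2])
        show "seg (vm ?st) (hh i) H1'" using c(5) lens by (simp, subst seg_put_other) (auto simp: zone_eqs)
        have "put (vm st'') (tt i) T2 x = vm st'' x" if "\<not> inz i x" for x
          by (rule put_inz[OF _ _ that]; use lens in \<open>simp add: zone_eqs\<close>)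
        then show "\<forall>x. \<not> inz i x \<longrightarrow> vm ?st x = vm st x" using c(4) by simp
        show "sm (fl tr'' i @ T2) = sm (f1 @ xs @ f2 @ T2)" using sm_append_cong[OF c(7) refl, of T2] by simp
      qed (use c lxs qp in auto)
      moreover have "seg (vm st'') (tt j) T2"
      proof -
        have "seg (vm st'') (tt j) T2 = seg (vm st) (tt j) T2"
        proof (rule seg_cong)
          fix x assume "tt j \<le> x" "x < tt j + length T2"
          then have "inz j x" using lens by (simp add: inz_def zone_eqs)
          then show "vm st'' x = vm st x" using c(4) zone_disj[of j i x] ij by auto
        qed
        then show ?thesis using q2(2) by simp
      qed
      ultimately show ?thesis by (intro safe_copyN) (use zones lens in \<open>auto simp: zone_eqs\<close>)
    qed
    show ?thesis
    proof (cases "bt \<le> length xs")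
      case True
      have "safe (emit B bt (tt i) (length xs) a (\<lambda>a c. catP B (root_addr tr i) a (\<lambda>g. catP B g ?g2 (\<lambda>g. ?fin g c)))) ?st1 (124 + 90) (goal (PP - 300 * bt))"
      proof (rule safe_emit[OF w1 nn])
        fix st' tr' a' assume em: "emitted ?st1 tr st' tr' xs a a'"
        have w': "world st' tr'" and o': "\<forall>m. m \<noteq> l + 2 \<longrightarrow> tr' m = tr m" and n': "tr' (l + 2) \<noteq> None"
          and sm': "sm (fl tr' (l + 2)) = sm xs" "set (fl tr' (l + 2)) \<subseteq> set xs"
          and v': "vm st' = ?m1" "vres st' = vres st" "hinv st' a'" "a' \<le> a + 2" "esum st' = esum st + length xs"
          "card (vL st') \<le> card (vL st) + 2" using em by (auto simp: emitted_def)
        have r1: "root_addr tr' i = root_addr tr i" "fl tr' i = f1" using o' ne by (auto intro!: fl_eq_other)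
        have "safe (catP B (root_addr tr' i) (root_addr tr' (l + 2)) (\<lambda>g. catP B g ?g2 (\<lambda>g. ?fin g a'))) st' (62 + 62) (goal (PP - 300 * bt))"
        proof (rule safe_wcat[OF w'])
          fix fd' tr''
          assume 3: "world (st'\<lparr>vfd := fd'\<rparr>) tr''" "\<forall>m. m \<noteq> i \<longrightarrow> m \<noteq> l + 2 \<longrightarrow> tr'' m = tr' m"
            "tr'' (l + 2) = None" "tr'' i \<noteq> None" "sm (fl tr'' i) = sm (fl tr' i @ fl tr' (l + 2))"
            "set (fl tr'' i) \<subseteq> set (fl tr' i) \<union> set (fl tr' (l + 2))"
          have u: "tr'' (l + 1) = tr (l + 1)" using 3(2) o' ne by auto
          have r3: "root_addr tr'' (l + 1) = ?g2" "fl tr'' (l + 1) = f2" using u by (auto intro!: fl_eq_other)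
          have "safe (catP B (root_addr tr'' i) (root_addr tr'' (l + 1)) (\<lambda>g. ?fin g a')) (st'\<lparr>vfd := fd'\<rparr>) (0 + 62) (goal (PP - 300 * bt))"
          proof (rule safe_wcat[OF 3(1)])
            fix fd2 tr3
            assume 4: "world (st'\<lparr>vfd := fd', vfd := fd2\<rparr>) tr3" "\<forall>m. m \<noteq> i \<longrightarrow> m \<noteq> l + 1 \<longrightarrow> tr3 m = tr'' m"
              "tr3 (l + 1) = None" "tr3 i \<noteq> None" "sm (fl tr3 i) = sm (fl tr'' i @ fl tr'' (l + 1))"
              "set (fl tr3 i) \<subseteq> set (fl tr'' i) \<union> set (fl tr'' (l + 1))"
            show "safe (?fin (root_addr tr3 i) a') (st'\<lparr>vfd := fd', vfd := fd2\<rparr>) 0 (goal (PP - 300 * bt))"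
            proof (rule fin2[OF 4(1)])
              have "sm (fl tr'' i) = sm (f1 @ xs)" unfolding 3(5) r1 by (rule sm_append_cong[OF refl sm'(1)])
              then have "sm (fl tr'' i @ f2) = sm ((f1 @ xs) @ f2)" by (rule sm_append_cong[OF _ refl])
              then show "sm (fl tr3 i) = sm (f1 @ xs @ f2)" unfolding 4(5) r3 by simp
              show "set (fl tr3 i) \<subseteq> set f1 \<union> set xs \<union> set f2" using 4(6) 3(6) sm'(2) unfolding r1 r3 by blast
              show "\<forall>k\<ge>l. tr3 k = None"
              proof (intro allI impI)
                fix k assume "l \<le> k"
                then show "tr3 k = None" using 4(2,3) 3(2,3) o' none i by (cases "k = l + 1"; cases "k = l + 2") auto
              qed
              show "\<forall>m\<le>l. m \<noteq> i \<longrightarrow> tr3 m = tr m" using 4(2) 3(2) o' by auto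
            qed (use 4(4) v' out1 sH in auto)
          qed (use 3(4) u False ne in auto)
          then show "safe (catP B (root_addr tr'' i) ?g2 (\<lambda>g. ?fin g a')) (st'\<lparr>vfd := fd'\<rparr>) 62 (goal (PP - 300 * bt))"
            unfolding r3 by simp
        qed (use ne n' o' g1 in auto)
        then show "safe (catP B (root_addr tr i) (root_addr tr' (l + 2)) (\<lambda>g. catP B g ?g2 (\<lambda>g. ?fin g a'))) st' 124 (goal (PP - 300 * bt))"
          unfolding r1 by simp
      qed (use sx srtx True lxs zones h1 aW in \<open>auto simp: zone_eqs\<close>)
      then have "safe (catBig B bt i j (root_addr tr i) (length H1') ?t ?g2 (length H2) (length T2) a) ?st1 214 (goal (PP - 300 * bt))"
        unfolding catBig_def lx h'_def using g2 True by simp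
      from safe_mono[OF this, of 300] show ?thesis using cost_bound(2)[OF le_add1 qp] by (intro exI[of _ 300]) simp
    next
      \<comment> \<open>The tail is too short for a record, so it is merged with the first record of
        the second tree. Both lists are sorted and \<open>xf\<close> separates them, so the result
        is again a legal record content.\<close>
      case small: False
      define ys where "ys = els r2"
      define zs where "zs = flt (tl (prs r2))"
      have ys: "vel st ?g2 = ys" "?g2 \<in> vL st" "?g2 = ad r2" "f2 = ys @ zs" using wr by (simp_all add: ys_def zs_def)
      have ly: "bt \<le> length ys" "length ys \<le> 2 * bt" "sorted_wrt (<) ys" using h ys(1,2) by (auto simp: hinv_def)
      let ?m2 = "put ?m1 (tt i + length xs) ys"
      let ?st2 = "st\<lparr>vm := ?m2\<rparr>"
      have sxy: "seg ?m2 (tt i) (xs @ ys)" unfolding seg_append using sx by (subst seg_put_other) auto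
      have sH2: "seg ?m2 (hh i) H1'" using sH lens by (subst seg_put_other) (auto simp: zone_eqs)
      have out2: "?m2 x = vm st x" if "\<not> inz i x" for x
      proof -
        have "?m2 x = ?m1 x" by (rule put_inz[OF _ _ that]; use small ly in \<open>simp add: zone_eqs\<close>)
        then show ?thesis using out1[OF that] by simp
      qed
      have srtxy: "sorted_wrt (<) (xs @ ys)" using srtx ly(3) xf ys(4) by (simp add: sorted_wrt_append)
      have w2: "world ?st2 tr" using w by simp
      let ?n = "length ys"
      let ?cont = "\<lambda>g2. emit B bt (tt i) (length xs + ?n) a (\<lambda>a c. catP B (root_addr tr i) a (\<lambda>g.
           if g2 = 0 then ?fin g c else catP B g g2 (\<lambda>g. ?fin g c)))"
      have "safe (popP B ?g2 ?cont) ?st2 (214 + 40) (goal (PP - 300 * bt))"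
      proof (rule safe_wpop[OF w2 r2])
        fix fd0 tr0
        let ?st3 = "?st2\<lparr>vL := vL ?st2 - {ad r2}, vfd := fd0\<rparr>"
        assume 2: "world ?st3 tr0" "\<forall>m. m \<noteq> l + 1 \<longrightarrow> tr0 m = tr m" "sm (fl tr0 (l + 1)) = sm (flt (tl (prs r2)))"
          "set (fl tr0 (l + 1)) \<subseteq> set (flt (tl (prs r2)))"
        have hb: "hinv ?st2 a" "ad r2 \<in> vL ?st2" using h ys(2,3) by simp_all
        have h3: "hinv ?st3 a" "esum ?st3 + ?n = esum st" "card (vL ?st3) \<le> card (vL st)"
          using hinv_free(1)[OF hb, of fd0] hinv_free(2)[OF hb, of fd0] hinv_free(3)[OF hb] ys(1,3) by simp_all
        have nn3: "tr0 (l + 2) = None" "tr0 (l + 3) = None" using nn 2(2) by auto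
        show "safe (?cont (root_addr tr0 (l + 1))) ?st3 214 (goal (PP - 300 * bt))"
        proof (rule safe_mono[OF safe_emit[OF 2(1) nn3, where m = 124]])
          show "seg (vm ?st3) (tt i) (xs @ ys)" using sxy by simp
          show "sorted_wrt (<) (xs @ ys)" by (rule srtxy)
          show "hinv ?st3 a" by (rule h3)
          fix st' tr' a' assume em: "emitted ?st3 tr0 st' tr' (xs @ ys) a a'"
          have w': "world st' tr'" and o': "\<forall>m. m \<noteq> l + 2 \<longrightarrow> tr' m = tr0 m" and n': "tr' (l + 2) \<noteq> None"
            and sm': "sm (fl tr' (l + 2)) = sm (xs @ ys)" "set (fl tr' (l + 2)) \<subseteq> set (xs @ ys)"
            and v': "vm st' = ?m2" "vres st' = vres st" "hinv st' a'" "a' \<le> a + 2" "esum st' = esum ?st3 + length (xs @ ys)"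
            "card (vL st') \<le> card (vL ?st3) + 2" using em by (auto simp: emitted_def)
          \<comment> \<open>The borrowed record is freed before its elements are written again, so
            they are not counted twice.\<close>
          have v2: "esum st' \<le> esum st + length xs" "card (vL st') \<le> card (vL st) + 2" using v'(5,6) h3 by auto
          have r1: "root_addr tr' i = root_addr tr i" "fl tr' i = f1" "tr' i = tr i" using o' 2(2) ne by (auto intro!: fl_eq_other)
          have "safe (catP B (root_addr tr' i) (root_addr tr' (l + 2)) (\<lambda>g. if root_addr tr0 (l + 1) = 0 then ?fin g a'
              else catP B g (root_addr tr0 (l + 1)) (\<lambda>g. ?fin g a'))) st' (62 + 62) (goal (PP - 300 * bt))"
          proof (rule safe_wcat[OF w'])
            fix fd' tr''
            assume 3: "world (st'\<lparr>vfd := fd'\<rparr>) tr''" "\<forall>m. m \<noteq> i \<longrightarrow> m \<noteq> l + 2 \<longrightarrow> tr'' m = tr' m"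
              "tr'' (l + 2) = None" "tr'' i \<noteq> None" "sm (fl tr'' i) = sm (fl tr' i @ fl tr' (l + 2))"
              "set (fl tr'' i) \<subseteq> set (fl tr' i) \<union> set (fl tr' (l + 2))"
            have u: "tr'' (l + 1) = tr0 (l + 1)" using 3(2) o' ne by auto
            have r3: "root_addr tr'' (l + 1) = root_addr tr0 (l + 1)" "fl tr'' (l + 1) = fl tr0 (l + 1)" using u by (auto intro!: fl_eq_other)
            have sm3: "sm (fl tr'' i @ fl tr0 (l + 1)) = sm (f1 @ xs @ f2)"
            proof -
              have "sm (fl tr'' i) = sm (f1 @ xs @ ys)" unfolding 3(5) r1 by (rule sm_append_cong[OF refl sm'(1)])
              then have "sm (fl tr'' i @ fl tr0 (l + 1)) = sm ((f1 @ xs @ ys) @ zs)"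
                by (rule sm_append_cong) (use 2(3) in \<open>simp add: zs_def\<close>)
              then show ?thesis unfolding ys(4) by simp
            qed
            have sub3: "set (fl tr'' i) \<union> set (fl tr0 (l + 1)) \<subseteq> set f1 \<union> set xs \<union> set f2"
              using 3(6) sm'(2) 2(4) unfolding r1 ys(4) zs_def[symmetric] set_append by blast
            show "safe (if root_addr tr0 (l + 1) = 0 then ?fin (root_addr tr'' i) a'
              else catP B (root_addr tr'' i) (root_addr tr0 (l + 1)) (\<lambda>g. ?fin g a')) (st'\<lparr>vfd := fd'\<rparr>) 62 (goal (PP - 300 * bt))"
            proof (cases "tr0 (l + 1) = None")
              case True
              then have "fl tr0 (l + 1) = []" "root_addr tr0 (l + 1) = 0" by (simp_all add: fl_def root_addr_def)
              moreover have "safe (?fin (root_addr tr'' i) a') (st'\<lparr>vfd := fd'\<rparr>) 62 (goal (PP - 300 * bt))"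
              proof (rule fin2[OF 3(1)])
                show "sm (fl tr'' i) = sm (f1 @ xs @ f2)" using sm3 \<open>fl tr0 (l + 1) = []\<close> by simp
                show "set (fl tr'' i) \<subseteq> set f1 \<union> set xs \<union> set f2" using sub3 by blast
                show "\<forall>k\<ge>l. tr'' k = None"
                proof (intro allI impI)
                  fix k assume "l \<le> k"
                  then show "tr'' k = None" using 3(2,3) o' 2(2) none True i u by (cases "k = l + 1"; cases "k = l + 2") auto
                qed
                show "\<forall>m\<le>l. m \<noteq> i \<longrightarrow> tr'' m = tr m" using 3(2) o' 2(2) by auto
              qed (use 3(4) v' v2 out2 sH2 in auto)
              ultimately show ?thesis by simp
            next
              case n0: False
              have "safe (catP B (root_addr tr'' i) (root_addr tr'' (l + 1)) (\<lambda>g. ?fin g a')) (st'\<lparr>vfd := fd'\<rparr>) (0 + 62) (goal (PP - 300 * bt))"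
              proof (rule safe_wcat[OF 3(1)])
                fix fd2 tr3
                assume 4: "world (st'\<lparr>vfd := fd', vfd := fd2\<rparr>) tr3" "\<forall>m. m \<noteq> i \<longrightarrow> m \<noteq> l + 1 \<longrightarrow> tr3 m = tr'' m"
                  "tr3 (l + 1) = None" "tr3 i \<noteq> None" "sm (fl tr3 i) = sm (fl tr'' i @ fl tr'' (l + 1))"
                  "set (fl tr3 i) \<subseteq> set (fl tr'' i) \<union> set (fl tr'' (l + 1))"
                show "safe (?fin (root_addr tr3 i) a') (st'\<lparr>vfd := fd', vfd := fd2\<rparr>) 0 (goal (PP - 300 * bt))"
                proof (rule fin2[OF 4(1)])
                  show "sm (fl tr3 i) = sm (f1 @ xs @ f2)" unfolding 4(5) r3 by (rule sm3)
                  show "set (fl tr3 i) \<subseteq> set f1 \<union> set xs \<union> set f2" using 4(6) sub3 unfolding r3 by blast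
                  show "\<forall>k\<ge>l. tr3 k = None"
                  proof (intro allI impI)
                    fix k assume "l \<le> k"
                    then show "tr3 k = None" using 4(2,3) 3(2,3) o' 2(2) none i by (cases "k = l + 1"; cases "k = l + 2") auto
                  qed
                  show "\<forall>m\<le>l. m \<noteq> i \<longrightarrow> tr3 m = tr m" using 4(2) 3(2) o' 2(2) by auto
                qed (use 4(4) v' v2 out2 sH2 in auto)
              qed (use 3(4) u n0 ne in auto)
              moreover have "root_addr tr0 (l + 1) \<noteq> 0" using root_eq_0[OF 2(1)] n0 by simp
              ultimately show ?thesis unfolding r3 by simp
            qed
          qed (use ne n' g1 r1 in auto)
          then show "safe (catP B (root_addr tr i) (root_addr tr' (l + 2)) (\<lambda>g. if root_addr tr0 (l + 1) = 0 then ?fin g a'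
              else catP B g (root_addr tr0 (l + 1)) (\<lambda>g. ?fin g a'))) st' 124 (goal (PP - 300 * bt))"
            unfolding r1 by simp
        qed (use small ly zones aW in \<open>auto simp: zone_eqs\<close>)
      qed
      then have "safe (loadRec ?g2 (tt i + length xs) ?n (popP B ?g2 ?cont)) ?st1 255 (goal (PP - 300 * bt))"
        by (intro safe_loadRec) (use ys small ly zones in \<open>auto simp: zone_eqs\<close>)
      then have "safe (getF ?g2 11 (\<lambda>n. loadRec ?g2 (tt i + length xs) n (popP B ?g2 (\<lambda>g2. emit B bt (tt i) (length xs + n) a (\<lambda>a c. catP B (root_addr tr i) a (\<lambda>g.
           if g2 = 0 then ?fin g c else catP B g g2 (\<lambda>g. ?fin g c))))))) ?st1 256 (goal (PP - 300 * bt))"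
        by (intro safe_getSize) (use ys in auto)
      then have "safe (catBig B bt i j (root_addr tr i) (length H1') ?t ?g2 (length H2) (length T2) a) ?st1 256 (goal (PP - 300 * bt))"
        unfolding catBig_def lx h'_def using g2 small by simp
      from safe_mono[OF this, of 300] show ?thesis using cost_bound(2)[OF le_add1 qp] by (intro exI[of _ 300]) simp
    qed
  qed
qed

lemma safe_catBody:
  "\<exists>n\<le>300. n * bt \<le> PP \<and>
    safe (catBody B bt i j (root_addr tr i) (length H1) (length T1) (root_addr tr (l + 1)) (length H2) (length T2) a) st n (goal (PP - n * bt))"
proof -
  have ec: "vm st (hh j) = Elem e0" using q2(1,4) by (cases H2) (auto simp: seg_Cons)
  let ?body = "\<lambda>h. if h = 0 then catMove B bt i j (root_addr tr (l + 1)) (length H2) (length T2) a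
      else if root_addr tr i = 0 then catSmall B bt i j h (root_addr tr (l + 1)) (length H2) (length T2) a
      else countL (tt i) (hh j) (length T1) 0 (\<lambda>t. copyN (hh j) (tt i + t) (length H2)
        (catBig B bt i j (root_addr tr i) h t (root_addr tr (l + 1)) (length H2) (length T2) a))"
  have pre: "safe (catBody B bt i j (root_addr tr i) (length H1) (length T1) (root_addr tr (l + 1)) (length H2) (length T2) a) st n Q"
    if "safe (?body (length H1')) st n Q" for n Q
    unfolding catBody_def
    by (rule safe_countL[OF q1(1) refl ec]) (use zones lens that bt in auto)
  show ?thesis
  proof (cases "H1' = []")
    case True
    have "safe (?body (length H1')) st 0 (goal PP)" using cat_move[OF True] True by simp
    from pre[OF this] show ?thesis by (intro exI[of _ 0]) simp
  next
    case ne: False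
    show ?thesis
    proof (cases "tr i = None")
      case True
      from cat_small[OF ne True] obtain n where n: "n \<le> 300" "n * bt \<le> PP"
        "safe (catSmall B bt i j (length H1') (root_addr tr (l + 1)) (length H2) (length T2) a) st n (goal (PP - n * bt))" by blast
      then have "safe (?body (length H1')) st n (goal (PP - n * bt))" using ne True by (simp add: root_addr_def)
      from pre[OF this] show ?thesis using n by blast
    next
      case False
      from cat_big[OF ne False] obtain n where n: "n \<le> 300" "n * bt \<le> PP"
        "safe (catBig B bt i j (root_addr tr i) (length H1') (length T1') (root_addr tr (l + 1)) (length H2) (length T2) a)
           (st\<lparr>vm := put (vm st) (tt i + length T1') H2\<rparr>) n (goal (PP - n * bt))" by blast
      from n(3) have "safe (copyN (hh j) (tt i + length T1') (length H2)
        (catBig B bt i j (root_addr tr i) (length H1') (length T1') (root_addr tr (l + 1)) (length H2) (length T2) a)) st n (goal (PP - n * bt))"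
        by (intro safe_copyN[OF q2(1) refl]) (use zones lens in \<open>auto simp: zone_eqs\<close>)
      then have "safe (countL (tt i) (hh j) (length T1) 0 (\<lambda>t. copyN (hh j) (tt i + t) (length H2)
        (catBig B bt i j (root_addr tr i) (length H1') t (root_addr tr (l + 1)) (length H2) (length T2) a))) st n (goal (PP - n * bt))"
        by (intro safe_countL[OF q1(2) refl ec]) (use zones lens bt in \<open>auto simp: zone_eqs\<close>)
      moreover have "root_addr tr i \<noteq> 0" using False root_eq_0[OF w] by simp
      ultimately have "safe (?body (length H1')) st n (goal (PP - n * bt))" using ne by simp
      from pre[OF this] show ?thesis using n by blast
    qed
  qed
qed

end

end

section \<open>Deletion of the minimum\<close>

context large
begin

text \<open>No I/O is needed while a second element is in the head buffer, or if there is no tree.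
  Otherwise either a record is freed, whose potential is exactly the \<open>300 * bt\<close>
  required, or the tree is abandoned and the head's share of \<open>2 * bt\<close> is
  released.\<close>

lemma safe_delBody:
  assumes inv: "invL st tr a Hs Ts" and i: "i < l" and H: "Hs i = x # H'" and aW: "a \<le> W"
  shows "\<exists>n\<le>300. n * bt \<le> 300 * bt * card (vL st) + 900 * qpot (fl tr i) (Hs i) (Ts i) \<and>
    safe (delBody B bt i (root_addr tr i) (length (Hs i)) (length (Ts i)) a) st n
      (Done i Hs Ts (fl tr) (sm (H' @ fl tr i @ Ts i)) (esum st + length H' + length (Ts i))
        (300 * bt * card (vL st) + 900 * qpot (fl tr i) (Hs i) (Ts i) - n * bt) a (vres st))"
    (is "\<exists>n\<le>300. n * bt \<le> ?P \<and> safe ?prog st n (Done i Hs Ts (fl tr) ?C ?E (?P - n * bt) a (vres st))")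
proof -
  define T where "T = Ts i"
  let ?f = "fl tr i"
  have w: "world st tr" and none: "\<forall>k\<ge>l. tr k = None" and h: "hinv st a"
    and oth: "\<And>k. k \<le> l \<Longrightarrow> k \<noteq> i \<Longrightarrow> qmem (vm st) k (Hs k) (Ts k) (root_addr tr k) \<and> qok (Hs k) (Ts k) (fl tr k)"
    using inv by (auto simp: invL_def)
  have qi: "qmem (vm st) i (Hs i) (Ts i) (root_addr tr i) \<and> qok (Hs i) (Ts i) (fl tr i)"
    using inv i unfolding invL_def by (meson less_imp_le)
  have qm: "qmem (vm st) i (x # H') T (root_addr tr i)" and q: "qok (x # H') T ?f" using qi by (simp_all add: H T_def)
  note leaf = queue_leaf[OF i oth aW]
  have sH: "seg (vm st) (hh i) (x # H')" "seg (vm st) (tt i) T" using qm by (auto simp: qmem_def)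
  have lenH: "length H' < 3 * bt" "length T < bt" using q by (auto simp: qok_def)
  have z: "B < hh i" "hh i + 16 * bt \<le> M" using zone_B[of i] zone_M[of i] i by auto
  show ?thesis
  proof (cases "H' = []")
    case False
    let ?m = "put (vm st) (hh i) H'"
    have "safe (finQ B bt i (root_addr tr i) (length H') (length T) a) (st\<lparr>vm := ?m\<rparr>) 0
        (Done i Hs Ts (fl tr) ?C ?E ?P a (vres st))"
    proof (rule leaf[where tr' = tr and H = H' and T = T])
      have "?m y = vm st y" if "\<not> inz i y" for y by (rule put_inz[OF _ _ that]) (use lenH in auto)
      then show "\<forall>y. \<not> inz i y \<longrightarrow> vm (st\<lparr>vm := ?m\<rparr>) y = vm st y" by simp
      show "qok H' T ?f" using q False by (auto simp: qok_def)
      have "qpot ?f H' T \<le> qpot ?f (Hs i) (Ts i)" by (auto simp: qpot_def H T_def intro: diff_le_mono)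
      then show "300 * bt * card (vL (st\<lparr>vm := ?m\<rparr>)) + 900 * qpot ?f H' T \<le> ?P" by simp
      show "seg (vm (st\<lparr>vm := ?m\<rparr>)) (tt i) T" using sH(2) lenH by (simp, subst seg_put_other) (auto simp: zone_eqs)
    qed (use w none h in \<open>auto simp: T_def\<close>)
    then have "safe (copyN (hh i + 1) (hh i) (length H') (finQ B bt i (root_addr tr i) (length H') (length T) a)) st 0
        (Done i Hs Ts (fl tr) ?C ?E ?P a (vres st))"
      by (intro safe_copyN[where xs = H']) (use sH z lenH in \<open>auto simp: seg_Cons\<close>)
    moreover have "2 \<le> length (Hs i)" using H False by (cases H') auto
    ultimately have "safe ?prog st 0 (Done i Hs Ts (fl tr) ?C ?E ?P a (vres st))"
      unfolding delBody_def by (simp add: H T_def)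
    then show ?thesis by (intro exI[of _ 0]) simp
  next
    case H': True
    have l1: "\<not> 2 \<le> length (Hs i)" using H H' by simp
    show ?thesis
    proof (cases "tr i")
      case None
      then have f: "?f = []" "root_addr tr i = 0" by (simp_all add: fl_def root_addr_def)
      then have T: "T = []" using q by (simp add: qok_def)
      have "safe (finQ B bt i 0 0 0 a) st 0 (Done i Hs Ts (fl tr) ?C ?E ?P a (vres st))"
      proof (rule leaf[where tr' = tr and H = "[]" and T = "[]"])
        show "qok [] [] ?f" using f bt by (simp add: qok_def)
        show "sm ([] @ ?f @ []) = ?C" using f T H' by (simp add: T_def)
      qed (use w none h f H' in \<open>auto simp: qpot_def\<close>)
      then have "safe ?prog st 0 (Done i Hs Ts (fl tr) ?C ?E ?P a (vres st))"
        unfolding delBody_def using l1 f by simp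
      then show ?thesis by (intro exI[of _ 0]) simp
    next
      case (Some r)
      note wr = world_root[OF w Some]
      define ys where "ys = els r"
      define zs where "zs = flt (tl (prs r))"
      define g where "g = ad r"
      have g: "root_addr tr i = g" "g \<in> vL st" "vel st g = ys" "ys \<noteq> []" "?f = ys @ zs" "\<forall>y\<in>set zs. hd ys < y" "g \<noteq> 0"
        using wr by (auto simp: ys_def zs_def g_def)
      have ly: "bt \<le> length ys" "length ys \<le> 2 * bt" "sorted_wrt (<) ys" using h g(2,3) by (auto simp: hinv_def)
      \<comment> \<open>The head has a single element, so the truncated difference in
        \<open>qpot\<close> is 0.\<close>
      have P: "?P = 300 * bt * card (vL st) + 900 * (2 * bt + length T)"
        using g(4,5) H H' bt by (simp add: qpot_def T_def)
      have C: "?C = sm (ys @ zs @ T)" using g(5) H' by (simp add: T_def)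
      have E: "?E = esum st + length T" using H' by (simp add: T_def)
      have hT: "\<forall>y\<in>set T. hd T \<le> y" "sorted_wrt (<) T" using q sorted_hd_le[of T] by (auto simp: qok_def)
      let ?m1 = "put (vm st) (hh i) ys"
      let ?st1 = "st\<lparr>vm := ?m1\<rparr>"
      have out1: "?m1 y = vm st y" if "\<not> inz i y" for y by (rule put_inz[OF _ _ that]) (use ly in auto)
      have sT1: "seg ?m1 (tt i) T" using sH(2) ly by (subst seg_put_other) (auto simp: zone_eqs)
      \<comment> \<open>The tail may attrite a part of the first record; if there is no tail,
        nothing is trimmed yet.\<close>
      define ys' where "ys' = (if T = [] then ys else takeWhile (\<lambda>y. y < hd T) ys)"
      have ys': "seg ?m1 (hh i) ys'"
      proof (cases "T = []")
        case False
        have "seg ?m1 (hh i) (takeWhile (\<lambda>y. y < hd T) ys @ dropWhile (\<lambda>y. y < hd T) ys)" by simp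
        then show ?thesis using False unfolding seg_append by (simp add: ys'_def)
      qed (simp add: ys'_def)
      have ly': "length ys' \<le> length ys" "sorted_wrt (<) ys'" "set ys' \<subseteq> set ys"
        using ly(3) by (auto simp: ys'_def length_takeWhile_le sorted_takeWhile dest: set_takeWhileD)
      have ys'T: "y < y'" if "y \<in> set ys'" "y' \<in> set T" for y y'
      proof -
        have "T \<noteq> []" using that by auto
        then have "y < hd T" using that(1) takeWhile_less[of y "hd T" ys] by (simp add: ys'_def)
        then show ?thesis using hT(1) that(2) by (meson less_le_trans)
      qed
      have trim: "sm (ys' @ zs' @ T) = sm (ys @ zs' @ T)" for zs'
      proof (cases "T = []")
        case False
        then show ?thesis using sm_trim[OF ly(3), of "hd T" "zs' @ T"] by (simp add: ys'_def)
      qed (simp add: ys'_def)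
      let ?Q = "Done i Hs Ts (fl tr) ?C ?E (?P - 300 * bt) a (vres st)"
      let ?fin = "\<lambda>m. if m = 0 then copyN (tt i) (hh i) (length T) (finQ B bt i 0 (length T) 0 a)
       else popP B g (\<lambda>g. if g = 0 then copyN (tt i) (hh i + m) (length T) (finQ B bt i 0 (m + length T) 0 a)
         else loadRec g (tt i + 2 * bt) 1 (countL (hh i) (tt i + 2 * bt) m 0 (\<lambda>m. finQ B bt i g m (length T) a)))"
      have leP: "300 * bt \<le> ?P" unfolding P by simp
      have fin: "safe (?fin (length ys')) ?st1 100 ?Q"
      proof (cases "ys' = []")
        case True
        then have Tne: "T \<noteq> []" using g(4) by (auto simp: ys'_def)
        then have hd_le: "hd T \<le> hd ys" using True g(4) by (cases ys) (auto simp: ys'_def split: if_splits)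
        have "sm ((ys @ zs) @ T) = sm T"
        proof (rule sm_drop[of "hd T"])
          show "hd T \<in> set T" using Tne by simp
          show "hd T \<le> y" if "y \<in> set (ys @ zs)" for y
            using that hd_le g(6) sorted_hd_le[OF ly(3)] by (auto intro: order_trans less_imp_le)
        qed
        then have C': "sm T = ?C" using C by simp
        let ?m2 = "put ?m1 (hh i) T"
        \<comment> \<open>As slot \<open>l\<close> is empty, this just empties slot
          \<open>i\<close>, in a form to which \<open>world_move\<close> applies. The records of the
          tree remain live.\<close>
        let ?tr = "tr(i := tr l, l := None)"
        have f: "fl ?tr i = []" "root_addr ?tr i = 0" using none i by (simp_all add: fl_def root_addr_def)
        have "safe (finQ B bt i 0 (length T) 0 a) (?st1\<lparr>vm := ?m2\<rparr>) 100 ?Q"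
        proof (rule leaf[where tr' = ?tr and H = T and T = "[]"])
          show "world (?st1\<lparr>vm := ?m2\<rparr>) ?tr" using world_move[OF w, of i l] i by simp
          show "\<forall>m\<le>l. m \<noteq> i \<longrightarrow> ?tr m = tr m" "\<forall>k\<ge>l. ?tr k = None" using none i by auto
          have "?m2 y = ?m1 y" if "\<not> inz i y" for y by (rule put_inz[OF _ _ that]) (use lenH in auto)
          then show "\<forall>y. \<not> inz i y \<longrightarrow> vm (?st1\<lparr>vm := ?m2\<rparr>) y = vm st y" using out1 by simp
          show "qok T [] (fl ?tr i)" using f hT lenH bt by (simp add: qok_def)
          show "sm (T @ fl ?tr i @ []) = ?C" using C' f by simp
          show "300 * bt * card (vL (?st1\<lparr>vm := ?m2\<rparr>)) + 900 * qpot (fl ?tr i) T [] \<le> ?P - 300 * bt"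
            using f unfolding P by (simp add: qpot_def)
        qed (use h f E in auto)
        then have "safe (copyN (tt i) (hh i) (length T) (finQ B bt i 0 (length T) 0 a)) ?st1 100 ?Q"
          by (intro safe_copyN[where xs = T]) (use sT1 z lenH in \<open>auto simp: zone_eqs\<close>)
        then show ?thesis using True by simp
      next
        case ne: False
        have hd_eq: "hd ys' = hd ys"
        proof (cases "T = []")
          case False
          then have y: "ys' = takeWhile (\<lambda>y. y < hd T) ys" by (simp add: ys'_def)
          then show ?thesis using ne by (cases ys) (auto split: if_splits)
        qed (simp add: ys'_def)
        have w1: "world ?st1 tr" using w by simp
        have "safe (popP B (root_addr tr i) (\<lambda>g. if g = 0 then copyN (tt i) (hh i + length ys') (length T) (finQ B bt i 0 (length ys' + length T) 0 a)
         else loadRec g (tt i + 2 * bt) 1 (countL (hh i) (tt i + 2 * bt) (length ys') 0 (\<lambda>m. finQ B bt i g m (length T) a)))) ?st1 (60 + 40) ?Q"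
        proof (rule safe_wpop[OF w1 Some])
          fix fd' tr'
          let ?st2 = "?st1\<lparr>vL := vL ?st1 - {ad r}, vfd := fd'\<rparr>"
          assume 2: "world ?st2 tr'" "\<forall>m. m \<noteq> i \<longrightarrow> tr' m = tr m" "sm (fl tr' i) = sm (flt (tl (prs r)))"
            "set (fl tr' i) \<subseteq> set (flt (tl (prs r)))"
          have hb: "hinv ?st1 a" "g \<in> vL ?st1" using h g(2) by simp_all
          have h2: "hinv ?st2 a" "esum ?st2 + length ys = esum st" "card (vL st) = Suc (card (vL ?st2))"
            using hinv_free(1)[OF hb, of fd'] hinv_free(2)[OF hb, of fd'] hinv_free(3)[OF hb] g(3) by (simp_all add: g_def)
          \<comment> \<open>The payment for this operation: one record fewer.\<close>
          have cb: "300 * bt * card (vL ?st2) + 300 * bt = 300 * bt * card (vL st)" unfolding h2(3) by simp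
          show "safe (if root_addr tr' i = 0 then copyN (tt i) (hh i + length ys') (length T) (finQ B bt i 0 (length ys' + length T) 0 a)
            else loadRec (root_addr tr' i) (tt i + 2 * bt) 1 (countL (hh i) (tt i + 2 * bt) (length ys') 0 (\<lambda>m. finQ B bt i (root_addr tr' i) m (length T) a))) ?st2 60 ?Q"
          proof (cases "tr' i")
            case None
            then have f: "fl tr' i = []" "root_addr tr' i = 0" by (simp_all add: fl_def root_addr_def)
            then have zs: "zs = []" using 2(3) sm_eq_empty_iff[of zs] by (simp add: zs_def)
            let ?m2 = "put ?m1 (hh i + length ys') T"
            let ?H = "ys' @ T"
            have "safe (finQ B bt i 0 (length ys' + length T) 0 a) (?st2\<lparr>vm := ?m2\<rparr>) 60 ?Q"
            proof (rule leaf[where tr' = tr' and H = ?H and T = "[]"])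
              show "world (?st2\<lparr>vm := ?m2\<rparr>) tr'" by (rule world_vm(1)[THEN iffD2, OF 2(1)])
              show "\<forall>m\<le>l. m \<noteq> i \<longrightarrow> tr' m = tr m" "\<forall>k\<ge>l. tr' k = None" using 2(2) none i by auto
              have "?m2 y = ?m1 y" if "\<not> inz i y" for y by (rule put_inz[OF _ _ that]) (use lenH ly ly' in auto)
              then show "\<forall>y. \<not> inz i y \<longrightarrow> vm (?st2\<lparr>vm := ?m2\<rparr>) y = vm st y" using out1 by simp
              show "seg (vm (?st2\<lparr>vm := ?m2\<rparr>)) (hh i) ?H"
                unfolding seg_append using ys' by (simp, subst seg_put_other) auto
              have "sorted_wrt (<) ?H" unfolding sorted_wrt_append using ly'(2) hT(2) ys'T by blast
              then show "qok ?H [] (fl tr' i)" using f ly ly' lenH bt by (simp add: qok_def)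
              show "sm (?H @ fl tr' i @ []) = ?C" using f C trim[of "[]"] zs by simp
              have "300 * bt * card (vL ?st2) + 900 * (length ys' + length T) \<le> ?P - 300 * bt"
                unfolding P unfolding cb[symmetric] using ly(2) ly'(1) by simp
              then show "300 * bt * card (vL (?st2\<lparr>vm := ?m2\<rparr>)) + 900 * qpot (fl tr' i) ?H [] \<le> ?P - 300 * bt"
                using f by (simp add: qpot_def)
              show "esum (?st2\<lparr>vm := ?m2\<rparr>) + length ?H + length [] \<le> ?E"
                unfolding E hinv_fd(4) length_append list.size(3) using h2(2) ly'(1) by linarith
              show "hinv (?st2\<lparr>vm := ?m2\<rparr>) a" by (rule hinv_fd(3)[THEN iffD2, OF h2(1)])
            qed (use h2 f in auto)
            then have "safe (copyN (tt i) (hh i + length ys') (length T) (finQ B bt i 0 (length ys' + length T) 0 a)) ?st2 60 ?Q"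
              by (intro safe_copyN[where xs = T]) (use sT1 z lenH ly ly' in \<open>auto simp: zone_eqs\<close>)
            then show ?thesis using f by simp
          next
            case (Some r')
            note wr' = world_root[OF 2(1) Some]
            define e where "e = key r'"
            define g' where "g' = root_addr tr' i"
            have e: "e \<in> set (fl tr' i)" "\<forall>y\<in>set (fl tr' i). e \<le> y" "g' \<in> vL ?st2" "g' \<noteq> 0" "take 1 (vel ?st2 g') = [e]"
                "1 \<le> length (vel ?st2 g')"
              using wr' by (auto simp: e_def g'_def neq_Nil_conv)
            have fne: "fl tr' i \<noteq> []" using e(1) by auto
            \<comment> \<open>The new head must lie below the whole remaining tree, so it is trimmed
              by the key of the new root.\<close>
            define ys2 where "ys2 = takeWhile (\<lambda>y. y < e) ys'"
            have ly2: "length ys2 \<le> length ys'" "sorted_wrt (<) ys2" "set ys2 \<subseteq> set ys'"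
              using ly'(2) by (auto simp: ys2_def length_takeWhile_le sorted_takeWhile dest: set_takeWhileD)
            \<comment> \<open>The key of the old root lies strictly below everything that followed
              it, so the new head is not empty.\<close>
            have "hd ys' < e" using hd_eq g(6) e(1) 2(4) unfolding zs_def by auto
            then have ne2: "ys2 \<noteq> []" using ne by (cases ys') (auto simp: ys2_def)
            let ?m2 = "put ?m1 (tt i + 2 * bt) [e]"
            have sy2: "seg ?m2 (hh i) ys'" using ys' ly ly' by (subst seg_put_other) (auto simp: zone_eqs)
            then have sy3: "seg ?m2 (hh i) ys2"
              using seg_append[of ?m2 "hh i" ys2 "dropWhile (\<lambda>y. y < e) ys'"] by (simp add: ys2_def)
            have "safe (finQ B bt i g' (length ys2) (length T) a) (?st2\<lparr>vm := ?m2\<rparr>) 59 ?Q"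
            proof (rule leaf[where tr' = tr' and H = ys2 and T = T])
              show "world (?st2\<lparr>vm := ?m2\<rparr>) tr'" by (rule world_vm(1)[THEN iffD2, OF 2(1)])
              show "\<forall>m\<le>l. m \<noteq> i \<longrightarrow> tr' m = tr m" "\<forall>k\<ge>l. tr' k = None" using 2(2) none i by auto
              have "?m2 y = ?m1 y" if "\<not> inz i y" for y by (rule put_inz[OF _ _ that]) (use bt in \<open>auto simp: zone_eqs\<close>)
              then show "\<forall>y. \<not> inz i y \<longrightarrow> vm (?st2\<lparr>vm := ?m2\<rparr>) y = vm st y" using out1 by simp
              show "seg (vm (?st2\<lparr>vm := ?m2\<rparr>)) (hh i) ys2" using sy3 by simp
              show "seg (vm (?st2\<lparr>vm := ?m2\<rparr>)) (tt i) T" using sT1 lenH by (simp, subst seg_put_other) auto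
              have "y < y'" if "y \<in> set ys2" "y' \<in> set (fl tr' i) \<union> set T" for y y'
              proof (cases "y' \<in> set T")
                case True
                then show ?thesis using ys'T that(1) ly2(3) by blast
              next
                case False
                then have "e \<le> y'" using that(2) e(2) by blast
                moreover have "y < e" using that(1) takeWhile_less[of y e ys'] by (simp add: ys2_def)
                ultimately show ?thesis by simp
              qed
              then show "qok ys2 T (fl tr' i)" using ly2 ly' ly lenH hT fne ne2 by (simp add: qok_def)
              have "sm (ys2 @ fl tr' i @ T) = sm (ys' @ fl tr' i @ T)"
                unfolding ys2_def by (rule sm_trim[OF ly'(2)]) (use e(1) in simp)
              also have "\<dots> = sm (ys @ fl tr' i @ T)" by (rule trim)
              also have "\<dots> = sm (ys @ zs @ T)"
                by (rule sm_append_cong[OF refl], rule sm_append_cong[OF _ refl]) (simp add: 2(3) zs_def)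
              finally show "sm (ys2 @ fl tr' i @ T) = ?C" using C by simp
              have "qpot (fl tr' i) ys2 T = 2 * bt + length T" using fne ly2 ly' ly by (simp add: qpot_def)
              then show "300 * bt * card (vL (?st2\<lparr>vm := ?m2\<rparr>)) + 900 * qpot (fl tr' i) ys2 T \<le> ?P - 300 * bt"
                unfolding P using cb by simp
              show "esum (?st2\<lparr>vm := ?m2\<rparr>) + length ys2 + length T \<le> ?E" unfolding E hinv_fd(4) using h2(2) ly'(1) ly2(1) by linarith
              show "hinv (?st2\<lparr>vm := ?m2\<rparr>) a" by (rule hinv_fd(3)[THEN iffD2, OF h2(1)])
            qed (use h2 in \<open>auto simp: g'_def\<close>)
            then have "safe (countL (hh i) (tt i + 2 * bt) (length ys') 0 (\<lambda>m. finQ B bt i g' m (length T) a)) (?st2\<lparr>vm := ?m2\<rparr>) 59 ?Q"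
              by (intro safe_countL[where xs = ys' and y = e])
                (use sy2 z ly ly' bt ys2_def in \<open>auto simp: zone_eqs put_def\<close>)
            then have "safe (loadRec g' (tt i + 2 * bt) 1 (countL (hh i) (tt i + 2 * bt) (length ys') 0 (\<lambda>m. finQ B bt i g' m (length T) a))) ?st2 60 ?Q"
              by (intro safe_loadRec) (use e(3,5,6) z bt in \<open>auto simp: zone_eqs\<close>)
            then show ?thesis using e(4) by (simp add: g'_def)
          qed
        qed
        then show ?thesis using ne g(1) by simp
      qed
      have "safe (trimP (length T) (hh i) (tt i) (length ys) ?fin) ?st1 100 ?Q"
      proof (cases "T = []")
        case True
        then have yy: "ys' = ys" by (simp add: ys'_def)
        have tp: "trimP (length T) (hh i) (tt i) (length ys) ?fin = ?fin (length ys')"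
          unfolding yy using True by (simp add: trimP_def)
        show ?thesis unfolding tp by (rule fin)
      next
        case False
        have yy: "ys' = takeWhile (\<lambda>y. y < hd T) ys" using False by (simp add: ys'_def)
        have "safe (countL (hh i) (tt i) (length ys) 0 ?fin) ?st1 100 ?Q"
        proof (rule safe_countL[where xs = ys and y = "hd T"])
          show "vm ?st1 (tt i) = Elem (hd T)" using sT1 False by (cases T) (auto simp: seg_Cons)
          show "safe (?fin (length (takeWhile (\<lambda>y. y < hd T) ys))) ?st1 100 ?Q" using fin unfolding yy .
        qed (use z ly bt in \<open>auto simp: zone_eqs\<close>)
        moreover have "trimP (length T) (hh i) (tt i) (length ys) ?fin = countL (hh i) (tt i) (length ys) 0 ?fin"
          using False by (simp add: trimP_def)
        ultimately show ?thesis by (simp only:)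
      qed
      then have "safe (loadRec g (hh i) (length ys) (trimP (length T) (hh i) (tt i) (length ys) ?fin)) st 101 ?Q"
        by (intro safe_loadRec) (use g z ly in auto)
      then have "safe (getF g 11 (\<lambda>n. loadRec g (hh i) n (trimP (length T) (hh i) (tt i) n ?fin))) st 102 ?Q"
        by (intro safe_getSize) (use g in auto)
      moreover have "?prog = getF g 11 (\<lambda>n. loadRec g (hh i) n (trimP (length T) (hh i) (tt i) n ?fin))"
        unfolding delBody_def g(1) T_def[symmetric] by (simp only: l1 g(7) if_False)
      ultimately have "safe ?prog st 102 ?Q" by (simp only:)
      from safe_mono[OF this, of 300] show ?thesis using leP by (intro exI[of _ 300]) simp
    qed
  qed
qed

section \<open>The invariant of the structure for large blocks\<close>

definition InvL :: "'a config \<Rightarrow> (nat \<Rightarrow> 'a set) \<Rightarrow> nat \<Rightarrow> nat \<Rightarrow> nat \<Rightarrow> bool" where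
  "InvL s Q t e \<phi> \<longleftrightarrow> (\<exists>st tr a Hs Ts. R s st \<and> invL st tr a Hs Ts \<and> Hs l = [] \<and>
     (\<forall>k<l. Q k = sm (Hs k @ fl tr k @ Ts k)) \<and> a \<le> 2 * t \<and>
     esum st + (\<Sum>k\<le>l. length (Hs k) + length (Ts k)) \<le> e \<and>
     300 * bt * card (vL st) + 900 * (\<Sum>k\<le>l. qpot (fl tr k) (Hs k) (Ts k)) \<le> \<phi>)"

text \<open>In both sums only the summand of queue \<open>i\<close> has changed, so the bounds
  \<open>E\<close> and \<open>P\<close> replace its old share.\<close>

lemma Done_InvL:
  assumes d: "Done i Hs Ts F C E P A r s" and i: "i < l" and l0: "Hs l = []"
    and Q: "\<And>k. k < l \<Longrightarrow> k \<noteq> i \<Longrightarrow> Q k = sm (Hs k @ F k @ Ts k)" "Q i = C" and A: "A \<le> 2 * t"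
    and e: "E + (\<Sum>k\<in>{..l} - {i}. length (Hs k) + length (Ts k)) \<le> e"
    and p: "P + 900 * (\<Sum>k\<in>{..l} - {i}. qpot (F k) (Hs k) (Ts k)) \<le> \<phi>"
  shows "InvL s Q t e \<phi> \<and> result s = r"
proof -
  from d obtain st tr a H T where 1: "R s st" "invL st tr a (Hs(i := H)) (Ts(i := T))"
    "\<forall>k\<le>l. k \<noteq> i \<longrightarrow> fl tr k = F k" "sm (H @ fl tr i @ T) = C" "esum st + length H + length T \<le> E"
    "300 * bt * card (vL st) + 900 * qpot (fl tr i) H T \<le> P" "a \<le> A" "result s = r"
    unfolding Done_def by blast
  let ?Hs = "Hs(i := H)" and ?Ts = "Ts(i := T)"
  have il: "i \<in> {..l}" using i by simp
  have "(\<Sum>k\<in>{..l} - {i}. length (?Hs k) + length (?Ts k)) = (\<Sum>k\<in>{..l} - {i}. length (Hs k) + length (Ts k))"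
    by (rule sum.cong) auto
  then have s1: "(\<Sum>k\<le>l. length (?Hs k) + length (?Ts k)) = length H + length T + (\<Sum>k\<in>{..l} - {i}. length (Hs k) + length (Ts k))"
    using sum.remove[OF _ il, of "\<lambda>k. length (?Hs k) + length (?Ts k)"] by simp
  have "(\<Sum>k\<in>{..l} - {i}. qpot (fl tr k) (?Hs k) (?Ts k)) = (\<Sum>k\<in>{..l} - {i}. qpot (F k) (Hs k) (Ts k))"
    by (rule sum.cong) (use 1(3) in auto)
  then have s2: "(\<Sum>k\<le>l. qpot (fl tr k) (?Hs k) (?Ts k)) = qpot (fl tr i) H T + (\<Sum>k\<in>{..l} - {i}. qpot (F k) (Hs k) (Ts k))"
    using sum.remove[OF _ il, of "\<lambda>k. qpot (fl tr k) (?Hs k) (?Ts k)"] by simp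
  have "InvL s Q t e \<phi>" unfolding InvL_def
  proof (intro exI conjI)
    show "?Hs l = []" using l0 i by simp
    show "\<forall>k<l. Q k = sm (?Hs k @ fl tr k @ ?Ts k)" using Q 1(3,4) by auto
    show "esum st + (\<Sum>k\<le>l. length (?Hs k) + length (?Ts k)) \<le> e" unfolding s1 using 1(5) e by linarith
    show "300 * bt * card (vL st) + 900 * (\<Sum>k\<le>l. qpot (fl tr k) (?Hs k) (?Ts k)) \<le> \<phi>"
      unfolding s2 distrib_left using 1(6) p by linarith
    show "a \<le> 2 * t" using 1(7) A by simp
    show "R s st" by (rule 1(1))
    show "invL st tr a ?Hs ?Ts" by (rule 1(2))
  qed
  then show ?thesis using 1(8) by simp
qed

lemma exec_start:
  assumes "R s st" "safe p (st\<lparr>vres := None\<rparr>) n Q"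
  shows "\<exists>s'. exec mc arg p (s\<lparr>result := None, ios := 0\<rparr>) = Some s' \<and> ios s' \<le> n \<and> Q s'"
proof -
  have "R (s\<lparr>result := None, ios := 0\<rparr>) (st\<lparr>vres := None\<rparr>)" using assms(1) by (simp add: R_def)
  then show ?thesis using assms(2) unfolding safe_def by fastforce
qed

lemma invL_vres [simp]: "invL (st\<lparr>vres := x\<rparr>) tr a Hs Ts = invL st tr a Hs Ts"
  by (simp add: invL_def)

lemma invL_queue: "invL st tr a Hs Ts \<Longrightarrow> k \<le> l \<Longrightarrow> qmem (vm st) k (Hs k) (Ts k) (root_addr tr k) \<and> qok (Hs k) (Ts k) (fl tr k)"
  by (simp add: invL_def)

lemma queue_nonempty:
  assumes "invL st tr a Hs Ts" "i < l" "sm (Hs i @ fl tr i @ Ts i) \<noteq> {}"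
  shows "\<exists>x H'. Hs i = x # H' \<and> vm st (hh i) = Elem x \<and> (\<forall>y\<in>set (H' @ fl tr i @ Ts i). x < y)"
proof -
  have q: "qmem (vm st) i (Hs i) (Ts i) (root_addr tr i)" "qok (Hs i) (Ts i) (fl tr i)"
    using invL_queue[OF assms(1), of i] assms(2) by auto
  have "Hs i \<noteq> []" using q(2) assms(3) by (auto simp: qok_def)
  then obtain x H' where H: "Hs i = x # H'" by (cases "Hs i") auto
  then show ?thesis using q by (auto simp: qmem_def qok_def seg_Cons)
qed

lemma InvL_find:
  assumes I: "InvL s Q t e \<phi>" and leg: "cpqa_legal l (FindMin i) Q"
  shows "\<exists>s'. exec mc arg (find_min_prog (large_impl B bt l) i) (s\<lparr>result := None, ios := 0\<rparr>) = Some s' \<and> ios s' \<le> 0 \<and>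
    result s' = Some (Min (Q i)) \<and> InvL s' Q (Suc t) e \<phi>"
proof -
  from I obtain st tr a Hs Ts where 1: "R s st" "invL st tr a Hs Ts" "Hs l = []"
    "\<forall>k<l. Q k = sm (Hs k @ fl tr k @ Ts k)" "a \<le> 2 * t"
    "esum st + (\<Sum>k\<le>l. length (Hs k) + length (Ts k)) \<le> e"
    "300 * bt * card (vL st) + 900 * (\<Sum>k\<le>l. qpot (fl tr k) (Hs k) (Ts k)) \<le> \<phi>"
    unfolding InvL_def by blast
  have i: "i < l" "Q i \<noteq> {}" using leg by auto
  from queue_nonempty[OF 1(2) i(1)] obtain x H' where x: "Hs i = x # H'" "vm st (hh i) = Elem x"
    "\<forall>y\<in>set (H' @ fl tr i @ Ts i). x < y" using 1(4) i by auto
  have m: "Min (Q i) = x" using 1(4) i x(1) Min_sm_Cons[OF x(3)] by simp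
  have "InvL s' Q (Suc t) e \<phi> \<and> result s' = Some x" if "R s' (st\<lparr>vres := Some x\<rparr>)" for s'
  proof
    show "InvL s' Q (Suc t) e \<phi>" unfolding InvL_def
    proof (intro exI conjI)
      show "R s' (st\<lparr>vres := Some x\<rparr>)" by fact
      show "invL (st\<lparr>vres := Some x\<rparr>) tr a Hs Ts" using 1(2) by simp
      show "esum (st\<lparr>vres := Some x\<rparr>) + (\<Sum>k\<le>l. length (Hs k) + length (Ts k)) \<le> e" using 1(6) by simp
      show "300 * bt * card (vL (st\<lparr>vres := Some x\<rparr>)) + 900 * (\<Sum>k\<le>l. qpot (fl tr k) (Hs k) (Ts k)) \<le> \<phi>" using 1(7) by simp
    qed (use 1 in auto)
    show "result s' = Some x" using that by (simp add: R_def)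
  qed
  then have "safe Halt (st\<lparr>vres := None, vres := Some x\<rparr>) 0 (\<lambda>s'. InvL s' Q (Suc t) e \<phi> \<and> result s' = Some x)"
    by (intro safe_Halt) simp
  then have "safe (find_min_prog (large_impl B bt l) i) (st\<lparr>vres := None\<rparr>) 0 (\<lambda>s'. InvL s' Q (Suc t) e \<phi> \<and> result s' = Some x)"
    unfolding large_impl_def cpqa_impl.simps
    by (intro safe_Output) (use x zone_B[of i] zone_M[of i] i bt in auto)
  from exec_start[OF 1(1) this] show ?thesis using m by blast
qed

lemma InvL_delete:
  assumes I: "InvL s Q t e \<phi>" and leg: "cpqa_legal l (DeleteMin i) Q" and t: "t < N"
  shows "\<exists>s' \<phi>'. exec mc arg (delete_min_prog (large_impl B bt l) i) (s\<lparr>result := None, ios := 0\<rparr>) = Some s' \<and> ios s' \<le> 300 \<and>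
    bt * ios s' + \<phi>' \<le> \<phi> \<and> 1 \<le> e \<and>
    result s' = Some (Min (Q i)) \<and> InvL s' (cpqa_step (DeleteMin i) Q) (Suc t) (e - 1) \<phi>'"
proof -
  from I obtain st tr a Hs Ts where 1: "R s st" "invL st tr a Hs Ts" "Hs l = []"
    "\<forall>k<l. Q k = sm (Hs k @ fl tr k @ Ts k)" "a \<le> 2 * t"
    "esum st + (\<Sum>k\<le>l. length (Hs k) + length (Ts k)) \<le> e"
    "300 * bt * card (vL st) + 900 * (\<Sum>k\<le>l. qpot (fl tr k) (Hs k) (Ts k)) \<le> \<phi>"
    unfolding InvL_def by blast
  have i: "i < l" "i \<le> l" "Q i \<noteq> {}" using leg by auto
  from queue_nonempty[OF 1(2) i(1)] obtain x H' where x: "Hs i = x # H'" "vm st (hh i) = Elem x"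
    "\<forall>y\<in>set (H' @ fl tr i @ Ts i). x < y" using 1(4) i by auto
  have m: "Min (Q i) = x" using 1(4) i x(1) Min_sm_Cons[OF x(3)] by simp
  have m2: "Q i - {Min (Q i)} = sm (H' @ fl tr i @ Ts i)" using 1(4) i x(1) sm_Cons_minus_Min[OF x(3)] by simp
  let ?st = "st\<lparr>vres := Some x\<rparr>"
  let ?P = "300 * bt * card (vL st) + 900 * qpot (fl tr i) (Hs i) (Ts i)"
  let ?Q = "cpqa_step (DeleteMin i) Q"
  have inv: "invL ?st tr a Hs Ts" using 1(2) by simp
  have aW: "a \<le> W" using 1(5) WN t by simp
  from safe_delBody[OF inv i(1) x(1) aW] obtain n where n: "n \<le> 300" "n * bt \<le> ?P"
    "safe (delBody B bt i (root_addr tr i) (length (Hs i)) (length (Ts i)) a) ?st n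
      (Done i Hs Ts (fl tr) (sm (H' @ fl tr i @ Ts i)) (esum st + length H' + length (Ts i)) (?P - n * bt) a (Some x))"
    by auto
  have il: "i \<in> {..l}" using i by simp
  have s1: "(\<Sum>k\<le>l. length (Hs k) + length (Ts k)) = length (Hs i) + length (Ts i) + (\<Sum>k\<in>{..l} - {i}. length (Hs k) + length (Ts k))"
    using sum.remove[OF _ il, of "\<lambda>k. length (Hs k) + length (Ts k)"] by simp
  have s2: "(\<Sum>k\<le>l. qpot (fl tr k) (Hs k) (Ts k)) = qpot (fl tr i) (Hs i) (Ts i) + (\<Sum>k\<in>{..l} - {i}. qpot (fl tr k) (Hs k) (Ts k))"
    using sum.remove[OF _ il, of "\<lambda>k. qpot (fl tr k) (Hs k) (Ts k)"] by simp
  have phi: "?P + 900 * (\<Sum>k\<in>{..l} - {i}. qpot (fl tr k) (Hs k) (Ts k)) \<le> \<phi>" using 1(7) unfolding s2 distrib_left by linarith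
  let ?\<phi> = "\<phi> - n * bt"
  have D: "InvL s' ?Q (Suc t) (e - 1) ?\<phi> \<and> result s' = Some x"
    if "Done i Hs Ts (fl tr) (sm (H' @ fl tr i @ Ts i)) (esum st + length H' + length (Ts i)) (?P - n * bt) a (Some x) s'" for s'
  proof (rule Done_InvL[OF that i(1) 1(3)])
    show "?Q i = sm (H' @ fl tr i @ Ts i)" using m2 by simp
    show "esum st + length H' + length (Ts i) + (\<Sum>k\<in>{..l} - {i}. length (Hs k) + length (Ts k)) \<le> e - 1"
      using 1(6) unfolding s1 x(1) by simp
    show "?P - n * bt + 900 * (\<Sum>k\<in>{..l} - {i}. qpot (fl tr k) (Hs k) (Ts k)) \<le> ?\<phi>" using phi n(2) by linarith
  qed (use 1 in auto)
  have "safe (delBody B bt i (root_addr tr i) (length (Hs i)) (length (Ts i)) a) ?st n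
     (\<lambda>s'. InvL s' ?Q (Suc t) (e - 1) ?\<phi> \<and> result s' = Some x)"
    using n(3) D unfolding safe_def by blast
  then have "safe (getQ B bt i (\<lambda>g h t. CaseNum (B + 1) (\<lambda>c. delBody B bt i g h t c))) ?st n
     (\<lambda>s'. InvL s' ?Q (Suc t) (e - 1) ?\<phi> \<and> result s' = Some x)"
    by (intro safe_getQ[OF i(2), where H = "Hs i" and T = "Ts i" and g = "root_addr tr i"] safe_CaseNum[where v = a])
      (use inv invL_queue[OF inv i(2)] B1 BM lM bt in \<open>auto simp: invL_def\<close>)
  then have "safe (delete_min_prog (large_impl B bt l) i) (st\<lparr>vres := None\<rparr>) n
     (\<lambda>s'. InvL s' ?Q (Suc t) (e - 1) ?\<phi> \<and> result s' = Some x)"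
    unfolding large_impl_def cpqa_impl.simps
    by (intro safe_Output) (use x zone_B[of i] zone_M[of i] i bt in auto)
  from exec_start[OF 1(1) this] obtain s' where s': "exec mc arg (delete_min_prog (large_impl B bt l) i) (s\<lparr>result := None, ios := 0\<rparr>) = Some s'"
    "ios s' \<le> n" "InvL s' ?Q (Suc t) (e - 1) ?\<phi>" "result s' = Some x" by blast
  have "bt * ios s' \<le> n * bt" using s'(2) by (simp add: mult.commute)
  then have "bt * ios s' + ?\<phi> \<le> \<phi>" using n(2) phi by linarith
  moreover have "1 \<le> e" using 1(6) unfolding s1 x(1) by simp
  ultimately show ?thesis using s' n(1) m by (intro exI[of _ s'] exI[of _ ?\<phi>]) auto
qed

text \<open>The second queue is given apart from the family, with its tree in slot
  \<open>l + 1\<close>, while the family already shows index \<open>j\<close> as it will be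
  afterwards. This serves catenation and insertion alike.\<close>

lemma safe_catBody_InvL:
  assumes i: "i < l" and j: "j \<le> l" "i \<noteq> j"
    and w: "world st tr" and none: "\<forall>k\<ge>l. k \<noteq> l + 1 \<longrightarrow> tr k = None"
    and q: "\<And>k. k \<le> l \<Longrightarrow> qmem (vm st) k (Hs k) (Ts k) (root_addr tr k) \<and> qok (Hs k) (Ts k) (fl tr k)"
    and q2: "seg (vm st) (hh j) H2" "seg (vm st) (tt j) T2" "qok H2 T2 (fl tr (l + 1))" "H2 \<noteq> []"
    and h: "hinv st a" and a: "a \<le> 2 * t" "t < N" and l0: "Hs l = []" and r: "vres st = None"
    and Q: "\<And>k. k < l \<Longrightarrow> k \<noteq> i \<Longrightarrow> Q k = sm (Hs k @ fl tr k @ Ts k)"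
      "Q i = sm (Hs i @ fl tr i @ Ts i @ H2 @ fl tr (l + 1) @ T2)"
    and e: "esum st + (\<Sum>k\<le>l. length (Hs k) + length (Ts k)) + length H2 + length T2 \<le> e"
    and p: "300 * bt * card (vL st) + 900 * ((\<Sum>k\<le>l. qpot (fl tr k) (Hs k) (Ts k)) + qpot (fl tr (l + 1)) H2 T2) \<le> \<phi>"
  shows "\<exists>n\<le>300. n * bt \<le> \<phi> \<and>
    safe (catBody B bt i j (root_addr tr i) (length (Hs i)) (length (Ts i)) (root_addr tr (l + 1)) (length H2) (length T2) a) st n
      (\<lambda>s. InvL s Q (Suc t) e (\<phi> - n * bt) \<and> result s = None)"
proof -
  have il: "i \<in> {..l}" "i \<le> l" using i by simp_all
  have s1: "(\<Sum>k\<le>l. length (Hs k) + length (Ts k)) = length (Hs i) + length (Ts i) + (\<Sum>k\<in>{..l} - {i}. length (Hs k) + length (Ts k))"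
    using sum.remove[OF _ il(1), of "\<lambda>k. length (Hs k) + length (Ts k)"] by simp
  have s2: "(\<Sum>k\<le>l. qpot (fl tr k) (Hs k) (Ts k)) = qpot (fl tr i) (Hs i) (Ts i) + (\<Sum>k\<in>{..l} - {i}. qpot (fl tr k) (Hs k) (Ts k))"
    using sum.remove[OF _ il(1), of "\<lambda>k. qpot (fl tr k) (Hs k) (Ts k)"] by simp
  let ?P = "300 * bt * card (vL st) + 900 * (qpot (fl tr i) (Hs i) (Ts i) + qpot (fl tr (l + 1)) H2 T2)"
  have aW: "16 * (a + 2) + 15 \<le> W" using a WN by simp
  have qi: "seg (vm st) (hh i) (Hs i)" "seg (vm st) (tt i) (Ts i)" "qok (Hs i) (Ts i) (fl tr i)"
    using q[OF il(2)] by (auto simp: qmem_def)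
  have oth: "qmem (vm st) k (Hs k) (Ts k) (root_addr tr k) \<and> qok (Hs k) (Ts k) (fl tr k)" if "k \<le> l" "k \<noteq> i" for k
    using q[OF that(1)] .
  from safe_catBody[OF i j w none oth qi q2 h aW] obtain n where n: "n \<le> 300" "n * bt \<le> ?P"
    "safe (catBody B bt i j (root_addr tr i) (length (Hs i)) (length (Ts i)) (root_addr tr (l + 1)) (length H2) (length T2) a) st n
      (Done i Hs Ts (fl tr) (sm (Hs i @ fl tr i @ Ts i @ H2 @ fl tr (l + 1) @ T2))
        (esum st + length (Hs i) + length (Ts i) + length H2 + length T2) (?P - n * bt) (a + 2) (vres st))" by blast
  have phi: "?P + 900 * (\<Sum>k\<in>{..l} - {i}. qpot (fl tr k) (Hs k) (Ts k)) \<le> \<phi>" using p unfolding s2 distrib_left by linarith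
  have D: "InvL s Q (Suc t) e (\<phi> - n * bt) \<and> result s = None"
    if "Done i Hs Ts (fl tr) (sm (Hs i @ fl tr i @ Ts i @ H2 @ fl tr (l + 1) @ T2))
        (esum st + length (Hs i) + length (Ts i) + length H2 + length T2) (?P - n * bt) (a + 2) (vres st) s" for s
    unfolding r[symmetric]
  proof (rule Done_InvL[OF that i l0 Q])
    show "a + 2 \<le> 2 * Suc t" using a by simp
    show "esum st + length (Hs i) + length (Ts i) + length H2 + length T2 + (\<Sum>k\<in>{..l} - {i}. length (Hs k) + length (Ts k)) \<le> e"
      using e unfolding s1 by simp
    show "?P - n * bt + 900 * (\<Sum>k\<in>{..l} - {i}. qpot (fl tr k) (Hs k) (Ts k)) \<le> \<phi> - n * bt" using phi n(2) by linarith
  qed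
  have "safe (catBody B bt i j (root_addr tr i) (length (Hs i)) (length (Ts i)) (root_addr tr (l + 1)) (length H2) (length T2) a) st n
      (\<lambda>s. InvL s Q (Suc t) e (\<phi> - n * bt) \<and> result s = None)"
    using n(3) D unfolding safe_def by blast
  moreover have "n * bt \<le> \<phi>" using n(2) phi by linarith
  ultimately show ?thesis using n(1) by blast
qed

lemma exec_start_paid:
  assumes "R s st" "n \<le> \<kappa>" "n * bt \<le> \<phi>" "safe p (st\<lparr>vres := None\<rparr>) n (\<lambda>s. InvL s Q t e (\<phi> - n * bt) \<and> result s = r)"
  shows "\<exists>s' \<phi>'. exec mc arg p (s\<lparr>result := None, ios := 0\<rparr>) = Some s' \<and> ios s' \<le> \<kappa> \<and> bt * ios s' + \<phi>' \<le> \<phi> \<and>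
    result s' = r \<and> InvL s' Q t e \<phi>'"
proof -
  from exec_start[OF assms(1,4)] obtain s' where s': "exec mc arg p (s\<lparr>result := None, ios := 0\<rparr>) = Some s'"
    "ios s' \<le> n" "InvL s' Q t e (\<phi> - n * bt)" "result s' = r" by blast
  have "bt * ios s' \<le> n * bt" using s'(2) by (simp add: mult.commute)
  then have "bt * ios s' + (\<phi> - n * bt) \<le> \<phi>" using assms(3) by linarith
  then show ?thesis using s' assms(2) by (intro exI[of _ s'] exI[of _ "\<phi> - n * bt"]) auto
qed

lemma InvL_cat:
  assumes I: "InvL s Q t e \<phi>" and leg: "cpqa_legal l (CatenateAndAttrite i j) Q" and t: "t < N"
  shows "\<exists>s' \<phi>'. exec mc arg (catenate_prog (large_impl B bt l) i j) (s\<lparr>result := None, ios := 0\<rparr>) = Some s' \<and> ios s' \<le> 300 \<and>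
    bt * ios s' + \<phi>' \<le> \<phi> \<and> result s' = None \<and> InvL s' (cpqa_step (CatenateAndAttrite i j) Q) (Suc t) e \<phi>'"
proof -
  from I obtain st tr a Hs Ts where 1: "R s st" "invL st tr a Hs Ts" "Hs l = []"
    "\<forall>k<l. Q k = sm (Hs k @ fl tr k @ Ts k)" "a \<le> 2 * t"
    "esum st + (\<Sum>k\<le>l. length (Hs k) + length (Ts k)) \<le> e"
    "300 * bt * card (vL st) + 900 * (\<Sum>k\<le>l. qpot (fl tr k) (Hs k) (Ts k)) \<le> \<phi>"
    unfolding InvL_def by blast
  have i: "i < l" "i \<le> l" and j: "j < l" "j \<le> l" "i \<noteq> j" using leg by auto
  let ?Q = "cpqa_step (CatenateAndAttrite i j) Q"
  let ?st = "st\<lparr>vres := None\<rparr>"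
  have inv: "invL ?st tr a Hs Ts" using 1(2) by simp
  have w: "world st tr" "\<forall>k\<ge>l. tr k = None" "hinv st a" using 1(2) by (simp_all add: invL_def)
  let ?body = "\<lambda>g1 h1 t1 g2 h2 t2 c. if h2 = 0 then Halt else setQ B bt j 0 0 0 (catBody B bt i j g1 h1 t1 g2 h2 t2 c)"
  have pre: "safe (catenate_prog (large_impl B bt l) i j) ?st n P"
    if "safe (?body (root_addr tr i) (length (Hs i)) (length (Ts i)) (root_addr tr j) (length (Hs j)) (length (Ts j)) a) ?st n P" for n P
    unfolding large_impl_def cpqa_impl.simps
    by (intro safe_getQ[OF i(2), where H = "Hs i" and T = "Ts i" and g = "root_addr tr i"]
        safe_getQ[OF j(2), where H = "Hs j" and T = "Ts j" and g = "root_addr tr j"] safe_CaseNum[where v = a])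
      (use that inv invL_queue[OF inv i(2)] invL_queue[OF inv j(2)] B1 BM lM bt in \<open>auto simp: invL_def\<close>)
  show ?thesis
  proof (cases "Hs j = []")
    case True
    then have "fl tr j = []" "Ts j = []" using invL_queue[OF inv j(2)] by (auto simp: qok_def)
    then have "Q j = {}" using 1(4) j(1) True by simp
    then have Q: "?Q = Q" by (auto simp: catenate_attrite_def fun_eq_iff)
    have "InvL s' ?Q (Suc t) e (\<phi> - 0 * bt) \<and> result s' = None" if "R s' ?st" for s'
    proof
      show "InvL s' ?Q (Suc t) e (\<phi> - 0 * bt)" unfolding InvL_def Q
      proof (intro exI conjI)
        show "R s' ?st" by fact
        show "invL ?st tr a Hs Ts" by fact
      qed (use 1 in auto)
      show "result s' = None" using that by (simp add: R_def)
    qed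
    then have "safe Halt ?st 0 (\<lambda>s'. InvL s' ?Q (Suc t) e (\<phi> - 0 * bt) \<and> result s' = None)" by (rule safe_Halt)
    then have "safe (?body (root_addr tr i) (length (Hs i)) (length (Ts i)) (root_addr tr j) (length (Hs j)) (length (Ts j)) a) ?st 0
        (\<lambda>s'. InvL s' ?Q (Suc t) e (\<phi> - 0 * bt) \<and> result s' = None)" using True by simp
    from exec_start_paid[OF 1(1) _ _ pre[OF this]] show ?thesis by simp
  next
    case False
    \<comment> \<open>Queue \<open>j\<close> becomes empty by clearing its three numbers; its
      elements are still in zone \<open>j\<close> for \<open>catBody\<close> to read.\<close>
    let ?m = "(vm st)(nn j := Num 0, nn j + 1 := Num 0, nn j + 2 := Num 0)"
    let ?st1 = "?st\<lparr>vm := ?m\<rparr>"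
    \<comment> \<open>The tree of queue \<open>j\<close> is parked outside the family until it is
      catenated.\<close>
    let ?tr = "tr(l + 1 := tr j, j := None)"
    let ?Hs = "Hs(j := [])" and ?Ts = "Ts(j := [])"
    have qj: "seg (vm st) (hh j) (Hs j)" "seg (vm st) (tt j) (Ts j)" "qok (Hs j) (Ts j) (fl tr j)"
      using invL_queue[OF inv j(2)] by (auto simp: qmem_def)
    have lj: "length (Hs j) \<le> 3 * bt" "length (Ts j) < bt" using qj(3) by (auto simp: qok_def)
    have ll: "l + 1 \<noteq> j" using j by simp
    have f: "fl ?tr (l + 1) = fl tr j" "root_addr ?tr (l + 1) = root_addr tr j" "fl ?tr j = []" "root_addr ?tr j = 0"
      "\<And>k. k \<le> l \<Longrightarrow> k \<noteq> j \<Longrightarrow> fl ?tr k = fl tr k" "\<And>k. k \<le> l \<Longrightarrow> k \<noteq> j \<Longrightarrow> root_addr ?tr k = root_addr tr k"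
      using j by (simp_all add: fl_def root_addr_def)
    have m: "?m x = vm st x" if "\<not> inz j x \<or> x < nn j" for x using that bt by (auto simp: inz_def zone_eqs)
    have jl: "j \<in> {..l}" using j by simp
    have "(\<Sum>k\<in>{..l} - {j}. length (?Hs k) + length (?Ts k)) = (\<Sum>k\<in>{..l} - {j}. length (Hs k) + length (Ts k))"
      by (rule sum.cong) auto
    then have s1: "(\<Sum>k\<le>l. length (Hs k) + length (Ts k)) = (\<Sum>k\<le>l. length (?Hs k) + length (?Ts k)) + length (Hs j) + length (Ts j)"
      using sum.remove[OF _ jl, of "\<lambda>k. length (Hs k) + length (Ts k)"]
        sum.remove[OF _ jl, of "\<lambda>k. length (?Hs k) + length (?Ts k)"] by simp
    have "(\<Sum>k\<in>{..l} - {j}. qpot (fl ?tr k) (?Hs k) (?Ts k)) = (\<Sum>k\<in>{..l} - {j}. qpot (fl tr k) (Hs k) (Ts k))"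
      by (rule sum.cong[OF refl]) (use f(5) in \<open>simp del: fun_upd_apply add: fun_upd_other\<close>)
    moreover have "qpot (fl ?tr j) (?Hs j) (?Ts j) = 0" unfolding f(3) by (simp add: qpot_def)
    ultimately have s2: "(\<Sum>k\<le>l. qpot (fl tr k) (Hs k) (Ts k)) = (\<Sum>k\<le>l. qpot (fl ?tr k) (?Hs k) (?Ts k)) + qpot (fl ?tr (l + 1)) (Hs j) (Ts j)"
      unfolding f(1) using sum.remove[OF finite_atMost jl, of "\<lambda>k. qpot (fl tr k) (Hs k) (Ts k)"]
        sum.remove[OF finite_atMost jl, of "\<lambda>k. qpot (fl ?tr k) (?Hs k) (?Ts k)"] by linarith
    have "\<exists>n\<le>300. n * bt \<le> \<phi> \<and>
      safe (catBody B bt i j (root_addr ?tr i) (length (?Hs i)) (length (?Ts i)) (root_addr ?tr (l + 1)) (length (Hs j)) (length (Ts j)) a) ?st1 n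
        (\<lambda>s. InvL s ?Q (Suc t) e (\<phi> - n * bt) \<and> result s = None)"
    proof (rule safe_catBody_InvL[OF i(1) j(2,3)])
      show "world ?st1 ?tr" using world_move[OF w(1) ll] by simp
      show "\<forall>k\<ge>l. k \<noteq> l + 1 \<longrightarrow> ?tr k = None" using w(2) by auto
      show "qmem (vm ?st1) k (?Hs k) (?Ts k) (root_addr ?tr k) \<and> qok (?Hs k) (?Ts k) (fl ?tr k)" if k: "k \<le> l" for k
      proof (cases "k = j")
        case True
        then show ?thesis using f(3,4) bt by (simp add: qmem_def qok_def)
      next
        case False
        have qk: "qmem (vm st) k (Hs k) (Ts k) (root_addr tr k)" "qok (Hs k) (Ts k) (fl tr k)" using invL_queue[OF inv k] by auto
        have "qmem ?m k (Hs k) (Ts k) (root_addr tr k)"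
          by (rule qmem_frame[OF m _ _ qk(1)]) (use zone_disj[of k j] qok_len[OF qk(2)] False in auto)
        then show ?thesis using qk(2) f(5,6)[OF k False] False by (simp del: fun_upd_apply add: fun_upd_other)
      qed
      show "seg (vm ?st1) (hh j) (Hs j)"
        using qj(1) seg_cong[of "hh j" "Hs j" ?m "vm st"] m lj by (simp del: fun_upd_apply add: zone_eqs)
      show "seg (vm ?st1) (tt j) (Ts j)"
        using qj(2) seg_cong[of "tt j" "Ts j" ?m "vm st"] m lj by (simp del: fun_upd_apply add: zone_eqs)
      show "qok (Hs j) (Ts j) (fl ?tr (l + 1))" unfolding f(1) by (rule qj(3))
      show "?Hs l = []" using 1(3) j by simp
      show "?Q k = sm (?Hs k @ fl ?tr k @ ?Ts k)" if "k < l" "k \<noteq> i" for k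
      proof (cases "k = j")
        case True
        then show ?thesis using f(3) by simp
      next
        case False
        have "fl ?tr k = fl tr k" using f(5) that False by simp
        then show ?thesis using 1(4) that False by (simp del: fun_upd_apply add: fun_upd_other)
      qed
      have fi: "fl ?tr i = fl tr i" using f(5)[OF i(2) j(3)] .
      have "?Q i = catenate_attrite (sm (Hs i @ fl tr i @ Ts i)) (sm (Hs j @ fl tr j @ Ts j))"
        using 1(4) i j by simp
      also have "\<dots> = sm ((Hs i @ fl tr i @ Ts i) @ (Hs j @ fl tr j @ Ts j))" by (rule sm_append[symmetric])
      finally show "?Q i = sm (?Hs i @ fl ?tr i @ ?Ts i @ Hs j @ fl ?tr (l + 1) @ Ts j)"
        unfolding f(1) fi using j(3) by simp
      show "esum ?st1 + (\<Sum>k\<le>l. length (?Hs k) + length (?Ts k)) + length (Hs j) + length (Ts j) \<le> e"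
        using 1(6) s1 by simp
      show "300 * bt * card (vL ?st1) + 900 * ((\<Sum>k\<le>l. qpot (fl ?tr k) (?Hs k) (?Ts k)) + qpot (fl ?tr (l + 1)) (Hs j) (Ts j)) \<le> \<phi>"
        using 1(7) unfolding s2 by simp
    qed (use False w t 1(5) in auto)
    then obtain n where n: "n \<le> 300" "n * bt \<le> \<phi>"
      "safe (catBody B bt i j (root_addr tr i) (length (Hs i)) (length (Ts i)) (root_addr tr j) (length (Hs j)) (length (Ts j)) a) ?st1 n
        (\<lambda>s. InvL s ?Q (Suc t) e (\<phi> - n * bt) \<and> result s = None)"
      unfolding f(2) f(6)[OF i(2) j(3)] using j(3) by auto
    have "safe (?body (root_addr tr i) (length (Hs i)) (length (Ts i)) (root_addr tr j) (length (Hs j)) (length (Ts j)) a) ?st n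
        (\<lambda>s. InvL s ?Q (Suc t) e (\<phi> - n * bt) \<and> result s = None)"
      using n(3) False by (simp del: cpqa_step.simps) (rule safe_setQ[OF j(2)], auto)
    from exec_start_paid[OF 1(1) n(1,2) pre[OF this]] show ?thesis .
  qed
qed

lemma InvL_insert:
  assumes I: "InvL s Q t e \<phi>" and leg: "cpqa_legal l (InsertAndAttrite i x) Q" and t: "t < N" and arg: "arg = Some x"
  shows "\<exists>s' \<phi>'. exec mc arg (insert_prog (large_impl B bt l) i) (s\<lparr>result := None, ios := 0\<rparr>) = Some s' \<and> ios s' \<le> 300 \<and>
    bt * ios s' + \<phi>' \<le> \<phi> + 900 \<and> result s' = None \<and> InvL s' (cpqa_step (InsertAndAttrite i x) Q) (Suc t) (Suc e) \<phi>'"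
proof -
  from I obtain st tr a Hs Ts where 1: "R s st" "invL st tr a Hs Ts" "Hs l = []"
    "\<forall>k<l. Q k = sm (Hs k @ fl tr k @ Ts k)" "a \<le> 2 * t"
    "esum st + (\<Sum>k\<le>l. length (Hs k) + length (Ts k)) \<le> e"
    "300 * bt * card (vL st) + 900 * (\<Sum>k\<le>l. qpot (fl tr k) (Hs k) (Ts k)) \<le> \<phi>"
    unfolding InvL_def by blast
  have i: "i < l" "i \<le> l" "i \<noteq> l" using leg by auto
  let ?Q = "cpqa_step (InsertAndAttrite i x) Q"
  let ?st = "st\<lparr>vres := None\<rparr>"
  \<comment> \<open>\<open>x\<close> is placed in the scratch zone without recording a length, so
    queue \<open>l\<close> formally stays empty. The element brings a potential of 900, which is the
    amortized charge.\<close>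
  let ?st1 = "?st\<lparr>vm := put (vm st) (hh l) [x]\<rparr>"
  have inv: "invL ?st tr a Hs Ts" using 1(2) by simp
  have w: "world st tr" "\<forall>k\<ge>l. tr k = None" "hinv st a" using 1(2) by (simp_all add: invL_def)
  have f: "fl tr (l + 1) = []" "root_addr tr (l + 1) = 0" "fl tr l = []" using w(2) by (simp_all add: fl_def root_addr_def)
  have q: "qmem (vm ?st1) k (Hs k) (Ts k) (root_addr tr k) \<and> qok (Hs k) (Ts k) (fl tr k)" if k: "k \<le> l" for k
  proof -
    have qk: "qmem (vm st) k (Hs k) (Ts k) (root_addr tr k)" "qok (Hs k) (Ts k) (fl tr k)" using invL_queue[OF inv k] by auto
    have "qmem (vm ?st1) k (Hs k) (Ts k) (root_addr tr k)"
    proof (cases "k = l")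
      case True
      then have "Ts k = []" using qk(2) f(3) by (simp add: qok_def)
      then show ?thesis using qk(1) True 1(3) bt by (simp add: qmem_def put_def zone_eqs)
    next
      case False
      show ?thesis
        by (rule qmem_frame[OF _ _ _ qk(1)])
          (use zone_disj[OF False] qok_len[OF qk(2)] put_inz[of l "hh l" "[x]"] bt in auto)
    qed
    then show ?thesis using qk(2) by simp
  qed
  have "\<exists>n\<le>300. n * bt \<le> \<phi> + 900 \<and>
    safe (catBody B bt i l (root_addr tr i) (length (Hs i)) (length (Ts i)) (root_addr tr (l + 1)) (length [x]) (length ([] :: 'a list)) a) ?st1 n
      (\<lambda>s. InvL s ?Q (Suc t) (Suc e) (\<phi> + 900 - n * bt) \<and> result s = None)"
  proof (rule safe_catBody_InvL[OF i(1) le_refl i(3)])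
    show "world ?st1 tr" using w by simp
    show "\<forall>k\<ge>l. k \<noteq> l + 1 \<longrightarrow> tr k = None" using w(2) by auto
    show "qok [x] [] (fl tr (l + 1))" using f bt by (simp add: qok_def)
    show "?Q k = sm (Hs k @ fl tr k @ Ts k)" if "k < l" "k \<noteq> i" for k using 1(4) that by simp
    have "?Q i = catenate_attrite (sm (Hs i @ fl tr i @ Ts i)) (sm [x])" using 1(4) i insert_attrite_eq by simp
    also have "\<dots> = sm ((Hs i @ fl tr i @ Ts i) @ [x])" by (rule sm_append[symmetric])
    finally show "?Q i = sm (Hs i @ fl tr i @ Ts i @ [x] @ fl tr (l + 1) @ [])" using f by simp
    show "300 * bt * card (vL ?st1) + 900 * ((\<Sum>k\<le>l. qpot (fl tr k) (Hs k) (Ts k)) + qpot (fl tr (l + 1)) [x] []) \<le> \<phi> + 900"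
      using 1(7) f(1) by (simp add: qpot_def)
  qed (use w t 1(3,5,6) q in auto)
  then obtain n where n: "n \<le> 300" "n * bt \<le> \<phi> + 900"
    "safe (catBody B bt i l (root_addr tr i) (length (Hs i)) (length (Ts i)) 0 1 0 a) ?st1 n
      (\<lambda>s. InvL s ?Q (Suc t) (Suc e) (\<phi> + 900 - n * bt) \<and> result s = None)"
    unfolding f(2) by auto
  have B1l: "vm ?st1 (B + 1) = Num a" using 1(2) zone_B[of l] by (simp add: invL_def put_def)
  have "safe (insert_prog (large_impl B bt l) i) ?st n (\<lambda>s. InvL s ?Q (Suc t) (Suc e) (\<phi> + 900 - n * bt) \<and> result s = None)"
    unfolding large_impl_def cpqa_impl.simps
  proof (rule safe_GetArg[OF _ _ arg])
    show "safe (getQ B bt i (\<lambda>g h t. CaseNum (B + 1) (catBody B bt i l g h t 0 1 0))) (?st\<lparr>vm := put (vm ?st) (hh l) [x]\<rparr>) n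
      (\<lambda>s. InvL s ?Q (Suc t) (Suc e) (\<phi> + 900 - n * bt) \<and> result s = None)"
      by (intro safe_getQ[OF i(2), where H = "Hs i" and T = "Ts i" and g = "root_addr tr i"] safe_CaseNum[where v = a])
        (use n(3) q[OF i(2)] B1l B1 BM lM bt in \<open>auto simp del: cpqa_step.simps\<close>)
  qed (use zone_B[of l] zone_M[of l] bt in auto)
  from exec_start_paid[OF 1(1) n(1,2) this] show ?thesis .
qed

lemma InvL_step:
  assumes I: "InvL s Q t e \<phi>" and leg: "cpqa_legal l x Q" and t: "t < N" and arg: "op_arg x = arg"
  shows "\<exists>s' e' \<phi>'. exec mc arg (op_prog (large_impl B bt l) x) (s\<lparr>result := None, ios := 0\<rparr>) = Some s' \<and>
       result s' = cpqa_answer x Q \<and> ios s' \<le> 300 \<and> bt * ios s' + \<phi>' \<le> \<phi> + 900 \<and>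
       e' + (if is_delete x then 1 else 0) \<le> e + (if is_catenate_or_insert x then 1 else 0) \<and>
       InvL s' (cpqa_step x Q) (Suc t) e' \<phi>'"
proof (cases x)
  case (FindMin i)
  from InvL_find[OF I leg[unfolded FindMin]] show ?thesis unfolding FindMin
    by (fastforce intro: exI[of _ e] exI[of _ \<phi>])
next
  case (DeleteMin i)
  from InvL_delete[OF I leg[unfolded DeleteMin] t] obtain s' \<phi>' where
    "exec mc arg (delete_min_prog (large_impl B bt l) i) (s\<lparr>result := None, ios := 0\<rparr>) = Some s'" "ios s' \<le> 300"
    "bt * ios s' + \<phi>' \<le> \<phi>" "1 \<le> e" "result s' = Some (Min (Q i))" "InvL s' (cpqa_step (DeleteMin i) Q) (Suc t) (e - 1) \<phi>'"
    by blast
  then show ?thesis unfolding DeleteMin by (intro exI[of _ s'] exI[of _ "e - 1"] exI[of _ \<phi>']) simp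
next
  case (CatenateAndAttrite i j)
  from InvL_cat[OF I leg[unfolded CatenateAndAttrite] t] obtain s' \<phi>' where
    "exec mc arg (catenate_prog (large_impl B bt l) i j) (s\<lparr>result := None, ios := 0\<rparr>) = Some s'" "ios s' \<le> 300"
    "bt * ios s' + \<phi>' \<le> \<phi>" "result s' = None" "InvL s' (cpqa_step (CatenateAndAttrite i j) Q) (Suc t) e \<phi>'"
    by blast
  then show ?thesis unfolding CatenateAndAttrite by (intro exI[of _ s'] exI[of _ e] exI[of _ \<phi>']) simp
next
  case (InsertAndAttrite i y)
  have "arg = Some y" using arg InsertAndAttrite by simp
  from InvL_insert[OF I leg[unfolded InsertAndAttrite] t this] obtain s' \<phi>' where
    "exec mc arg (insert_prog (large_impl B bt l) i) (s\<lparr>result := None, ios := 0\<rparr>) = Some s'" "ios s' \<le> 300"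
    "bt * ios s' + \<phi>' \<le> \<phi> + 900" "result s' = None" "InvL s' (cpqa_step (InsertAndAttrite i y) Q) (Suc t) (Suc e) \<phi>'"
    by blast
  then show ?thesis unfolding InsertAndAttrite by (intro exI[of _ s'] exI[of _ "Suc e"] exI[of _ \<phi>']) simp
qed

lemma InvL_blank: "InvL blank_config (\<lambda>_. {}) 0 0 0"
  unfolding InvL_def
proof (intro exI conjI)
  let ?st = "\<lparr>vm = (\<lambda>_. Num 0), vres = None, vL = {}, vel = (\<lambda>_. []), vfd = (\<lambda>_ _. 0)\<rparr> :: 'a vst"
  let ?tr = "\<lambda>_. None :: 'a rc option"
  let ?E = "\<lambda>_. [] :: 'a list"
  show "R blank_config ?st" by (simp add: R_def blank_config_def)
  show "invL ?st ?tr 0 ?E ?E"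
    using bt by (simp add: invL_def world_def fl_def root_addr_def hinv_def qmem_def qok_def)
  show "\<forall>k<l. {} = sm (?E k @ fl ?tr k @ ?E k)" by (simp add: fl_def)
  show "esum ?st + (\<Sum>k\<le>l. length (?E k) + length (?E k)) \<le> 0" by (simp add: esum_def)
  show "300 * bt * card (vL ?st) + 900 * (\<Sum>k\<le>l. qpot (fl ?tr k) (?E k) (?E k)) \<le> 0" by (simp add: fl_def qpot_def)
qed simp_all

text \<open>Every live record, attrited or not, stores at least \<open>bt\<close> elements, and all
  of them are counted in \<open>e\<close>.\<close>

lemma InvL_blocks:
  assumes "InvL s Q t e \<phi>"
  shows "bt * blocks_used s \<le> 12 * e"
proof -
  from assms obtain st tr a Hs Ts where 1: "R s st" "invL st tr a Hs Ts"
    "esum st + (\<Sum>k\<le>l. length (Hs k) + length (Ts k)) \<le> e"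
    unfolding InvL_def by blast
  have "(\<Sum>x\<in>vL st. bt) \<le> esum st" unfolding esum_def
    by (rule sum_mono) (use 1(2) in \<open>auto simp: invL_def hinv_def\<close>)
  then have "bt * card (vL st) \<le> e" using 1(3) by (simp add: mult.commute)
  moreover have "bt * blocks_used s \<le> bt * (12 * card (vL st))" using R_blocks_used[OF 1(1)] by (rule mult_le_mono2)
  ultimately show ?thesis by linarith
qed

end

section \<open>Word size, constants and conclusion\<close>

lemma word_bounds:
  fixes n M C :: nat
  assumes "2 \<le> M" "8 \<le> C"
  shows "32 * n + 47 \<le> (n + M) ^ C" "M \<le> (n + M) ^ C" "2 * n * n + 2 * n \<le> (n + M) ^ C"
proof -
  define x where "x = n + M"
  have x: "2 \<le> x" "n \<le> x" "M \<le> x" using assms by (auto simp: x_def)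
  have p: "x ^ k \<le> x ^ C" if "k \<le> 8" for k using x that assms by (intro power_increasing) auto
  \<comment> \<open>As \<open>2 \<le> x\<close>, constant factors are absorbed into powers of
    \<open>x\<close>; exponents up to 7 occur.\<close>
  have two: "2 ^ k * x \<le> x ^ (k + 1)" for k
    using power_mono[OF x(1), of k] x by (simp add: mult.commute)
  show "32 * n + 47 \<le> (n + M) ^ C"
  proof -
    have "32 * n + 47 \<le> 2 ^ 6 * x" using x by simp
    also have "\<dots> \<le> x ^ 7" using two[of 6] by simp
    also have "\<dots> \<le> x ^ C" by (rule p) simp
    finally show ?thesis unfolding x_def[symmetric] .
  qed
  show "M \<le> (n + M) ^ C" using p[of 1] x unfolding x_def[symmetric] by simp
  have "2 * n * n + 2 * n \<le> 2 * (x * x) + 2 * (x * x)"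
    using x mult_le_mono[OF x(2) x(2)] mult_le_mono[of n x 1 x] by simp
  also have "\<dots> = 2 ^ 2 * (x * x)" by simp
  also have "\<dots> \<le> x ^ 2 * (x * x)" using power_mono[OF x(1), of 2] by (intro mult_le_mono1) simp
  also have "\<dots> = x ^ 4" by (simp add: eval_nat_numeral)
  also have "\<dots> \<le> x ^ C" by (rule p) simp
  finally show "2 * n * n + 2 * n \<le> (n + M) ^ C" unfolding x_def[symmetric] .
qed

lemma prod_encode_bound:
  assumes "a \<le> n" "c \<le> n"
  shows "prod_encode (a, c) \<le> 2 * n * n + 2 * n"
proof -
  have "(a + c) * Suc (a + c) \<le> (2 * n) * Suc (2 * n)" using assms by (intro mult_le_mono) auto
  then have "(a + c) * Suc (a + c) div 2 \<le> (2 * n) * Suc (2 * n) div 2" by (rule div_le_mono)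
  then show ?thesis using assms by (simp add: prod_encode_def triangle_def)
qed

lemma real_bound:
  fixes b C S n :: nat
  assumes "b * S \<le> C * n" "1 \<le> b"
  shows "real S \<le> real C * (real n / real b)"
proof -
  have "real (b * S) \<le> real (C * n)" using assms(1) by (simp only: of_nat_le_iff)
  then show ?thesis using assms(2) by (simp add: field_simps)
qed

text \<open>An I/O is charged \<open>\<beta>\<close> units, an operation supplies \<open>c\<close>,
  and \<open>b \<le> \<gamma> * \<beta>\<close> converts the resulting bounds into multiples of
  \<open>1 / b\<close>.\<close>

lemma cpqa_conclusion:
  fixes C b l :: nat and ops :: "'a::linorder cpqa_op list"
    and Inv :: "'a config \<Rightarrow> (nat \<Rightarrow> 'a set) \<Rightarrow> nat \<Rightarrow> nat \<Rightarrow> nat \<Rightarrow> bool"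
  assumes step: "\<And>s Q t e \<phi> x. Inv s Q t e \<phi> \<Longrightarrow> cpqa_legal l x Q \<Longrightarrow> t < length ops \<Longrightarrow>
     \<exists>s' e' \<phi>'. exec mc (op_arg x) (op_prog D x) (s\<lparr>result := None, ios := 0\<rparr>) = Some s' \<and>
       result s' = cpqa_answer x Q \<and> ios s' \<le> \<kappa> \<and> \<beta> * ios s' + \<phi>' \<le> \<phi> + c \<and>
       e' + (if is_delete x then 1 else 0) \<le> e + (if is_catenate_or_insert x then 1 else 0) \<and>
       Inv s' (cpqa_step x Q) (Suc t) e' \<phi>'"
    and blank: "Inv blank_config (\<lambda>_. {}) 0 0 0"
    and blocks: "\<And>s Q t e \<phi>. Inv s Q t e \<phi> \<Longrightarrow> \<beta> * blocks_used s \<le> 12 * e"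
    and leg: "all_legal l ops (\<lambda>_. {})"
    and b: "1 \<le> b" "b \<le> \<gamma> * \<beta>" and C: "\<kappa> \<le> C" "\<gamma> * c \<le> C" "\<gamma> * 12 \<le> C"
  shows "\<exists>s tr. run_ops mc D ops blank_config = Some (s, tr) \<and>
           map fst tr = all_answers ops (\<lambda>_. {}) \<and>
           (\<forall>t \<in> set (map snd tr). t \<le> C) \<and>
           real (sum_list (map snd tr)) \<le> real C * (real (length ops) / real b) \<and>
           real (blocks_used s) \<le>
             real C * ((real (length (filter is_catenate_or_insert ops))
                        - real (length (filter is_delete ops))) / real b)"
proof -
  let ?d = "length (filter is_delete ops)" and ?i = "length (filter is_catenate_or_insert ops)"
  have "\<exists>s' tr Q' e' \<phi>'. run_ops mc D ops blank_config = Some (s', tr) \<and> map fst tr = all_answers ops (\<lambda>_. {}) \<and>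
       (\<forall>k\<in>set (map snd tr). k \<le> \<kappa>) \<and> \<beta> * sum_list (map snd tr) + \<phi>' \<le> 0 + c * length ops \<and>
       e' + ?d \<le> 0 + ?i \<and> Inv s' Q' (0 + length ops) e' \<phi>'"
    by (rule run_ops_inv[where Inv = Inv and l = l and N = "length ops"]) (fact step, rule blank, rule leg, simp)
  then obtain s tr Q' e \<phi> where r: "run_ops mc D ops blank_config = Some (s, tr)" "map fst tr = all_answers ops (\<lambda>_. {})"
     "\<forall>k\<in>set (map snd tr). k \<le> \<kappa>" "\<beta> * sum_list (map snd tr) + \<phi> \<le> 0 + c * length ops"
     "e + ?d \<le> 0 + ?i" "Inv s Q' (0 + length ops) e \<phi>"
    by auto
  have scale: "b * S \<le> C * m" if "\<beta> * S \<le> k * m" "\<gamma> * k \<le> C" for S k m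
  proof -
    have "b * S \<le> \<gamma> * \<beta> * S" using b(2) by (rule mult_le_mono1)
    also have "\<dots> \<le> \<gamma> * (k * m)" using that(1) by simp
    also have "\<dots> \<le> C * m" using mult_le_mono1[OF that(2), of m] by simp
    finally show ?thesis .
  qed
  have "real (sum_list (map snd tr)) \<le> real C * (real (length ops) / real b)"
    by (rule real_bound[OF scale[OF _ C(2)] b(1)]) (use r(4) in simp)
  moreover have "real (blocks_used s) \<le> real C * ((real ?i - real ?d) / real b)"
  proof -
    have "real (blocks_used s) \<le> real C * (real e / real b)"
      by (rule real_bound[OF scale[OF blocks[OF r(6)] C(3)] b(1)])
    also have "\<dots> \<le> real C * ((real ?i - real ?d) / real b)"
      using r(5) by (intro mult_left_mono divide_right_mono) auto
    finally show ?thesis .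
  qed
  moreover have "\<forall>t\<in>set (map snd tr). t \<le> C" using r(3) C(1) by fastforce
  ultimately show ?thesis using r(1,2) by blast
qed

lemma small_cpqa:
  fixes ops :: "'a::linorder cpqa_op list"
  assumes "1 \<le> b" "b < 128" "b \<le> B" "1 \<le> l" "l * b \<le> M" "2 * B \<le> M" and C: "230400 \<le> C"
    and leg: "all_legal l ops (\<lambda>_. {})"
  shows "\<exists>s tr. run_ops \<lparr>mem_size = M, block_size = B, word_max = (length ops + M) ^ C\<rparr> (small_impl B l) ops blank_config = Some (s, tr) \<and>
           map fst tr = all_answers ops (\<lambda>_. {}) \<and>
           (\<forall>t \<in> set (map snd tr). t \<le> C) \<and>
           real (sum_list (map snd tr)) \<le> real C * (real (length ops) / real b) \<and>
           real (blocks_used s) \<le>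
             real C * ((real (length (filter is_catenate_or_insert ops))
                        - real (length (filter is_delete ops))) / real b)"
proof -
  let ?W = "(length ops + M) ^ C"
  have M: "2 \<le> M" "8 \<le> C" using assms by auto
  note wb = word_bounds[OF M, of "length ops"]
  have "l * 1 \<le> l * b" using assms(1) by (intro mult_le_mono2)
  then have "l \<le> M" using assms(5) by linarith
  then interpret small B M ?W arg l "length ops" for arg :: "'a option"
  proof unfold_locales
    show "1 \<le> ?W" "16 * length ops + 31 \<le> ?W" using wb(1) by linarith+
    show "prod_encode (a, c) \<le> ?W" if "a \<le> length ops" "c \<le> length ops" for a c
      using prod_encode_bound[OF that] wb(3) by (rule order_trans)
  qed (use assms in linarith)+
  show ?thesis
  \<comment> \<open>With \<open>\<beta> = 1\<close> every operation pays for its own I/Os, and the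
    factor \<open>b < 128\<close> is absorbed by the constant.\<close>
  proof (rule cpqa_conclusion[where Inv = InvS and \<beta> = 1 and \<gamma> = 128 and c = 80 and \<kappa> = 80, OF InvS_step InvS_blank _ leg])
    show "1 * blocks_used s \<le> 12 * e" if "InvS s Q t e \<phi>" for s Q t e \<phi> using InvS_blocks[OF that] by simp
  qed (use assms in auto)
qed

lemma large_cpqa:
  fixes ops :: "'a::linorder cpqa_op list"
  assumes "128 \<le> b" "b \<le> B" "1 \<le> l" "l * b \<le> M" "2 * B \<le> M" and C: "230400 \<le> C"
    and leg: "all_legal l ops (\<lambda>_. {})"
  shows "\<exists>s tr. run_ops \<lparr>mem_size = M, block_size = B, word_max = (length ops + M) ^ C\<rparr> (large_impl B (b div 128) l) ops blank_config = Some (s, tr) \<and>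
           map fst tr = all_answers ops (\<lambda>_. {}) \<and>
           (\<forall>t \<in> set (map snd tr). t \<le> C) \<and>
           real (sum_list (map snd tr)) \<le> real C * (real (length ops) / real b) \<and>
           real (blocks_used s) \<le>
             real C * ((real (length (filter is_catenate_or_insert ops))
                        - real (length (filter is_delete ops))) / real b)"
proof -
  let ?W = "(length ops + M) ^ C"
  define bt where "bt = b div 128"
  have "1 \<le> bt" "128 * bt + b mod 128 = b" "b mod 128 < 128" using assms(1) by (auto simp: bt_def)
  \<comment> \<open>Rounding loses at most a factor 2:
    \<open>b < 128 * (bt + 1) \<le> 256 * bt\<close>.\<close>
  then have b_bt: "1 \<le> bt" "128 * bt \<le> b" "b \<le> 256 * bt" by linarith+
  have M: "2 \<le> M" "8 \<le> C" using assms by auto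
  note wb = word_bounds[OF M, of "length ops"]
  have "128 * (bt * l) = l * (128 * bt)" by simp
  also have "\<dots> \<le> l * b" using b_bt(2) by (rule mult_le_mono2)
  also have "\<dots> \<le> M" by (rule assms(4))
  finally have lb: "128 * (bt * l) \<le> M" .
  interpret large B M ?W arg bt l "length ops" for arg :: "'a option"
  proof unfold_locales
    show "1 \<le> ?W" using wb(1) by linarith
    have "16 * (2 * length ops + 2) + 15 = 32 * length ops + 47" by simp
    then show "16 * (2 * length ops + 2) + 15 \<le> ?W" using wb(1) by (simp only:)
    show "M \<le> ?W" by (rule wb(2))
    \<comment> \<open>\<open>B\<close> takes at most half of the memory, the zones of the queues at
      most an eighth, the scratch zone at most an eighth of \<open>B\<close>; the rest exceeds 2
      because \<open>256 \<le> M\<close>.\<close>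
    have "B + 2 + 16 * (bt * l) + 16 * bt \<le> M" using lb b_bt assms by linarith
    then show "B + 2 + 16 * bt * (l + 1) \<le> M" by simp
  qed (use assms b_bt in linarith)+
  show ?thesis unfolding bt_def[symmetric]
    by (rule cpqa_conclusion[where Inv = InvL and \<beta> = bt and \<gamma> = 256 and c = 900 and \<kappa> = 300, OF InvL_step InvL_blank InvL_blocks leg])
      (use assms b_bt in auto)
qed

text \<open>The programs are chosen before the sequence of operations; only the word length grows
  with it, logarithmically in \<open>length ops + M\<close>.\<close>

theorem theorem1:
  "\<exists>C::nat. \<forall>B b l M :: nat.
     1 \<le> b \<and> b \<le> B \<and> 1 \<le> l \<and> l * b \<le> M \<and> 2 * B \<le> M \<longrightarrow>
     (\<exists>D :: cpqa_impl. \<forall>ops :: 'a::linorder cpqa_op list.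
        all_legal l ops (\<lambda>_. {}) \<longrightarrow>
        (\<exists>s tr.
           run_ops \<lparr>mem_size = M, block_size = B, word_max = (length ops + M) ^ C\<rparr>
             D ops blank_config = Some (s, tr) \<and>
           map fst tr = all_answers ops (\<lambda>_. {}) \<and>
           (\<forall>t \<in> set (map snd tr). t \<le> C) \<and>
           real (sum_list (map snd tr)) \<le> real C * (real (length ops) / real b) \<and>
           real (blocks_used s) \<le>
             real C * ((real (length (filter is_catenate_or_insert ops))
                        - real (length (filter is_delete ops))) / real b)))"
proof -
  \<comment> \<open>\<open>230400 = 256 * 900\<close> is the product of the rounding factor and the
    amortized charge for large blocks, the largest constant required.\<close>
  obtain C :: nat where C: "230400 \<le> C" by blast
  have "\<exists>D :: cpqa_impl. \<forall>ops :: 'a cpqa_op list.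
        all_legal l ops (\<lambda>_. {}) \<longrightarrow>
        (\<exists>s tr.
           run_ops \<lparr>mem_size = M, block_size = B, word_max = (length ops + M) ^ C\<rparr>
             D ops blank_config = Some (s, tr) \<and>
           map fst tr = all_answers ops (\<lambda>_. {}) \<and>
           (\<forall>t \<in> set (map snd tr). t \<le> C) \<and>
           real (sum_list (map snd tr)) \<le> real C * (real (length ops) / real b) \<and>
           real (blocks_used s) \<le>
             real C * ((real (length (filter is_catenate_or_insert ops))
                        - real (length (filter is_delete ops))) / real b))"
    if "1 \<le> b \<and> b \<le> B \<and> 1 \<le> l \<and> l * b \<le> M \<and> 2 * B \<le> M" for B b l M :: nat
  proof (cases "b < 128")
    case True
    with that C show ?thesis by (intro exI[of _ "small_impl B l"] allI impI small_cpqa) auto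
  next
    case False
    with that C show ?thesis by (intro exI[of _ "large_impl B (b div 128) l"] allI impI large_cpqa) auto
  qed
  then show ?thesis by (intro exI[of _ C] allI impI)
qed

end
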